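(* Let $R$ be a commutative unital ring, $\mathtt O$ a unary (nonunital) operadic category and $\mathtt M$ a left operadic $\mathtt O$-module, both satisfying the weak blow-up axiom. Let $\mathcal P$ be a unital $\mathtt O$-operad in graded $R$-modules and $\mathcal M$ a unital $\mathcal P$-module. Then: (1) For every object $\Upsilon$ of $\mathtt M$ having properties (P1) and (P2), the augmented un-normalized bar complex $\beta_*(\mathcal P,\mathcal M)(\Upsilon)\xrightarrow{\ \epsilon\ }\mathcal M(\Upsilon)$ is acyclic (all homology of the augmented complex, including at the spot $\mathcal M(\Upsilon)$, vanishes). (2) If an object $\Upsilon$ of $\mathtt M$ is rigid, then for each $n\ge 0$ the module $\beta_n(\mathcal P,\mathcal M)(\Upsilon)$ is a piece of a free unital $\mathcal P$-module, i.e. it is (isomorphic to) the component at $\Upsilon$ of the free unital $\mathcal P$-module generated by some collection. The analogous statements hold for the normalized bar construction $B_*(\mathcal P,\mathcal M)$ in place of $\beta_*(\mathcal P,\mathcal M)$.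
   Context: **Unary operadic category.** A category $\mathtt O$ with functors $\mathscr F_S:\mathtt O/S\to\mathtt O$, $S\in\mathtt O$ (fiber functors). For $f:X\to S$ put $\mathrm{Fib}(f):=\mathscr F_S(f)$. If $\varphi:X'\to X''$ satisfies $f''\varphi=f'$ with $f':X'\to S$, $f'':X''\to S$, let $\varphi_S:\mathrm{Fib}(f')\to\mathrm{Fib}(f'')$ be the induced morphism $\mathscr F_S(\varphi)$. Axioms: (a) $\mathrm{Fib}(\varphi_S)=\mathrm{Fib}(\varphi)$; (b) for $Y\xrightarrow{\varphi}X\xrightarrow{a}S\xrightarrow{c}T$, with $\varphi_T:\mathrm{Fib}(ca\varphi)\to\mathrm{Fib}(ca)$ viewed as a morphism over $\mathrm{Fib}(c)$ via $(a\varphi)_T$ and $a_T$, one has $(\varphi_T)_{\mathrm{Fib}(c)}=\varphi_S$. Put $U_T:=\mathrm{Fib}(\mathrm{id}_T)$. **Left operadic $\mathtt O$-module $\mathtt M$.** A set of objects, and for each object $L$ of $\mathtt M$ and $S\in\mathtt O$ a set of arrows $\alpha:L\to S$, with an associative unital action $(\alpha,g)\mapsto g\alpha:L\to T$ of morphisms $g:S\to T$ of $\mathtt O$. Moreover each arrow $\alpha:L\to S$ has a fiber $\mathrm{Fib}(\alpha)$, an object of $\mathtt M$, and each pair of an arrow $\alpha:L\to X$ and a morphism $g:X\to S$ induces an arrow $\alpha_S:\mathrm{Fib}(g\alpha)\to\mathrm{Fib}(g)$ of $\mathtt M$, with $(h\alpha)_S=h_S\alpha_S$ for morphisms $h$ over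 $S$, $\mathrm{Fib}(\alpha_S)=\mathrm{Fib}(\alpha)$, and $(\alpha_T)_{\mathrm{Fib}(c)}=\alpha_S$ for $L\xrightarrow{\alpha}X\xrightarrow{a}S\xrightarrow{c}T$. **Operad.** An $\mathtt O$-operad $\mathcal P$ is a collection $\{\mathcal P(A)\}_{A\in\mathtt O}$ of graded $R$-modules with maps $\gamma_h:\mathcal P(F)\otimes\mathcal P(B)\to\mathcal P(A)$ for each $h:A\to B$ with fiber $F$, such that for $A\xrightarrow{f}B\xrightarrow{g}C$ with $F=\mathrm{Fib}(f)=\mathrm{Fib}(f_C)$, $Y=\mathrm{Fib}(g)$, one has $\gamma_f(\mathrm{id}\otimes\gamma_g)=\gamma_{gf}(\gamma_{f_C}\otimes\mathrm{id})$ on $\mathcal P(F)\otimes\mathcal P(Y)\otimes\mathcal P(C)$. It is *unital* if there are maps $\eta_T:R\to\mathcal P(U_T)$, $T\in\mathtt O$, with $1_T:=\eta_T(1)$, such that $\gamma_{\mathrm{id}_T}(1_T,x)=x$ for $x\in\mathcal P(T)$ (left unitality) and, for each $f:S\to T$ with fiber $F$ and the induced $f_T:F\to U_T$ (whose fiber is $F$), $\gamma_{f_T}(x,1_T)=x$ for $x\in\mathcal P(F)$ (right unitality). **$\mathcal P$-module.** A collection $\mathcal M=\{\mathcal M(L)\}$ of graded $R$-modules indexed by objects of $\mathtt M$ with actions $\nu_\alpha:\mathcal M(G)\otimes\mathcal P(S)\to\mathcal M(L)$ for each arrow $\alpha:L\to S$ with fiber $G$, such that for $L\xrightarrow{\alpha}B\xrightarrow{g}C$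 with $G=\mathrm{Fib}(\alpha)$, $F=\mathrm{Fib}(g)$, $\nu_\alpha(\mathrm{id}\otimes\gamma_g)=\nu_{g\alpha}(\nu_{\alpha_C}\otimes\mathrm{id})$ on $\mathcal M(G)\otimes\mathcal P(F)\otimes\mathcal P(C)$. It is *unital* if for each $\alpha:L\to T$ with fiber $G$ and induced $\alpha_T:G\to U_T$ (fiber $G$), $\nu_{\alpha_T}(x,1_T)=x$ for $x\in\mathcal M(G)$. Morphisms are families of maps commuting with the actions. The *free unital $\mathcal P$-module* generated by a collection $\mathcal E=\{\mathcal E(L)\}$ is the value at $\mathcal E$ of the left adjoint of the forgetful functor from unital $\mathcal P$-modules to collections of graded $R$-modules indexed by objects of $\mathtt M$. **Weak blow-up.** For $\mathtt O$: for each $f':X'\to S$ with fiber $F'$ and each $\phi:F'\to F''$ there is a unique pair $\varphi:X'\to X''$, $f'':X''\to S$ with $f''\varphi=f'$, $\mathrm{Fib}(f'')=F''$, $\varphi_S=\phi$. For $\mathtt M$: the same with $f',\phi,\varphi$ arrows of $\mathtt M$ and $f''$ a morphism of $\mathtt O$. **Bar construction.** For $M\in\mathtt M$ and $n\ge0$, $$\beta_n(\mathcal P,\mathcal M)(M):=\bigoplus\mathcal P(T_0)\otimes\mathcal P(F_1)\otimes\cdots\otimes\mathcal P(F_n)\otimes\mathcal M(N),$$ the sum over all towers $T_0\xleftarrow{f_1}T_1\leftarrow\cdots\xleftarrow{f_n}T_n\xleftarrow{\alpha}M$ ($f_i$ morphisms of $\mathtt O$, $\alpha$ an arrow of $\mathtt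 M$), where $F_i=\mathrm{Fib}(f_i)$, $N=\mathrm{Fib}(\alpha)$. The differential is $\partial_n=\sum_{i=0}^n(-1)^id_i$, acting on $t_0\otimes p_1\otimes\cdots\otimes p_n\otimes m$ (Koszul sign rule for graded objects): $d_0$ deletes $T_0$ and replaces $t_0\otimes p_1$ by $\gamma_{f_1}(p_1,t_0)\in\mathcal P(T_1)$; for $1\le i\le n-1$, $d_i$ deletes $T_i$ (composing $f_if_{i+1}$) and replaces $p_i\otimes p_{i+1}$ by $\gamma_{(f_{i+1})_{T_{i-1}}}(p_{i+1},p_i)\in\mathcal P(\mathrm{Fib}(f_if_{i+1}))$; $d_n$ (for $n\geq1$) deletes $T_n$ and replaces $p_n\otimes m$ by $\nu_{\alpha_{T_{n-1}}}(m,p_n)\in\mathcal M(\mathrm{Fib}(f_n\alpha))$. The augmentation is $\epsilon(t_0\otimes m)=\nu_\alpha(m,t_0)$. Degeneracies $s_j$, $0\le j\le n$, insert $\mathrm{id}:T_j\to T_j$ into the tower and $1_{T_j}\in\mathcal P(U_{T_j})$ after $p_j$ (after $t_0$ if $j=0$). $B_*(\mathcal P,\mathcal M)(M)$ is the quotient of $\beta_*(\mathcal P,\mathcal M)(M)$ by the images of all $s_j$, with the induced augmentation. **Conditions on $\Upsilon\in\mathtt M$.** Let $\Upsilon/\mathtt O$ be the category of arrows $\Upsilon\to X$, $X\in\mathtt O$, with morphisms the commutative triangles over morphisms of $\mathtt O$. (P1): $\Upsilon/\mathtt O$ has a terminal object $!:\Upsilon\to\odot$. (P2): the fiber of $!:\Upsilon\to\odot$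 is $\Upsilon$, and $\mathscr F_\odot:\mathtt O/\odot\to\mathtt O$ is the domain functor. $\Upsilon$ is *rigid* if there is precisely one object $\odot$ of $\mathtt O$ and one arrow $\Upsilon\to\odot$ with fiber $\Upsilon$. *)

theory Defs
  imports "HOL-Algebra.Module" "HOL-Algebra.AbelCoset"
begin

section \<open>Linear algebra over a commutative ring\<close>

text \<open>The ring reduct of the record type of modules has a multiplication and a unit,
  which are irrelevant for modules and left unspecified below.\<close>

definition lin_map ::
  "('r, 's) ring_scheme \<Rightarrow> ('r, 'x) module \<Rightarrow> ('r, 'y) module \<Rightarrow> ('x \<Rightarrow> 'y) \<Rightarrow> bool" where
  "lin_map R M N h \<longleftrightarrow> h \<in> carrier M \<rightarrow> carrier N
     \<and> (\<forall>x\<in>carrier M. \<forall>y\<in>carrier M. h (x \<oplus>\<^bsub>M\<^esub> y) = h x \<oplus>\<^bsub>N\<^esub> h y)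
     \<and> (\<forall>r\<in>carrier R. \<forall>x\<in>carrier M. h (r \<odot>\<^bsub>M\<^esub> x) = r \<odot>\<^bsub>N\<^esub> h x)"

definition bilin_map ::
  "('r, 's) ring_scheme \<Rightarrow> ('r, 'x) module \<Rightarrow> ('r, 'y) module \<Rightarrow> ('r, 'z) module
     \<Rightarrow> ('x \<Rightarrow> 'y \<Rightarrow> 'z) \<Rightarrow> bool" where
  "bilin_map R A B C b \<longleftrightarrow>
     (\<forall>x\<in>carrier A. lin_map R B C (b x)) \<and> (\<forall>y\<in>carrier B. lin_map R A C (\<lambda>x. b x y))"

definition mod_iso ::
  "('r, 's) ring_scheme \<Rightarrow> ('r, 'x) module \<Rightarrow> ('r, 'y) module \<Rightarrow> bool" where
  "mod_iso R M N \<longleftrightarrow> (\<exists>h. lin_map R M N h \<and> bij_betw h (carrier M) (carrier N))"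

definition submod_span ::
  "('r, 's) ring_scheme \<Rightarrow> ('r, 'x) module \<Rightarrow> 'x set \<Rightarrow> 'x set" where
  "submod_span R M S = \<Inter> {H. submodule H R M \<and> S \<subseteq> H}"

definition quot_mod :: "('r, 'x) module \<Rightarrow> 'x set \<Rightarrow> ('r, 'x set) module" where
  "quot_mod M H = \<lparr>carrier = a_rcosets\<^bsub>M\<^esub> H, mult = undefined, one = undefined,
     zero = H, add = set_add M, smult = (\<lambda>r X. \<Union>x\<in>X. H +>\<^bsub>M\<^esub> (r \<odot>\<^bsub>M\<^esub> x))\<rparr>"

definition dsum :: "'i set \<Rightarrow> ('i \<Rightarrow> ('r, 'x) module) \<Rightarrow> ('r, 'i \<Rightarrow> 'x) module" where
  "dsum I F = \<lparr>
     carrier = {v \<in> Pi\<^sub>E I (\<lambda>i. carrier (F i)). finite {i \<in> I. v i \<noteq> \<zero>\<^bsub>F i\<^esub>}},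
     mult = undefined, one = undefined,
     zero = (\<lambda>i\<in>I. \<zero>\<^bsub>F i\<^esub>),
     add = (\<lambda>v w. \<lambda>i\<in>I. v i \<oplus>\<^bsub>F i\<^esub> w i),
     smult = (\<lambda>r v. \<lambda>i\<in>I. r \<odot>\<^bsub>F i\<^esub> v i)\<rparr>"

definition dsum_in :: "'i set \<Rightarrow> ('i \<Rightarrow> ('r, 'x) module) \<Rightarrow> 'i \<Rightarrow> 'x \<Rightarrow> 'i \<Rightarrow> 'x" where
  "dsum_in I F i x = (\<lambda>j\<in>I. if j = i then x else \<zero>\<^bsub>F j\<^esub>)"

definition dsum_lift ::
  "('r, 'y) module \<Rightarrow> 'i set \<Rightarrow> ('i \<Rightarrow> ('r, 'x) module) \<Rightarrow> ('i \<Rightarrow> 'x \<Rightarrow> 'y) \<Rightarrow> ('i \<Rightarrow> 'x) \<Rightarrow> 'y" where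
  "dsum_lift T I F g v = (\<Oplus>\<^bsub>T\<^esub>i\<in>{i \<in> I. v i \<noteq> \<zero>\<^bsub>F i\<^esub>}. g i (v i))"

definition free_mod :: "('r, 's) ring_scheme \<Rightarrow> 'x set \<Rightarrow> ('r, 'x \<Rightarrow> 'r) module" where
  "free_mod R X = \<lparr>
     carrier = {c. range c \<subseteq> carrier R \<and> finite {x. c x \<noteq> \<zero>\<^bsub>R\<^esub>} \<and> {x. c x \<noteq> \<zero>\<^bsub>R\<^esub>} \<subseteq> X},
     mult = undefined, one = undefined,
     zero = (\<lambda>x. \<zero>\<^bsub>R\<^esub>),
     add = (\<lambda>c d x. c x \<oplus>\<^bsub>R\<^esub> d x),
     smult = (\<lambda>r c x. r \<otimes>\<^bsub>R\<^esub> c x)\<rparr>"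

definition delta :: "('r, 's) ring_scheme \<Rightarrow> 'x \<Rightarrow> 'x \<Rightarrow> 'r" where
  "delta R x = (\<lambda>y. if y = x then \<one>\<^bsub>R\<^esub> else \<zero>\<^bsub>R\<^esub>)"

text \<open>The tensor product of finitely many modules, of which the last one may have elements of
  another type: the free module on the tuples modulo the multilinearity relations.\<close>

definition tuples :: "('r, 'x) module list \<Rightarrow> ('r, 'y) module \<Rightarrow> ('x list \<times> 'y) set" where
  "tuples As B = {(xs, y). length xs = length As \<and> (\<forall>i<length As. xs ! i \<in> carrier (As ! i))
     \<and> y \<in> carrier B}"

definition multilin_rels ::
  "('r, 's) ring_scheme \<Rightarrow> ('r, 'x) module list \<Rightarrow> ('r, 'y) module \<Rightarrow> ('x list \<times> 'y \<Rightarrow> 'r) set" where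
  "multilin_rels R As B = (let F = free_mod R (tuples As B) in
     {delta R (xs[i := a \<oplus>\<^bsub>As ! i\<^esub> b], y)
        \<ominus>\<^bsub>F\<^esub> (delta R (xs[i := a], y) \<oplus>\<^bsub>F\<^esub> delta R (xs[i := b], y)) |xs y i a b.
        (xs, y) \<in> tuples As B \<and> i < length As \<and> a \<in> carrier (As ! i) \<and> b \<in> carrier (As ! i)}
   \<union> {delta R (xs[i := r \<odot>\<^bsub>As ! i\<^esub> a], y) \<ominus>\<^bsub>F\<^esub> r \<odot>\<^bsub>F\<^esub> delta R (xs[i := a], y) |xs y i r a.
        (xs, y) \<in> tuples As B \<and> i < length As \<and> r \<in> carrier R \<and> a \<in> carrier (As ! i)}
   \<union> {delta R (xs, a \<oplus>\<^bsub>B\<^esub> b) \<ominus>\<^bsub>F\<^esub> (delta R (xs, a) \<oplus>\<^bsub>F\<^esub> delta R (xs, b)) |xs a b.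
        (xs, a) \<in> tuples As B \<and> b \<in> carrier B}
   \<union> {delta R (xs, r \<odot>\<^bsub>B\<^esub> a) \<ominus>\<^bsub>F\<^esub> r \<odot>\<^bsub>F\<^esub> delta R (xs, a) |xs r a.
        (xs, a) \<in> tuples As B \<and> r \<in> carrier R})"

definition tensor_ker ::
  "('r, 's) ring_scheme \<Rightarrow> ('r, 'x) module list \<Rightarrow> ('r, 'y) module \<Rightarrow> ('x list \<times> 'y \<Rightarrow> 'r) set" where
  "tensor_ker R As B = submod_span R (free_mod R (tuples As B)) (multilin_rels R As B)"

definition tensor ::
  "('r, 's) ring_scheme \<Rightarrow> ('r, 'x) module list \<Rightarrow> ('r, 'y) module
     \<Rightarrow> ('r, ('x list \<times> 'y \<Rightarrow> 'r) set) module" where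
  "tensor R As B = quot_mod (free_mod R (tuples As B)) (tensor_ker R As B)"

definition pure_tensor ::
  "('r, 's) ring_scheme \<Rightarrow> ('r, 'x) module list \<Rightarrow> ('r, 'y) module
     \<Rightarrow> 'x list \<times> 'y \<Rightarrow> ('x list \<times> 'y \<Rightarrow> 'r) set" where
  "pure_tensor R As B t = tensor_ker R As B +>\<^bsub>free_mod R (tuples As B)\<^esub> delta R t"

text \<open>The linear map out of a tensor product with value \<open>\<phi> t\<close> on the pure tensor of \<open>t\<close>,
  for multilinear \<open>\<phi>\<close>.\<close>

definition tensor_lift ::
  "('r, 's) ring_scheme \<Rightarrow> ('r, 'z) module \<Rightarrow> ('x list \<times> 'y \<Rightarrow> 'z)
     \<Rightarrow> ('x list \<times> 'y \<Rightarrow> 'r) set \<Rightarrow> 'z" where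
  "tensor_lift R T \<phi> X =
     (let c = (SOME c. c \<in> X) in \<Oplus>\<^bsub>T\<^esub>t\<in>{t. c t \<noteq> \<zero>\<^bsub>R\<^esub>}. c t \<odot>\<^bsub>T\<^esub> \<phi> t)"

definition neg1_pow :: "('r, 's) ring_scheme \<Rightarrow> int \<Rightarrow> 'r" where
  "neg1_pow R a = (if even a then \<one>\<^bsub>R\<^esub> else \<ominus>\<^bsub>R\<^esub> \<one>\<^bsub>R\<^esub>)"

text \<open>A graded module is the family of its homogeneous components.  Maps of graded modules
  have degree 0, and maps out of a tensor product of two graded modules are families of
  bilinear maps indexed by pairs of degrees.\<close>

definition gr_collection ::
  "('r, 's) ring_scheme \<Rightarrow> 'i set \<Rightarrow> ('i \<Rightarrow> int \<Rightarrow> ('r, 'x) module) \<Rightarrow> bool" where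
  "gr_collection R I E \<longleftrightarrow> (\<forall>i\<in>I. \<forall>k. module R (E i k))"

definition gr_iso ::
  "('r, 's) ring_scheme \<Rightarrow> (int \<Rightarrow> ('r, 'x) module) \<Rightarrow> (int \<Rightarrow> ('r, 'y) module) \<Rightarrow> bool" where
  "gr_iso R X Y \<longleftrightarrow> (\<forall>k. mod_iso R (X k) (Y k))"


section \<open>Unary operadic categories and left operadic modules\<close>

text \<open>An object of the slice over \<open>S\<close> is a morphism with codomain \<open>S\<close>; a morphism of the slice
  is given by \<open>\<phi> : X' \<rightarrow> X''\<close> together with its target \<open>f'' : X'' \<rightarrow> S\<close>, its source being
  \<open>f'' \<phi>\<close>.  So the fiber functors amount to \<open>Fib f\<close> on objects and \<open>FibM \<phi> f''\<close> on morphisms;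
  the latter is written \<open>\<phi>\<^sub>S : Fib (f'' \<phi>) \<rightarrow> Fib f''\<close> in the mathematics.
  \<open>Cmp g f\<close> is \<open>g\<close> after \<open>f\<close>.\<close>

record ('o, 'a) opcat =
  Ob :: "'o set"
  Mor :: "'a set"
  Dom :: "'a \<Rightarrow> 'o"
  Cod :: "'a \<Rightarrow> 'o"
  Idn :: "'o \<Rightarrow> 'a"
  Cmp :: "'a \<Rightarrow> 'a \<Rightarrow> 'a"
  Fib :: "'a \<Rightarrow> 'o"
  FibM :: "'a \<Rightarrow> 'a \<Rightarrow> 'a"

locale unary_operadic_category =
  fixes OC :: "('o, 'a) opcat"
  assumes Dom_closed: "f \<in> Mor OC \<Longrightarrow> Dom OC f \<in> Ob OC"
    and Cod_closed: "f \<in> Mor OC \<Longrightarrow> Cod OC f \<in> Ob OC"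
    and Idn_closed: "S \<in> Ob OC \<Longrightarrow> Idn OC S \<in> Mor OC"
    and Dom_Idn: "S \<in> Ob OC \<Longrightarrow> Dom OC (Idn OC S) = S"
    and Cod_Idn: "S \<in> Ob OC \<Longrightarrow> Cod OC (Idn OC S) = S"
    and Cmp_closed: "\<lbrakk>f \<in> Mor OC; g \<in> Mor OC; Cod OC f = Dom OC g\<rbrakk> \<Longrightarrow> Cmp OC g f \<in> Mor OC"
    and Dom_Cmp: "\<lbrakk>f \<in> Mor OC; g \<in> Mor OC; Cod OC f = Dom OC g\<rbrakk>
      \<Longrightarrow> Dom OC (Cmp OC g f) = Dom OC f"
    and Cod_Cmp: "\<lbrakk>f \<in> Mor OC; g \<in> Mor OC; Cod OC f = Dom OC g\<rbrakk>
      \<Longrightarrow> Cod OC (Cmp OC g f) = Cod OC g"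
    and Cmp_Idn_right: "f \<in> Mor OC \<Longrightarrow> Cmp OC f (Idn OC (Dom OC f)) = f"
    and Cmp_Idn_left: "f \<in> Mor OC \<Longrightarrow> Cmp OC (Idn OC (Cod OC f)) f = f"
    and Cmp_assoc: "\<lbrakk>f \<in> Mor OC; g \<in> Mor OC; h \<in> Mor OC; Cod OC f = Dom OC g; Cod OC g = Dom OC h\<rbrakk>
      \<Longrightarrow> Cmp OC h (Cmp OC g f) = Cmp OC (Cmp OC h g) f"
    and Fib_closed: "f \<in> Mor OC \<Longrightarrow> Fib OC f \<in> Ob OC"
    and FibM_closed: "\<lbrakk>\<phi> \<in> Mor OC; f \<in> Mor OC; Cod OC \<phi> = Dom OC f\<rbrakk> \<Longrightarrow> FibM OC \<phi> f \<in> Mor OC"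
    and Dom_FibM: "\<lbrakk>\<phi> \<in> Mor OC; f \<in> Mor OC; Cod OC \<phi> = Dom OC f\<rbrakk>
      \<Longrightarrow> Dom OC (FibM OC \<phi> f) = Fib OC (Cmp OC f \<phi>)"
    and Cod_FibM: "\<lbrakk>\<phi> \<in> Mor OC; f \<in> Mor OC; Cod OC \<phi> = Dom OC f\<rbrakk>
      \<Longrightarrow> Cod OC (FibM OC \<phi> f) = Fib OC f"
    and FibM_Idn: "f \<in> Mor OC \<Longrightarrow> FibM OC (Idn OC (Dom OC f)) f = Idn OC (Fib OC f)"
    and FibM_Cmp:
      "\<lbrakk>\<phi> \<in> Mor OC; \<psi> \<in> Mor OC; f \<in> Mor OC; Cod OC \<phi> = Dom OC \<psi>; Cod OC \<psi> = Dom OC f\<rbrakk>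
      \<Longrightarrow> FibM OC (Cmp OC \<psi> \<phi>) f = Cmp OC (FibM OC \<psi> f) (FibM OC \<phi> (Cmp OC f \<psi>))"
    and Fib_FibM: "\<lbrakk>\<phi> \<in> Mor OC; f \<in> Mor OC; Cod OC \<phi> = Dom OC f\<rbrakk>
      \<Longrightarrow> Fib OC (FibM OC \<phi> f) = Fib OC \<phi>"
    and FibM_FibM: "\<lbrakk>\<phi> \<in> Mor OC; a \<in> Mor OC; c \<in> Mor OC; Cod OC \<phi> = Dom OC a; Cod OC a = Dom OC c\<rbrakk>
      \<Longrightarrow> FibM OC (FibM OC \<phi> (Cmp OC c a)) (FibM OC a c) = FibM OC \<phi> a"

definition Ufib :: "('o, 'a) opcat \<Rightarrow> 'o \<Rightarrow> 'o" where
  "Ufib OC T = Fib OC (Idn OC T)"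

text \<open>\<open>MFibM \<alpha> g\<close> is \<open>\<alpha>\<^sub>S : MFib (g \<alpha>) \<rightarrow> Fib g\<close> for \<open>g : X \<rightarrow> S\<close>.\<close>

record ('o, 'a, 'l, 'q) opmod =
  MOb :: "'l set"
  MArr :: "'q set"
  Src :: "'q \<Rightarrow> 'l"
  Tgt :: "'q \<Rightarrow> 'o"
  Act :: "'a \<Rightarrow> 'q \<Rightarrow> 'q"
  MFib :: "'q \<Rightarrow> 'l"
  MFibM :: "'q \<Rightarrow> 'a \<Rightarrow> 'q"

locale left_operadic_module =
  fixes OC :: "('o, 'a) opcat" and MC :: "('o, 'a, 'l, 'q) opmod"
  assumes Src_closed: "\<alpha> \<in> MArr MC \<Longrightarrow> Src MC \<alpha> \<in> MOb MC"
    and Tgt_closed: "\<alpha> \<in> MArr MC \<Longrightarrow> Tgt MC \<alpha> \<in> Ob OC"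
    and Act_closed: "\<lbrakk>\<alpha> \<in> MArr MC; g \<in> Mor OC; Tgt MC \<alpha> = Dom OC g\<rbrakk> \<Longrightarrow> Act MC g \<alpha> \<in> MArr MC"
    and Src_Act: "\<lbrakk>\<alpha> \<in> MArr MC; g \<in> Mor OC; Tgt MC \<alpha> = Dom OC g\<rbrakk>
      \<Longrightarrow> Src MC (Act MC g \<alpha>) = Src MC \<alpha>"
    and Tgt_Act: "\<lbrakk>\<alpha> \<in> MArr MC; g \<in> Mor OC; Tgt MC \<alpha> = Dom OC g\<rbrakk>
      \<Longrightarrow> Tgt MC (Act MC g \<alpha>) = Cod OC g"
    and Act_Idn: "\<alpha> \<in> MArr MC \<Longrightarrow> Act MC (Idn OC (Tgt MC \<alpha>)) \<alpha> = \<alpha>"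
    and Act_Cmp: "\<lbrakk>\<alpha> \<in> MArr MC; f \<in> Mor OC; g \<in> Mor OC; Tgt MC \<alpha> = Dom OC f; Cod OC f = Dom OC g\<rbrakk>
      \<Longrightarrow> Act MC (Cmp OC g f) \<alpha> = Act MC g (Act MC f \<alpha>)"
    and MFib_closed: "\<alpha> \<in> MArr MC \<Longrightarrow> MFib MC \<alpha> \<in> MOb MC"
    and MFibM_closed: "\<lbrakk>\<alpha> \<in> MArr MC; g \<in> Mor OC; Tgt MC \<alpha> = Dom OC g\<rbrakk>
      \<Longrightarrow> MFibM MC \<alpha> g \<in> MArr MC"
    and Src_MFibM: "\<lbrakk>\<alpha> \<in> MArr MC; g \<in> Mor OC; Tgt MC \<alpha> = Dom OC g\<rbrakk>
      \<Longrightarrow> Src MC (MFibM MC \<alpha> g) = MFib MC (Act MC g \<alpha>)"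
    and Tgt_MFibM: "\<lbrakk>\<alpha> \<in> MArr MC; g \<in> Mor OC; Tgt MC \<alpha> = Dom OC g\<rbrakk>
      \<Longrightarrow> Tgt MC (MFibM MC \<alpha> g) = Fib OC g"
    and MFibM_Act: "\<lbrakk>\<alpha> \<in> MArr MC; h \<in> Mor OC; g \<in> Mor OC; Tgt MC \<alpha> = Dom OC h; Cod OC h = Dom OC g\<rbrakk>
      \<Longrightarrow> MFibM MC (Act MC h \<alpha>) g = Act MC (FibM OC h g) (MFibM MC \<alpha> (Cmp OC g h))"
    and MFib_MFibM: "\<lbrakk>\<alpha> \<in> MArr MC; g \<in> Mor OC; Tgt MC \<alpha> = Dom OC g\<rbrakk>
      \<Longrightarrow> MFib MC (MFibM MC \<alpha> g) = MFib MC \<alpha>"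
    and MFibM_MFibM: "\<lbrakk>\<alpha> \<in> MArr MC; a \<in> Mor OC; c \<in> Mor OC; Tgt MC \<alpha> = Dom OC a; Cod OC a = Dom OC c\<rbrakk>
      \<Longrightarrow> MFibM MC (MFibM MC \<alpha> (Cmp OC c a)) (FibM OC a c) = MFibM MC \<alpha> a"

definition weak_blow_up :: "('o, 'a) opcat \<Rightarrow> bool" where
  "weak_blow_up OC \<longleftrightarrow> (\<forall>f'\<in>Mor OC. \<forall>\<phi>\<in>Mor OC. Dom OC \<phi> = Fib OC f' \<longrightarrow>
     (\<exists>!(\<phi>', f''). \<phi>' \<in> Mor OC \<and> f'' \<in> Mor OC \<and> Cod OC \<phi>' = Dom OC f'' \<and> Cmp OC f'' \<phi>' = f'
        \<and> Fib OC f'' = Cod OC \<phi> \<and> FibM OC \<phi>' f'' = \<phi>))"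

definition weak_blow_up_mod :: "('o, 'a) opcat \<Rightarrow> ('o, 'a, 'l, 'q) opmod \<Rightarrow> bool" where
  "weak_blow_up_mod OC MC \<longleftrightarrow> (\<forall>f'\<in>MArr MC. \<forall>\<phi>\<in>MArr MC. Src MC \<phi> = MFib MC f' \<longrightarrow>
     (\<exists>!(\<phi>', f''). \<phi>' \<in> MArr MC \<and> f'' \<in> Mor OC \<and> Tgt MC \<phi>' = Dom OC f'' \<and> Act MC f'' \<phi>' = f'
        \<and> Fib OC f'' = Tgt MC \<phi> \<and> MFibM MC \<phi>' f'' = \<phi>))"

text \<open>\<open>b\<close> is a terminal object of the category of arrows out of \<open>L\<close>.\<close>

definition terminal_arrow :: "('o, 'a) opcat \<Rightarrow> ('o, 'a, 'l, 'q) opmod \<Rightarrow> 'l \<Rightarrow> 'q \<Rightarrow> bool" where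
  "terminal_arrow OC MC L b \<longleftrightarrow> b \<in> MArr MC \<and> Src MC b = L \<and>
     (\<forall>\<alpha>\<in>MArr MC. Src MC \<alpha> = L \<longrightarrow>
        (\<exists>!g. g \<in> Mor OC \<and> Dom OC g = Tgt MC \<alpha> \<and> Cod OC g = Tgt MC b \<and> Act MC g \<alpha> = b))"

definition domain_fiber_functor :: "('o, 'a) opcat \<Rightarrow> 'o \<Rightarrow> bool" where
  "domain_fiber_functor OC S \<longleftrightarrow> (\<forall>f\<in>Mor OC. Cod OC f = S \<longrightarrow> Fib OC f = Dom OC f
     \<and> (\<forall>\<phi>\<in>Mor OC. Cod OC \<phi> = Dom OC f \<longrightarrow> FibM OC \<phi> f = \<phi>))"

definition rigid :: "('o, 'a) opcat \<Rightarrow> ('o, 'a, 'l, 'q) opmod \<Rightarrow> 'l \<Rightarrow> bool" where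
  "rigid OC MC L \<longleftrightarrow>
     (\<exists>!(S, b). S \<in> Ob OC \<and> b \<in> MArr MC \<and> Src MC b = L \<and> Tgt MC b = S \<and> MFib MC b = L)"


section \<open>Operads and their modules\<close>

text \<open>\<open>gam h i j\<close> is the component of \<open>\<gamma>\<^sub>h\<close> in bidegree \<open>(i, j)\<close>.  A linear map from \<open>R\<close>
  is given by the image of 1, so the unit maps are recorded as elements of degree 0.\<close>

record ('r, 'o, 'a, 'p) operad =
  Pm :: "'o \<Rightarrow> int \<Rightarrow> ('r, 'p) module"
  gam :: "'a \<Rightarrow> int \<Rightarrow> int \<Rightarrow> 'p \<Rightarrow> 'p \<Rightarrow> 'p"
  unt :: "'o \<Rightarrow> 'p"

locale unital_operad =
  fixes R :: "('r, 's) ring_scheme" and OC :: "('o, 'a) opcat" and Q :: "('r, 'o, 'a, 'p) operad"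
  assumes Pm_collection: "gr_collection R (Ob OC) (Pm Q)"
    and gam_bilin: "h \<in> Mor OC \<Longrightarrow>
      bilin_map R (Pm Q (Fib OC h) i) (Pm Q (Cod OC h) j) (Pm Q (Dom OC h) (i + j)) (gam Q h i j)"
    and gam_assoc:
      "\<lbrakk>f \<in> Mor OC; g \<in> Mor OC; Cod OC f = Dom OC g; x \<in> carrier (Pm Q (Fib OC f) i);
        y \<in> carrier (Pm Q (Fib OC g) j); z \<in> carrier (Pm Q (Cod OC g) k)\<rbrakk>
      \<Longrightarrow> gam Q f i (j + k) x (gam Q g j k y z)
        = gam Q (Cmp OC g f) (i + j) k (gam Q (FibM OC f g) i j x y) z"
    and unt_closed: "T \<in> Ob OC \<Longrightarrow> unt Q T \<in> carrier (Pm Q (Ufib OC T) 0)"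
    and unt_left: "\<lbrakk>T \<in> Ob OC; x \<in> carrier (Pm Q T k)\<rbrakk> \<Longrightarrow> gam Q (Idn OC T) 0 k (unt Q T) x = x"
    and unt_right: "\<lbrakk>f \<in> Mor OC; x \<in> carrier (Pm Q (Fib OC f) k)\<rbrakk>
      \<Longrightarrow> gam Q (FibM OC f (Idn OC (Cod OC f))) k 0 x (unt Q (Cod OC f)) = x"

record ('r, 'l, 'q, 'p, 'm) pmodule =
  Mm :: "'l \<Rightarrow> int \<Rightarrow> ('r, 'm) module"
  nu :: "'q \<Rightarrow> int \<Rightarrow> int \<Rightarrow> 'm \<Rightarrow> 'p \<Rightarrow> 'm"

locale unital_pmodule =
  fixes R :: "('r, 's) ring_scheme" and OC :: "('o, 'a) opcat" and MC :: "('o, 'a, 'l, 'q) opmod"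
    and Q :: "('r, 'o, 'a, 'p) operad" and N :: "('r, 'l, 'q, 'p, 'm) pmodule"
  assumes Mm_collection: "gr_collection R (MOb MC) (Mm N)"
    and nu_bilin: "\<alpha> \<in> MArr MC \<Longrightarrow>
      bilin_map R (Mm N (MFib MC \<alpha>) i) (Pm Q (Tgt MC \<alpha>) j) (Mm N (Src MC \<alpha>) (i + j)) (nu N \<alpha> i j)"
    and nu_assoc:
      "\<lbrakk>\<alpha> \<in> MArr MC; g \<in> Mor OC; Tgt MC \<alpha> = Dom OC g; x \<in> carrier (Mm N (MFib MC \<alpha>) i);
        y \<in> carrier (Pm Q (Fib OC g) j); z \<in> carrier (Pm Q (Cod OC g) k)\<rbrakk>
      \<Longrightarrow> nu N \<alpha> i (j + k) x (gam Q g j k y z)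
        = nu N (Act MC g \<alpha>) (i + j) k (nu N (MFibM MC \<alpha> g) i j x y) z"
    and nu_unit: "\<lbrakk>\<alpha> \<in> MArr MC; x \<in> carrier (Mm N (MFib MC \<alpha>) k)\<rbrakk>
      \<Longrightarrow> nu N (MFibM MC \<alpha> (Idn OC (Tgt MC \<alpha>))) k 0 x (unt Q (Tgt MC \<alpha>)) = x"

definition pmodule_hom ::
  "('r, 's) ring_scheme \<Rightarrow> ('o, 'a, 'l, 'q) opmod \<Rightarrow> ('r, 'o, 'a, 'p) operad
     \<Rightarrow> ('r, 'l, 'q, 'p, 'm) pmodule \<Rightarrow> ('r, 'l, 'q, 'p, 'n) pmodule
     \<Rightarrow> ('l \<Rightarrow> int \<Rightarrow> 'm \<Rightarrow> 'n) \<Rightarrow> bool" where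
  "pmodule_hom R MC Q N N' h \<longleftrightarrow>
     (\<forall>L\<in>MOb MC. \<forall>k. lin_map R (Mm N L k) (Mm N' L k) (h L k)) \<and>
     (\<forall>\<alpha>\<in>MArr MC. \<forall>i j. \<forall>x\<in>carrier (Mm N (MFib MC \<alpha>) i). \<forall>p\<in>carrier (Pm Q (Tgt MC \<alpha>) j).
        h (Src MC \<alpha>) (i + j) (nu N \<alpha> i j x p) = nu N' \<alpha> i j (h (MFib MC \<alpha>) i x) p)"


subsection \<open>Free unital modules\<close>

text \<open>The free unital module on a collection \<open>E\<close> is constructed from formal terms modulo the
  congruence generated by the axioms of unital modules.  Its universal property, which makes it
  the value at \<open>E\<close> of the left adjoint of the forgetful functor, is proved below.\<close>

datatype ('r, 'q, 'p, 'e) fterm =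
    FZero
  | FAdd "('r, 'q, 'p, 'e) fterm" "('r, 'q, 'p, 'e) fterm"
  | FSmult 'r "('r, 'q, 'p, 'e) fterm"
  | FGen 'e
  | FAct 'q int int "('r, 'q, 'p, 'e) fterm" 'p

primrec fwt ::
  "('r, 's) ring_scheme \<Rightarrow> ('o, 'a, 'l, 'q) opmod \<Rightarrow> ('r, 'o, 'a, 'p) operad
     \<Rightarrow> ('l \<Rightarrow> int \<Rightarrow> ('r, 'e) module) \<Rightarrow> 'l \<Rightarrow> int \<Rightarrow> ('r, 'q, 'p, 'e) fterm \<Rightarrow> bool" where
  "fwt R MC Q E L k FZero \<longleftrightarrow> True"
| "fwt R MC Q E L k (FAdd s t) \<longleftrightarrow> fwt R MC Q E L k s \<and> fwt R MC Q E L k t"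
| "fwt R MC Q E L k (FSmult r t) \<longleftrightarrow> r \<in> carrier R \<and> fwt R MC Q E L k t"
| "fwt R MC Q E L k (FGen e) \<longleftrightarrow> e \<in> carrier (E L k)"
| "fwt R MC Q E L k (FAct \<alpha> i j t p) \<longleftrightarrow> \<alpha> \<in> MArr MC \<and> Src MC \<alpha> = L \<and> k = i + j
     \<and> fwt R MC Q E (MFib MC \<alpha>) i t \<and> p \<in> carrier (Pm Q (Tgt MC \<alpha>) j)"

inductive feq ::
  "('r, 's) ring_scheme \<Rightarrow> ('o, 'a) opcat \<Rightarrow> ('o, 'a, 'l, 'q) opmod \<Rightarrow> ('r, 'o, 'a, 'p) operad
     \<Rightarrow> ('l \<Rightarrow> int \<Rightarrow> ('r, 'e) module) \<Rightarrow> 'l \<Rightarrow> int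
     \<Rightarrow> ('r, 'q, 'p, 'e) fterm \<Rightarrow> ('r, 'q, 'p, 'e) fterm \<Rightarrow> bool"
  for R OC MC Q E where
  refl: "fwt R MC Q E L k t \<Longrightarrow> feq R OC MC Q E L k t t"
| sym: "feq R OC MC Q E L k s t \<Longrightarrow> feq R OC MC Q E L k t s"
| trans: "feq R OC MC Q E L k s t \<Longrightarrow> feq R OC MC Q E L k t u \<Longrightarrow> feq R OC MC Q E L k s u"
| add_cong: "feq R OC MC Q E L k s s' \<Longrightarrow> feq R OC MC Q E L k t t'
    \<Longrightarrow> feq R OC MC Q E L k (FAdd s t) (FAdd s' t')"
| smult_cong: "r \<in> carrier R \<Longrightarrow> feq R OC MC Q E L k t t'
    \<Longrightarrow> feq R OC MC Q E L k (FSmult r t) (FSmult r t')"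
| act_cong: "\<alpha> \<in> MArr MC \<Longrightarrow> feq R OC MC Q E (MFib MC \<alpha>) i t t' \<Longrightarrow> p \<in> carrier (Pm Q (Tgt MC \<alpha>) j)
    \<Longrightarrow> feq R OC MC Q E (Src MC \<alpha>) (i + j) (FAct \<alpha> i j t p) (FAct \<alpha> i j t' p)"
| add_assoc: "fwt R MC Q E L k s \<Longrightarrow> fwt R MC Q E L k t \<Longrightarrow> fwt R MC Q E L k u
    \<Longrightarrow> feq R OC MC Q E L k (FAdd (FAdd s t) u) (FAdd s (FAdd t u))"
| add_comm: "fwt R MC Q E L k s \<Longrightarrow> fwt R MC Q E L k t
    \<Longrightarrow> feq R OC MC Q E L k (FAdd s t) (FAdd t s)"
| add_zero: "fwt R MC Q E L k t \<Longrightarrow> feq R OC MC Q E L k (FAdd FZero t) t"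
| add_neg: "fwt R MC Q E L k t \<Longrightarrow> feq R OC MC Q E L k (FAdd (FSmult (\<ominus>\<^bsub>R\<^esub> \<one>\<^bsub>R\<^esub>) t) t) FZero"
| smult_l_distr: "r \<in> carrier R \<Longrightarrow> r' \<in> carrier R \<Longrightarrow> fwt R MC Q E L k t
    \<Longrightarrow> feq R OC MC Q E L k (FSmult (r \<oplus>\<^bsub>R\<^esub> r') t) (FAdd (FSmult r t) (FSmult r' t))"
| smult_r_distr: "r \<in> carrier R \<Longrightarrow> fwt R MC Q E L k s \<Longrightarrow> fwt R MC Q E L k t
    \<Longrightarrow> feq R OC MC Q E L k (FSmult r (FAdd s t)) (FAdd (FSmult r s) (FSmult r t))"
| smult_assoc: "r \<in> carrier R \<Longrightarrow> r' \<in> carrier R \<Longrightarrow> fwt R MC Q E L k t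
    \<Longrightarrow> feq R OC MC Q E L k (FSmult (r \<otimes>\<^bsub>R\<^esub> r') t) (FSmult r (FSmult r' t))"
| smult_one: "fwt R MC Q E L k t \<Longrightarrow> feq R OC MC Q E L k (FSmult \<one>\<^bsub>R\<^esub> t) t"
| gen_add: "e \<in> carrier (E L k) \<Longrightarrow> e' \<in> carrier (E L k) \<Longrightarrow> L \<in> MOb MC
    \<Longrightarrow> feq R OC MC Q E L k (FGen (e \<oplus>\<^bsub>E L k\<^esub> e')) (FAdd (FGen e) (FGen e'))"
| gen_smult: "r \<in> carrier R \<Longrightarrow> e \<in> carrier (E L k) \<Longrightarrow> L \<in> MOb MC
    \<Longrightarrow> feq R OC MC Q E L k (FGen (r \<odot>\<^bsub>E L k\<^esub> e)) (FSmult r (FGen e))"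
| act_add_l: "\<alpha> \<in> MArr MC \<Longrightarrow> fwt R MC Q E (MFib MC \<alpha>) i s \<Longrightarrow> fwt R MC Q E (MFib MC \<alpha>) i t
    \<Longrightarrow> p \<in> carrier (Pm Q (Tgt MC \<alpha>) j)
    \<Longrightarrow> feq R OC MC Q E (Src MC \<alpha>) (i + j)
          (FAct \<alpha> i j (FAdd s t) p) (FAdd (FAct \<alpha> i j s p) (FAct \<alpha> i j t p))"
| act_smult_l: "\<alpha> \<in> MArr MC \<Longrightarrow> r \<in> carrier R \<Longrightarrow> fwt R MC Q E (MFib MC \<alpha>) i t
    \<Longrightarrow> p \<in> carrier (Pm Q (Tgt MC \<alpha>) j)
    \<Longrightarrow> feq R OC MC Q E (Src MC \<alpha>) (i + j)
          (FAct \<alpha> i j (FSmult r t) p) (FSmult r (FAct \<alpha> i j t p))"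
| act_add_r: "\<alpha> \<in> MArr MC \<Longrightarrow> fwt R MC Q E (MFib MC \<alpha>) i t
    \<Longrightarrow> p \<in> carrier (Pm Q (Tgt MC \<alpha>) j) \<Longrightarrow> p' \<in> carrier (Pm Q (Tgt MC \<alpha>) j)
    \<Longrightarrow> feq R OC MC Q E (Src MC \<alpha>) (i + j)
          (FAct \<alpha> i j t (p \<oplus>\<^bsub>Pm Q (Tgt MC \<alpha>) j\<^esub> p')) (FAdd (FAct \<alpha> i j t p) (FAct \<alpha> i j t p'))"
| act_smult_r: "\<alpha> \<in> MArr MC \<Longrightarrow> r \<in> carrier R \<Longrightarrow> fwt R MC Q E (MFib MC \<alpha>) i t
    \<Longrightarrow> p \<in> carrier (Pm Q (Tgt MC \<alpha>) j)
    \<Longrightarrow> feq R OC MC Q E (Src MC \<alpha>) (i + j)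
          (FAct \<alpha> i j t (r \<odot>\<^bsub>Pm Q (Tgt MC \<alpha>) j\<^esub> p)) (FSmult r (FAct \<alpha> i j t p))"
| act_assoc: "\<alpha> \<in> MArr MC \<Longrightarrow> g \<in> Mor OC \<Longrightarrow> Tgt MC \<alpha> = Dom OC g
    \<Longrightarrow> fwt R MC Q E (MFib MC \<alpha>) i t
    \<Longrightarrow> p \<in> carrier (Pm Q (Fib OC g) j) \<Longrightarrow> p' \<in> carrier (Pm Q (Cod OC g) k)
    \<Longrightarrow> feq R OC MC Q E (Src MC \<alpha>) (i + (j + k))
          (FAct \<alpha> i (j + k) t (gam Q g j k p p'))
          (FAct (Act MC g \<alpha>) (i + j) k (FAct (MFibM MC \<alpha> g) i j t p) p')"
| act_unit: "\<alpha> \<in> MArr MC \<Longrightarrow> fwt R MC Q E (MFib MC \<alpha>) k t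
    \<Longrightarrow> feq R OC MC Q E (MFib MC \<alpha>) k
          (FAct (MFibM MC \<alpha> (Idn OC (Tgt MC \<alpha>))) k 0 t (unt Q (Tgt MC \<alpha>))) t"

definition fcls ::
  "('r, 's) ring_scheme \<Rightarrow> ('o, 'a) opcat \<Rightarrow> ('o, 'a, 'l, 'q) opmod \<Rightarrow> ('r, 'o, 'a, 'p) operad
     \<Rightarrow> ('l \<Rightarrow> int \<Rightarrow> ('r, 'e) module) \<Rightarrow> 'l \<Rightarrow> int
     \<Rightarrow> ('r, 'q, 'p, 'e) fterm \<Rightarrow> ('r, 'q, 'p, 'e) fterm set" where
  "fcls R OC MC Q E L k t = {s. feq R OC MC Q E L k t s}"

definition frep :: "('r, 'q, 'p, 'e) fterm set \<Rightarrow> ('r, 'q, 'p, 'e) fterm" where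
  "frep X = (SOME t. t \<in> X)"

definition free_pmodule ::
  "('r, 's) ring_scheme \<Rightarrow> ('o, 'a) opcat \<Rightarrow> ('o, 'a, 'l, 'q) opmod \<Rightarrow> ('r, 'o, 'a, 'p) operad
     \<Rightarrow> ('l \<Rightarrow> int \<Rightarrow> ('r, 'e) module) \<Rightarrow> ('r, 'l, 'q, 'p, ('r, 'q, 'p, 'e) fterm set) pmodule" where
  "free_pmodule R OC MC Q E = \<lparr>
     Mm = (\<lambda>L k. \<lparr>carrier = fcls R OC MC Q E L k ` {t. fwt R MC Q E L k t},
        mult = undefined, one = undefined,
        zero = fcls R OC MC Q E L k FZero,
        add = (\<lambda>X Y. fcls R OC MC Q E L k (FAdd (frep X) (frep Y))),
        smult = (\<lambda>r X. fcls R OC MC Q E L k (FSmult r (frep X)))\<rparr>),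
     nu = (\<lambda>\<alpha> i j X p. fcls R OC MC Q E (Src MC \<alpha>) (i + j) (FAct \<alpha> i j (frep X) p))\<rparr>"

definition free_unit ::
  "('r, 's) ring_scheme \<Rightarrow> ('o, 'a) opcat \<Rightarrow> ('o, 'a, 'l, 'q) opmod \<Rightarrow> ('r, 'o, 'a, 'p) operad
     \<Rightarrow> ('l \<Rightarrow> int \<Rightarrow> ('r, 'e) module) \<Rightarrow> 'l \<Rightarrow> int \<Rightarrow> 'e \<Rightarrow> ('r, 'q, 'p, 'e) fterm set" where
  "free_unit R OC MC Q E L k e = fcls R OC MC Q E L k (FGen e)"

locale free_pmodule_setting =
  unary_operadic_category OC + left_operadic_module OC MC + unital_operad R OC Q
  for R :: "('r, 's) ring_scheme" and OC :: "('o, 'a) opcat"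
    and MC :: "('o, 'a, 'l, 'q) opmod" and Q :: "('r, 'o, 'a, 'p) operad" +
  fixes E :: "'l \<Rightarrow> int \<Rightarrow> ('r, 'e) module"
  assumes cring_R: "cring R" and E_collection: "gr_collection R (MOb MC) E"
begin

abbreviation "wt \<equiv> fwt R MC Q E"
abbreviation "ceq \<equiv> feq R OC MC Q E"
abbreviation "cls \<equiv> fcls R OC MC Q E"
abbreviation "FM \<equiv> free_pmodule R OC MC Q E"

lemma Pm_module: "A \<in> Ob OC \<Longrightarrow> module R (Pm Q A k)"
  using Pm_collection by (simp add: gr_collection_def)

lemma E_module: "L \<in> MOb MC \<Longrightarrow> module R (E L k)"
  using E_collection by (simp add: gr_collection_def)

lemma Pm_add: "A \<in> Ob OC \<Longrightarrow> x \<in> carrier (Pm Q A k) \<Longrightarrow> y \<in> carrier (Pm Q A k)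
    \<Longrightarrow> x \<oplus>\<^bsub>Pm Q A k\<^esub> y \<in> carrier (Pm Q A k)"
  using Pm_module[of A k] by (simp add: module_def abelian_group_def abelian_monoid.a_closed)

lemma Pm_smult: "A \<in> Ob OC \<Longrightarrow> r \<in> carrier R \<Longrightarrow> x \<in> carrier (Pm Q A k)
    \<Longrightarrow> r \<odot>\<^bsub>Pm Q A k\<^esub> x \<in> carrier (Pm Q A k)"
  using Pm_module[of A k] by (simp add: module.smult_closed)

lemma E_add: "L \<in> MOb MC \<Longrightarrow> x \<in> carrier (E L k) \<Longrightarrow> y \<in> carrier (E L k)
    \<Longrightarrow> x \<oplus>\<^bsub>E L k\<^esub> y \<in> carrier (E L k)"
  using E_module[of L k] by (simp add: module_def abelian_group_def abelian_monoid.a_closed)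

lemma E_smult: "L \<in> MOb MC \<Longrightarrow> r \<in> carrier R \<Longrightarrow> x \<in> carrier (E L k)
    \<Longrightarrow> r \<odot>\<^bsub>E L k\<^esub> x \<in> carrier (E L k)"
  using E_module[of L k] by (simp add: module.smult_closed)

lemma gam_closed: "h \<in> Mor OC \<Longrightarrow> x \<in> carrier (Pm Q (Fib OC h) i) \<Longrightarrow> y \<in> carrier (Pm Q (Cod OC h) j)
    \<Longrightarrow> gam Q h i j x y \<in> carrier (Pm Q (Dom OC h) (i + j))"
  using gam_bilin[of h i j] by (auto simp: bilin_map_def lin_map_def Pi_def)

lemma R_closed:
  "\<one>\<^bsub>R\<^esub> \<in> carrier R" "\<ominus>\<^bsub>R\<^esub> \<one>\<^bsub>R\<^esub> \<in> carrier R"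
  "r \<in> carrier R \<Longrightarrow> r' \<in> carrier R \<Longrightarrow> r \<oplus>\<^bsub>R\<^esub> r' \<in> carrier R"
  "r \<in> carrier R \<Longrightarrow> r' \<in> carrier R \<Longrightarrow> r \<otimes>\<^bsub>R\<^esub> r' \<in> carrier R"
proof -
  interpret R: cring R by (rule cring_R)
  show "\<one>\<^bsub>R\<^esub> \<in> carrier R" "\<ominus>\<^bsub>R\<^esub> \<one>\<^bsub>R\<^esub> \<in> carrier R"
    "r \<in> carrier R \<Longrightarrow> r' \<in> carrier R \<Longrightarrow> r \<oplus>\<^bsub>R\<^esub> r' \<in> carrier R"
    "r \<in> carrier R \<Longrightarrow> r' \<in> carrier R \<Longrightarrow> r \<otimes>\<^bsub>R\<^esub> r' \<in> carrier R"
    by auto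
qed

lemmas arr_facts = Src_closed Tgt_closed Act_closed Src_Act Tgt_Act MFib_closed MFibM_closed
  Src_MFibM Tgt_MFibM MFib_MFibM Act_Idn Idn_closed Dom_Idn Cod_Idn Fib_closed Cod_closed Dom_closed

lemma MFibM_unit: "\<alpha> \<in> MArr MC \<Longrightarrow> MFibM MC \<alpha> (Idn OC (Tgt MC \<alpha>)) \<in> MArr MC
   \<and> Src MC (MFibM MC \<alpha> (Idn OC (Tgt MC \<alpha>))) = MFib MC \<alpha>
   \<and> Tgt MC (MFibM MC \<alpha> (Idn OC (Tgt MC \<alpha>))) = Ufib OC (Tgt MC \<alpha>)
   \<and> MFib MC (MFibM MC \<alpha> (Idn OC (Tgt MC \<alpha>))) = MFib MC \<alpha>"
  by (simp add: arr_facts Ufib_def)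

lemma eq_wt: "ceq L k s t \<Longrightarrow> wt L k s \<and> wt L k t"
proof (induction rule: feq.induct)
  case (act_assoc \<alpha> g i t p j p' k)
  then show ?case using gam_closed[of g p j p' k] by (simp add: arr_facts add.assoc)
next
  case (act_unit \<alpha> k t)
  then show ?case using MFibM_unit[of \<alpha>] unt_closed[of "Tgt MC \<alpha>"] by (simp add: arr_facts)
qed (auto simp: R_closed E_add E_smult Pm_add Pm_smult arr_facts)

lemma cls_eq_iff: "wt L k s \<Longrightarrow> wt L k t \<Longrightarrow> cls L k s = cls L k t \<longleftrightarrow> ceq L k s t"
  unfolding fcls_def set_eq_iff mem_Collect_eq
  by (iprover intro: feq.refl feq.sym feq.trans elim: iffE allE)

lemma cls_eqI: "ceq L k s t \<Longrightarrow> cls L k s = cls L k t"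
  using cls_eq_iff eq_wt by blast

lemma rep_eq: "wt L k t \<Longrightarrow> ceq L k t (frep (cls L k t))"
  unfolding frep_def fcls_def using feq.refl[of R MC Q E L k t OC]
  by (metis (mono_tags, lifting) mem_Collect_eq someI)

lemma rep_wt: "wt L k t \<Longrightarrow> wt L k (frep (cls L k t))"
  using rep_eq eq_wt by blast

lemma carrier_FM: "carrier (Mm FM L k) = cls L k ` {t. wt L k t}"
  by (simp add: free_pmodule_def)

lemma zero_FM: "\<zero>\<^bsub>Mm FM L k\<^esub> = cls L k FZero"
  by (simp add: free_pmodule_def)

lemma add_FM: "wt L k s \<Longrightarrow> wt L k t \<Longrightarrow> cls L k s \<oplus>\<^bsub>Mm FM L k\<^esub> cls L k t = cls L k (FAdd s t)"
  by (simp add: free_pmodule_def) (rule cls_eqI, rule feq.sym, rule feq.add_cong, (rule rep_eq, assumption)+)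

lemma smult_FM: "r \<in> carrier R \<Longrightarrow> wt L k t \<Longrightarrow> r \<odot>\<^bsub>Mm FM L k\<^esub> cls L k t = cls L k (FSmult r t)"
  by (simp add: free_pmodule_def) (rule cls_eqI, rule feq.sym, rule feq.smult_cong, assumption, rule rep_eq)

lemma nu_FM: "\<alpha> \<in> MArr MC \<Longrightarrow> wt (MFib MC \<alpha>) i t \<Longrightarrow> p \<in> carrier (Pm Q (Tgt MC \<alpha>) j)
    \<Longrightarrow> nu FM \<alpha> i j (cls (MFib MC \<alpha>) i t) p = cls (Src MC \<alpha>) (i + j) (FAct \<alpha> i j t p)"
  by (simp add: free_pmodule_def) (rule cls_eqI, rule feq.sym, rule feq.act_cong, assumption, rule rep_eq)

lemma FM_module: "module R (Mm FM L k)"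
proof (rule moduleI)
  show "abelian_group (Mm FM L k)"
  proof (rule abelian_groupI)
    fix x y z
    assume "x \<in> carrier (Mm FM L k)" "y \<in> carrier (Mm FM L k)" "z \<in> carrier (Mm FM L k)"
    then obtain s t u where [simp]: "x = cls L k s" "wt L k s" "y = cls L k t" "wt L k t"
      "z = cls L k u" "wt L k u" by (auto simp: carrier_FM)
    show "x \<oplus>\<^bsub>Mm FM L k\<^esub> y \<in> carrier (Mm FM L k)"
      by (simp add: add_FM) (simp add: carrier_FM)
    show "x \<oplus>\<^bsub>Mm FM L k\<^esub> y \<oplus>\<^bsub>Mm FM L k\<^esub> z = x \<oplus>\<^bsub>Mm FM L k\<^esub> (y \<oplus>\<^bsub>Mm FM L k\<^esub> z)"
      by (simp add: add_FM cls_eqI feq.add_assoc)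
    show "x \<oplus>\<^bsub>Mm FM L k\<^esub> y = y \<oplus>\<^bsub>Mm FM L k\<^esub> x"
      by (simp add: add_FM cls_eqI feq.add_comm)
    show "\<zero>\<^bsub>Mm FM L k\<^esub> \<oplus>\<^bsub>Mm FM L k\<^esub> x = x"
      by (simp add: add_FM zero_FM cls_eqI feq.add_zero)
    show "\<exists>y\<in>carrier (Mm FM L k). y \<oplus>\<^bsub>Mm FM L k\<^esub> x = \<zero>\<^bsub>Mm FM L k\<^esub>"
      by (rule bexI[of _ "cls L k (FSmult (\<ominus>\<^bsub>R\<^esub> \<one>\<^bsub>R\<^esub>) s)"])
        (simp add: add_FM zero_FM R_closed cls_eqI feq.add_neg, simp add: carrier_FM R_closed)
  qed (simp add: zero_FM carrier_FM)
next
  fix a b x y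
  assume [simp]: "a \<in> carrier R" "b \<in> carrier R"
    and "x \<in> carrier (Mm FM L k)" "y \<in> carrier (Mm FM L k)"
  then obtain s t where [simp]: "x = cls L k s" "wt L k s" "y = cls L k t" "wt L k t"
    by (auto simp: carrier_FM)
  show "a \<odot>\<^bsub>Mm FM L k\<^esub> x \<in> carrier (Mm FM L k)"
    by (simp add: smult_FM) (simp add: carrier_FM)
  show "(a \<oplus>\<^bsub>R\<^esub> b) \<odot>\<^bsub>Mm FM L k\<^esub> x = a \<odot>\<^bsub>Mm FM L k\<^esub> x \<oplus>\<^bsub>Mm FM L k\<^esub> b \<odot>\<^bsub>Mm FM L k\<^esub> x"
    by (simp add: smult_FM add_FM R_closed cls_eqI feq.smult_l_distr)
  show "a \<odot>\<^bsub>Mm FM L k\<^esub> (x \<oplus>\<^bsub>Mm FM L k\<^esub> y) = a \<odot>\<^bsub>Mm FM L k\<^esub> x \<oplus>\<^bsub>Mm FM L k\<^esub> a \<odot>\<^bsub>Mm FM L k\<^esub> y"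
    by (simp add: smult_FM add_FM cls_eqI feq.smult_r_distr)
  show "(a \<otimes>\<^bsub>R\<^esub> b) \<odot>\<^bsub>Mm FM L k\<^esub> x = a \<odot>\<^bsub>Mm FM L k\<^esub> (b \<odot>\<^bsub>Mm FM L k\<^esub> x)"
    by (simp add: smult_FM R_closed cls_eqI feq.smult_assoc)
next
  fix x assume "x \<in> carrier (Mm FM L k)"
  then obtain s where [simp]: "x = cls L k s" "wt L k s"
    by (auto simp: carrier_FM)
  show "\<one>\<^bsub>R\<^esub> \<odot>\<^bsub>Mm FM L k\<^esub> x = x"
    by (simp add: smult_FM R_closed cls_eqI feq.smult_one)
qed (rule cring_R)

theorem free_pmodule_unital: "unital_pmodule R OC MC Q FM"
proof
  show "gr_collection R (MOb MC) (Mm FM)"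
    by (simp add: gr_collection_def FM_module)
next
  fix \<alpha> i j
  assume \<alpha>[simp]: "\<alpha> \<in> MArr MC"
  show "bilin_map R (Mm FM (MFib MC \<alpha>) i) (Pm Q (Tgt MC \<alpha>) j) (Mm FM (Src MC \<alpha>) (i + j)) (nu FM \<alpha> i j)"
    unfolding bilin_map_def lin_map_def
    by (auto simp: carrier_FM nu_FM add_FM smult_FM Pm_add Pm_smult Tgt_closed intro!: cls_eqI
        intro: feq.act_add_l feq.act_add_r feq.act_smult_l feq.act_smult_r)
next
  fix \<alpha> g x y z i j k
  assume a[simp]: "\<alpha> \<in> MArr MC" "g \<in> Mor OC" "Tgt MC \<alpha> = Dom OC g"
    and x: "x \<in> carrier (Mm FM (MFib MC \<alpha>) i)"
    and p[simp]: "y \<in> carrier (Pm Q (Fib OC g) j)" "z \<in> carrier (Pm Q (Cod OC g) k)"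
  from x obtain t where t[simp]: "x = cls (MFib MC \<alpha>) i t" "wt (MFib MC \<alpha>) i t"
    by (auto simp: carrier_FM)
  have 1: "nu FM (MFibM MC \<alpha> g) i j x y
      = cls (MFib MC (Act MC g \<alpha>)) (i + j) (FAct (MFibM MC \<alpha> g) i j t y)"
    using nu_FM[of "MFibM MC \<alpha> g" i t y j] by (simp add: arr_facts)
  have 2: "nu FM (Act MC g \<alpha>) (i + j) k (nu FM (MFibM MC \<alpha> g) i j x y) z
      = cls (Src MC \<alpha>) (i + j + k) (FAct (Act MC g \<alpha>) (i + j) k (FAct (MFibM MC \<alpha> g) i j t y) z)"
    unfolding 1
    using nu_FM[of "Act MC g \<alpha>" "i + j" "FAct (MFibM MC \<alpha> g) i j t y" z k] by (simp add: arr_facts)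
  have 3: "nu FM \<alpha> i (j + k) x (gam Q g j k y z)
      = cls (Src MC \<alpha>) (i + (j + k)) (FAct \<alpha> i (j + k) t (gam Q g j k y z))"
    using nu_FM[of \<alpha> i t "gam Q g j k y z" "j + k"] gam_closed[of g y j z k] by simp
  show "nu FM \<alpha> i (j + k) x (gam Q g j k y z)
      = nu FM (Act MC g \<alpha>) (i + j) k (nu FM (MFibM MC \<alpha> g) i j x y) z"
    unfolding 2 3
    using cls_eqI[OF feq.act_assoc[OF a t(2) p]] by (simp add: add.assoc)
next
  fix \<alpha> x k
  assume a: "\<alpha> \<in> MArr MC" and "x \<in> carrier (Mm FM (MFib MC \<alpha>) k)"
  then obtain t where t: "x = cls (MFib MC \<alpha>) k t" "wt (MFib MC \<alpha>) k t"
    by (auto simp: carrier_FM)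
  show "nu FM (MFibM MC \<alpha> (Idn OC (Tgt MC \<alpha>))) k 0 x (unt Q (Tgt MC \<alpha>)) = x"
    using nu_FM[of "MFibM MC \<alpha> (Idn OC (Tgt MC \<alpha>))" k t "unt Q (Tgt MC \<alpha>)" 0]
      MFibM_unit[OF a] unt_closed[of "Tgt MC \<alpha>"] cls_eqI[OF feq.act_unit[OF a t(2)]] a
    by (simp add: t Tgt_closed)
qed

lemma free_unit_lin: "L \<in> MOb MC \<Longrightarrow> lin_map R (E L k) (Mm FM L k) (free_unit R OC MC Q E L k)"
  unfolding lin_map_def free_unit_def
  by (auto simp: carrier_FM add_FM smult_FM intro!: cls_eqI intro: feq.gen_add feq.gen_smult)

end

primrec feval ::
  "('o, 'a, 'l, 'q) opmod \<Rightarrow> ('r, 'l, 'q, 'p, 'm) pmodule \<Rightarrow> ('l \<Rightarrow> int \<Rightarrow> 'e \<Rightarrow> 'm)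
     \<Rightarrow> 'l \<Rightarrow> int \<Rightarrow> ('r, 'q, 'p, 'e) fterm \<Rightarrow> 'm" where
  "feval MC N \<phi> L k FZero = \<zero>\<^bsub>Mm N L k\<^esub>"
| "feval MC N \<phi> L k (FAdd s t) = feval MC N \<phi> L k s \<oplus>\<^bsub>Mm N L k\<^esub> feval MC N \<phi> L k t"
| "feval MC N \<phi> L k (FSmult r t) = r \<odot>\<^bsub>Mm N L k\<^esub> feval MC N \<phi> L k t"
| "feval MC N \<phi> L k (FGen e) = \<phi> L k e"
| "feval MC N \<phi> L k (FAct \<alpha> i j t p) = nu N \<alpha> i j (feval MC N \<phi> (MFib MC \<alpha>) i t) p"

locale free_pmodule_target =
  free_pmodule_setting R OC MC Q E + unital_pmodule R OC MC Q N
  for R :: "('r, 's) ring_scheme" and OC :: "('o, 'a) opcat"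
    and MC :: "('o, 'a, 'l, 'q) opmod" and Q :: "('r, 'o, 'a, 'p) operad"
    and E :: "'l \<Rightarrow> int \<Rightarrow> ('r, 'e) module" and N :: "('r, 'l, 'q, 'p, 'm) pmodule" +
  fixes \<phi> :: "'l \<Rightarrow> int \<Rightarrow> 'e \<Rightarrow> 'm"
  assumes \<phi>_lin: "L \<in> MOb MC \<Longrightarrow> lin_map R (E L k) (Mm N L k) (\<phi> L k)"
begin

abbreviation "ev \<equiv> feval MC N \<phi>"

lemma Mm_module: "L \<in> MOb MC \<Longrightarrow> module R (Mm N L k)"
  using Mm_collection by (simp add: gr_collection_def)

lemma nu_closed: "\<alpha> \<in> MArr MC \<Longrightarrow> x \<in> carrier (Mm N (MFib MC \<alpha>) i)
    \<Longrightarrow> p \<in> carrier (Pm Q (Tgt MC \<alpha>) j) \<Longrightarrow> nu N \<alpha> i j x p \<in> carrier (Mm N (Src MC \<alpha>) (i + j))"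
  using nu_bilin[of \<alpha> i j] by (auto simp: bilin_map_def lin_map_def Pi_def)

lemma ev_closed: "wt L k t \<Longrightarrow> L \<in> MOb MC \<Longrightarrow> ev L k t \<in> carrier (Mm N L k)"
proof (induction t arbitrary: L k)
  case (FGen e)
  then show ?case using \<phi>_lin[of L k] by (auto simp: lin_map_def Pi_def)
next
  case (FAct \<alpha> i j t p)
  then show ?case by (auto intro!: nu_closed simp: MFib_closed)
qed (auto simp: module.smult_closed[OF Mm_module] abelian_monoid.zero_closed abelian_monoid.a_closed
    Mm_module[unfolded module_def abelian_group_def])

lemma eq_ev: "ceq L k s t \<Longrightarrow> L \<in> MOb MC \<Longrightarrow> ev L k s = ev L k t"
proof (induction rule: feq.induct)
  case (add_assoc L k s t u)
  then interpret M: module R "Mm N L k" by (simp add: Mm_module)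
  from add_assoc show ?case by (simp add: ev_closed M.a_assoc)
next
  case (add_comm L k s t)
  then interpret M: module R "Mm N L k" by (simp add: Mm_module)
  from add_comm show ?case by (simp add: ev_closed M.a_comm)
next
  case (add_zero L k t)
  then interpret M: module R "Mm N L k" by (simp add: Mm_module)
  from add_zero show ?case by (simp add: ev_closed)
next
  case (add_neg L k t)
  then interpret M: module R "Mm N L k" by (simp add: Mm_module)
  from add_neg show ?case by (simp add: ev_closed M.smult_l_minus M.l_neg)
next
  case (smult_l_distr r r' L k t)
  then interpret M: module R "Mm N L k" by (simp add: Mm_module)
  from smult_l_distr show ?case by (simp add: ev_closed M.smult_l_distr)
next
  case (smult_r_distr r L k s t)
  then interpret M: module R "Mm N L k" by (simp add: Mm_module)
  from smult_r_distr show ?case by (simp add: ev_closed M.smult_r_distr)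
next
  case (smult_assoc r r' L k t)
  then interpret M: module R "Mm N L k" by (simp add: Mm_module)
  from smult_assoc show ?case by (simp add: ev_closed M.smult_assoc1)
next
  case (smult_one L k t)
  then interpret M: module R "Mm N L k" by (simp add: Mm_module)
  from smult_one show ?case by (simp add: ev_closed)
next
  case (gen_add e L k e')
  then show ?case using \<phi>_lin[of L k] by (simp add: lin_map_def)
next
  case (gen_smult r e L k)
  then show ?case using \<phi>_lin[of L k] by (simp add: lin_map_def)
next
  case (act_add_l \<alpha> i s t p j)
  then show ?case using nu_bilin[of \<alpha> i j] by (simp add: bilin_map_def lin_map_def ev_closed MFib_closed)
next
  case (act_smult_l \<alpha> r i t p j)
  then show ?case using nu_bilin[of \<alpha> i j] by (simp add: bilin_map_def lin_map_def ev_closed MFib_closed)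
next
  case (act_add_r \<alpha> i t p j p')
  then show ?case using nu_bilin[of \<alpha> i j] by (simp add: bilin_map_def lin_map_def ev_closed MFib_closed)
next
  case (act_smult_r \<alpha> r i t p j)
  then show ?case using nu_bilin[of \<alpha> i j] by (simp add: bilin_map_def lin_map_def ev_closed MFib_closed)
next
  case (act_assoc \<alpha> g i t p j p' k)
  then show ?case
    by (simp add: nu_assoc ev_closed MFib_closed MFib_MFibM)
next
  case (act_unit \<alpha> k t)
  then show ?case using MFibM_unit[of \<alpha>] by (simp add: nu_unit ev_closed MFib_closed)
qed (auto simp: MFib_closed)

theorem free_pmodule_extension:
  "\<exists>h. pmodule_hom R MC Q FM N h
     \<and> (\<forall>L\<in>MOb MC. \<forall>k. \<forall>e\<in>carrier (E L k). h L k (free_unit R OC MC Q E L k e) = \<phi> L k e)"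
proof -
  define h where "h = (\<lambda>L k X. ev L k (frep X))"
  have h: "h L k (cls L k t) = ev L k t" if "wt L k t" "L \<in> MOb MC" for L k t
    using eq_ev[OF rep_eq[OF that(1)] that(2)] by (simp add: h_def)
  have "pmodule_hom R MC Q FM N h"
    unfolding pmodule_hom_def
  proof (intro conjI ballI allI)
    fix L k assume "L \<in> MOb MC"
    then show "lin_map R (Mm FM L k) (Mm N L k) (h L k)"
      unfolding lin_map_def by (auto simp: carrier_FM add_FM smult_FM h ev_closed)
  next
    fix \<alpha> i j x p
    assume a: "\<alpha> \<in> MArr MC" "x \<in> carrier (Mm FM (MFib MC \<alpha>) i)" "p \<in> carrier (Pm Q (Tgt MC \<alpha>) j)"
    then obtain t where t: "x = cls (MFib MC \<alpha>) i t" "wt (MFib MC \<alpha>) i t"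
      by (auto simp: carrier_FM)
    show "h (Src MC \<alpha>) (i + j) (nu FM \<alpha> i j x p) = nu N \<alpha> i j (h (MFib MC \<alpha>) i x) p"
      using a t by (simp add: nu_FM h MFib_closed Src_closed)
  qed
  moreover have "h L k (free_unit R OC MC Q E L k e) = \<phi> L k e"
    if "L \<in> MOb MC" "e \<in> carrier (E L k)" for L k e
    using that h[of L k "FGen e"] by (simp add: free_unit_def)
  ultimately show ?thesis by blast
qed

theorem free_pmodule_unique:
  assumes h: "pmodule_hom R MC Q FM N h"
    "\<And>L k e. L \<in> MOb MC \<Longrightarrow> e \<in> carrier (E L k) \<Longrightarrow> h L k (free_unit R OC MC Q E L k e) = \<phi> L k e"
    and h': "pmodule_hom R MC Q FM N h'"
    "\<And>L k e. L \<in> MOb MC \<Longrightarrow> e \<in> carrier (E L k) \<Longrightarrow> h' L k (free_unit R OC MC Q E L k e) = \<phi> L k e"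
    and "L \<in> MOb MC" "X \<in> carrier (Mm FM L k)"
  shows "h L k X = h' L k X"
proof -
  have *: "g L k (cls L k t) = ev L k t"
    if g: "pmodule_hom R MC Q FM N g"
      "\<And>L k e. L \<in> MOb MC \<Longrightarrow> e \<in> carrier (E L k) \<Longrightarrow> g L k (free_unit R OC MC Q E L k e) = \<phi> L k e"
      and "wt L k t" "L \<in> MOb MC" for g L k t
    using that(3,4)
  proof (induction t arbitrary: L k)
    case FZero
    interpret F: module R "Mm FM L k" by (rule FM_module)
    interpret M: module R "Mm N L k" using FZero by (simp add: Mm_module)
    have l: "lin_map R (Mm FM L k) (Mm N L k) (g L k)"
      using g(1) FZero by (simp add: pmodule_hom_def)
    have "g L k (\<zero>\<^bsub>R\<^esub> \<odot>\<^bsub>Mm FM L k\<^esub> \<zero>\<^bsub>Mm FM L k\<^esub>) = \<zero>\<^bsub>R\<^esub> \<odot>\<^bsub>Mm N L k\<^esub> g L k \<zero>\<^bsub>Mm FM L k\<^esub>"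
      using l by (simp add: lin_map_def del: F.smult_l_null F.smult_r_null M.smult_l_null)
    moreover have "g L k \<zero>\<^bsub>Mm FM L k\<^esub> \<in> carrier (Mm N L k)"
      using l F.zero_closed unfolding lin_map_def by blast
    moreover have "\<zero>\<^bsub>R\<^esub> \<odot>\<^bsub>Mm FM L k\<^esub> \<zero>\<^bsub>Mm FM L k\<^esub> = \<zero>\<^bsub>Mm FM L k\<^esub>"
      by (rule F.smult_l_null) simp
    ultimately show ?case by (simp flip: zero_FM)
  next
    case (FAdd s t)
    then have "lin_map R (Mm FM L k) (Mm N L k) (g L k)"
      using g(1) by (simp add: pmodule_hom_def)
    with FAdd show ?case by (simp add: lin_map_def carrier_FM flip: add_FM)
  next
    case (FSmult r t)
    then have "lin_map R (Mm FM L k) (Mm N L k) (g L k)"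
      using g(1) by (simp add: pmodule_hom_def)
    with FSmult show ?case by (simp add: lin_map_def carrier_FM flip: smult_FM)
  next
    case (FGen e)
    then show ?case using g(2)[of L e k] by (simp add: free_unit_def)
  next
    case (FAct \<alpha> i j t p)
    then have f: "\<alpha> \<in> MArr MC" "Src MC \<alpha> = L" "k = i + j" "wt (MFib MC \<alpha>) i t"
      "p \<in> carrier (Pm Q (Tgt MC \<alpha>) j)"
      by simp_all
    have "cls (MFib MC \<alpha>) i t \<in> carrier (Mm FM (MFib MC \<alpha>) i)"
      using f by (simp add: carrier_FM)
    then have "g (Src MC \<alpha>) (i + j) (nu FM \<alpha> i j (cls (MFib MC \<alpha>) i t) p)
        = nu N \<alpha> i j (g (MFib MC \<alpha>) i (cls (MFib MC \<alpha>) i t)) p"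
      using g(1) f unfolding pmodule_hom_def by blast
    moreover have "g (MFib MC \<alpha>) i (cls (MFib MC \<alpha>) i t) = ev (MFib MC \<alpha>) i t"
      using FAct.IH f by (simp add: MFib_closed)
    moreover have "nu FM \<alpha> i j (cls (MFib MC \<alpha>) i t) p = cls L k (FAct \<alpha> i j t p)"
      using nu_FM[of \<alpha> i t p j] f by simp
    ultimately show ?case using f by simp
  qed
  show ?thesis using assms *[OF h] *[OF h'] by (auto simp: carrier_FM)
qed

end

section \<open>The bar construction\<close>

text \<open>The tower \<open>T\<^sub>0 \<leftarrow> \<dots> \<leftarrow> T\<^sub>n \<leftarrow> L\<close> with morphisms \<open>f\<^sub>1, \<dots>, f\<^sub>n\<close> and arrow \<open>\<alpha>\<close>
  is the pair \<open>([f\<^sub>1, \<dots>, f\<^sub>n], \<alpha>)\<close>; thus \<open>f\<^sub>i = fs ! (i - 1)\<close>.\<close>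

type_synonym ('a, 'q) tower = "'a list \<times> 'q"

definition vert ::
  "('o, 'a) opcat \<Rightarrow> ('o, 'a, 'l, 'q) opmod \<Rightarrow> ('a, 'q) tower \<Rightarrow> nat \<Rightarrow> 'o" where
  "vert OC MC = (\<lambda>(fs, \<alpha>) i. if i < length fs then Cod OC (fs ! i) else Tgt MC \<alpha>)"

definition towers ::
  "('o, 'a) opcat \<Rightarrow> ('o, 'a, 'l, 'q) opmod \<Rightarrow> nat \<Rightarrow> 'l \<Rightarrow> ('a, 'q) tower set" where
  "towers OC MC n L = {(fs, \<alpha>). length fs = n \<and> set fs \<subseteq> Mor OC \<and> \<alpha> \<in> MArr MC \<and> Src MC \<alpha> = L
     \<and> (\<forall>i<n. Dom OC (fs ! i) = vert OC MC (fs, \<alpha>) (Suc i))}"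

text \<open>The summands in degree \<open>k\<close> are indexed by a tower together with the degrees of
  \<open>t\<^sub>0, p\<^sub>1, \<dots>, p\<^sub>n\<close> (as a list) and of \<open>m\<close>.\<close>

type_synonym ('a, 'q) bar_idx = "('a, 'q) tower \<times> int list \<times> int"

type_synonym ('r, 'a, 'q, 'p, 'm) bar_elt =
  "('a, 'q) bar_idx \<Rightarrow> ('p list \<times> 'm \<Rightarrow> 'r) set"

text \<open>Element type for generating collections.  An existential statement about collections needs
  some fixed type; the factor \<open>'q\<close> and the outer set constructor leave room for direct sums over
  arrows and for quotients of pieces of the bar construction.\<close>

type_synonym ('r, 'a, 'q, 'p, 'm) gen_elt = "'q \<Rightarrow> ('r, 'a, 'q, 'p, 'm) bar_elt set"

definition bar_index ::
  "('o, 'a) opcat \<Rightarrow> ('o, 'a, 'l, 'q) opmod \<Rightarrow> nat \<Rightarrow> 'l \<Rightarrow> int \<Rightarrow> ('a, 'q) bar_idx set" where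
  "bar_index OC MC n L k =
     {(\<tau>, ks, l). \<tau> \<in> towers OC MC n L \<and> length ks = Suc n \<and> sum_list ks + l = k}"

definition bar_facs ::
  "('o, 'a) opcat \<Rightarrow> ('o, 'a, 'l, 'q) opmod \<Rightarrow> ('r, 'o, 'a, 'p) operad
     \<Rightarrow> ('a, 'q) tower \<Rightarrow> int list \<Rightarrow> ('r, 'p) module list" where
  "bar_facs OC MC Q \<tau> ks = map2 (Pm Q) (vert OC MC \<tau> 0 # map (Fib OC) (fst \<tau>)) ks"

definition bar_summand ::
  "('r, 's) ring_scheme \<Rightarrow> ('o, 'a) opcat \<Rightarrow> ('o, 'a, 'l, 'q) opmod \<Rightarrow> ('r, 'o, 'a, 'p) operad
     \<Rightarrow> ('r, 'l, 'q, 'p, 'm) pmodule \<Rightarrow> ('a, 'q) bar_idx \<Rightarrow> ('r, ('p list \<times> 'm \<Rightarrow> 'r) set) module" where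
  "bar_summand R OC MC Q N =
     (\<lambda>(\<tau>, ks, l). tensor R (bar_facs OC MC Q \<tau> ks) (Mm N (MFib MC (snd \<tau>)) l))"

definition bar ::
  "('r, 's) ring_scheme \<Rightarrow> ('o, 'a) opcat \<Rightarrow> ('o, 'a, 'l, 'q) opmod \<Rightarrow> ('r, 'o, 'a, 'p) operad
     \<Rightarrow> ('r, 'l, 'q, 'p, 'm) pmodule \<Rightarrow> nat \<Rightarrow> 'l \<Rightarrow> int
     \<Rightarrow> ('r, ('r, 'a, 'q, 'p, 'm) bar_elt) module" where
  "bar R OC MC Q N n L k = dsum (bar_index OC MC n L k) (bar_summand R OC MC Q N)"

text \<open>The element \<open>t\<^sub>0 \<otimes> p\<^sub>1 \<otimes> \<dots> \<otimes> p\<^sub>n \<otimes> m\<close> of the summand with the given index, and the linear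
  map determined by its values on such elements.\<close>

definition bar_gen ::
  "('r, 's) ring_scheme \<Rightarrow> ('o, 'a) opcat \<Rightarrow> ('o, 'a, 'l, 'q) opmod \<Rightarrow> ('r, 'o, 'a, 'p) operad
     \<Rightarrow> ('r, 'l, 'q, 'p, 'm) pmodule \<Rightarrow> nat \<Rightarrow> 'l \<Rightarrow> int
     \<Rightarrow> ('a, 'q) bar_idx \<Rightarrow> 'p list \<times> 'm \<Rightarrow> ('r, 'a, 'q, 'p, 'm) bar_elt" where
  "bar_gen R OC MC Q N n L k = (\<lambda>(\<tau>, ks, l) t.
     dsum_in (bar_index OC MC n L k) (bar_summand R OC MC Q N) (\<tau>, ks, l)
       (pure_tensor R (bar_facs OC MC Q \<tau> ks) (Mm N (MFib MC (snd \<tau>)) l) t))"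

definition bar_lift ::
  "('r, 's) ring_scheme \<Rightarrow> ('o, 'a) opcat \<Rightarrow> ('o, 'a, 'l, 'q) opmod \<Rightarrow> ('r, 'o, 'a, 'p) operad
     \<Rightarrow> ('r, 'l, 'q, 'p, 'm) pmodule \<Rightarrow> nat \<Rightarrow> 'l \<Rightarrow> int \<Rightarrow> ('r, 'z) module
     \<Rightarrow> (('a, 'q) bar_idx \<Rightarrow> 'p list \<times> 'm \<Rightarrow> 'z) \<Rightarrow> ('r, 'a, 'q, 'p, 'm) bar_elt \<Rightarrow> 'z" where
  "bar_lift R OC MC Q N n L k T \<phi> =
     dsum_lift T (bar_index OC MC n L k) (bar_summand R OC MC Q N) (\<lambda>\<iota>. tensor_lift R T (\<phi> \<iota>))"

text \<open>The face \<open>d\<^sub>i\<close> on indices and on tuples.  For \<open>i < n\<close> it multiplies the adjacent entries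
  number \<open>i\<close> and \<open>i + 1\<close> of the list \<open>[t\<^sub>0, p\<^sub>1, \<dots>, p\<^sub>n]\<close>, in the opposite order, along \<open>f\<^sub>1\<close> if
  \<open>i = 0\<close> and along the morphism induced by \<open>f\<^bsub>i+1\<^esub>\<close> on fibers over \<open>T\<^bsub>i-1\<^esub>\<close> otherwise.
  Exchanging the two factors is the source of the Koszul sign \<open>face_sign\<close>.\<close>

definition face_tower ::
  "('o, 'a) opcat \<Rightarrow> ('o, 'a, 'l, 'q) opmod \<Rightarrow> nat \<Rightarrow> ('a, 'q) tower \<Rightarrow> ('a, 'q) tower" where
  "face_tower OC MC i = (\<lambda>(fs, \<alpha>).
     if i = 0 then (tl fs, \<alpha>)
     else if i < length fs then (take (i - 1) fs @ Cmp OC (fs ! (i - 1)) (fs ! i) # drop (i + 1) fs, \<alpha>)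
     else (butlast fs, Act MC (last fs) \<alpha>))"

definition face_deg :: "nat \<Rightarrow> nat \<Rightarrow> int list \<times> int \<Rightarrow> int list \<times> int" where
  "face_deg n i = (\<lambda>(ks, l).
     if i < n then (take i ks @ (ks ! (i + 1) + ks ! i) # drop (i + 2) ks, l)
     else (butlast ks, l + last ks))"

definition face_sign :: "('r, 's) ring_scheme \<Rightarrow> nat \<Rightarrow> nat \<Rightarrow> int list \<times> int \<Rightarrow> 'r" where
  "face_sign R n i = (\<lambda>(ks, l).
     if i < n then neg1_pow R (ks ! i * ks ! (i + 1)) else neg1_pow R (last ks * l))"

definition face_tuple ::
  "('o, 'a) opcat \<Rightarrow> ('o, 'a, 'l, 'q) opmod \<Rightarrow> ('r, 'o, 'a, 'p) operad
     \<Rightarrow> ('r, 'l, 'q, 'p, 'm) pmodule \<Rightarrow> nat \<Rightarrow> ('a, 'q) bar_idx \<Rightarrow> 'p list \<times> 'm \<Rightarrow> 'p list \<times> 'm" where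
  "face_tuple OC MC Q N i = (\<lambda>((fs, \<alpha>), ks, l) (xs, m).
     if i < length fs then
       (take i xs @
        gam Q (if i = 0 then fs ! 0 else FibM OC (fs ! i) (fs ! (i - 1)))
          (ks ! (i + 1)) (ks ! i) (xs ! (i + 1)) (xs ! i)
        # drop (i + 2) xs, m)
     else (butlast xs, nu N (MFibM MC \<alpha> (last fs)) l (last ks) m (last xs)))"

definition bar_face ::
  "('r, 's) ring_scheme \<Rightarrow> ('o, 'a) opcat \<Rightarrow> ('o, 'a, 'l, 'q) opmod \<Rightarrow> ('r, 'o, 'a, 'p) operad
     \<Rightarrow> ('r, 'l, 'q, 'p, 'm) pmodule \<Rightarrow> nat \<Rightarrow> 'l \<Rightarrow> int \<Rightarrow> nat
     \<Rightarrow> ('r, 'a, 'q, 'p, 'm) bar_elt \<Rightarrow> ('r, 'a, 'q, 'p, 'm) bar_elt" where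
  "bar_face R OC MC Q N n L k i =
     bar_lift R OC MC Q N n L k (bar R OC MC Q N (n - 1) L k)
       (\<lambda>(\<tau>, \<kappa>) t. face_sign R n i \<kappa> \<odot>\<^bsub>bar R OC MC Q N (n - 1) L k\<^esub>
          bar_gen R OC MC Q N (n - 1) L k (face_tower OC MC i \<tau>, face_deg n i \<kappa>)
            (face_tuple OC MC Q N i (\<tau>, \<kappa>) t))"

text \<open>The differential from level \<open>n\<close> to level \<open>n - 1\<close>, for \<open>n \<ge> 1\<close>.\<close>

definition bar_diff ::
  "('r, 's) ring_scheme \<Rightarrow> ('o, 'a) opcat \<Rightarrow> ('o, 'a, 'l, 'q) opmod \<Rightarrow> ('r, 'o, 'a, 'p) operad
     \<Rightarrow> ('r, 'l, 'q, 'p, 'm) pmodule \<Rightarrow> nat \<Rightarrow> 'l \<Rightarrow> int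
     \<Rightarrow> ('r, 'a, 'q, 'p, 'm) bar_elt \<Rightarrow> ('r, 'a, 'q, 'p, 'm) bar_elt" where
  "bar_diff R OC MC Q N n L k x =
     (\<Oplus>\<^bsub>bar R OC MC Q N (n - 1) L k\<^esub>i\<in>{0..n}.
        neg1_pow R (int i) \<odot>\<^bsub>bar R OC MC Q N (n - 1) L k\<^esub> bar_face R OC MC Q N n L k i x)"

definition bar_aug ::
  "('r, 's) ring_scheme \<Rightarrow> ('o, 'a) opcat \<Rightarrow> ('o, 'a, 'l, 'q) opmod \<Rightarrow> ('r, 'o, 'a, 'p) operad
     \<Rightarrow> ('r, 'l, 'q, 'p, 'm) pmodule \<Rightarrow> 'l \<Rightarrow> int \<Rightarrow> ('r, 'a, 'q, 'p, 'm) bar_elt \<Rightarrow> 'm" where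
  "bar_aug R OC MC Q N L k =
     bar_lift R OC MC Q N 0 L k (Mm N L k)
       (\<lambda>((fs, \<alpha>), ks, l) (xs, m).
          neg1_pow R (ks ! 0 * l) \<odot>\<^bsub>Mm N L k\<^esub> nu N \<alpha> l (ks ! 0) m (xs ! 0))"

definition bar_degen ::
  "('r, 's) ring_scheme \<Rightarrow> ('o, 'a) opcat \<Rightarrow> ('o, 'a, 'l, 'q) opmod \<Rightarrow> ('r, 'o, 'a, 'p) operad
     \<Rightarrow> ('r, 'l, 'q, 'p, 'm) pmodule \<Rightarrow> nat \<Rightarrow> 'l \<Rightarrow> int \<Rightarrow> nat
     \<Rightarrow> ('r, 'a, 'q, 'p, 'm) bar_elt \<Rightarrow> ('r, 'a, 'q, 'p, 'm) bar_elt" where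
  "bar_degen R OC MC Q N n L k j =
     bar_lift R OC MC Q N n L k (bar R OC MC Q N (Suc n) L k)
       (\<lambda>((fs, \<alpha>), ks, l) (xs, m).
          bar_gen R OC MC Q N (Suc n) L k
            ((take j fs @ Idn OC (vert OC MC (fs, \<alpha>) j) # drop j fs, \<alpha>),
             take (Suc j) ks @ 0 # drop (Suc j) ks, l)
            (take (Suc j) xs @ unt Q (vert OC MC (fs, \<alpha>) j) # drop (Suc j) xs, m))"

definition degenerate ::
  "('r, 's) ring_scheme \<Rightarrow> ('o, 'a) opcat \<Rightarrow> ('o, 'a, 'l, 'q) opmod \<Rightarrow> ('r, 'o, 'a, 'p) operad
     \<Rightarrow> ('r, 'l, 'q, 'p, 'm) pmodule \<Rightarrow> nat \<Rightarrow> 'l \<Rightarrow> int \<Rightarrow> ('r, 'a, 'q, 'p, 'm) bar_elt set" where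
  "degenerate R OC MC Q N n L k = submod_span R (bar R OC MC Q N n L k)
     (\<Union>j<n. bar_degen R OC MC Q N (n - 1) L k j ` carrier (bar R OC MC Q N (n - 1) L k))"

definition nbar ::
  "('r, 's) ring_scheme \<Rightarrow> ('o, 'a) opcat \<Rightarrow> ('o, 'a, 'l, 'q) opmod \<Rightarrow> ('r, 'o, 'a, 'p) operad
     \<Rightarrow> ('r, 'l, 'q, 'p, 'm) pmodule \<Rightarrow> nat \<Rightarrow> 'l \<Rightarrow> int
     \<Rightarrow> ('r, ('r, 'a, 'q, 'p, 'm) bar_elt set) module" where
  "nbar R OC MC Q N n L k = quot_mod (bar R OC MC Q N n L k) (degenerate R OC MC Q N n L k)"

definition nbar_diff ::
  "('r, 's) ring_scheme \<Rightarrow> ('o, 'a) opcat \<Rightarrow> ('o, 'a, 'l, 'q) opmod \<Rightarrow> ('r, 'o, 'a, 'p) operad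
     \<Rightarrow> ('r, 'l, 'q, 'p, 'm) pmodule \<Rightarrow> nat \<Rightarrow> 'l \<Rightarrow> int
     \<Rightarrow> ('r, 'a, 'q, 'p, 'm) bar_elt set \<Rightarrow> ('r, 'a, 'q, 'p, 'm) bar_elt set" where
  "nbar_diff R OC MC Q N n L k X = the_elem
     ((\<lambda>x. degenerate R OC MC Q N (n - 1) L k +>\<^bsub>bar R OC MC Q N (n - 1) L k\<^esub>
             bar_diff R OC MC Q N n L k x) ` X)"

definition nbar_aug ::
  "('r, 's) ring_scheme \<Rightarrow> ('o, 'a) opcat \<Rightarrow> ('o, 'a, 'l, 'q) opmod \<Rightarrow> ('r, 'o, 'a, 'p) operad
     \<Rightarrow> ('r, 'l, 'q, 'p, 'm) pmodule \<Rightarrow> 'l \<Rightarrow> int \<Rightarrow> ('r, 'a, 'q, 'p, 'm) bar_elt set \<Rightarrow> 'm" where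
  "nbar_aug R OC MC Q N L k X = the_elem (bar_aug R OC MC Q N L k ` X)"

text \<open>Vanishing of the homology of \<open>\<dots> \<rightarrow> C\<^sub>1 \<rightarrow> C\<^sub>0 \<rightarrow> A \<rightarrow> 0\<close> in every place, where
  \<open>d n : C\<^sub>n \<rightarrow> C\<^bsub>n-1\<^esub>\<close> for \<open>n \<ge> 1\<close>: cycles and boundaries coincide.\<close>

definition aug_acyclic ::
  "(nat \<Rightarrow> ('r, 'x) module) \<Rightarrow> (nat \<Rightarrow> 'x \<Rightarrow> 'x) \<Rightarrow> ('r, 'y) module \<Rightarrow> ('x \<Rightarrow> 'y) \<Rightarrow> bool" where
  "aug_acyclic C d A \<epsilon> \<longleftrightarrow>
     \<epsilon> ` carrier (C 0) = carrier A
     \<and> {x \<in> carrier (C 0). \<epsilon> x = \<zero>\<^bsub>A\<^esub>} = d 1 ` carrier (C 1)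
     \<and> (\<forall>n\<ge>1. {x \<in> carrier (C n). d n x = \<zero>\<^bsub>C (n - 1)\<^esub>} = d (n + 1) ` carrier (C (n + 1)))"

end

theory Submission
  imports Defs
begin

text \<open>Up to the sign \<open>(-1)\<close> to the power \<open>\<Sum>\<^bsub>a<b\<^esub> k\<^sub>a k\<^sub>b\<close>, where \<open>k\<^sub>0, k\<^sub>1, \<dots>\<close> are the degrees of its entries, a generator
  of the bar construction is a chain of composable morphisms of a category and the faces multiply
  adjacent entries without sign.  The operad axioms are associativity and unitality of this multiplication.

  For (1), one may replace the terminal arrow \<open>b\<close> by the one that it induces on fibers over its own target
  \<open>\<odot>\<close>; then \<open>\<alpha> : \<Upsilon> \<rightarrow> X\<close> is equal to the arrow that it induces on fibers over \<open>\<odot>\<close>, and prepending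
  \<open>1\<^sub>\<odot>\<close> and \<open>T\<^sub>0 \<rightarrow> \<odot>\<close> to a chain is a contracting homotopy.

  For (2), the bar construction in a fixed simplicial degree, or its quotient by the degenerate part,
  is a \<open>P\<close>-module \<open>B\<close>: an arrow \<open>\<alpha>\<close> acts on a generator over a tower under \<open>Fib \<alpha>\<close> by blowing up the
  tower along \<open>\<alpha>\<close> and multiplying into \<open>t\<^sub>0\<close>.  Let \<open>E(L)\<close> be spanned in \<open>B(L)\<close> by the generators \<open>1 \<otimes> p\<^sub>1 \<otimes> \<dots> \<otimes> m\<close>
  over towers of fibers over \<open>T\<^sub>0\<close>.  The map from the free module on \<open>E\<close> to \<open>B\<close> has at a rigid object the
  inverse that sends \<open>t\<^sub>0 \<otimes> p\<^sub>1 \<otimes> \<dots> \<otimes> m\<close> to the action of \<open>t\<^sub>0\<close> on the generator with \<open>t\<^sub>0\<close> replaced by \<open>1\<close>: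
  rigidity supplies an arrow with fiber \<open>\<Upsilon>\<close>, so that every free generator in \<open>E(\<Upsilon>)\<close> is the action of a unit on itself.\<close>

section \<open>Linear maps, quotients, tensor products and direct sums\<close>

text \<open>The rescaling works because merging two neighbours of degrees \<open>a\<close> and
  \<open>b\<close> lowers the sum of pairwise products by \<open>a * b\<close>, the exponent of the
  Koszul sign of a face, and because units have degree 0. In (1) the obstacle is that (P2) controls
  the morphisms of \<open>OC\<close> over the terminal object, but not the arrows that arrows out of
  \<open>\<Upsilon>\<close> induce there; the contraction would fail where such an arrow is itself
  taken to fibers. Uniqueness of blow-ups keeps the replacement of \<open>b\<close> terminal. In (2)
  different towers may have the same tower of fibers, so an element of \<open>E\<close> does not
  remember its tower. On the free side the two maps therefore return, from \<open>q\<close> acting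
  along \<open>\<alpha>\<close>, the element \<open>\<gamma>_h(1, q)\<close> acting along another
  arrow \<open>\<alpha>'\<close> with \<open>h \<alpha>' = \<alpha>\<close>; associativity pulls the
  unit out and unitality absorbs it. The normalized case also needs that blowing up neither creates
  nor destroys degenerate entries: a morphism is an identity as soon as the one it induces on fibers
  is, again by uniqueness of blow-ups.\<close>

lemma lin_mapI:
  assumes "\<And>x. x \<in> carrier M \<Longrightarrow> h x \<in> carrier N"
    and "\<And>x y. \<lbrakk>x \<in> carrier M; y \<in> carrier M\<rbrakk> \<Longrightarrow> h (x \<oplus>\<^bsub>M\<^esub> y) = h x \<oplus>\<^bsub>N\<^esub> h y"
    and "\<And>r x. \<lbrakk>r \<in> carrier R; x \<in> carrier M\<rbrakk> \<Longrightarrow> h (r \<odot>\<^bsub>M\<^esub> x) = r \<odot>\<^bsub>N\<^esub> h x"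
  shows "lin_map R M N h"
  using assms by (auto simp: lin_map_def)

lemma lin_map_closed: "lin_map R M N h \<Longrightarrow> x \<in> carrier M \<Longrightarrow> h x \<in> carrier N"
  by (auto simp: lin_map_def)

lemma lin_map_add:
  "lin_map R M N h \<Longrightarrow> x \<in> carrier M \<Longrightarrow> y \<in> carrier M \<Longrightarrow> h (x \<oplus>\<^bsub>M\<^esub> y) = h x \<oplus>\<^bsub>N\<^esub> h y"
  by (auto simp: lin_map_def)

lemma lin_map_smult:
  "lin_map R M N h \<Longrightarrow> r \<in> carrier R \<Longrightarrow> x \<in> carrier M \<Longrightarrow> h (r \<odot>\<^bsub>M\<^esub> x) = r \<odot>\<^bsub>N\<^esub> h x"
  by (auto simp: lin_map_def)

lemma lin_map_compose:
  "lin_map R M N h \<Longrightarrow> lin_map R N T g \<Longrightarrow> lin_map R M T (\<lambda>x. g (h x))"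
  by (intro lin_mapI) (simp_all add: lin_map_closed lin_map_add lin_map_smult)

lemma lin_map_cong:
  assumes "module R M" "\<And>x. x \<in> carrier M \<Longrightarrow> h x = h' x"
  shows "lin_map R M N h \<longleftrightarrow> lin_map R M N h'"
proof -
  interpret M: module R M by fact
  show ?thesis using assms(2) by (simp add: lin_map_def Pi_iff)
qed

lemma submodule_zero_mem: "submodule H R M \<Longrightarrow> \<zero>\<^bsub>M\<^esub> \<in> H"
  using subgroup.one_closed[of H "add_monoid M"] by (simp add: submodule_def)

lemma (in abelian_group) minus_zero_right: "x \<in> carrier G \<Longrightarrow> x \<ominus> \<zero> = x"
  using add.inv_one by (simp add: a_minus_def)

lemma (in abelian_group) minus_eq_zero_imp_eq:
  "x \<ominus> y = \<zero> \<Longrightarrow> x \<in> carrier G \<Longrightarrow> y \<in> carrier G \<Longrightarrow> x = y"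
  using add.inv_equality[of x "\<ominus> y"] by (simp add: a_minus_def)

lemma lin_map_ident: "lin_map R M M (\<lambda>x. x)"
  by (simp add: lin_map_def)

context
  fixes R :: "('r, 's) ring_scheme" and M :: "('r, 'x) module" and N :: "('r, 'y) module"
  assumes M: "module R M" and N: "module R N"
begin

interpretation M: module R M by (rule M)
interpretation N: module R N by (rule N)

lemma lin_map_zero: "lin_map R M N h \<Longrightarrow> h \<zero>\<^bsub>M\<^esub> = \<zero>\<^bsub>N\<^esub>"
  using lin_map_smult[of R M N h "\<zero>\<^bsub>R\<^esub>" "\<zero>\<^bsub>M\<^esub>"] lin_map_closed[of R M N h "\<zero>\<^bsub>M\<^esub>"] by simp

lemma lin_map_uminus: "lin_map R M N h \<Longrightarrow> x \<in> carrier M \<Longrightarrow> h (\<ominus>\<^bsub>M\<^esub> x) = \<ominus>\<^bsub>N\<^esub> h x"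
  using lin_map_smult[of R M N h "\<ominus>\<^bsub>R\<^esub> \<one>\<^bsub>R\<^esub>" x] lin_map_closed[of R M N h x]
  by (simp add: M.smult_l_minus N.smult_l_minus)

lemma lin_map_minus: "lin_map R M N h \<Longrightarrow> x \<in> carrier M \<Longrightarrow> y \<in> carrier M
    \<Longrightarrow> h (x \<ominus>\<^bsub>M\<^esub> y) = h x \<ominus>\<^bsub>N\<^esub> h y"
  by (simp add: a_minus_def lin_map_add lin_map_uminus)

lemma lin_map_finsum:
  assumes h: "lin_map R M N h" and "f \<in> A \<rightarrow> carrier M"
  shows "h (\<Oplus>\<^bsub>M\<^esub>i\<in>A. f i) = (\<Oplus>\<^bsub>N\<^esub>i\<in>A. h (f i))"
  using assms(2)
proof (induction A rule: infinite_finite_induct)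
  case (insert x F)
  then show ?case using h
    by (subst M.finsum_insert N.finsum_insert; force simp: lin_map_add lin_map_closed Pi_def)+
qed (simp_all add: lin_map_zero[OF h])

lemma lin_map_plus:
  "lin_map R M N g \<Longrightarrow> lin_map R M N h \<Longrightarrow> lin_map R M N (\<lambda>x. g x \<oplus>\<^bsub>N\<^esub> h x)"
  by (intro lin_mapI) (simp_all add: lin_map_closed lin_map_add lin_map_smult N.smult_r_distr N.a_ac)

lemma lin_map_scale:
  "lin_map R M N h \<Longrightarrow> r \<in> carrier R \<Longrightarrow> lin_map R M N (\<lambda>x. r \<odot>\<^bsub>N\<^esub> h x)"
  by (intro lin_mapI)
    (simp_all add: lin_map_closed lin_map_add lin_map_smult N.smult_r_distr M.m_comm
      flip: N.smult_assoc1)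

lemma lin_map_const_zero: "lin_map R M N (\<lambda>x. \<zero>\<^bsub>N\<^esub>)"
  by (intro lin_mapI) simp_all

lemma lin_map_sum:
  assumes "finite A" and "\<And>i. i \<in> A \<Longrightarrow> lin_map R M N (f i)"
  shows "lin_map R M N (\<lambda>x. \<Oplus>\<^bsub>N\<^esub>i\<in>A. f i x)"
  using assms
proof (induction A rule: finite_induct)
  case (insert a A)
  have "lin_map R M N (\<lambda>x. f a x \<oplus>\<^bsub>N\<^esub> (\<Oplus>\<^bsub>N\<^esub>i\<in>A. f i x))"
    using insert by (intro lin_map_plus) auto
  moreover have "(\<Oplus>\<^bsub>N\<^esub>i\<in>insert a A. f i x) = f a x \<oplus>\<^bsub>N\<^esub> (\<Oplus>\<^bsub>N\<^esub>i\<in>A. f i x)"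
    if "x \<in> carrier M" for x
    using insert that by (intro N.finsum_insert) (auto intro: lin_map_closed)
  ultimately show ?case by (subst lin_map_cong[OF M]) auto
qed (simp add: lin_map_const_zero)

lemma submodule_preimage:
  assumes h: "lin_map R M N h" and "submodule K R N"
  shows "submodule {x \<in> carrier M. h x \<in> K} R M"
proof -
  note K = N.submoduleE[OF assms(2)]
  have "\<zero>\<^bsub>N\<^esub> \<in> K" using assms(2) by (rule submodule_zero_mem)
  then show ?thesis
    using h K
    by (intro M.submoduleI)
      (auto simp: lin_map_zero lin_map_uminus lin_map_add lin_map_smult)
qed

lemma submodule_equalizer:
  assumes "lin_map R M N g" "lin_map R M N h"
  shows "submodule {x \<in> carrier M. g x = h x} R M"
  using assms by (intro M.submoduleI)
      (auto simp: lin_map_zero lin_map_uminus lin_map_add lin_map_smult)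

end

lemma submodule_zero:
  assumes "module R M" shows "submodule {\<zero>\<^bsub>M\<^esub>} R M"
proof -
  interpret module R M by fact
  show ?thesis by (intro submoduleI) auto
qed

lemma submodule_finsum:
  assumes "module R M" "submodule H R M" "\<And>i. i \<in> A \<Longrightarrow> f i \<in> H"
  shows "(\<Oplus>\<^bsub>M\<^esub>i\<in>A. f i) \<in> H"
proof -
  interpret module R M by fact
  note H = submoduleE[OF assms(2)]
  show ?thesis using assms(3)
  proof (induction A rule: infinite_finite_induct)
    case (insert x F)
    then have "f \<in> F \<rightarrow> carrier M" "f x \<in> carrier M" using H(1) by auto
    with insert H show ?case by (simp add: finsum_insert)
  qed (simp_all add: submodule_zero_mem[OF assms(2)])
qed

lemma submod_span_submodule:
  assumes "module R M" "S \<subseteq> carrier M"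
  shows "submodule (submod_span R M S) R M"
proof -
  interpret module R M by fact
  have "submod_span R M S \<subseteq> carrier M"
    unfolding submod_span_def using carrier_is_submodule assms(2) by blast
  then show ?thesis
    using submoduleE submodule_zero_mem
    by (intro submoduleI) (auto simp: submod_span_def)
qed

lemma submod_span_superset: "S \<subseteq> submod_span R M S"
  by (auto simp: submod_span_def)

lemma submod_span_least: "submodule H R M \<Longrightarrow> S \<subseteq> H \<Longrightarrow> submod_span R M S \<subseteq> H"
  by (auto simp: submod_span_def)

lemma lin_map_span_subset:
  assumes "module R M" "module R N" "lin_map R M N h" "submodule K R N" "S \<subseteq> carrier M"
    and "h ` S \<subseteq> K"
  shows "h ` submod_span R M S \<subseteq> K"
  using submod_span_least[OF submodule_preimage[OF assms(1-4)], of S] assms(5,6) by blast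

lemma lin_map_span_eq:
  assumes "module R M" "module R N" "lin_map R M N g" "lin_map R M N h"
    and "S \<subseteq> carrier M" "\<And>x. x \<in> S \<Longrightarrow> g x = h x" "x \<in> submod_span R M S"
  shows "g x = h x"
  using submod_span_least[OF submodule_equalizer[OF assms(1-4)], of S] assms(5-7) by blast


subsection \<open>Quotients\<close>

context
  fixes R :: "('r, 's) ring_scheme" and M :: "('r, 'x) module" and H :: "'x set"
  assumes M: "module R M" and H: "submodule H R M"
begin

interpretation M: module R M by (rule M)
interpretation H: abelian_subgroup H M
  using H M.abelian_group_axioms
  by (intro abelian_subgroupI3 additive_subgroup.intro) (auto simp: submodule_def)

lemma coset_eq_iff:
  assumes "x \<in> carrier M" "y \<in> carrier M"
  shows "H +>\<^bsub>M\<^esub> x = H +>\<^bsub>M\<^esub> y \<longleftrightarrow> x \<ominus>\<^bsub>M\<^esub> y \<in> H"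
  using assms H.a_rcos_self[of x] H.a_rcos_module[of y x] M.a_repr_independence[of x H y]
    H.a_subgroup by (auto simp: a_minus_def)

lemma coset_eq_self_iff: "x \<in> carrier M \<Longrightarrow> H +>\<^bsub>M\<^esub> x = H \<longleftrightarrow> x \<in> H"
  using coset_eq_iff[of x "\<zero>\<^bsub>M\<^esub>"] H.a_subset by (simp add: M.minus_zero_right)

lemma coset_self: "x \<in> carrier M \<Longrightarrow> x \<in> H +>\<^bsub>M\<^esub> x"
  by (rule H.a_rcos_self)

lemma coset_mem: "x \<in> carrier M \<Longrightarrow> y \<in> H +>\<^bsub>M\<^esub> x \<Longrightarrow> y \<in> carrier M \<and> y \<ominus>\<^bsub>M\<^esub> x \<in> H"
  using H.a_rcos_module[of x y] H.a_elemrcos_carrier[of x y] by (auto simp: a_minus_def)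

lemma carrier_quot_mod: "carrier (quot_mod M H) = (\<lambda>x. H +>\<^bsub>M\<^esub> x) ` carrier M"
  by (auto simp: quot_mod_def A_RCOSETS_def')

lemma quot_add: "x \<in> carrier M \<Longrightarrow> y \<in> carrier M
    \<Longrightarrow> (H +>\<^bsub>M\<^esub> x) \<oplus>\<^bsub>quot_mod M H\<^esub> (H +>\<^bsub>M\<^esub> y) = H +>\<^bsub>M\<^esub> (x \<oplus>\<^bsub>M\<^esub> y)"
  by (simp add: quot_mod_def H.a_rcos_sum)

lemma quot_zero: "\<zero>\<^bsub>quot_mod M H\<^esub> = H"
  by (simp add: quot_mod_def)

lemma quot_smult:
  assumes "r \<in> carrier R" "x \<in> carrier M"
  shows "r \<odot>\<^bsub>quot_mod M H\<^esub> (H +>\<^bsub>M\<^esub> x) = H +>\<^bsub>M\<^esub> (r \<odot>\<^bsub>M\<^esub> x)"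
proof -
  have "H +>\<^bsub>M\<^esub> (r \<odot>\<^bsub>M\<^esub> y) = H +>\<^bsub>M\<^esub> (r \<odot>\<^bsub>M\<^esub> x)" if "y \<in> H +>\<^bsub>M\<^esub> x" for y
  proof -
    have y: "y \<in> carrier M" "y \<ominus>\<^bsub>M\<^esub> x \<in> H" using coset_mem[OF assms(2) that] by auto
    then have "r \<odot>\<^bsub>M\<^esub> (y \<ominus>\<^bsub>M\<^esub> x) \<in> H" using M.submoduleE(4)[OF H assms(1)] by simp
    moreover have "r \<odot>\<^bsub>M\<^esub> (y \<ominus>\<^bsub>M\<^esub> x) = r \<odot>\<^bsub>M\<^esub> y \<ominus>\<^bsub>M\<^esub> r \<odot>\<^bsub>M\<^esub> x"
      using assms y(1) by (simp add: a_minus_def M.smult_r_distr M.smult_r_minus)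
    ultimately show ?thesis using assms y(1) by (simp add: coset_eq_iff)
  qed
  moreover have "x \<in> H +>\<^bsub>M\<^esub> x" using assms by (simp add: coset_self)
  ultimately have "(\<Union>y\<in>H +>\<^bsub>M\<^esub> x. H +>\<^bsub>M\<^esub> (r \<odot>\<^bsub>M\<^esub> y)) = H +>\<^bsub>M\<^esub> (r \<odot>\<^bsub>M\<^esub> x)"
    by blast
  then show ?thesis by (simp add: quot_mod_def)
qed

lemma quot_module: "module R (quot_mod M H)"
proof (rule moduleI)
  show "abelian_group (quot_mod M H)"
  proof (rule abelian_groupI)
    fix x assume "x \<in> carrier (quot_mod M H)"
    then obtain a where a: "a \<in> carrier M" "x = H +>\<^bsub>M\<^esub> a" by (auto simp: carrier_quot_mod)
    have H0: "H = H +>\<^bsub>M\<^esub> \<zero>\<^bsub>M\<^esub>" using coset_eq_self_iff[of "\<zero>\<^bsub>M\<^esub>"] by simp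
    show "\<zero>\<^bsub>quot_mod M H\<^esub> \<oplus>\<^bsub>quot_mod M H\<^esub> x = x"
      using a quot_add[of "\<zero>\<^bsub>M\<^esub>" a] by (simp add: quot_zero flip: H0)
    show "\<exists>y\<in>carrier (quot_mod M H). y \<oplus>\<^bsub>quot_mod M H\<^esub> x = \<zero>\<^bsub>quot_mod M H\<^esub>"
      using a by (intro bexI[of _ "H +>\<^bsub>M\<^esub> (\<ominus>\<^bsub>M\<^esub> a)"])
        (auto simp: quot_add quot_zero carrier_quot_mod M.l_neg H0[symmetric])
  next
    have "H = H +>\<^bsub>M\<^esub> \<zero>\<^bsub>M\<^esub>" using coset_eq_self_iff[of "\<zero>\<^bsub>M\<^esub>"] by simp
    then show "\<zero>\<^bsub>quot_mod M H\<^esub> \<in> carrier (quot_mod M H)"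
      by (auto simp: quot_zero carrier_quot_mod)
  next
    fix x y z
    assume "x \<in> carrier (quot_mod M H)" "y \<in> carrier (quot_mod M H)" "z \<in> carrier (quot_mod M H)"
    then obtain a b c where [simp]: "a \<in> carrier M" "x = H +>\<^bsub>M\<^esub> a"
      "b \<in> carrier M" "y = H +>\<^bsub>M\<^esub> b" "c \<in> carrier M" "z = H +>\<^bsub>M\<^esub> c"
      by (auto simp: carrier_quot_mod)
    show "x \<oplus>\<^bsub>quot_mod M H\<^esub> y \<in> carrier (quot_mod M H)"
      by (simp add: quot_add carrier_quot_mod)
    show "x \<oplus>\<^bsub>quot_mod M H\<^esub> y = y \<oplus>\<^bsub>quot_mod M H\<^esub> x"
      by (simp add: quot_add M.a_comm)
    show "x \<oplus>\<^bsub>quot_mod M H\<^esub> y \<oplus>\<^bsub>quot_mod M H\<^esub> z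
        = x \<oplus>\<^bsub>quot_mod M H\<^esub> (y \<oplus>\<^bsub>quot_mod M H\<^esub> z)"
      by (simp add: quot_add M.a_assoc)
  qed
next
  fix r r' x y
  assume [simp]: "r \<in> carrier R" "r' \<in> carrier R"
    and "x \<in> carrier (quot_mod M H)" "y \<in> carrier (quot_mod M H)"
  then obtain a b where [simp]: "a \<in> carrier M" "x = H +>\<^bsub>M\<^esub> a" "b \<in> carrier M" "y = H +>\<^bsub>M\<^esub> b"
    by (auto simp: carrier_quot_mod)
  show "r \<odot>\<^bsub>quot_mod M H\<^esub> x \<in> carrier (quot_mod M H)"
    by (simp add: quot_smult carrier_quot_mod)
  show "(r \<oplus>\<^bsub>R\<^esub> r') \<odot>\<^bsub>quot_mod M H\<^esub> x
      = r \<odot>\<^bsub>quot_mod M H\<^esub> x \<oplus>\<^bsub>quot_mod M H\<^esub> r' \<odot>\<^bsub>quot_mod M H\<^esub> x"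
    by (simp add: quot_smult quot_add M.smult_l_distr)
  show "r \<odot>\<^bsub>quot_mod M H\<^esub> (x \<oplus>\<^bsub>quot_mod M H\<^esub> y)
      = r \<odot>\<^bsub>quot_mod M H\<^esub> x \<oplus>\<^bsub>quot_mod M H\<^esub> r \<odot>\<^bsub>quot_mod M H\<^esub> y"
    by (simp add: quot_smult quot_add M.smult_r_distr)
  show "(r \<otimes>\<^bsub>R\<^esub> r') \<odot>\<^bsub>quot_mod M H\<^esub> x = r \<odot>\<^bsub>quot_mod M H\<^esub> (r' \<odot>\<^bsub>quot_mod M H\<^esub> x)"
    by (simp add: quot_smult M.smult_assoc1)
next
  fix x assume "x \<in> carrier (quot_mod M H)"
  then show "\<one>\<^bsub>R\<^esub> \<odot>\<^bsub>quot_mod M H\<^esub> x = x"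
    by (auto simp: carrier_quot_mod quot_smult)
qed (rule M.R.cring_axioms)

lemma quot_proj_lin: "lin_map R M (quot_mod M H) (\<lambda>x. H +>\<^bsub>M\<^esub> x)"
  by (rule lin_mapI) (simp_all add: quot_add quot_smult carrier_quot_mod)

text \<open>The map \<open>g\<close> need only take on each coset some value of \<open>f\<close> on
  that coset. Both encodings of induced maps in the definitions fit this: the chosen representative
  in \<open>tensor_lift\<close> and \<open>the_elem\<close> of the image in the normalized
  complex.\<close>

lemma quot_lift:
  assumes N: "module R N" and f: "lin_map R M N f" and "\<And>x. x \<in> H \<Longrightarrow> f x = \<zero>\<^bsub>N\<^esub>"
    and g: "\<And>x. x \<in> carrier M \<Longrightarrow> g (H +>\<^bsub>M\<^esub> x) \<in> f ` (H +>\<^bsub>M\<^esub> x)"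
  shows "lin_map R (quot_mod M H) N g" and "x \<in> carrier M \<Longrightarrow> g (H +>\<^bsub>M\<^esub> x) = f x"
proof -
  interpret N: module R N by fact
  have const: "f y = f x" if "x \<in> carrier M" "y \<in> H +>\<^bsub>M\<^esub> x" for x y
  proof -
    have y: "y \<in> carrier M" "y \<ominus>\<^bsub>M\<^esub> x \<in> H" using coset_mem[OF that] by auto
    have "f y \<ominus>\<^bsub>N\<^esub> f x = \<zero>\<^bsub>N\<^esub>" unfolding lin_map_minus[OF M N f y(1) that(1), symmetric] by (rule assms(3)[OF y(2)])
    then show ?thesis by (rule N.minus_eq_zero_imp_eq) (rule lin_map_closed[OF f] y(1) that(1))+
  qed
  show *: "g (H +>\<^bsub>M\<^esub> x) = f x" if "x \<in> carrier M" for x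
    using g[OF that] by (rule imageE) (simp add: const[OF that])
  show "lin_map R (quot_mod M H) N g"
  proof (rule lin_mapI)
    fix X Y assume "X \<in> carrier (quot_mod M H)" "Y \<in> carrier (quot_mod M H)"
    then obtain x y where xy: "x \<in> carrier M" "X = H +>\<^bsub>M\<^esub> x" "y \<in> carrier M" "Y = H +>\<^bsub>M\<^esub> y"
      by (auto simp: carrier_quot_mod)
    show "g X \<in> carrier N" using xy(1) by (simp add: xy(2) *[OF xy(1)] lin_map_closed[OF f])
    show "g (X \<oplus>\<^bsub>quot_mod M H\<^esub> Y) = g X \<oplus>\<^bsub>N\<^esub> g Y"
      using xy(1,3) *[OF M.a_closed[OF xy(1,3)]]
      by (simp add: xy(2,4) *[OF xy(1)] *[OF xy(3)] quot_add lin_map_add[OF f])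
  next
    fix r X assume r: "r \<in> carrier R" and "X \<in> carrier (quot_mod M H)"
    then obtain x where xy: "x \<in> carrier M" "X = H +>\<^bsub>M\<^esub> x" by (auto simp: carrier_quot_mod)
    show "g (r \<odot>\<^bsub>quot_mod M H\<^esub> X) = r \<odot>\<^bsub>N\<^esub> g X"
      using xy(1) r *[OF M.smult_closed[OF r xy(1)]]
      by (simp add: xy(2) *[OF xy(1)] quot_smult lin_map_smult[OF f])
  qed
qed

text \<open>The image of the coset is a singleton, so \<open>the_elem\<close> meets the hypothesis
  on \<open>g\<close> in \<open>quot_lift\<close>.\<close>

lemma the_elem_image_mem:
  assumes "x \<in> carrier M" "\<And>y. y \<in> H +>\<^bsub>M\<^esub> x \<Longrightarrow> f y = f x"
  shows "the_elem (f ` (H +>\<^bsub>M\<^esub> x)) \<in> f ` (H +>\<^bsub>M\<^esub> x)"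
proof -
  have "f ` (H +>\<^bsub>M\<^esub> x) \<subseteq> {f x}"
  proof
    fix z assume "z \<in> f ` (H +>\<^bsub>M\<^esub> x)"
    then obtain y where y: "y \<in> H +>\<^bsub>M\<^esub> x" "z = f y" by (rule imageE) 
    show "z \<in> {f x}" unfolding y(2) assms(2)[OF y(1)] by (rule singletonI)
  qed
  then have "f ` (H +>\<^bsub>M\<^esub> x) = {f x}" using coset_self[OF assms(1)] by blast
  then show ?thesis by simp
qed

end

subsection \<open>Free modules and tensor products\<close>

context
  fixes R :: "('r, 's) ring_scheme" and X :: "'x set"
  assumes R: "cring R"
begin

interpretation R: cring R by (rule R)

lemma free_mod_carrierD:
  "c \<in> carrier (free_mod R X) \<Longrightarrow> c x \<in> carrier R"
  "c \<in> carrier (free_mod R X) \<Longrightarrow> finite {x. c x \<noteq> \<zero>\<^bsub>R\<^esub>}"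
  "c \<in> carrier (free_mod R X) \<Longrightarrow> c x \<noteq> \<zero>\<^bsub>R\<^esub> \<Longrightarrow> x \<in> X"
  by (auto simp: free_mod_def)

lemma free_mod_carrierI:
  assumes "\<And>x. c x \<in> carrier R" "finite S" "S \<subseteq> X" "\<And>x. x \<notin> S \<Longrightarrow> c x = \<zero>\<^bsub>R\<^esub>"
  shows "c \<in> carrier (free_mod R X)"
proof -
  have "{x. c x \<noteq> \<zero>\<^bsub>R\<^esub>} \<subseteq> S" using assms(4) by blast
  then show ?thesis using assms(1-3) finite_subset by (fastforce simp: free_mod_def)
qed

lemma free_mod_simps:
  "\<zero>\<^bsub>free_mod R X\<^esub> = (\<lambda>x. \<zero>\<^bsub>R\<^esub>)"
  "c \<oplus>\<^bsub>free_mod R X\<^esub> d = (\<lambda>x. c x \<oplus>\<^bsub>R\<^esub> d x)"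
  "r \<odot>\<^bsub>free_mod R X\<^esub> c = (\<lambda>x. r \<otimes>\<^bsub>R\<^esub> c x)"
  by (simp_all add: free_mod_def)

lemma free_mod_closed:
  "c \<in> carrier (free_mod R X) \<Longrightarrow> d \<in> carrier (free_mod R X) \<Longrightarrow> c \<oplus>\<^bsub>free_mod R X\<^esub> d \<in> carrier (free_mod R X)"
  "r \<in> carrier R \<Longrightarrow> c \<in> carrier (free_mod R X) \<Longrightarrow> r \<odot>\<^bsub>free_mod R X\<^esub> c \<in> carrier (free_mod R X)"
  "\<zero>\<^bsub>free_mod R X\<^esub> \<in> carrier (free_mod R X)"
proof -
  assume c: "c \<in> carrier (free_mod R X)"
  note C = free_mod_carrierD[OF c]
  show "c \<oplus>\<^bsub>free_mod R X\<^esub> d \<in> carrier (free_mod R X)" if d: "d \<in> carrier (free_mod R X)"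
    using C free_mod_carrierD[OF d] unfolding free_mod_simps
    by (intro free_mod_carrierI[of _ "{x. c x \<noteq> \<zero>\<^bsub>R\<^esub>} \<union> {x. d x \<noteq> \<zero>\<^bsub>R\<^esub>}"]) auto
  show "r \<odot>\<^bsub>free_mod R X\<^esub> c \<in> carrier (free_mod R X)" if "r \<in> carrier R"
    using C that unfolding free_mod_simps
    by (intro free_mod_carrierI[of _ "{x. c x \<noteq> \<zero>\<^bsub>R\<^esub>}"]) auto
next
  show "\<zero>\<^bsub>free_mod R X\<^esub> \<in> carrier (free_mod R X)"
    unfolding free_mod_simps by (intro free_mod_carrierI[of _ "{}"]) auto
qed

lemma free_mod_module: "module R (free_mod R X)"
proof (rule moduleI[OF R])
  show "abelian_group (free_mod R X)"
  proof (rule abelian_groupI)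
    fix c d e assume c: "c \<in> carrier (free_mod R X)" and d: "d \<in> carrier (free_mod R X)"
      and e: "e \<in> carrier (free_mod R X)"
    note [simp] = free_mod_carrierD(1)[OF c] free_mod_carrierD(1)[OF d] free_mod_carrierD(1)[OF e]
    show "c \<oplus>\<^bsub>free_mod R X\<^esub> d \<in> carrier (free_mod R X)" using c d by (rule free_mod_closed)
    show "c \<oplus>\<^bsub>free_mod R X\<^esub> d \<oplus>\<^bsub>free_mod R X\<^esub> e = c \<oplus>\<^bsub>free_mod R X\<^esub> (d \<oplus>\<^bsub>free_mod R X\<^esub> e)"
      by (simp add: free_mod_simps R.a_assoc)
    show "c \<oplus>\<^bsub>free_mod R X\<^esub> d = d \<oplus>\<^bsub>free_mod R X\<^esub> c"
      by (simp add: free_mod_simps R.a_comm)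
    show "\<zero>\<^bsub>free_mod R X\<^esub> \<oplus>\<^bsub>free_mod R X\<^esub> c = c" by (simp add: free_mod_simps)
    have "(\<ominus>\<^bsub>R\<^esub> \<one>\<^bsub>R\<^esub>) \<odot>\<^bsub>free_mod R X\<^esub> c \<in> carrier (free_mod R X)" using c by (simp add: free_mod_closed)
    then show "\<exists>d\<in>carrier (free_mod R X). d \<oplus>\<^bsub>free_mod R X\<^esub> c = \<zero>\<^bsub>free_mod R X\<^esub>"
      by (rule bexI[rotated]) (simp add: free_mod_simps R.l_minus R.l_neg)
  qed (rule free_mod_closed)
qed (fact free_mod_closed(2), auto simp: free_mod_simps free_mod_carrierD(1) R.l_distr R.r_distr R.m_assoc)

lemma delta_closed: "x \<in> X \<Longrightarrow> delta R x \<in> carrier (free_mod R X)"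
  by (intro free_mod_carrierI[of _ "{x}"]) (auto simp: delta_def)

text \<open>Induction on a finite set containing the support, clearing one coefficient at a
  time.\<close>

lemma free_mod_generated:
  assumes K: "submodule K R (free_mod R X)" "\<And>x. x \<in> X \<Longrightarrow> delta R x \<in> K"
    and c: "c \<in> carrier (free_mod R X)"
  shows "c \<in> K"
proof -
  interpret F: module R "free_mod R X" by (rule free_mod_module)
  note K' = F.submoduleE[OF K(1)]
  have "finite S \<Longrightarrow> S \<subseteq> X \<Longrightarrow> {x. c x \<noteq> \<zero>\<^bsub>R\<^esub>} \<subseteq> S \<Longrightarrow> c \<in> carrier (free_mod R X) \<Longrightarrow> c \<in> K" for S c
  proof (induction S arbitrary: c rule: finite_induct)
    case empty
    then have "c = \<zero>\<^bsub>free_mod R X\<^esub>" by (auto simp: free_mod_simps)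
    then show ?case using submodule_zero_mem[OF K(1)] by simp
  next
    case (insert s S)
    note C = free_mod_carrierD[OF insert.prems(3)]
    let ?d = "\<lambda>x. if x = s then \<zero>\<^bsub>R\<^esub> else c x"
    have d: "?d \<in> carrier (free_mod R X)"
      using C insert.prems insert.hyps by (intro free_mod_carrierI[of _ S]) auto
    have "?d \<in> K" using insert.prems by (intro insert.IH d) auto
    moreover have "c s \<odot>\<^bsub>free_mod R X\<^esub> delta R s \<in> K"
      using K' K(2) C insert.prems by auto
    moreover have "c = c s \<odot>\<^bsub>free_mod R X\<^esub> delta R s \<oplus>\<^bsub>free_mod R X\<^esub> ?d"
      using C by (auto simp: free_mod_simps delta_def)
    ultimately show ?case using K'(5) by metis
  qed
  from this[of "{x. c x \<noteq> \<zero>\<^bsub>R\<^esub>}" c] show ?thesis using free_mod_carrierD[OF c] c by blast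
qed

text \<open>The value that \<open>tensor_lift\<close> computes from one representative, isolated in
  order to prove linearity before passing to cosets.\<close>

definition lincomb :: "('r, 'z) module \<Rightarrow> ('x \<Rightarrow> 'z) \<Rightarrow> ('x \<Rightarrow> 'r) \<Rightarrow> 'z" where
  "lincomb T \<phi> c = (\<Oplus>\<^bsub>T\<^esub>t\<in>{t. c t \<noteq> \<zero>\<^bsub>R\<^esub>}. c t \<odot>\<^bsub>T\<^esub> \<phi> t)"

text \<open>Supports may shrink under addition and scaling, so linearity is proved by summing over a
  common finite superset, where the extra terms are zero.\<close>

lemma lincomb_superset:
  assumes T: "module R T" and \<phi>: "\<And>t. t \<in> X \<Longrightarrow> \<phi> t \<in> carrier T"
    and c: "c \<in> carrier (free_mod R X)"
    and S: "finite S" "S \<subseteq> X" "{t. c t \<noteq> \<zero>\<^bsub>R\<^esub>} \<subseteq> S"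
  shows "lincomb T \<phi> c = (\<Oplus>\<^bsub>T\<^esub>t\<in>S. c t \<odot>\<^bsub>T\<^esub> \<phi> t)"
proof -
  interpret T: module R T by fact
  show ?thesis unfolding lincomb_def using S \<phi> free_mod_carrierD(1)[OF c]
    by (intro T.add.finprod_mono_neutral_cong_left) auto
qed

lemma lincomb_lin:
  assumes T: "module R T" and \<phi>: "\<And>t. t \<in> X \<Longrightarrow> \<phi> t \<in> carrier T"
  shows "lin_map R (free_mod R X) T (lincomb T \<phi>)"
proof (rule lin_mapI)
  interpret T: module R T by fact
  fix c d assume c: "c \<in> carrier (free_mod R X)" and d: "d \<in> carrier (free_mod R X)"
  note C = free_mod_carrierD[OF c] and D = free_mod_carrierD[OF d]
  note [simp] = C(1) D(1)
  show "lincomb T \<phi> c \<in> carrier T"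
    unfolding lincomb_def using C \<phi> by (intro T.finsum_closed) auto
  let ?S = "{x. c x \<noteq> \<zero>\<^bsub>R\<^esub>} \<union> {x. d x \<noteq> \<zero>\<^bsub>R\<^esub>}"
  have S: "finite ?S" "?S \<subseteq> X" using C D by auto
  have *: "(\<lambda>t. c t \<odot>\<^bsub>T\<^esub> \<phi> t) \<in> ?S \<rightarrow> carrier T" "(\<lambda>t. d t \<odot>\<^bsub>T\<^esub> \<phi> t) \<in> ?S \<rightarrow> carrier T"
    using S \<phi> by auto
  have "lincomb T \<phi> (c \<oplus>\<^bsub>free_mod R X\<^esub> d)
      = (\<Oplus>\<^bsub>T\<^esub>t\<in>?S. (c \<oplus>\<^bsub>free_mod R X\<^esub> d) t \<odot>\<^bsub>T\<^esub> \<phi> t)"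
    by (rule lincomb_superset[OF T \<phi> free_mod_closed(1)[OF c d] S]) (auto simp: free_mod_simps)
  also have "\<dots> = (\<Oplus>\<^bsub>T\<^esub>t\<in>?S. c t \<odot>\<^bsub>T\<^esub> \<phi> t \<oplus>\<^bsub>T\<^esub> d t \<odot>\<^bsub>T\<^esub> \<phi> t)"
    using S \<phi> by (intro T.finsum_cong') (auto simp: free_mod_simps T.smult_l_distr)
  also have "\<dots> = (\<Oplus>\<^bsub>T\<^esub>t\<in>?S. c t \<odot>\<^bsub>T\<^esub> \<phi> t) \<oplus>\<^bsub>T\<^esub> (\<Oplus>\<^bsub>T\<^esub>t\<in>?S. d t \<odot>\<^bsub>T\<^esub> \<phi> t)"
    using * by (rule T.finsum_addf)
  also have "\<dots> = lincomb T \<phi> c \<oplus>\<^bsub>T\<^esub> lincomb T \<phi> d"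
    using lincomb_superset[OF T \<phi> c S] lincomb_superset[OF T \<phi> d S] by simp
  finally show "lincomb T \<phi> (c \<oplus>\<^bsub>free_mod R X\<^esub> d) = lincomb T \<phi> c \<oplus>\<^bsub>T\<^esub> lincomb T \<phi> d" .
next
  interpret T: module R T by fact
  fix r c assume r: "r \<in> carrier R" and c: "c \<in> carrier (free_mod R X)"
  note C = free_mod_carrierD[OF c]
  note [simp] = C(1)
  let ?S = "{x. c x \<noteq> \<zero>\<^bsub>R\<^esub>}"
  have S: "finite ?S" "?S \<subseteq> X" using C by auto
  have "lincomb T \<phi> (r \<odot>\<^bsub>free_mod R X\<^esub> c) = (\<Oplus>\<^bsub>T\<^esub>t\<in>?S. (r \<odot>\<^bsub>free_mod R X\<^esub> c) t \<odot>\<^bsub>T\<^esub> \<phi> t)"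
    by (rule lincomb_superset[OF T \<phi> free_mod_closed(2)[OF r c] S]) (use r in \<open>auto simp: free_mod_simps\<close>)
  also have "\<dots> = (\<Oplus>\<^bsub>T\<^esub>t\<in>?S. r \<odot>\<^bsub>T\<^esub> (c t \<odot>\<^bsub>T\<^esub> \<phi> t))"
    using S \<phi> r by (intro T.finsum_cong') (auto simp: free_mod_simps T.smult_assoc1)
  also have "\<dots> = r \<odot>\<^bsub>T\<^esub> lincomb T \<phi> c"
    unfolding lincomb_def using S \<phi> r by (intro T.finsum_smult_ldistr[symmetric]) auto
  finally show "lincomb T \<phi> (r \<odot>\<^bsub>free_mod R X\<^esub> c) = r \<odot>\<^bsub>T\<^esub> lincomb T \<phi> c" .
qed

lemma lincomb_delta:
  assumes T: "module R T" and \<phi>: "\<And>t. t \<in> X \<Longrightarrow> \<phi> t \<in> carrier T" and x: "x \<in> X"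
  shows "lincomb T \<phi> (delta R x) = \<phi> x"
proof -
  interpret T: module R T by fact
  have "lincomb T \<phi> (delta R x) = (\<Oplus>\<^bsub>T\<^esub>t\<in>{x}. delta R x t \<odot>\<^bsub>T\<^esub> \<phi> t)"
    using x by (intro lincomb_superset[OF T \<phi> delta_closed[OF x]]) (auto simp: delta_def)
  also have "\<dots> = \<phi> x"
    using \<phi>[OF x] by (subst T.finsum_insert) (auto simp: delta_def)
  finally show ?thesis .
qed

end

text \<open>Slots are varied by \<open>xs[i := a]\<close> with the other entries held in a valid
  tuple, the same shape as the generators of \<open>multilin_rels\<close>; the last slot has its own
  type and is treated apart.\<close>

definition multilin ::
  "('r, 's) ring_scheme \<Rightarrow> ('r, 'x) module list \<Rightarrow> ('r, 'y) module \<Rightarrow> ('r, 'z) module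
     \<Rightarrow> ('x list \<times> 'y \<Rightarrow> 'z) \<Rightarrow> bool" where
  "multilin R As B T \<phi> \<longleftrightarrow> (\<forall>xs y. (xs, y) \<in> tuples As B \<longrightarrow>
     (\<forall>i<length As. lin_map R (As ! i) T (\<lambda>a. \<phi> (xs[i := a], y))) \<and> lin_map R B T (\<lambda>b. \<phi> (xs, b)))"

lemma multilinD:
  assumes "multilin R As B T \<phi>" "(xs, y) \<in> tuples As B"
  shows "i < length As \<Longrightarrow> lin_map R (As ! i) T (\<lambda>a. \<phi> (xs[i := a], y))"
    and "lin_map R B T (\<lambda>b. \<phi> (xs, b))"
  using assms by (auto simp: multilin_def)

lemma multilin_closed:
  assumes "multilin R As B T \<phi>" "t \<in> tuples As B"
  shows "\<phi> t \<in> carrier T"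
proof -
  obtain xs y where t: "t = (xs, y)" by (cases t)
  then show ?thesis
    using lin_map_closed[OF multilinD(2)[OF assms(1), of xs y], of y] assms(2) by (auto simp: tuples_def)
qed

lemma multilin_compose:
  assumes "multilin R As B S \<phi>" "lin_map R S T f"
  shows "multilin R As B T (\<lambda>t. f (\<phi> t))"
  unfolding multilin_def
  by (intro allI impI conjI lin_map_compose[OF _ assms(2)] multilinD[OF assms(1)]) assumption+

lemma tuples_update: "(xs, y) \<in> tuples As B \<Longrightarrow> i < length As \<Longrightarrow> a \<in> carrier (As ! i)
    \<Longrightarrow> (xs[i := a], y) \<in> tuples As B"
  by (auto simp: tuples_def nth_list_update)

lemma tuples_last: "(xs, y) \<in> tuples As B \<Longrightarrow> b \<in> carrier B \<Longrightarrow> (xs, b) \<in> tuples As B"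
  by (auto simp: tuples_def)

context
  fixes R :: "('r, 's) ring_scheme" and As :: "('r, 'x) module list" and B :: "('r, 'y) module"
  assumes R: "cring R" and As: "\<And>A. A \<in> set As \<Longrightarrow> module R A" and B: "module R B"
begin

interpretation R: cring R by (rule R)
interpretation B: module R B by (rule B)

abbreviation "fm \<equiv> free_mod R (tuples As B)"
abbreviation "tk \<equiv> tensor_ker R As B"

interpretation F: module R fm by (rule free_mod_module[OF R])

lemma nth_module: "i < length As \<Longrightarrow> module R (As ! i)"
  by (simp add: As)

lemma nth_closed:
  assumes "i < length As"
  shows "a \<in> carrier (As ! i) \<Longrightarrow> b \<in> carrier (As ! i) \<Longrightarrow> a \<oplus>\<^bsub>As ! i\<^esub> b \<in> carrier (As ! i)"
    "r \<in> carrier R \<Longrightarrow> a \<in> carrier (As ! i) \<Longrightarrow> r \<odot>\<^bsub>As ! i\<^esub> a \<in> carrier (As ! i)"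
proof -
  interpret A: module R "As ! i" using assms by (rule nth_module)
  show "a \<in> carrier (As ! i) \<Longrightarrow> b \<in> carrier (As ! i) \<Longrightarrow> a \<oplus>\<^bsub>As ! i\<^esub> b \<in> carrier (As ! i)"
    "r \<in> carrier R \<Longrightarrow> a \<in> carrier (As ! i) \<Longrightarrow> r \<odot>\<^bsub>As ! i\<^esub> a \<in> carrier (As ! i)"
    by auto
qed

lemmas delta_tuple = delta_closed[OF R, of _ "tuples As B"]

lemma tuples_last_closed:
  "(xs, a) \<in> tuples As B \<Longrightarrow> b \<in> carrier B \<Longrightarrow> (xs, a \<oplus>\<^bsub>B\<^esub> b) \<in> tuples As B"
  "(xs, a) \<in> tuples As B \<Longrightarrow> r \<in> carrier R \<Longrightarrow> (xs, r \<odot>\<^bsub>B\<^esub> a) \<in> tuples As B"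
  by (auto simp: tuples_def)

lemma multilin_rels_subset: "multilin_rels R As B \<subseteq> carrier fm"
  unfolding multilin_rels_def Let_def
  by (auto intro!: F.minus_closed F.a_closed F.smult_closed delta_tuple tuples_update nth_closed tuples_last_closed
      intro: tuples_last)

lemma tensor_ker_submodule: "submodule tk R fm"
  unfolding tensor_ker_def by (rule submod_span_submodule[OF F.module_axioms multilin_rels_subset])

lemma tensor_module: "module R (tensor R As B)"
  unfolding tensor_def by (rule quot_module[OF F.module_axioms tensor_ker_submodule])

lemma rels_mem: "c \<in> multilin_rels R As B \<Longrightarrow> c \<in> tk"
  unfolding tensor_ker_def by (rule subsetD[OF submod_span_superset])

text \<open>Each required identity says that two cosets agree, and the difference of the
  representatives is literally one of the four kinds of relations.\<close>

lemma pure_tensor_multilin: "multilin R As B (tensor R As B) (pure_tensor R As B)"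
proof -
  note q = quot_proj_lin[OF F.module_axioms tensor_ker_submodule, folded tensor_def]
  have *: "tk +>\<^bsub>fm\<^esub> c = tk +>\<^bsub>fm\<^esub> d" if "c \<ominus>\<^bsub>fm\<^esub> d \<in> multilin_rels R As B"
    "c \<in> carrier fm" "d \<in> carrier fm" for c d
    using that by (simp add: coset_eq_iff[OF F.module_axioms tensor_ker_submodule] rels_mem)
  show ?thesis
    unfolding multilin_def pure_tensor_def
  proof (intro allI impI conjI)
    fix xs y i assume t: "(xs, y) \<in> tuples As B" and i: "i < length As"
    note cl = delta_tuple[OF tuples_update[OF t i]] nth_closed[OF i]
    show "lin_map R (As ! i) (tensor R As B) (\<lambda>a. tk +>\<^bsub>fm\<^esub> delta R (xs[i := a], y))"
    proof (rule lin_mapI)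
      fix a b assume a: "a \<in> carrier (As ! i)" and b: "b \<in> carrier (As ! i)"
      show "tk +>\<^bsub>fm\<^esub> delta R (xs[i := a], y) \<in> carrier (tensor R As B)"
        using a by (intro lin_map_closed[OF q] cl)
      have "tk +>\<^bsub>fm\<^esub> delta R (xs[i := a \<oplus>\<^bsub>As ! i\<^esub> b], y)
          = tk +>\<^bsub>fm\<^esub> (delta R (xs[i := a], y) \<oplus>\<^bsub>fm\<^esub> delta R (xs[i := b], y))"
      proof (rule *)
        show "delta R (xs[i := a \<oplus>\<^bsub>As ! i\<^esub> b], y)
          \<ominus>\<^bsub>fm\<^esub> (delta R (xs[i := a], y) \<oplus>\<^bsub>fm\<^esub> delta R (xs[i := b], y)) \<in> multilin_rels R As B"
          unfolding multilin_rels_def Let_def using t i a b by blast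
      qed (auto intro!: F.a_closed cl a b)
      then show "tk +>\<^bsub>fm\<^esub> delta R (xs[i := a \<oplus>\<^bsub>As ! i\<^esub> b], y)
          = (tk +>\<^bsub>fm\<^esub> delta R (xs[i := a], y)) \<oplus>\<^bsub>tensor R As B\<^esub> (tk +>\<^bsub>fm\<^esub> delta R (xs[i := b], y))"
        using a b by (simp add: lin_map_add[OF q] cl)
    next
      fix r a assume r: "r \<in> carrier R" and a: "a \<in> carrier (As ! i)"
      have "tk +>\<^bsub>fm\<^esub> delta R (xs[i := r \<odot>\<^bsub>As ! i\<^esub> a], y)
          = tk +>\<^bsub>fm\<^esub> (r \<odot>\<^bsub>fm\<^esub> delta R (xs[i := a], y))"
      proof (rule *)
        show "delta R (xs[i := r \<odot>\<^bsub>As ! i\<^esub> a], y)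
          \<ominus>\<^bsub>fm\<^esub> (r \<odot>\<^bsub>fm\<^esub> delta R (xs[i := a], y)) \<in> multilin_rels R As B"
          unfolding multilin_rels_def Let_def using t i a r by blast
      qed (auto intro!: F.smult_closed cl a r)
      then show "tk +>\<^bsub>fm\<^esub> delta R (xs[i := r \<odot>\<^bsub>As ! i\<^esub> a], y)
          = r \<odot>\<^bsub>tensor R As B\<^esub> (tk +>\<^bsub>fm\<^esub> delta R (xs[i := a], y))"
        using a r by (simp add: lin_map_smult[OF q] cl)
    qed
  next
    fix xs y assume t: "(xs, y) \<in> tuples As B"
    note cl = delta_tuple[OF tuples_last[OF t]] B.a_closed B.smult_closed
    show "lin_map R B (tensor R As B) (\<lambda>b. tk +>\<^bsub>fm\<^esub> delta R (xs, b))"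
    proof (rule lin_mapI)
      fix a b assume a: "a \<in> carrier B" and b: "b \<in> carrier B"
      show "tk +>\<^bsub>fm\<^esub> delta R (xs, a) \<in> carrier (tensor R As B)"
        using a by (intro lin_map_closed[OF q] cl)
      have "tk +>\<^bsub>fm\<^esub> delta R (xs, a \<oplus>\<^bsub>B\<^esub> b)
          = tk +>\<^bsub>fm\<^esub> (delta R (xs, a) \<oplus>\<^bsub>fm\<^esub> delta R (xs, b))"
      proof (rule *)
        show "delta R (xs, a \<oplus>\<^bsub>B\<^esub> b)
          \<ominus>\<^bsub>fm\<^esub> (delta R (xs, a) \<oplus>\<^bsub>fm\<^esub> delta R (xs, b)) \<in> multilin_rels R As B"
          unfolding multilin_rels_def Let_def using tuples_last[OF t a] b by blast
      qed (auto intro!: F.a_closed cl a b)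
      then show "tk +>\<^bsub>fm\<^esub> delta R (xs, a \<oplus>\<^bsub>B\<^esub> b)
          = (tk +>\<^bsub>fm\<^esub> delta R (xs, a)) \<oplus>\<^bsub>tensor R As B\<^esub> (tk +>\<^bsub>fm\<^esub> delta R (xs, b))"
        using a b by (simp add: lin_map_add[OF q] cl)
    next
      fix r a assume r: "r \<in> carrier R" and a: "a \<in> carrier B"
      have "tk +>\<^bsub>fm\<^esub> delta R (xs, r \<odot>\<^bsub>B\<^esub> a)
          = tk +>\<^bsub>fm\<^esub> (r \<odot>\<^bsub>fm\<^esub> delta R (xs, a))"
      proof (rule *)
        show "delta R (xs, r \<odot>\<^bsub>B\<^esub> a)
          \<ominus>\<^bsub>fm\<^esub> (r \<odot>\<^bsub>fm\<^esub> delta R (xs, a)) \<in> multilin_rels R As B"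
          unfolding multilin_rels_def Let_def using tuples_last[OF t a] r by blast
      qed (auto intro!: F.smult_closed cl a r)
      then show "tk +>\<^bsub>fm\<^esub> delta R (xs, r \<odot>\<^bsub>B\<^esub> a)
          = r \<odot>\<^bsub>tensor R As B\<^esub> (tk +>\<^bsub>fm\<^esub> delta R (xs, a))"
        using a r by (simp add: lin_map_smult[OF q] cl)
    qed
  qed
qed

lemma tensor_generated:
  assumes K: "submodule K R (tensor R As B)" "\<And>t. t \<in> tuples As B \<Longrightarrow> pure_tensor R As B t \<in> K"
    and X: "X \<in> carrier (tensor R As B)"
  shows "X \<in> K"
proof -
  note q = quot_proj_lin[OF F.module_axioms tensor_ker_submodule, folded tensor_def]
  have "X \<in> (\<lambda>c. tk +>\<^bsub>fm\<^esub> c) ` carrier fm"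
    using X unfolding tensor_def carrier_quot_mod[OF F.module_axioms tensor_ker_submodule] .
  then obtain c where c: "X = tk +>\<^bsub>fm\<^esub> c" "c \<in> carrier fm" by (rule imageE)
  have "delta R t \<in> {c \<in> carrier fm. tk +>\<^bsub>fm\<^esub> c \<in> K}" if "t \<in> tuples As B" for t
    using K(2)[OF that] delta_tuple[OF that] unfolding pure_tensor_def by simp
  from free_mod_generated[OF R submodule_preimage[OF F.module_axioms tensor_module q K(1)] this c(2)]
  have "c \<in> {c \<in> carrier fm. tk +>\<^bsub>fm\<^esub> c \<in> K}" .
  then show ?thesis using c by simp
qed

text \<open>Universal property of the tensor product. Multilinearity kills the four kinds of
  relations, hence the whole kernel, and then the representative picked by \<open>SOME\<close> does
  not matter.\<close>

lemma tensor_lift: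
  assumes T: "module R T" and \<phi>: "multilin R As B T \<phi>"
  shows "lin_map R (tensor R As B) T (tensor_lift R T \<phi>)"
    and "t \<in> tuples As B \<Longrightarrow> tensor_lift R T \<phi> (pure_tensor R As B t) = \<phi> t"
proof -
  interpret T: module R T by fact
  let ?l = "lincomb R T \<phi>"
  note cl = multilin_closed[OF \<phi>]
  have l: "lin_map R fm T ?l" by (rule lincomb_lin[OF R T]) (rule cl)
  have ld: "?l (delta R t) = \<phi> t" if "t \<in> tuples As B" for t
    by (rule lincomb_delta[OF R T _ that]) (rule cl)
  note lsub = lin_map_minus[OF F.module_axioms T l]
  have "?l ` multilin_rels R As B \<subseteq> {\<zero>\<^bsub>T\<^esub>}"
  proof
    have z: "x \<ominus>\<^bsub>T\<^esub> y = \<zero>\<^bsub>T\<^esub>" if "x = y" "y \<in> carrier T" for x y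
      using that by (simp add: a_minus_def T.r_neg)
    note D = delta_tuple F.a_closed F.smult_closed
    fix z assume "z \<in> ?l ` multilin_rels R As B"
    then consider
      (1) xs y i a b where "(xs, y) \<in> tuples As B" "i < length As" "a \<in> carrier (As ! i)" "b \<in> carrier (As ! i)"
        "z = ?l (delta R (xs[i := a \<oplus>\<^bsub>As ! i\<^esub> b], y) \<ominus>\<^bsub>fm\<^esub> (delta R (xs[i := a], y) \<oplus>\<^bsub>fm\<^esub> delta R (xs[i := b], y)))"
    | (2) xs y i r a where "(xs, y) \<in> tuples As B" "i < length As" "r \<in> carrier R" "a \<in> carrier (As ! i)"
        "z = ?l (delta R (xs[i := r \<odot>\<^bsub>As ! i\<^esub> a], y) \<ominus>\<^bsub>fm\<^esub> r \<odot>\<^bsub>fm\<^esub> delta R (xs[i := a], y))"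
    | (3) xs a b where "(xs, a) \<in> tuples As B" "b \<in> carrier B"
        "z = ?l (delta R (xs, a \<oplus>\<^bsub>B\<^esub> b) \<ominus>\<^bsub>fm\<^esub> (delta R (xs, a) \<oplus>\<^bsub>fm\<^esub> delta R (xs, b)))"
    | (4) xs r a where "(xs, a) \<in> tuples As B" "r \<in> carrier R"
        "z = ?l (delta R (xs, r \<odot>\<^bsub>B\<^esub> a) \<ominus>\<^bsub>fm\<^esub> r \<odot>\<^bsub>fm\<^esub> delta R (xs, a))"
      unfolding multilin_rels_def Let_def by blast
    then show "z \<in> {\<zero>\<^bsub>T\<^esub>}"
    proof cases
      case 1
      note m = multilinD(1)[OF \<phi> 1(1,2)] and u = tuples_update[OF 1(1,2)]
      show ?thesis using 1 nth_closed[OF 1(2)]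
        by (simp add: lsub D u lin_map_add[OF l] ld lin_map_add[OF m] cl z)
    next
      case 2
      note m = multilinD(1)[OF \<phi> 2(1,2)] and u = tuples_update[OF 2(1,2)]
      show ?thesis using 2 nth_closed[OF 2(2)]
        by (simp add: lsub D u lin_map_smult[OF l] ld lin_map_smult[OF m] cl z)
    next
      case 3
      note m = multilinD(2)[OF \<phi> 3(1)] and u = tuples_last[OF 3(1)]
      have "a \<in> carrier B" using 3(1) by (simp add: tuples_def)
      then show ?thesis using 3
        by (simp add: lsub D u lin_map_add[OF l] ld lin_map_add[OF m] cl z)
    next
      case 4
      note m = multilinD(2)[OF \<phi> 4(1)] and u = tuples_last[OF 4(1)]
      have "a \<in> carrier B" using 4(1) by (simp add: tuples_def)
      then show ?thesis using 4
        by (simp add: lsub D u lin_map_smult[OF l] ld lin_map_smult[OF m] cl z)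
    qed
  qed
  then have k: "?l ` tk \<subseteq> {\<zero>\<^bsub>T\<^esub>}"
    unfolding tensor_ker_def
    by (intro lin_map_span_subset[OF F.module_axioms T l submodule_zero[OF T] multilin_rels_subset])
  have g: "tensor_lift R T \<phi> (tk +>\<^bsub>fm\<^esub> c) \<in> ?l ` (tk +>\<^bsub>fm\<^esub> c)" if "c \<in> carrier fm" for c
  proof -
    have "(SOME c'. c' \<in> tk +>\<^bsub>fm\<^esub> c) \<in> tk +>\<^bsub>fm\<^esub> c"
      using coset_self[OF F.module_axioms tensor_ker_submodule that] by (rule someI[of "\<lambda>c'. c' \<in> tk +>\<^bsub>fm\<^esub> c"])
    then show ?thesis unfolding tensor_lift_def Let_def lincomb_def[OF R] by (rule imageI)
  qed
  note Q = quot_lift[OF F.module_axioms tensor_ker_submodule T l _ g, folded tensor_def]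
  show "lin_map R (tensor R As B) T (tensor_lift R T \<phi>)"
    by (rule Q) (use k in auto)
  show "tensor_lift R T \<phi> (pure_tensor R As B t) = \<phi> t" if "t \<in> tuples As B"
    unfolding pure_tensor_def using Q(2)[of "delta R t"] k that
    by (auto simp: delta_tuple ld)
qed

end

subsection \<open>Direct sums\<close>

context
  fixes R :: "('r, 's) ring_scheme" and I :: "'i set" and F :: "'i \<Rightarrow> ('r, 'x) module"
  assumes R: "cring R" and F: "\<And>i. i \<in> I \<Longrightarrow> module R (F i)"
begin

interpretation R: cring R by (rule R)

lemma dsum_summand_closed:
  assumes "i \<in> I"
  shows "x \<in> carrier (F i) \<Longrightarrow> y \<in> carrier (F i) \<Longrightarrow> x \<oplus>\<^bsub>F i\<^esub> y \<in> carrier (F i)"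
    "r \<in> carrier R \<Longrightarrow> x \<in> carrier (F i) \<Longrightarrow> r \<odot>\<^bsub>F i\<^esub> x \<in> carrier (F i)"
    "\<zero>\<^bsub>F i\<^esub> \<in> carrier (F i)"
    "x \<in> carrier (F i) \<Longrightarrow> \<zero>\<^bsub>F i\<^esub> \<oplus>\<^bsub>F i\<^esub> x = x"
    "x \<in> carrier (F i) \<Longrightarrow> x \<oplus>\<^bsub>F i\<^esub> \<zero>\<^bsub>F i\<^esub> = x"
    "r \<in> carrier R \<Longrightarrow> r \<odot>\<^bsub>F i\<^esub> \<zero>\<^bsub>F i\<^esub> = \<zero>\<^bsub>F i\<^esub>"
proof -
  interpret module R "F i" using assms by (rule F)
  show "x \<in> carrier (F i) \<Longrightarrow> y \<in> carrier (F i) \<Longrightarrow> x \<oplus>\<^bsub>F i\<^esub> y \<in> carrier (F i)"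
    "r \<in> carrier R \<Longrightarrow> x \<in> carrier (F i) \<Longrightarrow> r \<odot>\<^bsub>F i\<^esub> x \<in> carrier (F i)"
    "\<zero>\<^bsub>F i\<^esub> \<in> carrier (F i)"
    "x \<in> carrier (F i) \<Longrightarrow> \<zero>\<^bsub>F i\<^esub> \<oplus>\<^bsub>F i\<^esub> x = x"
    "x \<in> carrier (F i) \<Longrightarrow> x \<oplus>\<^bsub>F i\<^esub> \<zero>\<^bsub>F i\<^esub> = x"
    "r \<in> carrier R \<Longrightarrow> r \<odot>\<^bsub>F i\<^esub> \<zero>\<^bsub>F i\<^esub> = \<zero>\<^bsub>F i\<^esub>"
    by auto
qed

lemma dsum_carrierD:
  assumes "v \<in> carrier (dsum I F)"
  shows "i \<in> I \<Longrightarrow> v i \<in> carrier (F i)" "i \<notin> I \<Longrightarrow> v i = undefined"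
    "finite {i \<in> I. v i \<noteq> \<zero>\<^bsub>F i\<^esub>}"
  using assms by (auto simp: dsum_def PiE_def extensional_def)

lemma dsum_carrierI:
  assumes "\<And>i. i \<in> I \<Longrightarrow> v i \<in> carrier (F i)" "finite S"
    "\<And>i. i \<in> I \<Longrightarrow> i \<notin> S \<Longrightarrow> v i = \<zero>\<^bsub>F i\<^esub>"
  shows "restrict v I \<in> carrier (dsum I F)"
proof -
  have "{i \<in> I. restrict v I i \<noteq> \<zero>\<^bsub>F i\<^esub>} \<subseteq> S" using assms(3) by auto
  from finite_subset[OF this assms(2)] show ?thesis using assms(1) unfolding dsum_def by simp
qed

lemma dsum_simps:
  "\<zero>\<^bsub>dsum I F\<^esub> = (\<lambda>i\<in>I. \<zero>\<^bsub>F i\<^esub>)"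
  "v \<oplus>\<^bsub>dsum I F\<^esub> w = (\<lambda>i\<in>I. v i \<oplus>\<^bsub>F i\<^esub> w i)"
  "r \<odot>\<^bsub>dsum I F\<^esub> v = (\<lambda>i\<in>I. r \<odot>\<^bsub>F i\<^esub> v i)"
  by (simp_all add: dsum_def)

lemma dsum_closed:
  "v \<in> carrier (dsum I F) \<Longrightarrow> w \<in> carrier (dsum I F) \<Longrightarrow> v \<oplus>\<^bsub>dsum I F\<^esub> w \<in> carrier (dsum I F)"
  "r \<in> carrier R \<Longrightarrow> v \<in> carrier (dsum I F) \<Longrightarrow> r \<odot>\<^bsub>dsum I F\<^esub> v \<in> carrier (dsum I F)"
  "\<zero>\<^bsub>dsum I F\<^esub> \<in> carrier (dsum I F)"
proof -
  assume v: "v \<in> carrier (dsum I F)"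
  note V = dsum_carrierD[OF v]
  show "v \<oplus>\<^bsub>dsum I F\<^esub> w \<in> carrier (dsum I F)" if w: "w \<in> carrier (dsum I F)"
    using V(1,3) dsum_carrierD(1,3)[OF w] unfolding dsum_simps
    by (intro dsum_carrierI[of _ "{i \<in> I. v i \<noteq> \<zero>\<^bsub>F i\<^esub>} \<union> {i \<in> I. w i \<noteq> \<zero>\<^bsub>F i\<^esub>}"])
      (auto simp: dsum_summand_closed)
  show "r \<odot>\<^bsub>dsum I F\<^esub> v \<in> carrier (dsum I F)" if "r \<in> carrier R"
    using V(1,3) that unfolding dsum_simps
    by (intro dsum_carrierI[of _ "{i \<in> I. v i \<noteq> \<zero>\<^bsub>F i\<^esub>}"]) (auto simp: dsum_summand_closed)
next
  show "\<zero>\<^bsub>dsum I F\<^esub> \<in> carrier (dsum I F)"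
    unfolding dsum_simps by (intro dsum_carrierI[of _ "{}"]) (auto simp: dsum_summand_closed)
qed

lemma dsum_eqI:
  assumes "v \<in> carrier (dsum I F)" "w \<in> carrier (dsum I F)" "\<And>i. i \<in> I \<Longrightarrow> v i = w i"
  shows "v = w"
  using dsum_carrierD(2)[OF assms(1)] dsum_carrierD(2)[OF assms(2)] assms(3) by (metis ext)

lemma dsum_module: "module R (dsum I F)"
proof (rule moduleI[OF R])
  show "abelian_group (dsum I F)"
  proof (rule abelian_groupI)
    fix u v w assume u: "u \<in> carrier (dsum I F)" and v: "v \<in> carrier (dsum I F)"
      and w: "w \<in> carrier (dsum I F)"
    note D = dsum_carrierD(1)[OF u] dsum_carrierD(1)[OF v] dsum_carrierD(1)[OF w]
    have *: "u i \<oplus>\<^bsub>F i\<^esub> v i \<oplus>\<^bsub>F i\<^esub> w i = u i \<oplus>\<^bsub>F i\<^esub> (v i \<oplus>\<^bsub>F i\<^esub> w i)" "u i \<oplus>\<^bsub>F i\<^esub> v i = v i \<oplus>\<^bsub>F i\<^esub> u i"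
      "(\<ominus>\<^bsub>R\<^esub> \<one>\<^bsub>R\<^esub>) \<odot>\<^bsub>F i\<^esub> u i \<oplus>\<^bsub>F i\<^esub> u i = \<zero>\<^bsub>F i\<^esub>" if "i \<in> I" for i
    proof -
      interpret M: module R "F i" using that by (rule F)
      show "u i \<oplus>\<^bsub>F i\<^esub> v i \<oplus>\<^bsub>F i\<^esub> w i = u i \<oplus>\<^bsub>F i\<^esub> (v i \<oplus>\<^bsub>F i\<^esub> w i)" "u i \<oplus>\<^bsub>F i\<^esub> v i = v i \<oplus>\<^bsub>F i\<^esub> u i"
        "(\<ominus>\<^bsub>R\<^esub> \<one>\<^bsub>R\<^esub>) \<odot>\<^bsub>F i\<^esub> u i \<oplus>\<^bsub>F i\<^esub> u i = \<zero>\<^bsub>F i\<^esub>"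
        using D that by (simp add: M.a_assoc, simp add: M.a_comm, simp add: M.smult_l_minus M.l_neg)
    qed
    show "u \<oplus>\<^bsub>dsum I F\<^esub> v \<in> carrier (dsum I F)" using u v by (rule dsum_closed)
    show "u \<oplus>\<^bsub>dsum I F\<^esub> v \<oplus>\<^bsub>dsum I F\<^esub> w = u \<oplus>\<^bsub>dsum I F\<^esub> (v \<oplus>\<^bsub>dsum I F\<^esub> w)"
      using u v w by (intro dsum_eqI dsum_closed) (simp_all add: dsum_simps *(1))
    show "u \<oplus>\<^bsub>dsum I F\<^esub> v = v \<oplus>\<^bsub>dsum I F\<^esub> u"
      using u v *(2) by (intro dsum_eqI dsum_closed) (simp_all add: dsum_simps)
    show "\<zero>\<^bsub>dsum I F\<^esub> \<oplus>\<^bsub>dsum I F\<^esub> u = u"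
      using u D by (intro dsum_eqI dsum_closed) (simp_all add: dsum_simps dsum_summand_closed)
    have "(\<ominus>\<^bsub>R\<^esub> \<one>\<^bsub>R\<^esub>) \<odot>\<^bsub>dsum I F\<^esub> u \<in> carrier (dsum I F)" using u by (simp add: dsum_closed)
    moreover have "(\<ominus>\<^bsub>R\<^esub> \<one>\<^bsub>R\<^esub>) \<odot>\<^bsub>dsum I F\<^esub> u \<oplus>\<^bsub>dsum I F\<^esub> u = \<zero>\<^bsub>dsum I F\<^esub>"
      using u by (intro dsum_eqI dsum_closed) (simp_all add: dsum_simps *(3))
    ultimately show "\<exists>y\<in>carrier (dsum I F). y \<oplus>\<^bsub>dsum I F\<^esub> u = \<zero>\<^bsub>dsum I F\<^esub>" by blast
  qed (rule dsum_closed)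
next
  fix a b u v assume a: "a \<in> carrier R" and b: "b \<in> carrier R"
    and u: "u \<in> carrier (dsum I F)" and v: "v \<in> carrier (dsum I F)"
  note D = dsum_carrierD(1)[OF u] dsum_carrierD(1)[OF v]
  have *: "(a \<oplus>\<^bsub>R\<^esub> b) \<odot>\<^bsub>F i\<^esub> u i = a \<odot>\<^bsub>F i\<^esub> u i \<oplus>\<^bsub>F i\<^esub> b \<odot>\<^bsub>F i\<^esub> u i"
    "a \<odot>\<^bsub>F i\<^esub> (u i \<oplus>\<^bsub>F i\<^esub> v i) = a \<odot>\<^bsub>F i\<^esub> u i \<oplus>\<^bsub>F i\<^esub> a \<odot>\<^bsub>F i\<^esub> v i"
    "(a \<otimes>\<^bsub>R\<^esub> b) \<odot>\<^bsub>F i\<^esub> u i = a \<odot>\<^bsub>F i\<^esub> (b \<odot>\<^bsub>F i\<^esub> u i)" if "i \<in> I" for i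
  proof -
    interpret M: module R "F i" using that by (rule F)
    show "(a \<oplus>\<^bsub>R\<^esub> b) \<odot>\<^bsub>F i\<^esub> u i = a \<odot>\<^bsub>F i\<^esub> u i \<oplus>\<^bsub>F i\<^esub> b \<odot>\<^bsub>F i\<^esub> u i"
      "a \<odot>\<^bsub>F i\<^esub> (u i \<oplus>\<^bsub>F i\<^esub> v i) = a \<odot>\<^bsub>F i\<^esub> u i \<oplus>\<^bsub>F i\<^esub> a \<odot>\<^bsub>F i\<^esub> v i"
      "(a \<otimes>\<^bsub>R\<^esub> b) \<odot>\<^bsub>F i\<^esub> u i = a \<odot>\<^bsub>F i\<^esub> (b \<odot>\<^bsub>F i\<^esub> u i)"
      using D a b that by (simp_all add: M.smult_l_distr M.smult_r_distr M.smult_assoc1)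
  qed
  show "a \<odot>\<^bsub>dsum I F\<^esub> u \<in> carrier (dsum I F)" using a u by (rule dsum_closed)
  show "(a \<oplus>\<^bsub>R\<^esub> b) \<odot>\<^bsub>dsum I F\<^esub> u = a \<odot>\<^bsub>dsum I F\<^esub> u \<oplus>\<^bsub>dsum I F\<^esub> b \<odot>\<^bsub>dsum I F\<^esub> u"
    using a b u by (intro dsum_eqI dsum_closed) (simp_all add: dsum_simps *)
  show "a \<odot>\<^bsub>dsum I F\<^esub> (u \<oplus>\<^bsub>dsum I F\<^esub> v) = a \<odot>\<^bsub>dsum I F\<^esub> u \<oplus>\<^bsub>dsum I F\<^esub> a \<odot>\<^bsub>dsum I F\<^esub> v"
    using a u v by (intro dsum_eqI dsum_closed) (simp_all add: dsum_simps *)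
  show "(a \<otimes>\<^bsub>R\<^esub> b) \<odot>\<^bsub>dsum I F\<^esub> u = a \<odot>\<^bsub>dsum I F\<^esub> (b \<odot>\<^bsub>dsum I F\<^esub> u)"
    using a b u by (intro dsum_eqI dsum_closed) (simp_all add: dsum_simps *)
next
  fix u assume u: "u \<in> carrier (dsum I F)"
  show "\<one>\<^bsub>R\<^esub> \<odot>\<^bsub>dsum I F\<^esub> u = u"
    using u dsum_carrierD(1)[OF u]
    by (intro dsum_eqI dsum_closed) (simp_all add: dsum_simps module.smult_one[OF F])
qed

lemma dsum_in_lin:
  assumes i: "i \<in> I"
  shows "lin_map R (F i) (dsum I F) (dsum_in I F i)"
proof (rule lin_mapI)
  have cl: "dsum_in I F i x \<in> carrier (dsum I F)" if "x \<in> carrier (F i)" for x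
    unfolding dsum_in_def using that
    by (intro dsum_carrierI[of _ "{i}"]) (auto simp: dsum_summand_closed)
  note D = dsum_summand_closed
  fix x y assume x: "x \<in> carrier (F i)" and y: "y \<in> carrier (F i)"
  show "dsum_in I F i x \<in> carrier (dsum I F)" using x by (rule cl)
  show "dsum_in I F i (x \<oplus>\<^bsub>F i\<^esub> y) = dsum_in I F i x \<oplus>\<^bsub>dsum I F\<^esub> dsum_in I F i y"
    using x y i D by (intro dsum_eqI dsum_closed cl) (auto simp: dsum_simps dsum_in_def)
  show "dsum_in I F i (r \<odot>\<^bsub>F i\<^esub> x) = r \<odot>\<^bsub>dsum I F\<^esub> dsum_in I F i x" if "r \<in> carrier R" for r
    using x that i D by (intro dsum_eqI dsum_closed cl) (auto simp: dsum_simps dsum_in_def)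
qed

lemma dsum_generated:
  assumes K: "submodule K R (dsum I F)" "\<And>i x. i \<in> I \<Longrightarrow> x \<in> carrier (F i) \<Longrightarrow> dsum_in I F i x \<in> K"
    and v: "v \<in> carrier (dsum I F)"
  shows "v \<in> K"
proof -
  interpret D: module R "dsum I F" by (rule dsum_module)
  note K' = D.submoduleE[OF K(1)]
  have "finite S \<Longrightarrow> S \<subseteq> I \<Longrightarrow> {i \<in> I. v i \<noteq> \<zero>\<^bsub>F i\<^esub>} \<subseteq> S \<Longrightarrow> v \<in> carrier (dsum I F) \<Longrightarrow> v \<in> K" for S v
  proof (induction S arbitrary: v rule: finite_induct)
    case empty
    then have "v = \<zero>\<^bsub>dsum I F\<^esub>" by (intro dsum_eqI dsum_closed) (auto simp: dsum_simps)
    then show ?case using submodule_zero_mem[OF K(1)] by simp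
  next
    case (insert s S)
    note V = dsum_carrierD[OF insert.prems(3)]
    have s: "s \<in> I" using insert.prems by simp
    let ?w = "\<lambda>i\<in>I. if i = s then \<zero>\<^bsub>F i\<^esub> else v i"
    have w: "?w \<in> carrier (dsum I F)"
      using V(1) insert.prems insert.hyps
      by (intro dsum_carrierI[of _ S]) (auto simp: dsum_summand_closed)
    have "?w \<in> K" using insert.prems by (intro insert.IH w) (auto split: if_splits)
    moreover have d: "dsum_in I F s (v s) \<in> K" using s V(1) by (intro K(2))
    moreover have "v = dsum_in I F s (v s) \<oplus>\<^bsub>dsum I F\<^esub> ?w"
      using insert.prems(3) w subsetD[OF K'(1) d] V(1)
      by (intro dsum_eqI dsum_closed) (auto simp: dsum_simps dsum_in_def dsum_summand_closed)
    ultimately show ?case using K'(5) by metis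
  qed
  from this[of "{i \<in> I. v i \<noteq> \<zero>\<^bsub>F i\<^esub>}" v] show ?thesis using dsum_carrierD(3)[OF v] v by blast
qed

context
  fixes T :: "('r, 'y) module" and g :: "'i \<Rightarrow> 'x \<Rightarrow> 'y"
  assumes T: "module R T" and g: "\<And>i. i \<in> I \<Longrightarrow> lin_map R (F i) T (g i)"
begin

interpretation T: module R T by (rule T)

lemma dsum_lift_superset:
  assumes v: "v \<in> carrier (dsum I F)" and S: "finite S" "S \<subseteq> I" "{i \<in> I. v i \<noteq> \<zero>\<^bsub>F i\<^esub>} \<subseteq> S"
  shows "dsum_lift T I F g v = (\<Oplus>\<^bsub>T\<^esub>i\<in>S. g i (v i))"
proof -
  have "g i (v i) = \<zero>\<^bsub>T\<^esub>" if "i \<in> S - {i \<in> I. v i \<noteq> \<zero>\<^bsub>F i\<^esub>}" for i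
  proof -
    have "i \<in> I" "v i = \<zero>\<^bsub>F i\<^esub>" using that S by auto
    then show ?thesis using lin_map_zero[OF F[of i] T g[of i]] by simp
  qed
  moreover have "(\<lambda>i. g i (v i)) \<in> S \<rightarrow> carrier T"
    using S dsum_carrierD(1)[OF v] lin_map_closed[OF g] by auto
  ultimately show ?thesis unfolding dsum_lift_def using S
    by (intro T.add.finprod_mono_neutral_cong_left) auto
qed

lemma dsum_lift_lin: "lin_map R (dsum I F) T (dsum_lift T I F g)"
proof (rule lin_mapI)
  fix u v assume u: "u \<in> carrier (dsum I F)" and v: "v \<in> carrier (dsum I F)"
  note U = dsum_carrierD[OF u] and V = dsum_carrierD[OF v]
  show "dsum_lift T I F g u \<in> carrier T"
    unfolding dsum_lift_def using U lin_map_closed[OF g] by (intro T.finsum_closed) auto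
  let ?S = "{i \<in> I. u i \<noteq> \<zero>\<^bsub>F i\<^esub>} \<union> {i \<in> I. v i \<noteq> \<zero>\<^bsub>F i\<^esub>}"
  have S: "finite ?S" "?S \<subseteq> I" using U V by auto
  have *: "(\<lambda>i. g i (u i)) \<in> ?S \<rightarrow> carrier T" "(\<lambda>i. g i (v i)) \<in> ?S \<rightarrow> carrier T"
    using U V lin_map_closed[OF g] by auto
  have "dsum_lift T I F g (u \<oplus>\<^bsub>dsum I F\<^esub> v) = (\<Oplus>\<^bsub>T\<^esub>i\<in>?S. g i ((u \<oplus>\<^bsub>dsum I F\<^esub> v) i))"
    by (rule dsum_lift_superset[OF dsum_closed(1)[OF u v] S]) (auto simp: dsum_simps dsum_summand_closed)
  also have "\<dots> = (\<Oplus>\<^bsub>T\<^esub>i\<in>?S. g i (u i) \<oplus>\<^bsub>T\<^esub> g i (v i))"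
    using U(1) V(1) * by (intro T.finsum_cong') (auto simp: dsum_simps lin_map_add[OF g])
  also have "\<dots> = (\<Oplus>\<^bsub>T\<^esub>i\<in>?S. g i (u i)) \<oplus>\<^bsub>T\<^esub> (\<Oplus>\<^bsub>T\<^esub>i\<in>?S. g i (v i))"
    using * by (rule T.finsum_addf)
  also have "\<dots> = dsum_lift T I F g u \<oplus>\<^bsub>T\<^esub> dsum_lift T I F g v"
    using dsum_lift_superset[OF u S] dsum_lift_superset[OF v S] by simp
  finally show "dsum_lift T I F g (u \<oplus>\<^bsub>dsum I F\<^esub> v) = dsum_lift T I F g u \<oplus>\<^bsub>T\<^esub> dsum_lift T I F g v" .
next
  fix r u assume r: "r \<in> carrier R" and u: "u \<in> carrier (dsum I F)"
  note U = dsum_carrierD[OF u]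
  let ?S = "{i \<in> I. u i \<noteq> \<zero>\<^bsub>F i\<^esub>}"
  have S: "finite ?S" "?S \<subseteq> I" using U by auto
  have *: "(\<lambda>i. g i (u i)) \<in> ?S \<rightarrow> carrier T" using U lin_map_closed[OF g] by auto
  have "dsum_lift T I F g (r \<odot>\<^bsub>dsum I F\<^esub> u) = (\<Oplus>\<^bsub>T\<^esub>i\<in>?S. g i ((r \<odot>\<^bsub>dsum I F\<^esub> u) i))"
    by (rule dsum_lift_superset[OF dsum_closed(2)[OF r u] S])
      (use r in \<open>auto simp: dsum_simps dsum_summand_closed\<close>)
  also have "\<dots> = (\<Oplus>\<^bsub>T\<^esub>i\<in>?S. r \<odot>\<^bsub>T\<^esub> g i (u i))"
    using U(1) * r by (intro T.finsum_cong') (auto simp: dsum_simps lin_map_smult[OF g])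
  also have "\<dots> = r \<odot>\<^bsub>T\<^esub> dsum_lift T I F g u"
    unfolding dsum_lift_def using S * r by (intro T.finsum_smult_ldistr[symmetric])
  finally show "dsum_lift T I F g (r \<odot>\<^bsub>dsum I F\<^esub> u) = r \<odot>\<^bsub>T\<^esub> dsum_lift T I F g u" .
qed

lemma dsum_lift_in:
  assumes i: "i \<in> I" and x: "x \<in> carrier (F i)"
  shows "dsum_lift T I F g (dsum_in I F i x) = g i x"
proof -
  have "dsum_lift T I F g (dsum_in I F i x) = (\<Oplus>\<^bsub>T\<^esub>j\<in>{i}. g j (dsum_in I F i x j))"
    using i by (intro dsum_lift_superset lin_map_closed[OF dsum_in_lin x]) (auto simp: dsum_in_def)
  also have "\<dots> = g i x"
    using lin_map_closed[OF g[OF i] x] i by (subst T.finsum_insert) (auto simp: dsum_in_def)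
  finally show ?thesis .
qed

end

end

subsection \<open>Multilinear maps and operations on tuples\<close>

lemma multilinI:
  assumes "\<And>xs y i. (xs, y) \<in> tuples As B \<Longrightarrow> i < length As \<Longrightarrow> lin_map R (As ! i) T (\<lambda>a. \<phi> (xs[i := a], y))"
    and "\<And>xs y. (xs, y) \<in> tuples As B \<Longrightarrow> lin_map R B T (\<lambda>b. \<phi> (xs, b))"
  shows "multilin R As B T \<phi>"
  using assms by (auto simp: multilin_def)

lemma tuples_iff: "(xs, y) \<in> tuples As B \<longleftrightarrow> list_all2 (\<lambda>x A. x \<in> carrier A) xs As \<and> y \<in> carrier B"
  by (auto simp: tuples_def list_all2_conv_all_nth)

lemma lin_map_eqI:
  assumes "lin_map R M N h" "module R M" "\<And>x. x \<in> carrier M \<Longrightarrow> h' x = h x"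
  shows "lin_map R M N h'"
  using assms lin_map_cong[of R M h' h N] by blast

text \<open>This is the shape of the faces below the last one: \<open>g\<close> joins the slots
  \<open>i\<close> and \<open>i + 1\<close>. The case distinction compares the varied slot with
  \<open>i\<close>; slots after the pair move down by one.\<close>

lemma multilin_merge:
  assumes \<phi>: "multilin R (Us @ C # Vs) B T \<phi>" and g: "bilin_map R A1 A2 C g"
    and i: "i = length Us" and m: "\<And>A. A \<in> set (Us @ A1 # A2 # Vs) \<Longrightarrow> module R A"
  shows "multilin R (Us @ A1 # A2 # Vs) B T
    (\<lambda>(xs, y). \<phi> (take i xs @ g (xs ! i) (xs ! Suc i) # drop (i + 2) xs, y))"
proof -
  have g1: "lin_map R A2 C (g x)" if "x \<in> carrier A1" for x
    using g that by (simp add: bilin_map_def)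
  have g2: "lin_map R A1 C (\<lambda>x. g x y)" if "y \<in> carrier A2" for y
    using g that by (simp add: bilin_map_def)
  have *: "\<exists>us a1 a2 vs. xs = us @ a1 # a2 # vs \<and> length us = i \<and> length vs = length Vs
      \<and> a1 \<in> carrier A1 \<and> a2 \<in> carrier A2 \<and> (us @ g a1 a2 # vs, y) \<in> tuples (Us @ C # Vs) B"
    if "(xs, y) \<in> tuples (Us @ A1 # A2 # Vs) B" for xs y
  proof -
    from that obtain us a1 a2 vs where x: "xs = us @ a1 # a2 # vs" "list_all2 (\<lambda>x A. x \<in> carrier A) us Us"
      "a1 \<in> carrier A1" "a2 \<in> carrier A2" "list_all2 (\<lambda>x A. x \<in> carrier A) vs Vs" "y \<in> carrier B"
      by (auto simp: tuples_iff list_all2_append2 list_all2_Cons2)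
    then have "(us @ g a1 a2 # vs, y) \<in> tuples (Us @ C # Vs) B"
      by (simp add: tuples_iff list_all2_appendI lin_map_closed[OF g1])
    with x show ?thesis using i by (metis list_all2_lengthD)
  qed
  show ?thesis
  proof (rule multilinI)
    fix xs y j assume t: "(xs, y) \<in> tuples (Us @ A1 # A2 # Vs) B" and j: "j < length (Us @ A1 # A2 # Vs)"
    from *[OF t] obtain us a1 a2 vs where xs: "xs = us @ a1 # a2 # vs" "length us = i"
      "length vs = length Vs" "a1 \<in> carrier A1" "a2 \<in> carrier A2"
      "(us @ g a1 a2 # vs, y) \<in> tuples (Us @ C # Vs) B" by blast
    note \<phi>' = multilinD(1)[OF \<phi> xs(6)]
    consider "j < i" | "j = i" | "j = Suc i" | j' where "j = Suc (Suc (i + j'))"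
      by (metis add_Suc_right less_antisym linorder_neqE_nat less_imp_Suc_add)
    then show "lin_map R ((Us @ A1 # A2 # Vs) ! j) T
       (\<lambda>a. case (xs[j := a], y) of (xs, y) \<Rightarrow> \<phi> (take i xs @ g (xs ! i) (xs ! Suc i) # drop (i + 2) xs, y))"
    proof cases
      case 1
      then show ?thesis using \<phi>'[of j] i xs by (simp add: list_update_append nth_append)
    next
      case 2
      have "lin_map R A1 T (\<lambda>a. \<phi> ((us @ g a1 a2 # vs)[i := g a a2], y))"
        using \<phi>'[of i] i xs by (intro lin_map_compose[OF g2]) simp_all
      then show ?thesis using 2 i xs by (simp add: list_update_append nth_append)
    next
      case 3
      have "lin_map R A2 T (\<lambda>a. \<phi> ((us @ g a1 a2 # vs)[i := g a1 a], y))"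
        using \<phi>'[of i] i xs by (intro lin_map_compose[OF g1]) simp_all
      then show ?thesis using 3 i xs by (simp add: list_update_append nth_append)
    next
      case 4
      then show ?thesis using \<phi>'[of "Suc (i + j')"] i xs j by (simp add: list_update_append nth_append)
    qed
  next
    fix xs y assume t: "(xs, y) \<in> tuples (Us @ A1 # A2 # Vs) B"
    from *[OF t] obtain us a1 a2 vs where xs: "xs = us @ a1 # a2 # vs" "length us = i"
      "length vs = length Vs" "a1 \<in> carrier A1" "a2 \<in> carrier A2"
      "(us @ g a1 a2 # vs, y) \<in> tuples (Us @ C # Vs) B" by blast
    show "lin_map R B T
       (\<lambda>b. case (xs, b) of (xs, y) \<Rightarrow> \<phi> (take i xs @ g (xs ! i) (xs ! Suc i) # drop (i + 2) xs, y))"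
      using multilinD(2)[OF \<phi> xs(6)] i xs by (simp add: nth_append)
  qed
qed

text \<open>The shape of the last face and of the augmentation: the last list entry is absorbed by
  the module entry, which may live in another module afterwards.\<close>

lemma multilin_merge_last:
  assumes \<phi>: "multilin R Us C T \<phi>" and g: "bilin_map R B A C g"
  shows "multilin R (Us @ [A]) B T (\<lambda>(xs, y). \<phi> (butlast xs, g y (last xs)))"
proof -
  have g1: "lin_map R A C (g y)" if "y \<in> carrier B" for y
    using g that by (simp add: bilin_map_def)
  have g2: "lin_map R B C (\<lambda>y. g y x)" if "x \<in> carrier A" for x
    using g that by (simp add: bilin_map_def)
  have *: "\<exists>us a. xs = us @ [a] \<and> length us = length Us \<and> a \<in> carrier A \<and> y \<in> carrier B
     \<and> (us, g y a) \<in> tuples Us C"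
    if "(xs, y) \<in> tuples (Us @ [A]) B" for xs y
  proof -
    from that obtain us a where x: "xs = us @ [a]" "list_all2 (\<lambda>x A. x \<in> carrier A) us Us"
      "a \<in> carrier A" "y \<in> carrier B"
      by (auto simp: tuples_iff list_all2_append2 list_all2_Cons2)
    then have "(us, g y a) \<in> tuples Us C" by (simp add: tuples_iff lin_map_closed[OF g1])
    with x show ?thesis by (metis list_all2_lengthD)
  qed
  show ?thesis
  proof (rule multilinI)
    fix xs y j assume t: "(xs, y) \<in> tuples (Us @ [A]) B" and j: "j < length (Us @ [A])"
    from *[OF t] obtain us a where xs: "xs = us @ [a]" "length us = length Us" "a \<in> carrier A"
      "y \<in> carrier B" "(us, g y a) \<in> tuples Us C" by blast
    consider "j < length Us" | "j = length Us" using j by fastforce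
    then show "lin_map R ((Us @ [A]) ! j) T (\<lambda>x. case (xs[j := x], y) of (xs, y) \<Rightarrow> \<phi> (butlast xs, g y (last xs)))"
    proof cases
      case 1
      then show ?thesis using multilinD(1)[OF \<phi> xs(5), of j] xs by (simp add: list_update_append nth_append)
    next
      case 2
      then show ?thesis using lin_map_compose[OF g1 multilinD(2)[OF \<phi> xs(5)]] xs
        by (simp add: list_update_append nth_append)
    qed
  next
    fix xs y assume t: "(xs, y) \<in> tuples (Us @ [A]) B"
    from *[OF t] obtain us a where xs: "xs = us @ [a]" "length us = length Us" "a \<in> carrier A"
      "y \<in> carrier B" "(us, g y a) \<in> tuples Us C" by blast
    then show "lin_map R B T (\<lambda>b. case (xs, b) of (xs, y) \<Rightarrow> \<phi> (butlast xs, g y (last xs)))"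
      using lin_map_compose[OF g2 multilinD(2)[OF \<phi> xs(5)]] by simp
  qed
qed

text \<open>One slot is filled with a constant, as happens with the units inserted by the
  degeneracies and by the contraction.\<close>

lemma multilin_insert:
  assumes \<phi>: "multilin R (Us @ C # Vs) B T \<phi>" and c: "c \<in> carrier C" and i: "i = length Us"
  shows "multilin R (Us @ Vs) B T (\<lambda>(xs, y). \<phi> (take i xs @ c # drop i xs, y))"
proof -
  have *: "\<exists>us vs. xs = us @ vs \<and> length us = i \<and> length vs = length Vs
      \<and> (us @ c # vs, y) \<in> tuples (Us @ C # Vs) B"
    if "(xs, y) \<in> tuples (Us @ Vs) B" for xs y
  proof -
    from that obtain us vs where x: "xs = us @ vs" "list_all2 (\<lambda>x A. x \<in> carrier A) us Us"
      "list_all2 (\<lambda>x A. x \<in> carrier A) vs Vs" "y \<in> carrier B"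
      by (auto simp: tuples_iff list_all2_append2)
    then have "(us @ c # vs, y) \<in> tuples (Us @ C # Vs) B"
      by (simp add: tuples_iff list_all2_appendI c)
    with x show ?thesis using i by (metis list_all2_lengthD)
  qed
  show ?thesis
  proof (rule multilinI)
    fix xs y j assume t: "(xs, y) \<in> tuples (Us @ Vs) B" and j: "j < length (Us @ Vs)"
    from *[OF t] obtain us vs where xs: "xs = us @ vs" "length us = i"
      "length vs = length Vs" "(us @ c # vs, y) \<in> tuples (Us @ C # Vs) B" by blast
    consider "j < i" | j' where "j = i + j'" by (metis le_Suc_ex not_less)
    then show "lin_map R ((Us @ Vs) ! j) T (\<lambda>a. case (xs[j := a], y) of (xs, y) \<Rightarrow> \<phi> (take i xs @ c # drop i xs, y))"
    proof cases
      case 1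
      then show ?thesis using multilinD(1)[OF \<phi> xs(4), of j] i xs
        by (simp add: list_update_append nth_append)
    next
      case 2
      then show ?thesis using multilinD(1)[OF \<phi> xs(4), of "Suc (i + j')"] i xs j
        by (simp add: list_update_append nth_append)
    qed
  next
    fix xs y assume t: "(xs, y) \<in> tuples (Us @ Vs) B"
    from *[OF t] obtain us vs where xs: "xs = us @ vs" "length us = i"
      "length vs = length Vs" "(us @ c # vs, y) \<in> tuples (Us @ C # Vs) B" by blast
    then show "lin_map R B T (\<lambda>b. case (xs, b) of (xs, y) \<Rightarrow> \<phi> (take i xs @ c # drop i xs, y))"
      using multilinD(2)[OF \<phi> xs(4)] by simp
  qed
qed

lemma multilin_head:
  assumes \<phi>: "multilin R (C # Vs) B T \<phi>" and g: "lin_map R A C g"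
  shows "multilin R (A # Vs) B T (\<lambda>(xs, y). \<phi> (g (hd xs) # tl xs, y))"
proof -
  have *: "\<exists>a vs. xs = a # vs \<and> length vs = length Vs \<and> a \<in> carrier A \<and> (g a # vs, y) \<in> tuples (C # Vs) B"
    if "(xs, y) \<in> tuples (A # Vs) B" for xs y
  proof -
    from that obtain a vs where x: "xs = a # vs" "a \<in> carrier A"
      "list_all2 (\<lambda>x A. x \<in> carrier A) vs Vs" "y \<in> carrier B"
      by (auto simp: tuples_iff list_all2_Cons2)
    then have "(g a # vs, y) \<in> tuples (C # Vs) B" by (simp add: tuples_iff lin_map_closed[OF g])
    with x show ?thesis by (metis list_all2_lengthD)
  qed
  show ?thesis
  proof (rule multilinI)
    fix xs y j assume t: "(xs, y) \<in> tuples (A # Vs) B" and j: "j < length (A # Vs)"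
    from *[OF t] obtain a vs where xs: "xs = a # vs" "length vs = length Vs" "a \<in> carrier A"
      "(g a # vs, y) \<in> tuples (C # Vs) B" by blast
    show "lin_map R ((A # Vs) ! j) T (\<lambda>x. case (xs[j := x], y) of (xs, y) \<Rightarrow> \<phi> (g (hd xs) # tl xs, y))"
    proof (cases j)
      case 0
      then show ?thesis using lin_map_compose[OF g multilinD(1)[OF \<phi> xs(4), of 0, simplified]] xs by simp
    next
      case (Suc j')
      then show ?thesis using multilinD(1)[OF \<phi> xs(4), of j] xs j by simp
    qed
  next
    fix xs y assume t: "(xs, y) \<in> tuples (A # Vs) B"
    from *[OF t] obtain a vs where xs: "xs = a # vs" "length vs = length Vs" "a \<in> carrier A"
      "(g a # vs, y) \<in> tuples (C # Vs) B" by blast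
    then show "lin_map R B T (\<lambda>b. case (xs, b) of (xs, y) \<Rightarrow> \<phi> (g (hd xs) # tl xs, y))"
      using multilinD(2)[OF \<phi> xs(4)] by simp
  qed
qed

section \<open>Augmented complexes with a contraction\<close>

lemma neg1_pow_closed: "cring R \<Longrightarrow> neg1_pow R a \<in> carrier R"
proof -
  assume "cring R"
  then interpret cring R .
  show ?thesis by (simp add: neg1_pow_def)
qed

lemma neg1_pow_add: "cring R \<Longrightarrow> neg1_pow R a \<otimes>\<^bsub>R\<^esub> neg1_pow R b = neg1_pow R (a + b)"
proof -
  assume "cring R"
  then interpret cring R .
  show ?thesis by (simp add: neg1_pow_def l_minus)
qed

lemma neg1_pow_cong: "even a = even b \<Longrightarrow> neg1_pow R a = neg1_pow R b"
  by (simp add: neg1_pow_def)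

text \<open>The cancellation behind \<open>d d = 0\<close>: the term at (i, j) with j < i is
  cancelled by the one at (j, i - 1). In the induction step the new row
  \<open>i = Suc (Suc n)\<close> cancels against the new column \<open>j = Suc n\<close>.\<close>

lemma (in abelian_group) finsum_antisymmetric_zero:
  fixes c :: "nat \<Rightarrow> nat \<Rightarrow> 'a"
  assumes "\<And>i j. c i j \<in> carrier G"
    and "\<And>i j. j < i \<Longrightarrow> i \<le> Suc n \<Longrightarrow> c i j \<oplus> c j (i - 1) = \<zero>"
  shows "(\<Oplus>j\<in>{..n}. \<Oplus>i\<in>{..Suc n}. c i j) = \<zero>"
  using assms(2)
proof (induction n)
  case 0
  then show ?case using 0[of 0 1] by (simp add: assms(1))
next
  case (Suc n)
  have "(\<Oplus>j\<in>{..Suc n}. \<Oplus>i\<in>{..Suc (Suc n)}. c i j)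
      = (\<Oplus>i\<in>{..Suc (Suc n)}. c i (Suc n)) \<oplus> (\<Oplus>j\<in>{..n}. \<Oplus>i\<in>{..Suc (Suc n)}. c i j)"
    by (rule finsum_Suc) (simp add: assms(1) Pi_def)
  also have "(\<Oplus>j\<in>{..n}. \<Oplus>i\<in>{..Suc (Suc n)}. c i j)
      = (\<Oplus>j\<in>{..n}. c (Suc (Suc n)) j \<oplus> (\<Oplus>i\<in>{..Suc n}. c i j))"
    by (intro finsum_cong' finsum_Suc) (simp_all add: assms(1) Pi_def del: finsum_Suc)
  also have "\<dots> = (\<Oplus>j\<in>{..n}. c (Suc (Suc n)) j) \<oplus> (\<Oplus>j\<in>{..n}. \<Oplus>i\<in>{..Suc n}. c i j)"
    by (rule finsum_addf) (simp_all add: assms(1) Pi_def)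
  also have "(\<Oplus>j\<in>{..n}. \<Oplus>i\<in>{..Suc n}. c i j) = \<zero>"
    using Suc.prems by (intro Suc.IH) auto
  also have "(\<Oplus>i\<in>{..Suc (Suc n)}. c i (Suc n)) = c (Suc (Suc n)) (Suc n) \<oplus> (\<Oplus>i\<in>{..Suc n}. c i (Suc n))"
    by (rule finsum_Suc) (simp add: assms(1) Pi_def)
  also have "c (Suc (Suc n)) (Suc n) \<oplus> (\<Oplus>i\<in>{..Suc n}. c i (Suc n))
        \<oplus> ((\<Oplus>j\<in>{..n}. c (Suc (Suc n)) j) \<oplus> \<zero>)
      = (c (Suc (Suc n)) (Suc n) \<oplus> (\<Oplus>j\<in>{..n}. c (Suc (Suc n)) j)) \<oplus> (\<Oplus>i\<in>{..Suc n}. c i (Suc n))"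
    using assms(1) by (simp add: a_ac Pi_def del: finsum_Suc)
  also have "c (Suc (Suc n)) (Suc n) \<oplus> (\<Oplus>j\<in>{..n}. c (Suc (Suc n)) j) = (\<Oplus>j\<in>{..Suc n}. c (Suc (Suc n)) j)"
    by (rule finsum_Suc[symmetric]) (simp add: assms(1) Pi_def)
  also have "\<dots> \<oplus> (\<Oplus>i\<in>{..Suc n}. c i (Suc n)) = (\<Oplus>j\<in>{..Suc n}. c (Suc (Suc n)) j \<oplus> c j (Suc n))"
    by (rule finsum_addf[symmetric]) (simp_all add: assms(1) Pi_def)
  also have "\<dots> = (\<Oplus>j\<in>{..Suc n}. \<zero>)"
  proof (rule finsum_cong')
    show "c (Suc (Suc n)) j \<oplus> c j (Suc n) = \<zero>" if "j \<in> {..Suc n}" for j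
      using Suc.prems[of j "Suc (Suc n)"] that by simp
  qed simp_all
  finally show ?case by simp
qed

text \<open>The maps \<open>h\<close> and \<open>hA\<close> form a contracting homotopy of the
  augmented complex: a cycle \<open>x\<close> satisfies \<open>x = d (h x)\<close>, since the other
  summand is the homotopy applied to zero.\<close>

lemma aug_acyclicI:
  assumes C: "\<And>n. module R (C n)" and A: "module R A"
    and d: "\<And>n. n \<ge> 1 \<Longrightarrow> lin_map R (C n) (C (n - 1)) (d n)"
    and e: "lin_map R (C 0) A \<epsilon>"
    and h: "\<And>n. lin_map R (C n) (C (Suc n)) (h n)" and hA: "\<And>a. a \<in> carrier A \<Longrightarrow> hA a \<in> carrier (C 0)"
    and hA0: "hA \<zero>\<^bsub>A\<^esub> = \<zero>\<^bsub>C 0\<^esub>"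
    and ed: "\<And>x. x \<in> carrier (C 1) \<Longrightarrow> \<epsilon> (d 1 x) = \<zero>\<^bsub>A\<^esub>"
    and dd: "\<And>n x. n \<ge> 1 \<Longrightarrow> x \<in> carrier (C (Suc n)) \<Longrightarrow> d n (d (Suc n) x) = \<zero>\<^bsub>C (n - 1)\<^esub>"
    and eh: "\<And>a. a \<in> carrier A \<Longrightarrow> \<epsilon> (hA a) = a"
    and dh0: "\<And>x. x \<in> carrier (C 0) \<Longrightarrow> d 1 (h 0 x) \<oplus>\<^bsub>C 0\<^esub> hA (\<epsilon> x) = x"
    and dh: "\<And>n x. n \<ge> 1 \<Longrightarrow> x \<in> carrier (C n) \<Longrightarrow> d (Suc n) (h n x) \<oplus>\<^bsub>C n\<^esub> h (n - 1) (d n x) = x"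
  shows "aug_acyclic C d A \<epsilon>"
  unfolding aug_acyclic_def
proof (intro conjI allI impI)
  have rz: "x \<oplus>\<^bsub>C n\<^esub> \<zero>\<^bsub>C n\<^esub> = x" if "x \<in> carrier (C n)" for x n
  proof -
    interpret module R "C n" by (rule C)
    show ?thesis using that by simp
  qed
  show "\<epsilon> ` carrier (C 0) = carrier A"
  proof
    show "\<epsilon> ` carrier (C 0) \<subseteq> carrier A" using lin_map_closed[OF e] by blast
    show "carrier A \<subseteq> \<epsilon> ` carrier (C 0)"
    proof
      fix a assume "a \<in> carrier A"
      then show "a \<in> \<epsilon> ` carrier (C 0)" using eh[of a] hA[of a] by (intro image_eqI[of a \<epsilon> "hA a"]) simp_all
    qed
  qed
  have d1: "lin_map R (C 1) (C 0) (d 1)" using d[of 1] by simp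
  show "{x \<in> carrier (C 0). \<epsilon> x = \<zero>\<^bsub>A\<^esub>} = d 1 ` carrier (C 1)"
  proof (intro equalityI subsetI)
    fix x assume "x \<in> {x \<in> carrier (C 0). \<epsilon> x = \<zero>\<^bsub>A\<^esub>}"
    then have x: "x \<in> carrier (C 0)" "\<epsilon> x = \<zero>\<^bsub>A\<^esub>" by auto
    have hx: "h 0 x \<in> carrier (C 1)" using lin_map_closed[OF h[of 0] x(1)] by simp
    have "x = d 1 (h 0 x)"
      using dh0[OF x(1)] unfolding x(2) hA0 rz[OF lin_map_closed[OF d1 hx]] by simp
    with hx show "x \<in> d 1 ` carrier (C 1)" by (rule image_eqI[rotated])
  next
    fix x assume "x \<in> d 1 ` carrier (C 1)"
    then obtain y where y: "x = d 1 y" "y \<in> carrier (C 1)" by (rule imageE)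
    show "x \<in> {x \<in> carrier (C 0). \<epsilon> x = \<zero>\<^bsub>A\<^esub>}"
      using lin_map_closed[OF d1 y(2)] ed[OF y(2)] by (simp add: y(1))
  qed
  fix n :: nat assume n: "1 \<le> n"
  have dS: "lin_map R (C (n + 1)) (C n) (d (n + 1))" using d[of "n + 1"] by simp
  show "{x \<in> carrier (C n). d n x = \<zero>\<^bsub>C (n - 1)\<^esub>} = d (n + 1) ` carrier (C (n + 1))"
  proof (intro equalityI subsetI)
    fix x assume "x \<in> {x \<in> carrier (C n). d n x = \<zero>\<^bsub>C (n - 1)\<^esub>}"
    then have x: "x \<in> carrier (C n)" "d n x = \<zero>\<^bsub>C (n - 1)\<^esub>" by auto
    have hx: "h n x \<in> carrier (C (n + 1))" using lin_map_closed[OF h[of n] x(1)] by simp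
    have "h (n - 1) \<zero>\<^bsub>C (n - 1)\<^esub> = \<zero>\<^bsub>C n\<^esub>"
      using lin_map_zero[OF C C h[of "n - 1"]] n by simp
    then have "x = d (n + 1) (h n x)"
      using dh[OF n x(1)] rz[OF lin_map_closed[OF dS hx]] by (simp add: x(2))
    with hx show "x \<in> d (n + 1) ` carrier (C (n + 1))" by (rule image_eqI[rotated])
  next
    fix x assume "x \<in> d (n + 1) ` carrier (C (n + 1))"
    then obtain y where y: "x = d (n + 1) y" "y \<in> carrier (C (n + 1))" by (rule imageE)
    show "x \<in> {x \<in> carrier (C n). d n x = \<zero>\<^bsub>C (n - 1)\<^esub>}"
      using lin_map_closed[OF dS y(2)] dd[OF n, of y] y(2) by (simp add: y(1))
  qed
qed

text \<open>The map \<open>g\<close> has the form of \<open>nbar_diff\<close>, so the normalized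
  complex is covered with its definition as it stands.\<close>

lemma quot_map:
  assumes M: "module R M" and N: "module R N" and H: "submodule H R M" and K: "submodule K R N"
    and f: "lin_map R M N f" and fH: "\<And>x. x \<in> H \<Longrightarrow> f x \<in> K"
  defines "g \<equiv> \<lambda>X. the_elem ((\<lambda>x. K +>\<^bsub>N\<^esub> f x) ` X)"
  shows "lin_map R (quot_mod M H) (quot_mod N K) g"
    and "\<And>x. x \<in> carrier M \<Longrightarrow> g (H +>\<^bsub>M\<^esub> x) = K +>\<^bsub>N\<^esub> f x"
proof -
  have l: "lin_map R M (quot_mod N K) (\<lambda>x. K +>\<^bsub>N\<^esub> f x)"
    by (rule lin_map_compose[OF f quot_proj_lin[OF N K]])
  have z: "K +>\<^bsub>N\<^esub> f x = \<zero>\<^bsub>quot_mod N K\<^esub>" if "x \<in> H" for x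
    using coset_eq_self_iff[OF N K] lin_map_closed[OF f] fH[OF that] that module.submoduleE(1)[OF M H]
    by (auto simp: quot_zero[OF N K])
  have g: "g (H +>\<^bsub>M\<^esub> x) \<in> (\<lambda>x. K +>\<^bsub>N\<^esub> f x) ` (H +>\<^bsub>M\<^esub> x)" if x: "x \<in> carrier M" for x
    unfolding g_def
  proof (rule the_elem_image_mem[OF M H x])
    fix y assume y: "y \<in> H +>\<^bsub>M\<^esub> x"
    from coset_mem[OF M H x y] have *: "y \<in> carrier M" "y \<ominus>\<^bsub>M\<^esub> x \<in> H" by auto
    have "f y \<ominus>\<^bsub>N\<^esub> f x \<in> K" using fH[OF *(2)] lin_map_minus[OF M N f *(1) x] by simp
    then show "K +>\<^bsub>N\<^esub> f y = K +>\<^bsub>N\<^esub> f x"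
      using coset_eq_iff[OF N K lin_map_closed[OF f *(1)] lin_map_closed[OF f x]] by simp
  qed
  show "lin_map R (quot_mod M H) (quot_mod N K) g"
    by (rule quot_lift(1)[OF M H quot_module[OF N K] l z g])
  show "\<And>x. x \<in> carrier M \<Longrightarrow> g (H +>\<^bsub>M\<^esub> x) = K +>\<^bsub>N\<^esub> f x"
    by (rule quot_lift(2)[OF M H quot_module[OF N K] l z g])
qed

lemma quot_map_target:
  assumes M: "module R M" and N: "module R N" and H: "submodule H R M"
    and f: "lin_map R M N f" and fH: "\<And>x. x \<in> H \<Longrightarrow> f x = \<zero>\<^bsub>N\<^esub>"
  defines "g \<equiv> \<lambda>X. the_elem (f ` X)"
  shows "lin_map R (quot_mod M H) N g"
    and "\<And>x. x \<in> carrier M \<Longrightarrow> g (H +>\<^bsub>M\<^esub> x) = f x"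
proof -
  interpret N: module R N by (rule N)
  have g: "g (H +>\<^bsub>M\<^esub> x) \<in> f ` (H +>\<^bsub>M\<^esub> x)" if x: "x \<in> carrier M" for x
    unfolding g_def
  proof (rule the_elem_image_mem[OF M H x])
    fix y assume y: "y \<in> H +>\<^bsub>M\<^esub> x"
    from coset_mem[OF M H x y] have *: "y \<in> carrier M" "y \<ominus>\<^bsub>M\<^esub> x \<in> H" by auto
    have "f y \<ominus>\<^bsub>N\<^esub> f x = \<zero>\<^bsub>N\<^esub>" using fH[OF *(2)] lin_map_minus[OF M N f *(1) x] by simp
    then show "f y = f x"
      by (rule N.minus_eq_zero_imp_eq) (rule lin_map_closed[OF f] *(1) x)+
  qed
  show "lin_map R (quot_mod M H) N g" by (rule quot_lift(1)[OF M H N f fH g])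
  show "\<And>x. x \<in> carrier M \<Longrightarrow> g (H +>\<^bsub>M\<^esub> x) = f x" by (rule quot_lift(2)[OF M H N f fH g])
qed

text \<open>The homotopy descends along with the differential and its identities hold on
  representatives, so the homology of the subcomplex \<open>D\<close> never has to be
  computed.\<close>

lemma aug_acyclic_quotient:
  fixes C :: "nat \<Rightarrow> ('r, 'x) module" and D :: "nat \<Rightarrow> 'x set" and d h :: "nat \<Rightarrow> 'x \<Rightarrow> 'x"
  assumes C: "\<And>n. module R (C n)" and A: "module R A" and D: "\<And>n. submodule (D n) R (C n)"
    and d: "\<And>n. n \<ge> 1 \<Longrightarrow> lin_map R (C n) (C (n - 1)) (d n)"
    and e: "lin_map R (C 0) A \<epsilon>"
    and h: "\<And>n. lin_map R (C n) (C (Suc n)) (h n)" and hA: "lin_map R A (C 0) hA"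
    and ed: "\<And>x. x \<in> carrier (C 1) \<Longrightarrow> \<epsilon> (d 1 x) = \<zero>\<^bsub>A\<^esub>"
    and dd: "\<And>n x. n \<ge> 1 \<Longrightarrow> x \<in> carrier (C (Suc n)) \<Longrightarrow> d n (d (Suc n) x) = \<zero>\<^bsub>C (n - 1)\<^esub>"
    and eh: "\<And>a. a \<in> carrier A \<Longrightarrow> \<epsilon> (hA a) = a"
    and dh0: "\<And>x. x \<in> carrier (C 0) \<Longrightarrow> d 1 (h 0 x) \<oplus>\<^bsub>C 0\<^esub> hA (\<epsilon> x) = x"
    and dh: "\<And>n x. n \<ge> 1 \<Longrightarrow> x \<in> carrier (C n) \<Longrightarrow> d (Suc n) (h n x) \<oplus>\<^bsub>C n\<^esub> h (n - 1) (d n x) = x"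
    and dD: "\<And>n x. n \<ge> 1 \<Longrightarrow> x \<in> D n \<Longrightarrow> d n x \<in> D (n - 1)"
    and eD: "\<And>x. x \<in> D 0 \<Longrightarrow> \<epsilon> x = \<zero>\<^bsub>A\<^esub>"
    and hD: "\<And>n x. x \<in> D n \<Longrightarrow> h n x \<in> D (Suc n)"
  shows "aug_acyclic (\<lambda>n. quot_mod (C n) (D n))
    (\<lambda>n X. the_elem ((\<lambda>x. D (n - 1) +>\<^bsub>C (n - 1)\<^esub> d n x) ` X)) A (\<lambda>X. the_elem (\<epsilon> ` X))"
proof (rule aug_acyclicI[where R = R and h = "\<lambda>n X. the_elem ((\<lambda>x. D (Suc n) +>\<^bsub>C (Suc n)\<^esub> h n x) ` X)"
      and hA = "\<lambda>a. D 0 +>\<^bsub>C 0\<^esub> hA a"])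
  have qd: "the_elem ((\<lambda>x. D (n - 1) +>\<^bsub>C (n - 1)\<^esub> d n x) ` (D n +>\<^bsub>C n\<^esub> x)) = D (n - 1) +>\<^bsub>C (n - 1)\<^esub> d n x"
    if "n \<ge> 1" "x \<in> carrier (C n)" for n x
    using that by (intro quot_map(2)[OF C C D D d dD])
  have qh: "the_elem ((\<lambda>x. D (Suc n) +>\<^bsub>C (Suc n)\<^esub> h n x) ` (D n +>\<^bsub>C n\<^esub> x)) = D (Suc n) +>\<^bsub>C (Suc n)\<^esub> h n x"
    if "x \<in> carrier (C n)" for n x
    using that by (intro quot_map(2)[OF C C D D h hD])
  have qe: "the_elem (\<epsilon> ` (D 0 +>\<^bsub>C 0\<^esub> x)) = \<epsilon> x" if "x \<in> carrier (C 0)" for x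
    using that by (intro quot_map_target(2)[OF C A D e eD])
  note q = quot_add[OF C D] quot_zero[OF C D]
  have rep: "\<exists>x\<in>carrier (C n). X = D n +>\<^bsub>C n\<^esub> x" if "X \<in> carrier (quot_mod (C n) (D n))" for n X
    using that carrier_quot_mod[OF C D] by blast
  have dcl: "d n x \<in> carrier (C (n - 1))" if "n \<ge> 1" "x \<in> carrier (C n)" for n x
    using lin_map_closed[OF d[OF that(1)] that(2)] .
  have hcl: "h n x \<in> carrier (C (Suc n))" if "x \<in> carrier (C n)" for n x
    using lin_map_closed[OF h that] .
  have hAcl: "hA a \<in> carrier (C 0)" if "a \<in> carrier A" for a using lin_map_closed[OF hA that] .
  have zer: "D n +>\<^bsub>C n\<^esub> \<zero>\<^bsub>C n\<^esub> = D n" for n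
    using lin_map_zero[OF C quot_module[OF C D] quot_proj_lin[OF C D]] by (simp add: q)
  show "module R (quot_mod (C n) (D n))" for n by (rule quot_module[OF C D])
  show "module R A" by (rule A)
  show "lin_map R (quot_mod (C n) (D n)) (quot_mod (C (n - 1)) (D (n - 1)))
      (\<lambda>X. the_elem ((\<lambda>x. D (n - 1) +>\<^bsub>C (n - 1)\<^esub> d n x) ` X))" if "n \<ge> 1" for n
    using that by (intro quot_map(1)[OF C C D D d dD])
  show "lin_map R (quot_mod (C 0) (D 0)) A (\<lambda>X. the_elem (\<epsilon> ` X))" by (rule quot_map_target(1)[OF C A D e eD])
  show "lin_map R (quot_mod (C n) (D n)) (quot_mod (C (Suc n)) (D (Suc n)))
      (\<lambda>X. the_elem ((\<lambda>x. D (Suc n) +>\<^bsub>C (Suc n)\<^esub> h n x) ` X))" for n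
    by (rule quot_map(1)[OF C C D D h hD])
  show "D 0 +>\<^bsub>C 0\<^esub> hA a \<in> carrier (quot_mod (C 0) (D 0))" if "a \<in> carrier A" for a
    using hAcl[OF that] by (simp add: carrier_quot_mod[OF C D])
  show "D 0 +>\<^bsub>C 0\<^esub> hA \<zero>\<^bsub>A\<^esub> = \<zero>\<^bsub>quot_mod (C 0) (D 0)\<^esub>"
    using lin_map_zero[OF A C hA] zer by (simp add: q)
  show "the_elem (\<epsilon> ` (D 0 +>\<^bsub>C 0\<^esub> hA a)) = a" if "a \<in> carrier A" for a
    using qe[OF hAcl[OF that]] eh[OF that] by simp
  show "the_elem (\<epsilon> ` the_elem ((\<lambda>x. D (1 - 1) +>\<^bsub>C (1 - 1)\<^esub> d 1 x) ` X)) = \<zero>\<^bsub>A\<^esub>"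
    if "X \<in> carrier (quot_mod (C 1) (D 1))" for X
    using rep[OF that] qd[of 1] qe dcl[of 1] ed by auto
  show "the_elem ((\<lambda>x. D (n - 1) +>\<^bsub>C (n - 1)\<^esub> d n x) `
          the_elem ((\<lambda>x. D (Suc n - 1) +>\<^bsub>C (Suc n - 1)\<^esub> d (Suc n) x) ` X))
      = \<zero>\<^bsub>quot_mod (C (n - 1)) (D (n - 1))\<^esub>"
    if "n \<ge> 1" "X \<in> carrier (quot_mod (C (Suc n)) (D (Suc n)))" for n X
    using rep[OF that(2)] qd[of "Suc n"] qd[of n] dcl[of "Suc n"] dd[of n] that(1) zer[of "n - 1"]
    by (auto simp: q)
  show "the_elem ((\<lambda>x. D (1 - 1) +>\<^bsub>C (1 - 1)\<^esub> d 1 x) ` the_elem ((\<lambda>x. D (Suc 0) +>\<^bsub>C (Suc 0)\<^esub> h 0 x) ` X))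
      \<oplus>\<^bsub>quot_mod (C 0) (D 0)\<^esub> (D 0 +>\<^bsub>C 0\<^esub> hA (the_elem (\<epsilon> ` X))) = X"
    if "X \<in> carrier (quot_mod (C 0) (D 0))" for X
    using rep[OF that] qd[of 1] qh[of _ 0] qe dcl[of 1] hcl[of _ 0] dh0 hAcl lin_map_closed[OF e]
    by (auto simp: q)
  show "the_elem ((\<lambda>x. D (Suc n - 1) +>\<^bsub>C (Suc n - 1)\<^esub> d (Suc n) x) `
          the_elem ((\<lambda>x. D (Suc n) +>\<^bsub>C (Suc n)\<^esub> h n x) ` X))
      \<oplus>\<^bsub>quot_mod (C n) (D n)\<^esub>
        the_elem ((\<lambda>x. D (Suc (n - 1)) +>\<^bsub>C (Suc (n - 1))\<^esub> h (n - 1) x) `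
          the_elem ((\<lambda>x. D (n - 1) +>\<^bsub>C (n - 1)\<^esub> d n x) ` X)) = X"
    if "n \<ge> 1" "X \<in> carrier (quot_mod (C n) (D n))" for n X
    using rep[OF that(2)] qd[of "Suc n"] qd[of n] qh[of _ n] qh[of _ "n - 1"]
      dcl[of "Suc n"] dcl[of n] hcl[of _ n] hcl[of _ "n - 1"] dh[of n] that(1)
    by (auto simp: q)
qed

section \<open>The bar construction and its generators\<close>

locale bar_setting =
  unary_operadic_category OC + left_operadic_module OC MC + unital_operad R OC Q
  + unital_pmodule R OC MC Q N
  for R :: "('r, 's) ring_scheme" and OC :: "('o, 'a) opcat"
    and MC :: "('o, 'a, 'l, 'q) opmod" and Q :: "('r, 'o, 'a, 'p) operad"
    and N :: "('r, 'l, 'q, 'p, 'm) pmodule" +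
  assumes cring_R: "cring R"
begin

sublocale R: cring R by (rule cring_R)

lemma Pm_module: "A \<in> Ob OC \<Longrightarrow> module R (Pm Q A k)"
  using Pm_collection by (simp add: gr_collection_def)

lemma Mm_module: "L \<in> MOb MC \<Longrightarrow> module R (Mm N L k)"
  using Mm_collection by (simp add: gr_collection_def)

abbreviation "BI \<equiv> bar_index OC MC"
abbreviation "Bar \<equiv> bar R OC MC Q N"
abbreviation "gen \<equiv> bar_gen R OC MC Q N"
abbreviation "lift \<equiv> bar_lift R OC MC Q N"

text \<open>Tensor factors as functions of a single index, so that later statements need no case
  split over its components.\<close>

definition facs :: "('a, 'q) bar_idx \<Rightarrow> ('r, 'p) module list" where
  "facs \<iota> = bar_facs OC MC Q (fst \<iota>) (fst (snd \<iota>))"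

definition endm :: "('a, 'q) bar_idx \<Rightarrow> ('r, 'm) module" where
  "endm \<iota> = Mm N (MFib MC (snd (fst \<iota>))) (snd (snd \<iota>))"

lemma vert_ob: "\<tau> \<in> towers OC MC n L \<Longrightarrow> vert OC MC \<tau> i \<in> Ob OC"
  by (auto simp: towers_def vert_def Tgt_closed intro!: Cod_closed nth_mem)

lemma facs_module:
  assumes "\<iota> \<in> BI n L k" "A \<in> set (facs \<iota>)"
  shows "module R A"
proof -
  obtain \<tau> ks l where \<iota>: "\<iota> = (\<tau>, ks, l)" by (cases \<iota>)
  have \<tau>: "\<tau> \<in> towers OC MC n L" using assms(1) by (simp add: bar_index_def \<iota>)
  then have Ob: "set (vert OC MC \<tau> 0 # map (Fib OC) (fst \<tau>)) \<subseteq> Ob OC"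
    using vert_ob[OF \<tau>] by (auto simp: towers_def Fib_closed)
  have "A \<in> (\<lambda>(X, j). Pm Q X j) ` set (zip (vert OC MC \<tau> 0 # map (Fib OC) (fst \<tau>)) ks)"
    using assms(2) unfolding facs_def bar_facs_def \<iota> fst_conv snd_conv set_map .
  then obtain z where z: "A = (\<lambda>(X, j). Pm Q X j) z"
    "z \<in> set (zip (vert OC MC \<tau> 0 # map (Fib OC) (fst \<tau>)) ks)" by (rule imageE)
  obtain X j where Xj: "z = (X, j)" by (cases z)
  have "X \<in> set (vert OC MC \<tau> 0 # map (Fib OC) (fst \<tau>))" "A = Pm Q X j"
    using set_zip_leftD[OF z(2)[unfolded Xj]] z(1) Xj by simp_all
  then have "X \<in> Ob OC" "A = Pm Q X j" using Ob by blast+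
  then show ?thesis using Pm_module by simp
qed

lemma endm_module: "\<iota> \<in> BI n L k \<Longrightarrow> module R (endm \<iota>)"
  unfolding endm_def by (rule Mm_module) (auto simp: bar_index_def towers_def MFib_closed)

lemma bar_summand_eq: "bar_summand R OC MC Q N \<iota> = tensor R (facs \<iota>) (endm \<iota>)"
  by (simp add: bar_summand_def facs_def endm_def split: prod.split)

lemma gen_eq: "gen n L k \<iota> t
    = dsum_in (BI n L k) (bar_summand R OC MC Q N) \<iota> (pure_tensor R (facs \<iota>) (endm \<iota>) t)"
  by (simp add: bar_gen_def facs_def endm_def split: prod.split)

lemma summand_module: "\<iota> \<in> BI n L k \<Longrightarrow> module R (bar_summand R OC MC Q N \<iota>)"
  unfolding bar_summand_eq by (rule tensor_module[OF cring_R facs_module endm_module])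

lemma bar_module: "module R (Bar n L k)"
  unfolding bar_def by (rule dsum_module[OF cring_R summand_module])

text \<open>The condition under which \<open>bar_lift\<close> is meaningful. With
  \<open>lift_lin\<close>, \<open>lift_gen\<close> and \<open>bar_ext\<close> it gives the universal
  property of the bar module, which hides the quotients behind the tensor products from here
  on.\<close>

definition bar_ml :: "nat \<Rightarrow> 'l \<Rightarrow> int \<Rightarrow> ('r, 'z) module \<Rightarrow> (('a, 'q) bar_idx \<Rightarrow> 'p list \<times> 'm \<Rightarrow> 'z) \<Rightarrow> bool" where
  "bar_ml n L k T \<phi> \<longleftrightarrow> (\<forall>\<iota>\<in>BI n L k. multilin R (facs \<iota>) (endm \<iota>) T (\<phi> \<iota>))"

lemma gen_ml: "bar_ml n L k (Bar n L k) (gen n L k)"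
  unfolding bar_ml_def
proof
  fix \<iota> assume \<iota>: "\<iota> \<in> BI n L k"
  have "lin_map R (tensor R (facs \<iota>) (endm \<iota>)) (Bar n L k) (dsum_in (BI n L k) (bar_summand R OC MC Q N) \<iota>)"
    using dsum_in_lin[where F = "bar_summand R OC MC Q N" and I = "BI n L k", OF cring_R summand_module \<iota>] unfolding bar_def bar_summand_eq by simp
  from multilin_compose[OF pure_tensor_multilin[OF cring_R facs_module[OF \<iota>] endm_module[OF \<iota>]] this]
  show "multilin R (facs \<iota>) (endm \<iota>) (Bar n L k) (gen n L k \<iota>)"
    unfolding gen_eq[abs_def] .
qed

lemma gen_closed: "\<iota> \<in> BI n L k \<Longrightarrow> t \<in> tuples (facs \<iota>) (endm \<iota>) \<Longrightarrow> gen n L k \<iota> t \<in> carrier (Bar n L k)"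
  using gen_ml multilin_closed unfolding bar_ml_def by blast

lemma bar_generated:
  assumes K: "submodule K R (Bar n L k)"
    "\<And>\<iota> t. \<iota> \<in> BI n L k \<Longrightarrow> t \<in> tuples (facs \<iota>) (endm \<iota>) \<Longrightarrow> gen n L k \<iota> t \<in> K"
    and x: "x \<in> carrier (Bar n L k)"
  shows "x \<in> K"
proof (rule dsum_generated[OF cring_R summand_module K(1)[unfolded bar_def] _ x[unfolded bar_def]])
  fix \<iota> v assume \<iota>: "\<iota> \<in> BI n L k" and v: "v \<in> carrier (bar_summand R OC MC Q N \<iota>)"
  let ?d = "dsum_in (BI n L k) (bar_summand R OC MC Q N) \<iota>"
  note f = facs_module[OF \<iota>] endm_module[OF \<iota>]
  have l: "lin_map R (tensor R (facs \<iota>) (endm \<iota>)) (Bar n L k) ?d"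
    using dsum_in_lin[where F = "bar_summand R OC MC Q N" and I = "BI n L k", OF cring_R summand_module \<iota>] unfolding bar_def bar_summand_eq by simp
  have "v \<in> {v \<in> carrier (tensor R (facs \<iota>) (endm \<iota>)). ?d v \<in> K}"
  proof (rule tensor_generated[OF cring_R f submodule_preimage[OF tensor_module[OF cring_R f] bar_module l K(1)]])
    show "v \<in> carrier (tensor R (facs \<iota>) (endm \<iota>))" using v by (simp add: bar_summand_eq)
    fix t assume t: "t \<in> tuples (facs \<iota>) (endm \<iota>)"
    show "pure_tensor R (facs \<iota>) (endm \<iota>) t \<in> {v \<in> carrier (tensor R (facs \<iota>) (endm \<iota>)). ?d v \<in> K}"
      using K(2)[OF \<iota> t] multilin_closed[OF pure_tensor_multilin[OF cring_R f] t] by (simp add: gen_eq)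
  qed
  then show "?d v \<in> K" by simp
qed

lemma bar_ext:
  assumes "module R T" "lin_map R (Bar n L k) T f" "lin_map R (Bar n L k) T g"
    and "\<And>\<iota> t. \<iota> \<in> BI n L k \<Longrightarrow> t \<in> tuples (facs \<iota>) (endm \<iota>) \<Longrightarrow> f (gen n L k \<iota> t) = g (gen n L k \<iota> t)"
    and "x \<in> carrier (Bar n L k)"
  shows "f x = g x"
proof -
  have "x \<in> {x \<in> carrier (Bar n L k). f x = g x}"
    by (rule bar_generated[OF submodule_equalizer[OF bar_module assms(1-3)]])
      (use assms(4,5) gen_closed in auto)
  then show ?thesis by simp
qed

lemma
  assumes T: "module R T" and \<phi>: "bar_ml n L k T \<phi>"
  shows lift_lin: "lin_map R (Bar n L k) T (lift n L k T \<phi>)"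
    and lift_gen: "\<iota> \<in> BI n L k \<Longrightarrow> t \<in> tuples (facs \<iota>) (endm \<iota>) \<Longrightarrow> lift n L k T \<phi> (gen n L k \<iota> t) = \<phi> \<iota> t"
proof -
  have m: "multilin R (facs \<iota>) (endm \<iota>) T (\<phi> \<iota>)" if "\<iota> \<in> BI n L k" for \<iota>
    using \<phi> that by (simp add: bar_ml_def)
  have l: "lin_map R (bar_summand R OC MC Q N \<iota>) T (tensor_lift R T (\<phi> \<iota>))" if "\<iota> \<in> BI n L k" for \<iota>
    unfolding bar_summand_eq
    by (rule tensor_lift(1)[OF cring_R facs_module[OF that] endm_module[OF that] T m[OF that]])
  show "lin_map R (Bar n L k) T (lift n L k T \<phi>)"
    unfolding bar_def bar_lift_def by (rule dsum_lift_lin[OF cring_R summand_module T l])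
  assume \<iota>: "\<iota> \<in> BI n L k" and t: "t \<in> tuples (facs \<iota>) (endm \<iota>)"
  note f = facs_module[OF \<iota>] endm_module[OF \<iota>]
  have "pure_tensor R (facs \<iota>) (endm \<iota>) t \<in> carrier (bar_summand R OC MC Q N \<iota>)"
    unfolding bar_summand_eq by (rule multilin_closed[OF pure_tensor_multilin[OF cring_R f] t])
  from dsum_lift_in[where F = "bar_summand R OC MC Q N" and I = "BI n L k"
      and g = "\<lambda>\<iota>. tensor_lift R T (\<phi> \<iota>)", OF cring_R summand_module T l \<iota> this]
  show "lift n L k T \<phi> (gen n L k \<iota> t) = \<phi> \<iota> t"
    unfolding bar_lift_def gen_eq by (simp add: tensor_lift(2)[OF cring_R f T m[OF \<iota>] t])
qed

end

section \<open>Chains\<close>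

text \<open>The entries \<open>t\<^sub>0, p\<^sub>1, \<dots>, p\<^sub>n, m\<close> of a generator, each taken together with its place in the
  tower, behave like composable morphisms \<open>* \<rightarrow> T\<^sub>0 \<rightarrow> \<dots> \<rightarrow> T\<^sub>n \<rightarrow> *\<close> of a category: the multiplication
  of adjacent entries (\<open>cmul\<close>) is associative, and the units of the operad are identities.  The last
  constructor is for the values of the augmentation.\<close>

datatype ('o, 'a, 'q, 'l, 'p, 'm) cell =
    CT 'o int 'p
  | CF 'a int 'p
  | CA 'q int 'm
  | CE 'l int 'm

primrec cdeg :: "('o, 'a, 'q, 'l, 'p, 'm) cell \<Rightarrow> int" where
  "cdeg (CT T k x) = k"
| "cdeg (CF f k x) = k"
| "cdeg (CA \<alpha> k m) = k"
| "cdeg (CE L k m) = k"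

fun carr :: "('o, 'a, 'q, 'l, 'p, 'm) cell \<Rightarrow> 'a" where
  "carr (CF f k x) = f"
| "carr _ = undefined"

fun cq :: "('o, 'a, 'q, 'l, 'p, 'm) cell \<Rightarrow> 'q" where
  "cq (CA \<alpha> k m) = \<alpha>"
| "cq _ = undefined"

fun cval :: "('o, 'a, 'q, 'l, 'p, 'm) cell \<Rightarrow> 'p" where
  "cval (CT T k x) = x"
| "cval (CF f k x) = x"
| "cval _ = undefined"

fun cm :: "('o, 'a, 'q, 'l, 'p, 'm) cell \<Rightarrow> 'm" where
  "cm (CA \<alpha> k m) = m"
| "cm (CE L k m) = m"
| "cm _ = undefined"

fun pair_sum :: "int list \<Rightarrow> int" where
  "pair_sum [] = 0"
| "pair_sum (k # ks) = k * sum_list ks + pair_sum ks"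

text \<open>What merging loses is the exponent of \<open>face_sign\<close>; this is the reason why
  faces of the rescaled generators \<open>tg\<close> carry no sign.\<close>

lemma pair_sum_merge: "pair_sum (ks @ a # b # ls) = pair_sum (ks @ (a + b) # ls) + a * b"
  by (induction ks) (simp_all add: algebra_simps)

text \<open>Units have degree 0, so inserting one leaves the sign alone.\<close>

lemma pair_sum_zero: "pair_sum (ks @ 0 # ls) = pair_sum (ks @ ls)"
  by (induction ks) simp_all

context bar_setting
begin

text \<open>The cell of \<open>f\<close> runs against \<open>f\<close>, from its codomain to its
  domain, because towers are listed from \<open>T_0\<close> outwards. \<open>None\<close> stands for
  the outer point where a chain begins and ends; \<open>clink\<close> forbids composing
  there.\<close>

fun cdm :: "('o, 'a, 'q, 'l, 'p, 'm) cell \<Rightarrow> 'o option" where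
  "cdm (CF f k x) = Some (Cod OC f)"
| "cdm (CA \<alpha> k m) = Some (Tgt MC \<alpha>)"
| "cdm _ = None"

fun ccd :: "('o, 'a, 'q, 'l, 'p, 'm) cell \<Rightarrow> 'o option" where
  "ccd (CT T k x) = Some T"
| "ccd (CF f k x) = Some (Dom OC f)"
| "ccd _ = None"

fun csrc :: "('o, 'a, 'q, 'l, 'p, 'm) cell \<Rightarrow> 'l" where
  "csrc (CA \<alpha> k m) = Src MC \<alpha>"
| "csrc (CE L k m) = L"
| "csrc _ = undefined"

primrec cok :: "('o, 'a, 'q, 'l, 'p, 'm) cell \<Rightarrow> bool" where
  "cok (CT T k x) \<longleftrightarrow> T \<in> Ob OC \<and> x \<in> carrier (Pm Q T k)"
| "cok (CF f k x) \<longleftrightarrow> f \<in> Mor OC \<and> x \<in> carrier (Pm Q (Fib OC f) k)"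
| "cok (CA \<alpha> k m) \<longleftrightarrow> \<alpha> \<in> MArr MC \<and> m \<in> carrier (Mm N (MFib MC \<alpha>) k)"
| "cok (CE L k m) \<longleftrightarrow> L \<in> MOb MC \<and> m \<in> carrier (Mm N L k)"

definition clink :: "('o, 'a, 'q, 'l, 'p, 'm) cell \<Rightarrow> ('o, 'a, 'q, 'l, 'p, 'm) cell \<Rightarrow> bool" where
  "clink a b \<longleftrightarrow> ccd a = cdm b \<and> ccd a \<noteq> None"

text \<open>The four clauses are the face \<open>d_0\<close>, the inner faces, the last face and the
  augmentation. The operations of \<open>Q\<close> and \<open>N\<close> take the two entries in the
  order opposite to that of the tower. The last clause is a default for cells that do not
  compose.\<close>

fun cmul :: "('o, 'a, 'q, 'l, 'p, 'm) cell \<Rightarrow> ('o, 'a, 'q, 'l, 'p, 'm) cell \<Rightarrow> ('o, 'a, 'q, 'l, 'p, 'm) cell" where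
  "cmul (CT T i x) (CF f j y) = CT (Dom OC f) (j + i) (gam Q f j i y x)"
| "cmul (CF f i x) (CF g j y) = CF (Cmp OC f g) (j + i) (gam Q (FibM OC g f) j i y x)"
| "cmul (CF f i x) (CA \<alpha> j m) = CA (Act MC f \<alpha>) (j + i) (nu N (MFibM MC \<alpha> f) j i m x)"
| "cmul (CT T i x) (CA \<alpha> j m) = CE (Src MC \<alpha>) (j + i) (nu N \<alpha> j i m x)"
| "cmul a b = a"

definition cunit :: "'o \<Rightarrow> ('o, 'a, 'q, 'l, 'p, 'm) cell" where
  "cunit T = CF (Idn OC T) 0 (unt Q T)"

lemma gam_closed: "h \<in> Mor OC \<Longrightarrow> x \<in> carrier (Pm Q (Fib OC h) i) \<Longrightarrow> y \<in> carrier (Pm Q (Cod OC h) j)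
    \<Longrightarrow> gam Q h i j x y \<in> carrier (Pm Q (Dom OC h) (i + j))"
  using gam_bilin[of h i j] by (auto simp: bilin_map_def lin_map_def Pi_def)

lemma nu_closed: "\<alpha> \<in> MArr MC \<Longrightarrow> x \<in> carrier (Mm N (MFib MC \<alpha>) i)
    \<Longrightarrow> p \<in> carrier (Pm Q (Tgt MC \<alpha>) j) \<Longrightarrow> nu N \<alpha> i j x p \<in> carrier (Mm N (Src MC \<alpha>) (i + j))"
  using nu_bilin[of \<alpha> i j] by (auto simp: bilin_map_def lin_map_def Pi_def)

lemmas facts = Src_closed Tgt_closed Act_closed Src_Act Tgt_Act MFib_closed MFibM_closed
  Src_MFibM Tgt_MFibM MFib_MFibM Act_Idn Idn_closed Dom_Idn Cod_Idn Fib_closed Cod_closed Dom_closed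
  Cmp_closed Dom_Cmp Cod_Cmp FibM_closed Dom_FibM Cod_FibM Fib_FibM

lemma gam_FibM_closed:
  assumes "f \<in> Mor OC" "g \<in> Mor OC" "Cod OC g = Dom OC f"
    "y \<in> carrier (Pm Q (Fib OC g) j)" "x \<in> carrier (Pm Q (Fib OC f) i)"
  shows "gam Q (FibM OC g f) j i y x \<in> carrier (Pm Q (Fib OC (Cmp OC f g)) (j + i))"
  using gam_closed[of "FibM OC g f" y j x i] assms by (simp add: facts)

lemma nu_MFibM_closed:
  assumes "\<alpha> \<in> MArr MC" "f \<in> Mor OC" "Tgt MC \<alpha> = Dom OC f"
    "m \<in> carrier (Mm N (MFib MC \<alpha>) j)" "x \<in> carrier (Pm Q (Fib OC f) i)"
  shows "nu N (MFibM MC \<alpha> f) j i m x \<in> carrier (Mm N (MFib MC (Act MC f \<alpha>)) (j + i))"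
  using nu_closed[of "MFibM MC \<alpha> f" m j x i] assms by (simp add: facts)

lemma cmul_ok:
  assumes "cok a" "cok b" "clink a b"
  shows "cok (cmul a b)" "cdm (cmul a b) = cdm a" "ccd (cmul a b) = ccd b"
    "cdeg (cmul a b) = cdeg a + cdeg b" "ccd b = None \<Longrightarrow> csrc (cmul a b) = csrc b"
  using assms gam_closed nu_closed gam_FibM_closed nu_MFibM_closed
  by (cases a; cases b; simp add: clink_def facts)+

text \<open>Only a cell \<open>CF\<close> can have neighbours on both sides. If the cell to its left
  is \<open>CT\<close>, this is an axiom of the operad or of the module; if it is
  \<open>CF f\<close>, it is that axiom for the morphisms or arrows induced on fibers over the
  codomain of \<open>f\<close>.\<close>

lemma cmul_assoc:
  assumes "cok a" "cok b" "cok c" "clink a b" "clink b c"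
  shows "cmul (cmul a b) c = cmul a (cmul b c)"
proof (cases b)
  case b: (CF g j y)
  have g: "g \<in> Mor OC" "y \<in> carrier (Pm Q (Fib OC g) j)" using assms(2) b by auto
  show ?thesis
  proof (cases a)
    case a: (CT T i x)
    then have x: "x \<in> carrier (Pm Q (Cod OC g) i)" using assms b by (auto simp: clink_def)
    show ?thesis
    proof (cases c)
      case c: (CF h k z)
      with assms b have h: "h \<in> Mor OC" "z \<in> carrier (Pm Q (Fib OC h) k)" "Cod OC h = Dom OC g"
        by (auto simp: clink_def)
      show ?thesis using gam_assoc[OF h(1) g(1) h(3,2) g(2) x] by (simp add: a b c g h facts add.assoc)
    next
      case c: (CA \<alpha> k m)
      with assms b have h: "\<alpha> \<in> MArr MC" "m \<in> carrier (Mm N (MFib MC \<alpha>) k)" "Tgt MC \<alpha> = Dom OC g"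
        by (auto simp: clink_def)
      show ?thesis using nu_assoc[OF h(1) g(1) h(3,2) g(2) x] by (simp add: a b c g h facts add.assoc)
    qed (use assms b in \<open>auto simp: clink_def\<close>)
  next
    case a: (CF f i x)
    then have f: "f \<in> Mor OC" "x \<in> carrier (Pm Q (Fib OC f) i)" "Cod OC g = Dom OC f"
      using assms b by (auto simp: clink_def)
    show ?thesis
    proof (cases c)
      case c: (CF h k z)
      with assms b have h: "h \<in> Mor OC" "z \<in> carrier (Pm Q (Fib OC h) k)" "Cod OC h = Dom OC g"
        by (auto simp: clink_def)
      \<comment> \<open>Associativity is applied to \<open>h\<close> and \<open>g\<close> taken over
        the codomain of \<open>f\<close>; \<open>FibM_Cmp\<close> identifies what the composite
        induces, and axiom (b), \<open>FibM_FibM\<close>, what is induced in a second step.\<close>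
      have "gam Q (FibM OC h (Cmp OC f g)) k (j + i) z (gam Q (FibM OC g f) j i y x)
          = gam Q (FibM OC (Cmp OC g h) f) (k + j) i (gam Q (FibM OC h g) k j z y) x"
        using gam_assoc[of "FibM OC h (Cmp OC f g)" "FibM OC g f" z k y j x i] f g h
        by (simp add: facts FibM_Cmp FibM_FibM)
      then show ?thesis using f g h by (simp add: a b c Cmp_assoc add.assoc)
    next
      case c: (CA \<alpha> k m)
      with assms b have h: "\<alpha> \<in> MArr MC" "m \<in> carrier (Mm N (MFib MC \<alpha>) k)" "Tgt MC \<alpha> = Dom OC g"
        by (auto simp: clink_def)
      have "nu N (MFibM MC \<alpha> (Cmp OC f g)) k (j + i) m (gam Q (FibM OC g f) j i y x)
          = nu N (MFibM MC (Act MC g \<alpha>) f) (k + j) i (nu N (MFibM MC \<alpha> g) k j m y) x"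
        using nu_assoc[of "MFibM MC \<alpha> (Cmp OC f g)" "FibM OC g f" m k y j x i] f g h
        by (simp add: facts MFibM_Act MFibM_MFibM)
      then show ?thesis using f g h by (simp add: a b c Act_Cmp add.assoc)
    qed (use assms b in \<open>auto simp: clink_def\<close>)
  qed (use assms b in \<open>auto simp: clink_def\<close>)
qed (use assms in \<open>cases a; cases c; auto simp: clink_def\<close>)+

section \<open>Units of the operad as identity cells\<close>

lemma cunit_ok:
  assumes "T \<in> Ob OC"
  shows "cok (cunit T)" "cdm (cunit T) = Some T" "ccd (cunit T) = Some T" "cdeg (cunit T) = 0"
  using assms unt_closed[OF assms] by (simp_all add: cunit_def facts Ufib_def)

text \<open>By \<open>FibM_Idn\<close> the identity of \<open>Fib OC f\<close> is induced by that of
  \<open>Dom OC f\<close>, and induced morphisms keep their fibers.\<close>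

lemma Fib_Idn_Fib: "f \<in> Mor OC \<Longrightarrow> Fib OC (Idn OC (Fib OC f)) = Fib OC (Idn OC (Dom OC f))"
  using FibM_Idn[of f] Fib_FibM[of "Idn OC (Dom OC f)" f] by (simp add: facts)

text \<open>Left and right units coincide: the product of \<open>1_U\<close> and \<open>1_T\<close>
  along the identity of \<open>U = Ufib OC T\<close> equals \<open>1_T\<close> by left unitality and
  \<open>1_U\<close> by right unitality. This serves \<open>cmul_unit_right\<close>, where left
  unitality is available for the unit of \<open>Fib OC f\<close> while the cell carries the unit of
  \<open>Dom OC f\<close>.\<close>

lemma unt_Ufib:
  assumes T: "T \<in> Ob OC"
  shows "unt Q (Ufib OC T) = unt Q T"
proof -
  let ?U = "Ufib OC T"
  have i: "Idn OC T \<in> Mor OC" and U: "?U \<in> Ob OC" using T by (simp_all add: facts Ufib_def)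
  have FI: "FibM OC (Idn OC T) (Idn OC T) = Idn OC ?U"
    using FibM_Idn[OF i] T by (simp add: facts Ufib_def)
  have UU: "Ufib OC ?U = ?U" using Fib_Idn_Fib[OF i] T by (simp add: facts Ufib_def)
  have "gam Q (Idn OC ?U) 0 0 (unt Q ?U) (unt Q T) = unt Q T"
    by (rule unt_left[OF U unt_closed[OF T]])
  moreover have "gam Q (Idn OC ?U) 0 0 (unt Q ?U) (unt Q T) = unt Q ?U"
    using unt_right[OF i, of "unt Q ?U" 0] unt_closed[OF U] T UU FI by (simp add: facts Ufib_def)
  ultimately show ?thesis by simp
qed

lemma unt_cong: "S \<in> Ob OC \<Longrightarrow> T \<in> Ob OC \<Longrightarrow> Ufib OC S = Ufib OC T \<Longrightarrow> unt Q S = unt Q T"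
  using unt_Ufib by metis

lemma unt_Fib: "f \<in> Mor OC \<Longrightarrow> unt Q (Fib OC f) = unt Q (Dom OC f)"
  by (rule unt_cong) (simp_all add: facts Ufib_def Fib_Idn_Fib)

lemma cmul_unit_right:
  assumes "cok a" "ccd a = Some T"
  shows "cmul a (cunit T) = a"
proof (cases a)
  case (CT T' k x)
  then show ?thesis using assms unt_left[of T x k] by (simp add: cunit_def facts)
next
  case a: (CF f k x)
  then have f: "f \<in> Mor OC" "x \<in> carrier (Pm Q (Fib OC f) k)" "T = Dom OC f" using assms by auto
  have "FibM OC (Idn OC T) f = Idn OC (Fib OC f)" using FibM_Idn[OF f(1)] f(3) by simp
  then show ?thesis using f unt_left[of "Fib OC f" x k] Cmp_Idn_right[OF f(1)] unt_Fib[OF f(1)]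
    by (simp add: a cunit_def facts)
qed (use assms in auto)

lemma cmul_unit_left:
  assumes "cok b" "cdm b = Some T"
  shows "cmul (cunit T) b = b"
proof (cases b)
  case b: (CF f k x)
  then have f: "f \<in> Mor OC" "x \<in> carrier (Pm Q (Fib OC f) k)" "T = Cod OC f" using assms by auto
  then show ?thesis using unt_right[OF f(1,2)] Cmp_Idn_left[OF f(1)] by (simp add: b cunit_def)
next
  case b: (CA \<alpha> k m)
  then have f: "\<alpha> \<in> MArr MC" "m \<in> carrier (Mm N (MFib MC \<alpha>) k)" "T = Tgt MC \<alpha>" using assms by auto
  then show ?thesis using nu_unit[OF f(1,2)] by (simp add: b cunit_def facts)
qed (use assms in auto)

text \<open>A path from the outer point to itself. With \<open>n + 2\<close> cells it is a generator
  of level \<open>n\<close>; a single cell must be a \<open>CE\<close>, a value of the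
  augmentation.\<close>

definition chain :: "'l \<Rightarrow> int \<Rightarrow> ('o, 'a, 'q, 'l, 'p, 'm) cell list \<Rightarrow> bool" where
  "chain L k zs \<longleftrightarrow> zs \<noteq> [] \<and> (\<forall>z\<in>set zs. cok z) \<and> successively clink zs
     \<and> cdm (hd zs) = None \<and> ccd (last zs) = None \<and> csrc (last zs) = L \<and> sum_list (map cdeg zs) = k"

lemma chain_merge:
  assumes "chain L k (us @ a # b # vs)"
  shows "chain L k (us @ cmul a b # vs)" and "cok a" "cok b" "clink a b"
proof -
  show *: "cok a" "cok b" "clink a b" using assms by (auto simp: chain_def successively_append_iff)
  note m = cmul_ok[OF *]
  show "chain L k (us @ cmul a b # vs)"
    using assms m unfolding chain_def
    by (cases us; cases vs) (auto simp: successively_append_iff successively_Cons clink_def hd_append)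
qed

lemma chain_insert_unit:
  assumes "chain L k (us @ a # b # vs)" "ccd a = Some T"
  shows "chain L k (us @ a # cunit T # b # vs)"
proof -
  have "clink a b" "cok a" using assms by (auto simp: chain_def successively_append_iff)
  moreover have "T \<in> Ob OC" using assms(2) \<open>cok a\<close> by (cases a) (auto simp: facts)
  ultimately show ?thesis using assms cunit_ok[of T]
    unfolding chain_def by (auto simp: successively_append_iff clink_def hd_append)
qed

definition cfs :: "('o, 'a, 'q, 'l, 'p, 'm) cell list \<Rightarrow> 'a list" where
  "cfs zs = map carr (butlast (tl zs))"

definition cidx :: "('o, 'a, 'q, 'l, 'p, 'm) cell list \<Rightarrow> ('a, 'q) bar_idx" where
  "cidx zs = ((cfs zs, cq (last zs)), map cdeg (butlast zs), cdeg (last zs))"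

definition ctup :: "('o, 'a, 'q, 'l, 'p, 'm) cell list \<Rightarrow> 'p list \<times> 'm" where
  "ctup zs = (map cval (butlast zs), cm (last zs))"

text \<open>An inner cell has a vertex on either side, which leaves only \<open>CF\<close>; the
  outer ends leave \<open>CT\<close> and \<open>CA\<close>.\<close>

lemma chain_shape:
  assumes "chain L k zs" "length zs = Suc (Suc n)"
  obtains T i x ps \<alpha> j m where "zs = CT T i x # map (\<lambda>(f, i, x). CF f i x) ps @ [CA \<alpha> j m]" "length ps = n"
proof -
  obtain a zs' where a: "zs = a # zs'" using assms(2) by (cases zs) auto
  obtain mid e where e: "zs' = mid @ [e]" using assms(2) a by (cases zs' rule: rev_cases) auto
  have "clink a (hd (mid @ [e]))" "cdm a = None" "ccd e = None"
    using assms(1) by (auto simp: chain_def a e successively_Cons)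
  then obtain T i x where a': "a = CT T i x" by (cases a) (auto simp: clink_def)
  have "clink (last (a # mid)) e"
    using assms(1) successively_append_iff[of clink "a # mid" "[e]"] by (simp add: chain_def a e)
  then have "cdm e \<noteq> None" by (metis clink_def)
  with \<open>ccd e = None\<close> obtain \<alpha> j m where e': "e = CA \<alpha> j m" by (cases e) auto
  have "\<exists>f i x. z = CF f i x" if z: "z \<in> set mid" for z
  proof -
    obtain us vs where m: "mid = us @ z # vs" using split_list[OF z] by blast
    have "clink (last (a # us)) z" "clink z (hd (vs @ [e]))"
      using assms(1) successively_append_iff[of clink "a # us" "z # vs @ [e]"]
        successively_append_iff[of clink "a # us @ [z]" "vs @ [e]"]
      by (simp_all add: chain_def a e m)
    then have "cdm z \<noteq> None" "ccd z \<noteq> None" by (metis clink_def)+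
    then show ?thesis by (cases z) auto
  qed
  then have m: "mid = map (\<lambda>(f, i, x). CF f i x) (map (\<lambda>z. (carr z, cdeg z, cval z)) mid)"
    by (induction mid) (auto, force)
  have "length (map (\<lambda>z. (carr z, cdeg z, cval z)) mid) = n" using assms(2) a e by simp
  then show ?thesis
    by (rule that[rotated]) (simp only: a e a' e' append_Cons m[symmetric])
qed

lemma successively_map_append_single:
  "successively P (map g ps @ [e]) \<longleftrightarrow> (\<forall>i<length ps. P (g (ps ! i)) (if Suc i < length ps then g (ps ! Suc i) else e))"
  by (auto simp: successively_conv_nth nth_append less_Suc_eq)

text \<open>A \<open>CT\<close> cell stores \<open>T_0\<close>, whereas an index knows it only as
  the first vertex of its tower; hence the extra equation for \<open>T\<close>.\<close>

lemma chain_cidx: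
  fixes ps :: "('a \<times> int \<times> 'p) list"
  assumes "zs = CT T i x # map (\<lambda>(f, i, x). CF f i x) ps @ [CA \<alpha> j m]" "length ps = n"
  shows "chain L k zs \<longleftrightarrow> cidx zs \<in> BI n L k \<and> T = vert OC MC (fst (cidx zs)) 0
      \<and> ctup zs \<in> tuples (facs (cidx zs)) (endm (cidx zs))"
proof -
  let ?C = "\<lambda>(f, i, x). CF f i x :: ('o, 'a, 'q, 'l, 'p, 'm) cell"
  have bl: "butlast zs = CT T i x # map ?C ps" "butlast (tl zs) = map ?C ps" "last zs = CA \<alpha> j m"
    using assms by (simp_all add: butlast_append)
  have carr: "map carr (map ?C ps) = map fst ps" "map cdeg (map ?C ps) = map (fst \<circ> snd) ps"
    "map cval (map ?C ps) = map (snd \<circ> snd) ps"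
    by (auto simp: comp_def split: prod.splits)
  have ci: "cidx zs = ((map fst ps, \<alpha>), i # map (fst \<circ> snd) ps, j)"
    "ctup zs = (x # map (snd \<circ> snd) ps, m)"
    unfolding cidx_def ctup_def cfs_def bl by (simp_all add: carr del: map_map)
  have link: "successively clink (map ?C ps @ [CA \<alpha> j m]) \<longleftrightarrow>
      (\<forall>i<n. Dom OC (map fst ps ! i) = vert OC MC (map fst ps, \<alpha>) (Suc i))"
    unfolding successively_map_append_single assms(2)
    by (auto simp: clink_def vert_def assms(2) split: prod.splits)
      (metis fst_conv prod.exhaust_sel)+
  have ok: "(\<forall>z\<in>set (map ?C ps). cok z) \<longleftrightarrow> set (map fst ps) \<subseteq> Mor OC
      \<and> list_all2 (\<lambda>x A. x \<in> carrier A) (map (snd \<circ> snd) ps) (map2 (Pm Q) (map (Fib OC) (map fst ps)) (map (fst \<circ> snd) ps))"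
    by (induction ps) auto
  have sl: "sum_list (map cdeg zs) = sum_list (i # map (fst \<circ> snd) ps) + j"
    using assms(1) carr(2) by (simp del: map_map)
  have h: "clink (CT T i x) (hd (map ?C ps @ [CA \<alpha> j m])) \<longleftrightarrow> T = vert OC MC (map fst ps, \<alpha>) 0"
    using assms(2) by (cases ps) (auto simp: clink_def vert_def)
  have v: "vert OC MC (map fst ps, \<alpha>) 0 \<in> Ob OC" if "set (map fst ps) \<subseteq> Mor OC" "\<alpha> \<in> MArr MC"
    using that by (cases ps) (auto simp: vert_def facts)
  have "chain L k zs \<longleftrightarrow> (T \<in> Ob OC \<and> x \<in> carrier (Pm Q T i))
      \<and> (\<forall>z\<in>set (map ?C ps). cok z) \<and> (\<alpha> \<in> MArr MC \<and> m \<in> carrier (Mm N (MFib MC \<alpha>) j))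
      \<and> T = vert OC MC (map fst ps, \<alpha>) 0 \<and> successively clink (map ?C ps @ [CA \<alpha> j m])
      \<and> Src MC \<alpha> = L \<and> sum_list (i # map (fst \<circ> snd) ps) + j = k"
    unfolding chain_def sl h[symmetric] using assms(1) by (auto simp: successively_Cons)
  also have "\<dots> \<longleftrightarrow> cidx zs \<in> BI n L k \<and> T = vert OC MC (fst (cidx zs)) 0
      \<and> ctup zs \<in> tuples (facs (cidx zs)) (endm (cidx zs))"
    unfolding ok link using v assms(2)
    by (auto simp: ci bar_index_def towers_def tuples_iff facs_def endm_def bar_facs_def simp del: map_map)
  finally show ?thesis .
qed

lemma chain_gen_index:
  assumes "chain L k zs" "length zs = Suc (Suc n)"
  shows "cidx zs \<in> BI n L k" "ctup zs \<in> tuples (facs (cidx zs)) (endm (cidx zs))"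
proof -
  obtain T i x ps \<alpha> j m where "zs = CT T i x # map (\<lambda>(f, i, x). CF f i x) ps @ [CA \<alpha> j m]" "length ps = n"
    by (rule chain_shape[OF assms])
  from chain_cidx[OF this, of L k] assms(1) show "cidx zs \<in> BI n L k"
    "ctup zs \<in> tuples (facs (cidx zs)) (endm (cidx zs))" by auto
qed

lemma chain_cover:
  assumes \<iota>: "\<iota> \<in> BI n L k" and t: "t \<in> tuples (facs \<iota>) (endm \<iota>)"
  obtains zs where "chain L k zs" "length zs = Suc (Suc n)" "cidx zs = \<iota>" "ctup zs = t"
proof -
  obtain fs \<alpha> ks l where i: "\<iota> = ((fs, \<alpha>), ks, l)" by (metis prod.exhaust)
  obtain xs m where t': "t = (xs, m)" by (cases t)
  have len: "length fs = n" "length ks = Suc n" using \<iota> by (auto simp: i bar_index_def towers_def)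
  then have "length xs = Suc n" using t by (simp add: t' tuples_def facs_def bar_facs_def i)
  then obtain x xs' where xs: "xs = x # xs'" "length xs' = n" by (cases xs) auto
  obtain k0 ks' where ks: "ks = k0 # ks'" "length ks' = n" using len by (cases ks) auto
  let ?ps = "zip fs (zip ks' xs')"
  let ?zs = "CT (vert OC MC (fs, \<alpha>) 0) k0 x # map (\<lambda>(f, i, x). CF f i x) ?ps @ [CA \<alpha> l m]"
  have m: "map fst ?ps = fs" "map (fst \<circ> snd) ?ps = ks'" "map (snd \<circ> snd) ?ps = xs'"
    using len xs ks by (simp_all flip: map_map)
  have mm: "map carr (map (\<lambda>(f, i, x). CF f i x) ps) = map fst ps"
    "map cdeg (map (\<lambda>(f, i, x). CF f i x) ps) = map (fst \<circ> snd) ps"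
    "map cval (map (\<lambda>(f, i, x). CF f i x) ps) = map (snd \<circ> snd) ps" for ps :: "('a \<times> int \<times> 'p) list"
    by (auto simp: comp_def split: prod.splits)
  have c: "cidx ?zs = \<iota>" "ctup ?zs = t"
    unfolding cidx_def ctup_def cfs_def using m mm[of ?ps] xs ks
    by (simp_all add: i t' butlast_append del: map_map)
  have l: "length ?ps = n" using len xs ks by simp
  have "chain L k ?zs" using chain_cidx[OF HOL.refl l, where T = "vert OC MC (fs, \<alpha>) 0" and i = k0 and x = x
        and \<alpha> = \<alpha> and j = l and m = m and L = L and k = k] \<iota> t c
    by (simp add: i)
  then show ?thesis using that[of ?zs] c l by simp
qed

end

text \<open>Faces meet two neighbouring entries in the order of the tower, the operations of the
  operad in the opposite one.\<close>

lemma bilin_map_flip: "bilin_map R A B C b \<Longrightarrow> bilin_map R B A C (\<lambda>x y. b y x)"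
  by (simp add: bilin_map_def)

lemma multilin_cong:
  assumes "multilin R As B T \<phi>" "\<And>t. t \<in> tuples As B \<Longrightarrow> \<phi>' t = \<phi> t"
    and "\<And>A. A \<in> set As \<Longrightarrow> module R A" "module R B"
  shows "multilin R As B T \<phi>'"
proof (rule multilinI)
  fix xs y i assume t: "(xs, y) \<in> tuples As B" and i: "i < length As"
  show "lin_map R (As ! i) T (\<lambda>a. \<phi>' (xs[i := a], y))"
    by (rule lin_map_eqI[OF multilinD(1)[OF assms(1) t i]])
      (use assms(2) assms(3)[OF nth_mem[OF i]] tuples_update[OF t i] in auto)
next
  fix xs y assume t: "(xs, y) \<in> tuples As B"
  show "lin_map R B T (\<lambda>b. \<phi>' (xs, b))"
    by (rule lin_map_eqI[OF multilinD(2)[OF assms(1) t] assms(4)])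
      (use assms(2) tuples_last[OF t] in auto)
qed

context bar_setting
begin

section \<open>Linear maps out of the bar construction, tested on chains\<close>

fun cmod :: "('o, 'a, 'q, 'l, 'p, 'm) cell \<Rightarrow> ('r, 'p) module" where
  "cmod (CT T k x) = Pm Q T k"
| "cmod (CF f k x) = Pm Q (Fib OC f) k"
| "cmod _ = undefined"

definition cend :: "('o, 'a, 'q, 'l, 'p, 'm) cell \<Rightarrow> ('r, 'm) module" where
  "cend z = Mm N (MFib MC (cq z)) (cdeg z)"

lemma facs_chain:
  assumes "chain L k zs" "length zs = Suc (Suc n)"
  shows "facs (cidx zs) = map cmod (butlast zs)" "endm (cidx zs) = cend (last zs)"
proof -
  obtain T i x ps \<alpha> j m where zs: "zs = CT T i x # map (\<lambda>(f, i, x). CF f i x) ps @ [CA \<alpha> j m]" "length ps = n"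
    by (rule chain_shape[OF assms])
  from chain_cidx[OF this, of L k] assms(1) have T: "vert OC MC (fst (cidx zs)) 0 = T" by simp
  have "map2 (Pm Q) (map (Fib OC) (map carr (map (\<lambda>(f, i, x). CF f i x) ps))) (map cdeg (map (\<lambda>(f, i, x). CF f i x) ps))
      = map cmod (map (\<lambda>(f, i, x). CF f i x) ps)" for ps :: "('a \<times> int \<times> 'p) list"
    by (induction ps) auto
  then show "facs (cidx zs) = map cmod (butlast zs)"
    using T unfolding facs_def bar_facs_def
    by (simp add: zs(1) cidx_def cfs_def butlast_append del: map_map)
  show "endm (cidx zs) = cend (last zs)" by (simp add: endm_def cend_def cidx_def)
qed

lemma chain_cells:
  assumes "chain L k (us @ a # b # vs)"
  shows "us = [] \<longleftrightarrow> (\<exists>T i x. a = CT T i x)" "us \<noteq> [] \<longleftrightarrow> (\<exists>f i x. a = CF f i x)"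
    "vs = [] \<longleftrightarrow> (\<exists>\<alpha> i x. b = CA \<alpha> i x)" "vs \<noteq> [] \<longleftrightarrow> (\<exists>f i x. b = CF f i x)"
proof -
  have l: "ccd a = cdm b" "ccd a \<noteq> None"
    using chain_merge(4)[OF assms] unfolding clink_def by blast+
  have u: "us = [] \<longleftrightarrow> cdm a = None"
  proof (cases us rule: rev_cases)
    case (snoc us' u)
    then have "clink u a" using assms by (simp add: chain_def successively_append_iff)
    then have "cdm a \<noteq> None" by (metis clink_def)
    then show ?thesis using snoc by simp
  qed (use assms in \<open>simp add: chain_def\<close>)
  have v: "vs = [] \<longleftrightarrow> ccd b = None"
  proof (cases vs)
    case (Cons v vs')
    then have "clink b v" using assms by (simp add: chain_def successively_append_iff)
    then have "ccd b \<noteq> None" by (metis clink_def)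
    then show ?thesis using Cons by simp
  qed (use assms in \<open>simp add: chain_def\<close>)
  show "us = [] \<longleftrightarrow> (\<exists>T i x. a = CT T i x)" "us \<noteq> [] \<longleftrightarrow> (\<exists>f i x. a = CF f i x)"
    using u l by (cases a; auto)+
  show "vs = [] \<longleftrightarrow> (\<exists>\<alpha> i x. b = CA \<alpha> i x)" "vs \<noteq> [] \<longleftrightarrow> (\<exists>f i x. b = CF f i x)"
    using v l by (cases b; auto)+
qed

text \<open>Makes every index the index of some chain, so that \<open>bar_mlI\<close> can test
  multilinearity on chains alone.\<close>

lemma tuples_nonempty:
  assumes "\<iota> \<in> BI n L k"
  shows "\<exists>t. t \<in> tuples (facs \<iota>) (endm \<iota>)"
proof -
  have z: "\<zero>\<^bsub>A\<^esub> \<in> carrier A" if "module R A" for A :: "('r, 'x) module"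
  proof -
    interpret module R A by fact
    show ?thesis by simp
  qed
  have "(map (\<lambda>A. \<zero>\<^bsub>A\<^esub>) (facs \<iota>), \<zero>\<^bsub>endm \<iota>\<^esub>) \<in> tuples (facs \<iota>) (endm \<iota>)"
    using z[OF facs_module[OF assms]] z[OF endm_module[OF assms]] by (simp add: tuples_def)
  then show ?thesis by blast
qed

lemma bar_mlI:
  assumes "\<And>zs. chain L k zs \<Longrightarrow> length zs = Suc (Suc n)
    \<Longrightarrow> multilin R (map cmod (butlast zs)) (cend (last zs)) T (\<phi> (cidx zs))"
  shows "bar_ml n L k T \<phi>"
  unfolding bar_ml_def
proof
  fix \<iota> assume \<iota>: "\<iota> \<in> BI n L k"
  obtain t where t: "t \<in> tuples (facs \<iota>) (endm \<iota>)" using tuples_nonempty[OF \<iota>] by blast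
  obtain zs where zs: "chain L k zs" "length zs = Suc (Suc n)" "cidx zs = \<iota>" by (rule chain_cover[OF \<iota> t])
  show "multilin R (facs \<iota>) (endm \<iota>) T (\<phi> \<iota>)"
    using assms[OF zs(1,2)] facs_chain[OF zs(1,2)] by (simp add: zs(3))
qed

lemma gen_chain_ml:
  assumes "chain L k zs" "length zs = Suc (Suc n)"
  shows "multilin R (map cmod (butlast zs)) (cend (last zs)) (Bar n L k) (gen n L k (cidx zs))"
  using gen_ml chain_gen_index(1)[OF assms] facs_chain[OF assms] by (metis bar_ml_def)

lemma chain_modules:
  assumes "chain L k zs" "length zs = Suc (Suc n)"
  shows "A \<in> set (map cmod (butlast zs)) \<Longrightarrow> module R A" "module R (cend (last zs))"
  using facs_module[OF chain_gen_index(1)[OF assms], of A] endm_module[OF chain_gen_index(1)[OF assms]]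
  unfolding facs_chain[OF assms] by blast+

text \<open>The rescaled generator. Its sign is its own inverse, so these elements generate just as
  well (\<open>gen_tg\<close>, \<open>bar_tg_ext\<close>), and on them the faces are products in the
  category of cells.\<close>

definition tg :: "nat \<Rightarrow> 'l \<Rightarrow> int \<Rightarrow> ('o, 'a, 'q, 'l, 'p, 'm) cell list \<Rightarrow> ('r, 'a, 'q, 'p, 'm) bar_elt" where
  "tg n L k zs = neg1_pow R (pair_sum (map cdeg zs)) \<odot>\<^bsub>Bar n L k\<^esub> gen n L k (cidx zs) (ctup zs)"

lemma neg1_closed: "neg1_pow R a \<in> carrier R"
  by (rule neg1_pow_closed[OF cring_R])

lemma neg1_sq: "neg1_pow R a \<otimes>\<^bsub>R\<^esub> neg1_pow R a = \<one>\<^bsub>R\<^esub>"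
  by (simp add: neg1_pow_def R.l_minus)

lemma gen_chain_closed:
  assumes "chain L k zs" "length zs = Suc (Suc n)"
  shows "gen n L k (cidx zs) (ctup zs) \<in> carrier (Bar n L k)"
  by (rule gen_closed[OF chain_gen_index[OF assms]])

lemma tg_closed:
  assumes "chain L k zs" "length zs = Suc (Suc n)"
  shows "tg n L k zs \<in> carrier (Bar n L k)"
  unfolding tg_def by (rule module.smult_closed[OF bar_module neg1_closed gen_chain_closed[OF assms]])

lemma gen_tg:
  assumes "chain L k zs" "length zs = Suc (Suc n)"
  shows "gen n L k (cidx zs) (ctup zs) = neg1_pow R (pair_sum (map cdeg zs)) \<odot>\<^bsub>Bar n L k\<^esub> tg n L k zs"
proof -
  interpret B: module R "Bar n L k" by (rule bar_module)
  show ?thesis unfolding tg_def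
    using gen_chain_closed[OF assms] by (simp add: neg1_closed neg1_sq flip: B.smult_assoc1)
qed

lemma bar_tg_ext:
  assumes "module R T" "lin_map R (Bar n L k) T f" "lin_map R (Bar n L k) T g"
    and "\<And>zs. chain L k zs \<Longrightarrow> length zs = Suc (Suc n) \<Longrightarrow> f (tg n L k zs) = g (tg n L k zs)"
    and "x \<in> carrier (Bar n L k)"
  shows "f x = g x"
proof (rule bar_ext[OF assms(1-3) _ assms(5)])
  fix \<iota> t assume "\<iota> \<in> BI n L k" "t \<in> tuples (facs \<iota>) (endm \<iota>)"
  then obtain zs where zs: "chain L k zs" "length zs = Suc (Suc n)" "cidx zs = \<iota>" "ctup zs = t"
    by (rule chain_cover)
  show "f (gen n L k \<iota> t) = g (gen n L k \<iota> t)"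
    using gen_tg[OF zs(1,2)] assms(4)[OF zs(1,2)] tg_closed[OF zs(1,2)]
    by (simp add: zs(3,4) lin_map_smult[OF assms(2)] lin_map_smult[OF assms(3)] neg1_closed)
qed

lemma lift_tg:
  assumes "module R T" "bar_ml n L k T \<phi>" "chain L k zs" "length zs = Suc (Suc n)"
  shows "lift n L k T \<phi> (tg n L k zs) = neg1_pow R (pair_sum (map cdeg zs)) \<odot>\<^bsub>T\<^esub> \<phi> (cidx zs) (ctup zs)"
  unfolding tg_def
  by (simp add: lin_map_smult[OF lift_lin[OF assms(1,2)]] neg1_closed gen_chain_closed[OF assms(3,4)]
      lift_gen[OF assms(1,2) chain_gen_index[OF assms(3,4)]])

subsection \<open>Faces, augmentation and degeneracies\<close>

text \<open>Dictionary between the index arithmetic of the definitions and \<open>cmul\<close>. The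
  cases are \<open>d_0\<close>, an inner face and the last face; \<open>n \<ge> 1\<close> excludes a
  \<open>CT\<close> followed by a \<open>CA\<close> alone, whose product belongs to the
  augmentation.\<close>

lemma face_chain:
  assumes "chain L k (us @ a # b # vs)" "length (us @ a # b # vs) = Suc (Suc n)" "n \<ge> 1"
  shows "cidx (us @ cmul a b # vs) = (face_tower OC MC (length us) (fst (cidx (us @ a # b # vs))),
      face_deg n (length us) (snd (cidx (us @ a # b # vs))))"
    "ctup (us @ cmul a b # vs) = face_tuple OC MC Q N (length us) (cidx (us @ a # b # vs)) (ctup (us @ a # b # vs))"
    "face_sign R n (length us) (snd (cidx (us @ a # b # vs))) = neg1_pow R (cdeg a * cdeg b)"
proof -
  note c = chain_cells[OF assms(1)]
  consider (1) T i x f j y where "us = []" "vs \<noteq> []" "a = CT T i x" "b = CF f j y"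
    | (2) u us' f i x g j y where "us = u # us'" "vs \<noteq> []" "a = CF f i x" "b = CF g j y"
    | (3) u us' f i x \<alpha> j m where "us = u # us'" "vs = []" "a = CF f i x" "b = CA \<alpha> j m"
  proof (cases "us = []")
    case True
    moreover have "vs \<noteq> []" using assms(2,3) True by auto
    ultimately show ?thesis using c that(1) by blast
  next
    case False
    then show ?thesis using c that(2,3) by (metis neq_Nil_conv)
  qed
  then have "cidx (us @ cmul a b # vs) = (face_tower OC MC (length us) (fst (cidx (us @ a # b # vs))),
      face_deg n (length us) (snd (cidx (us @ a # b # vs))))
    \<and> ctup (us @ cmul a b # vs) = face_tuple OC MC Q N (length us) (cidx (us @ a # b # vs)) (ctup (us @ a # b # vs))
    \<and> face_sign R n (length us) (snd (cidx (us @ a # b # vs))) = neg1_pow R (cdeg a * cdeg b)"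
  proof cases
    case 1
    then show ?thesis using assms(2,3)
      by (simp add: cidx_def ctup_def cfs_def face_tower_def face_deg_def face_tuple_def face_sign_def)
  next
    case 2
    then have "Suc (length us') < n" using assms(2) by (cases vs) auto
    with 2 show ?thesis
      by (simp add: cidx_def ctup_def cfs_def face_tower_def face_deg_def face_tuple_def face_sign_def
          butlast_append nth_append)
  next
    case 3
    then have "Suc (length us') = n" using assms(2) by auto
    with 3 show ?thesis
      by (auto simp add: cidx_def ctup_def cfs_def face_tower_def face_deg_def face_tuple_def face_sign_def
          butlast_append nth_append)
  qed
  then show "cidx (us @ cmul a b # vs) = (face_tower OC MC (length us) (fst (cidx (us @ a # b # vs))),
      face_deg n (length us) (snd (cidx (us @ a # b # vs))))"
    "ctup (us @ cmul a b # vs) = face_tuple OC MC Q N (length us) (cidx (us @ a # b # vs)) (ctup (us @ a # b # vs))"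
    "face_sign R n (length us) (snd (cidx (us @ a # b # vs))) = neg1_pow R (cdeg a * cdeg b)"
    by blast+
qed

lemma chain_split:
  assumes "length zs = Suc (Suc n)" "i \<le> n"
  obtains us a b vs where "zs = us @ a # b # vs" "length us = i"
proof -
  have "zs = take i zs @ zs ! i # zs ! Suc i # drop (Suc (Suc i)) zs"
    using assms by (simp add: Cons_nth_drop_Suc)
  then show ?thesis using that[of "take i zs"] assms by simp
qed

lemma multilin_scale:
  assumes "module R T" "multilin R As B T \<phi>" "r \<in> carrier R"
    "\<And>A. A \<in> set As \<Longrightarrow> module R A" "module R B"
  shows "multilin R As B T (\<lambda>t. r \<odot>\<^bsub>T\<^esub> \<phi> t)"
proof (rule multilinI)
  fix xs y i assume t: "(xs, y) \<in> tuples As B" and i: "i < length As"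
  show "lin_map R (As ! i) T (\<lambda>a. r \<odot>\<^bsub>T\<^esub> \<phi> (xs[i := a], y))"
    by (rule lin_map_scale[OF assms(4)[OF nth_mem[OF i]] assms(1) multilinD(1)[OF assms(2) t i] assms(3)])
next
  fix xs y assume t: "(xs, y) \<in> tuples As B"
  show "lin_map R B T (\<lambda>b. r \<odot>\<^bsub>T\<^esub> \<phi> (xs, b))"
    by (rule lin_map_scale[OF assms(5,1) multilinD(2)[OF assms(2) t] assms(3)])
qed

text \<open>Before \<open>gen\<close> is applied, a face merges two list slots or absorbs the last
  list slot into the module slot; the two cases are \<open>multilin_merge\<close> and
  \<open>multilin_merge_last\<close>.\<close>

lemma face_ml:
  assumes "i \<le> n" "n \<ge> 1"
  shows "bar_ml n L k (Bar (n - 1) L k) (\<lambda>(\<tau>, \<kappa>) t. face_sign R n i \<kappa> \<odot>\<^bsub>Bar (n - 1) L k\<^esub>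
          gen (n - 1) L k (face_tower OC MC i \<tau>, face_deg n i \<kappa>) (face_tuple OC MC Q N i (\<tau>, \<kappa>) t))"
proof (rule bar_mlI)
  fix zs assume zs: "chain L k zs" "length zs = Suc (Suc n)"
  obtain us a b vs where s: "zs = us @ a # b # vs" and us: "length us = i" by (rule chain_split[OF zs(2) assms(1)])
  note Z = zs[unfolded s]
  note f = face_chain[OF Z assms(2)]
  note M = chain_merge[OF Z(1)]
  have len: "length (us @ cmul a b # vs) = Suc (Suc (n - 1))" using Z(2) assms(2) by simp
  let ?\<tau> = "fst (cidx zs)" and ?\<kappa> = "snd (cidx zs)"
  note G = gen_chain_ml[OF M(1) len]
  note md = chain_modules[OF zs]
  have fm: "multilin R (map cmod (butlast zs)) (cend (last zs)) (Bar (n - 1) L k)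
     (\<lambda>t. gen (n - 1) L k (cidx (us @ cmul a b # vs)) (face_tuple OC MC Q N i (cidx zs) t))"
  proof (cases "vs = []")
    case True
    then have us0: "us \<noteq> []" and i: "i = n" using Z(2) assms us by auto
    then obtain g j x \<alpha> l m where ab: "a = CF g j x" "b = CA \<alpha> l m"
      using chain_cells[OF Z(1)] True by blast
    have g: "g \<in> Mor OC" "\<alpha> \<in> MArr MC" "Tgt MC \<alpha> = Dom OC g"
      using M(2-4) by (auto simp: ab clink_def)
    have bl: "bilin_map R (cend b) (cmod a) (cend (cmul a b)) (nu N (MFibM MC \<alpha> g) l j)"
      using nu_bilin[of "MFibM MC \<alpha> g" l j] g by (simp add: ab cend_def facts)
    have "multilin R (map cmod us @ [cmod a]) (cend b) (Bar (n - 1) L k)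
       (\<lambda>(xs, y). gen (n - 1) L k (cidx (us @ cmul a b # vs)) (butlast xs, nu N (MFibM MC \<alpha> g) l j y (last xs)))"
    proof (rule multilin_merge_last[OF _ bl])
      show "multilin R (map cmod us) (cend (cmul a b)) (Bar (n - 1) L k) (gen (n - 1) L k (cidx (us @ cmul a b # vs)))"
        using G True by simp
    qed
    moreover have "face_tuple OC MC Q N i (cidx zs) = (\<lambda>(xs, m). (butlast xs, nu N (MFibM MC \<alpha> g) l j m (last xs)))"
    proof -
      have "cidx zs = ((map carr (tl us) @ [g], \<alpha>), map cdeg us @ [j], l)"
        unfolding s True cidx_def cfs_def using us0 by (simp add: ab butlast_append)
      moreover have "length (map carr (tl us) @ [g]) = i" using us us0 by (cases us) auto
      ultimately show ?thesis by (simp add: face_tuple_def fun_eq_iff)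
    qed
    ultimately show ?thesis by (simp add: s True butlast_append case_prod_unfold)
  next
    case False
    then have i: "i < n" using Z(2) us by (cases vs) auto
    obtain f j x where b: "b = CF f j x" using chain_cells[OF Z(1)] False by blast
    define h where "h = (if us = [] then f else FibM OC f (carr a))"
    have bl: "bilin_map R (cmod a) (cmod b) (cmod (cmul a b)) (\<lambda>x y. gam Q h (cdeg b) (cdeg a) y x)"
    proof (cases "us = []")
      case True
      then obtain T j' x' where a: "a = CT T j' x'" using chain_cells[OF Z(1)] by blast
      have "f \<in> Mor OC" "Cod OC f = T" using M(2-4) by (auto simp: a b clink_def)
      then show ?thesis using bilin_map_flip[OF gam_bilin[of f j j']] True by (simp add: a b h_def)
    next
      case False
      then obtain g j' x' where a: "a = CF g j' x'" using chain_cells[OF Z(1)] by blast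
      have "f \<in> Mor OC" "g \<in> Mor OC" "Cod OC f = Dom OC g" using M(2-4) by (auto simp: a b clink_def)
      then show ?thesis using bilin_map_flip[OF gam_bilin[of "FibM OC f g" j j']] False
        by (simp add: a b h_def facts)
    qed
    have "multilin R (map cmod us @ cmod a # cmod b # map cmod (butlast vs)) (cend (last vs)) (Bar (n - 1) L k)
       (\<lambda>(xs, y). gen (n - 1) L k (cidx (us @ cmul a b # vs))
         (take i xs @ gam Q h (cdeg b) (cdeg a) (xs ! Suc i) (xs ! i) # drop (i + 2) xs, y))"
    proof (rule multilin_merge[OF _ bl])
      show "multilin R (map cmod us @ cmod (cmul a b) # map cmod (butlast vs)) (cend (last vs)) (Bar (n - 1) L k)
        (gen (n - 1) L k (cidx (us @ cmul a b # vs)))"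
        using G False by (simp add: butlast_append)
      show "module R A" if "A \<in> set (map cmod us @ cmod a # cmod b # map cmod (butlast vs))" for A
        using that md(1)[of A] False unfolding s by (simp add: butlast_append)
    qed (simp add: us)
    moreover have "face_tuple OC MC Q N i (cidx zs)
        = (\<lambda>(xs, y). (take i xs @ gam Q h (cdeg b) (cdeg a) (xs ! Suc i) (xs ! i) # drop (i + 2) xs, y))"
    proof (cases us)
      case Nil
      then show ?thesis using us False
        by (auto simp: s cidx_def cfs_def face_tuple_def fun_eq_iff b h_def)
    next
      case (Cons u us')
      then show ?thesis using us False
        by (auto simp: s cidx_def cfs_def face_tuple_def fun_eq_iff b h_def butlast_append nth_append)
    qed
    ultimately show ?thesis using False by (simp add: s butlast_append case_prod_unfold)
  qed
  from multilin_scale[OF bar_module this neg1_closed[of "cdeg a * cdeg b"] md]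
  show "multilin R (map cmod (butlast zs)) (cend (last zs)) (Bar (n - 1) L k)
    ((\<lambda>(\<tau>, \<kappa>) t. face_sign R n i \<kappa> \<odot>\<^bsub>Bar (n - 1) L k\<^esub>
          gen (n - 1) L k (face_tower OC MC i \<tau>, face_deg n i \<kappa>) (face_tuple OC MC Q N i (\<tau>, \<kappa>) t)) (cidx zs))"
    using f by (simp add: us s case_prod_unfold)
qed

abbreviation "face n L k i \<equiv> bar_face R OC MC Q N n L k i"
abbreviation "diff n L k \<equiv> bar_diff R OC MC Q N n L k"
abbreviation "aug L k \<equiv> bar_aug R OC MC Q N L k"
abbreviation "degen n L k j \<equiv> bar_degen R OC MC Q N n L k j"

lemma face_lin: "i \<le> n \<Longrightarrow> n \<ge> 1 \<Longrightarrow> lin_map R (Bar n L k) (Bar (n - 1) L k) (face n L k i)"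
  unfolding bar_face_def by (rule lift_lin[OF bar_module face_ml])

lemma face_tg:
  assumes "chain L k (us @ a # b # vs)" "length (us @ a # b # vs) = Suc (Suc n)" "n \<ge> 1" "i = length us"
  shows "face n L k i (tg n L k (us @ a # b # vs)) = tg (n - 1) L k (us @ cmul a b # vs)"
proof -
  interpret B: module R "Bar (n - 1) L k" by (rule bar_module)
  have i: "i \<le> n" using assms by simp
  note c = chain_merge[OF assms(1)]
  have len: "length (us @ cmul a b # vs) = Suc (Suc (n - 1))" using assms by simp
  have cl: "gen (n - 1) L k (cidx (us @ cmul a b # vs)) (ctup (us @ cmul a b # vs)) \<in> carrier (Bar (n - 1) L k)"
    by (rule gen_chain_closed[OF c(1) len])
  \<comment> \<open>The two exponents differ by twice \<open>cdeg a * cdeg b\<close>.\<close>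
  have s: "neg1_pow R (pair_sum (map cdeg (us @ a # b # vs)) + cdeg a * cdeg b)
      = neg1_pow R (pair_sum (map cdeg (us @ cmul a b # vs)))"
    by (rule neg1_pow_cong) (simp add: pair_sum_merge cmul_ok(4)[OF c(2-4)])
  have "face n L k i (tg n L k (us @ a # b # vs)) = neg1_pow R (pair_sum (map cdeg (us @ a # b # vs)))
      \<odot>\<^bsub>Bar (n - 1) L k\<^esub> (neg1_pow R (cdeg a * cdeg b) \<odot>\<^bsub>Bar (n - 1) L k\<^esub>
        gen (n - 1) L k (cidx (us @ cmul a b # vs)) (ctup (us @ cmul a b # vs)))"
    unfolding bar_face_def lift_tg[OF bar_module face_ml[OF i assms(3)] assms(1,2)]
    using face_chain[OF assms(1-3)] by (simp add: assms(4) case_prod_unfold)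
  also have "\<dots> = (neg1_pow R (pair_sum (map cdeg (us @ a # b # vs))) \<otimes>\<^bsub>R\<^esub> neg1_pow R (cdeg a * cdeg b))
      \<odot>\<^bsub>Bar (n - 1) L k\<^esub> gen (n - 1) L k (cidx (us @ cmul a b # vs)) (ctup (us @ cmul a b # vs))"
    by (rule B.smult_assoc1[OF neg1_closed neg1_closed cl, symmetric])
  also have "\<dots> = tg (n - 1) L k (us @ cmul a b # vs)"
    unfolding tg_def neg1_pow_add[OF cring_R] s ..
  finally show ?thesis .
qed

lemma aug_ml: "bar_ml 0 L k (Mm N L k) (\<lambda>((fs, \<alpha>), ks, l) (xs, m).
          neg1_pow R (ks ! 0 * l) \<odot>\<^bsub>Mm N L k\<^esub> nu N \<alpha> l (ks ! 0) m (xs ! 0))"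
proof (rule bar_mlI)
  fix zs assume zs: "chain L k zs" "length zs = Suc (Suc 0)"
  obtain T i x \<alpha> l m where s: "zs = [CT T i x, CA \<alpha> l m]"
    by (rule chain_shape[OF zs]) auto
  have g: "\<alpha> \<in> MArr MC" "T = Tgt MC \<alpha>" "Src MC \<alpha> = L" "l + i = k"
    using zs(1) by (auto simp: s chain_def clink_def)
  note md = chain_modules[OF zs]
  have L: "module R (Mm N L k)" using g facts(1)[of \<alpha>] by (intro Mm_module) auto
  \<comment> \<open>The augmentation is a last face after which no list entries remain, so
    \<open>multilin_merge_last\<close> is applied to this map without list slots.\<close>
  have "multilin R [] (Mm N L k) (Mm N L k) (\<lambda>(xs, y). neg1_pow R (i * l) \<odot>\<^bsub>Mm N L k\<^esub> y)"
    by (rule multilinI) (simp_all add: lin_map_scale[OF L L lin_map_ident neg1_closed])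
  moreover have "bilin_map R (cend (CA \<alpha> l m)) (Pm Q T i) (Mm N L k) (nu N \<alpha> l i)"
    using nu_bilin[of \<alpha> l i] g by (simp add: cend_def)
  ultimately have "multilin R ([] @ [Pm Q T i]) (cend (CA \<alpha> l m)) (Mm N L k)
     (\<lambda>(xs, y). (\<lambda>(xs, y). neg1_pow R (i * l) \<odot>\<^bsub>Mm N L k\<^esub> y) (butlast xs, nu N \<alpha> l i y (last xs)))"
    by (rule multilin_merge_last)
  then have "multilin R [Pm Q T i] (cend (CA \<alpha> l m)) (Mm N L k)
     (\<lambda>(xs, m). neg1_pow R (i * l) \<odot>\<^bsub>Mm N L k\<^esub> nu N \<alpha> l i m (xs ! 0))"
    unfolding append_Nil
    by (rule multilin_cong) (use md in \<open>auto simp: s tuples_def length_Suc_conv\<close>)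
  then show "multilin R (map cmod (butlast zs)) (cend (last zs)) (Mm N L k) ((\<lambda>((fs, \<alpha>), ks, l) (xs, m).
          neg1_pow R (ks ! 0 * l) \<odot>\<^bsub>Mm N L k\<^esub> nu N \<alpha> l (ks ! 0) m (xs ! 0)) (cidx zs))"
    by (simp add: s cidx_def)
qed

lemma aug_lin: "L \<in> MOb MC \<Longrightarrow> lin_map R (Bar 0 L k) (Mm N L k) (aug L k)"
  unfolding bar_aug_def by (rule lift_lin[OF Mm_module aug_ml])

lemma aug_tg:
  assumes "L \<in> MOb MC" "chain L k [a, b]"
  shows "aug L k (tg 0 L k [a, b]) = cm (cmul a b)"
proof -
  interpret M: module R "Mm N L k" by (rule Mm_module[OF assms(1)])
  obtain T i x \<alpha> l m where s: "a = CT T i x" "b = CA \<alpha> l m"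
    by (rule chain_shape[OF assms(2), of 0]) auto
  have "cok (cmul a b)" "csrc (cmul a b) = L" "cdeg (cmul a b) = k"
    using chain_merge(1)[of L k "[]" a b "[]"] assms(2) by (auto simp: chain_def)
  then have "cm (cmul a b) \<in> carrier (Mm N L k)" by (simp add: s)
  then show ?thesis unfolding bar_aug_def
    using lift_tg[OF M.module_axioms aug_ml assms(2)] neg1_closed
    by (simp add: s cidx_def ctup_def neg1_sq flip: M.smult_assoc1)
qed

text \<open>The same dictionary for degeneracies. Positions are shifted between the lists: degrees
  and entries start with \<open>t_0\<close>, so the unit goes after \<open>Suc j\<close> of them,
  whereas the morphisms start with \<open>f_1\<close>, so the identity goes after
  \<open>j\<close>.\<close>

lemma degen_chain:
  assumes "chain L k (us @ a # b # vs)" "length (us @ a # b # vs) = Suc (Suc n)" "ccd a = Some T"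
  shows "vert OC MC (fst (cidx (us @ a # b # vs))) (length us) = T"
    and "cidx (us @ a # cunit T # b # vs) = (case cidx (us @ a # b # vs) of ((fs, \<alpha>), ks, l) \<Rightarrow>
      ((take (length us) fs @ Idn OC T # drop (length us) fs, \<alpha>),
       take (Suc (length us)) ks @ 0 # drop (Suc (length us)) ks, l))"
    and "ctup (us @ a # cunit T # b # vs) = (case ctup (us @ a # b # vs) of (xs, m) \<Rightarrow>
      (take (Suc (length us)) xs @ unt Q T # drop (Suc (length us)) xs, m))"
proof -
  note c = chain_cells[OF assms(1)]
  have l: "cdm b = Some T" using assms by (simp add: chain_def successively_append_iff clink_def)
  have fs: "cfs (us @ a # b # vs) = map carr (tl (us @ [a])) @ map carr (butlast (b # vs))"
    by (cases us) (simp_all add: cfs_def butlast_append)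
  show "vert OC MC (fst (cidx (us @ a # b # vs))) (length us) = T"
  proof (cases "vs = []")
    case True
    then obtain \<alpha> i x where "b = CA \<alpha> i x" using c by blast
    then show ?thesis using l True fs by (simp add: cidx_def vert_def)
  next
    case False
    then obtain f i x where "b = CF f i x" using c by blast
    then show ?thesis using l False fs by (simp add: cidx_def vert_def nth_append)
  qed
  have fs': "cfs (us @ a # cunit T # b # vs) = map carr (tl (us @ [a])) @ Idn OC T # map carr (butlast (b # vs))"
    by (cases us) (simp_all add: cfs_def butlast_append cunit_def)
  have u: "cdeg (cunit T) = 0" "cval (cunit T) = unt Q T" by (simp_all add: cunit_def)
  show "cidx (us @ a # cunit T # b # vs) = (case cidx (us @ a # b # vs) of ((fs, \<alpha>), ks, l) \<Rightarrow>
      ((take (length us) fs @ Idn OC T # drop (length us) fs, \<alpha>),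
       take (Suc (length us)) ks @ 0 # drop (Suc (length us)) ks, l))"
    by (simp add: cidx_def fs fs' butlast_append u)
  show "ctup (us @ a # cunit T # b # vs) = (case ctup (us @ a # b # vs) of (xs, m) \<Rightarrow>
      (take (Suc (length us)) xs @ unt Q T # drop (Suc (length us)) xs, m))"
    by (simp add: ctup_def butlast_append u)
qed

lemma chain_ccd:
  assumes "chain L k (us @ a # b # vs)"
  obtains T where "ccd a = Some T"
  using chain_merge(4)[OF assms] by (cases "ccd a") (auto simp: clink_def)

lemma degen_ml:
  assumes "j \<le> n"
  shows "bar_ml n L k (Bar (Suc n) L k) (\<lambda>((fs, \<alpha>), ks, l) (xs, m).
          gen (Suc n) L k
            ((take j fs @ Idn OC (vert OC MC (fs, \<alpha>) j) # drop j fs, \<alpha>),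
             take (Suc j) ks @ 0 # drop (Suc j) ks, l)
            (take (Suc j) xs @ unt Q (vert OC MC (fs, \<alpha>) j) # drop (Suc j) xs, m))"
proof (rule bar_mlI)
  fix zs assume zs: "chain L k zs" "length zs = Suc (Suc n)"
  obtain us a b vs where s: "zs = us @ a # b # vs" and us: "length us = j" by (rule chain_split[OF zs(2) assms(1)])
  note Z = zs[unfolded s]
  obtain T where T: "ccd a = Some T" by (rule chain_ccd[OF Z(1)])
  note d = degen_chain[OF Z T]
  note c = chain_insert_unit[OF Z(1) T]
  have len: "length (us @ a # cunit T # b # vs) = Suc (Suc (Suc n))" using Z(2) by simp
  have "cok (cunit T)" using c by (simp add: chain_def)
  then have u: "unt Q T \<in> carrier (cmod (cunit T))" by (simp add: cunit_def)
  have "multilin R (map cmod (us @ [a]) @ map cmod (butlast (b # vs))) (cend (last (b # vs))) (Bar (Suc n) L k)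
    (\<lambda>(xs, m). gen (Suc n) L k (cidx (us @ a # cunit T # b # vs)) (take (Suc j) xs @ unt Q T # drop (Suc j) xs, m))"
    using gen_chain_ml[OF c len] us
    by (intro multilin_insert[OF _ u]) (simp_all add: butlast_append)
  then show "multilin R (map cmod (butlast zs)) (cend (last zs)) (Bar (Suc n) L k)
    ((\<lambda>((fs, \<alpha>), ks, l) (xs, m).
          gen (Suc n) L k
            ((take j fs @ Idn OC (vert OC MC (fs, \<alpha>) j) # drop j fs, \<alpha>),
             take (Suc j) ks @ 0 # drop (Suc j) ks, l)
            (take (Suc j) xs @ unt Q (vert OC MC (fs, \<alpha>) j) # drop (Suc j) xs, m)) (cidx zs))"
    using d us by (simp add: s butlast_append case_prod_unfold)
qed

lemma degen_lin: "j \<le> n \<Longrightarrow> lin_map R (Bar n L k) (Bar (Suc n) L k) (degen n L k j)"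
  unfolding bar_degen_def by (rule lift_lin[OF bar_module degen_ml])

lemma degen_tg:
  assumes "chain L k (us @ a # b # vs)" "length (us @ a # b # vs) = Suc (Suc n)" "ccd a = Some T" "j = length us"
  shows "degen n L k j (tg n L k (us @ a # b # vs)) = tg (Suc n) L k (us @ a # cunit T # b # vs)"
proof -
  have j: "j \<le> n" using assms by simp
  have "pair_sum (map cdeg (us @ a # cunit T # b # vs)) = pair_sum (map cdeg (us @ a # b # vs))"
    using pair_sum_zero[of "map cdeg (us @ [a])" "map cdeg (b # vs)"] by (simp add: cunit_def)
  then show ?thesis
    unfolding bar_degen_def lift_tg[OF bar_module degen_ml[OF j] assms(1,2)]
    unfolding tg_def using degen_chain[OF assms(1-3)] by (simp add: assms(4) case_prod_unfold)
qed

subsection \<open>Simplicial identities\<close>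

text \<open>Two faces either overlap in three consecutive cells, where they agree by associativity,
  or act on disjoint pairs, where they commute on the nose.\<close>

lemma chain_split2:
  assumes "length zs = Suc (Suc n)" "j < i" "i \<le> n"
  obtains (adj) us a b c vs where "zs = us @ a # b # c # vs" "length us = j" "i = Suc j"
  | (sep) us a b ws c d vs where "zs = us @ a # b # ws @ c # d # vs" "length us = j" "i = Suc (Suc (j + length ws))"
proof -
  have "j \<le> n" using assms by simp
  from assms(1) this obtain us a b vs where s: "zs = us @ a # b # vs" and us: "length us = j"
    by (rule chain_split)
  show ?thesis
  proof (cases "i = Suc j")
    case True
    then obtain c vs' where c: "vs = c # vs'" using assms s us by (cases vs) auto
    show ?thesis by (rule adj) (use s us c True in simp_all)
  next
    case False
    define m where "m = i - Suc (Suc j)"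
    have m: "i = Suc (Suc (j + m))" using assms(2) False by (simp add: m_def)
    have n': "length vs = Suc (Suc (length vs - 2))" "m \<le> length vs - 2"
      using assms(1,3) m by (simp_all add: s us)
    from n' obtain ws c d vs' where w: "vs = ws @ c # d # vs'" "length ws = m" by (rule chain_split)
    show ?thesis by (rule sep) (use s us m w in auto)
  qed
qed

lemma face_closed: "i \<le> n \<Longrightarrow> n \<ge> 1 \<Longrightarrow> x \<in> carrier (Bar n L k) \<Longrightarrow> face n L k i x \<in> carrier (Bar (n - 1) L k)"
  by (rule lin_map_closed[OF face_lin])

lemma degen_closed: "j \<le> n \<Longrightarrow> x \<in> carrier (Bar n L k) \<Longrightarrow> degen n L k j x \<in> carrier (Bar (Suc n) L k)"
  by (rule lin_map_closed[OF degen_lin])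

lemma face_tg':
  assumes "chain L k zs" "zs = us @ a # b # vs" "length zs = Suc (Suc (Suc n))" "i = length us"
    "zs' = us @ cmul a b # vs"
  shows "face (Suc n) L k i (tg (Suc n) L k zs) = tg n L k zs'"
  using face_tg[of L k us a b vs "Suc n" i] assms by simp

lemma face_face:
  assumes n: "n \<ge> 1" and ij: "j < i" "i \<le> Suc n" and x: "x \<in> carrier (Bar (Suc n) L k)"
  shows "face n L k j (face (Suc n) L k i x) = face n L k (i - 1) (face (Suc n) L k j x)"
proof (rule bar_tg_ext[OF bar_module _ _ _ x])
  have l: "lin_map R (Bar (Suc n) L k) (Bar n L k) (face (Suc n) L k i')" if "i' \<le> Suc n" for i'
    using face_lin[OF that, of L k] by simp
  show "lin_map R (Bar (Suc n) L k) (Bar (n - 1) L k) (\<lambda>x. face n L k j (face (Suc n) L k i x))"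
    using ij n by (intro lin_map_compose[OF l face_lin]) auto
  show "lin_map R (Bar (Suc n) L k) (Bar (n - 1) L k) (\<lambda>x. face n L k (i - 1) (face (Suc n) L k j x))"
    using ij n by (intro lin_map_compose[OF l face_lin]) auto
  fix zs assume zs: "chain L k zs" "length zs = Suc (Suc (Suc n))"
  obtain m where m: "n = Suc m" using n by (cases n) auto
  note len = zs(2)[unfolded m]
  show "face n L k j (face (Suc n) L k i (tg (Suc n) L k zs)) = face n L k (i - 1) (face (Suc n) L k j (tg (Suc n) L k zs))"
    using zs(2) ij
  proof (cases rule: chain_split2)
    case (adj us a b c vs)
    have c1: "chain L k (us @ a # cmul b c # vs)"
      using chain_merge(1)[of L k "us @ [a]" b c vs] zs(1) by (simp add: adj(1))
    have c2: "chain L k (us @ cmul a b # c # vs)" using chain_merge(1) zs(1) unfolding adj(1) by blast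
    have l1: "length (us @ a # cmul b c # vs) = Suc (Suc (Suc m))" "length (us @ cmul a b # c # vs) = Suc (Suc (Suc m))"
      using len by (simp_all add: adj(1))
    have f1: "face (Suc n) L k i (tg (Suc n) L k zs) = tg n L k (us @ a # cmul b c # vs)"
      by (rule face_tg'[where us = "us @ [a]", OF zs(1) _ zs(2)]) (simp_all add: adj)
    have f2: "face (Suc n) L k j (tg (Suc n) L k zs) = tg n L k (us @ cmul a b # c # vs)"
      by (rule face_tg'[where us = us, OF zs(1) _ zs(2)]) (simp_all add: adj)
    have f3: "face n L k j (tg n L k (us @ a # cmul b c # vs)) = tg m L k (us @ cmul a (cmul b c) # vs)"
      unfolding m by (rule face_tg'[where us = us, OF c1 _ l1(1)]) (simp_all add: adj)
    have f4: "face n L k (i - 1) (tg n L k (us @ cmul a b # c # vs)) = tg m L k (us @ cmul (cmul a b) c # vs)"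
      unfolding m by (rule face_tg'[where us = us, OF c2 _ l1(2)]) (simp_all add: adj)
    have "cmul (cmul a b) c = cmul a (cmul b c)"
      using chain_merge(2-4)[of L k us a b "c # vs"] chain_merge(2-4)[of L k "us @ [a]" b c vs] zs(1)
      by (intro cmul_assoc) (simp_all add: adj(1))
    then show ?thesis by (simp only: f1 f2 f3 f4)
  next
    case (sep us a b ws c d vs)
    have c1: "chain L k (us @ a # b # ws @ cmul c d # vs)"
      using chain_merge(1)[of L k "us @ a # b # ws" c d vs] zs(1) by (simp add: sep(1))
    have c2: "chain L k (us @ cmul a b # ws @ c # d # vs)" using chain_merge(1) zs(1) unfolding sep(1) by blast
    have l1: "length (us @ a # b # ws @ cmul c d # vs) = Suc (Suc (Suc m))"
      "length (us @ cmul a b # ws @ c # d # vs) = Suc (Suc (Suc m))"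
      using len by (simp_all add: sep(1))
    have f1: "face (Suc n) L k i (tg (Suc n) L k zs) = tg n L k (us @ a # b # ws @ cmul c d # vs)"
      by (rule face_tg'[where us = "us @ a # b # ws", OF zs(1) _ zs(2)]) (simp_all add: sep)
    have f2: "face (Suc n) L k j (tg (Suc n) L k zs) = tg n L k (us @ cmul a b # ws @ c # d # vs)"
      by (rule face_tg'[where us = us, OF zs(1) _ zs(2)]) (simp_all add: sep)
    have f3: "face n L k j (tg n L k (us @ a # b # ws @ cmul c d # vs)) = tg m L k (us @ cmul a b # ws @ cmul c d # vs)"
      unfolding m by (rule face_tg'[where us = us, OF c1 _ l1(1)]) (simp_all add: sep)
    have f4: "face n L k (i - 1) (tg n L k (us @ cmul a b # ws @ c # d # vs)) = tg m L k (us @ cmul a b # ws @ cmul c d # vs)"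
      unfolding m by (rule face_tg'[where us = "us @ cmul a b # ws", OF c2 _ l1(2)]) (simp_all add: sep)
    show ?thesis by (simp only: f1 f2 f3 f4)
  qed
qed

section \<open>The differential squares to zero\<close>

lemma diff_eq: "diff n L k x = (\<Oplus>\<^bsub>Bar (n - 1) L k\<^esub>i\<in>{..n}.
     neg1_pow R (int i) \<odot>\<^bsub>Bar (n - 1) L k\<^esub> face n L k i x)"
  by (simp add: bar_diff_def atLeast0AtMost)

lemma diff_lin:
  assumes "n \<ge> 1"
  shows "lin_map R (Bar n L k) (Bar (n - 1) L k) (diff n L k)"
proof -
  have "lin_map R (Bar n L k) (Bar (n - 1) L k) (\<lambda>x. \<Oplus>\<^bsub>Bar (n - 1) L k\<^esub>i\<in>{..n}.
     neg1_pow R (int i) \<odot>\<^bsub>Bar (n - 1) L k\<^esub> face n L k i x)"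
    using assms by (intro lin_map_sum lin_map_scale bar_module face_lin neg1_closed) auto
  then show ?thesis unfolding diff_eq[abs_def] .
qed

lemma neg1_Suc: "neg1_pow R (int (Suc i)) = \<ominus>\<^bsub>R\<^esub> neg1_pow R (int i)"
  by (simp add: neg1_pow_def)

end

lemma (in abelian_monoid) finsum_remove2:
  assumes "finite A" "i \<in> A" "j \<in> A" "i \<noteq> j" "\<And>x. x \<in> A \<Longrightarrow> f x \<in> carrier G"
  shows "finsum G f A = f i \<oplus> (f j \<oplus> finsum G f (A - {i, j}))"
proof -
  have "finsum G f (insert i (insert j (A - {i, j}))) = f i \<oplus> finsum G f (insert j (A - {i, j}))"
    using assms by (intro finsum_insert) auto
  also have "finsum G f (insert j (A - {i, j})) = f j \<oplus> finsum G f (A - {i, j})"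
    using assms by (intro finsum_insert) auto
  also have "insert i (insert j (A - {i, j})) = A" using assms by blast
  finally show ?thesis .
qed

context bar_setting
begin

declare One_nat_def [simp del]

lemma diff_diff:
  assumes n: "n \<ge> 1" and x: "x \<in> carrier (Bar (Suc n) L k)"
  shows "diff n L k (diff (Suc n) L k x) = \<zero>\<^bsub>Bar (n - 1) L k\<^esub>"
proof -
  interpret B: module R "Bar (n - 1) L k" by (rule bar_module)
  interpret B': module R "Bar n L k" by (rule bar_module)
  let ?e = "\<lambda>i. neg1_pow R (int i)"
  have fc: "face (Suc n) L k i x \<in> carrier (Bar n L k)" if "i \<le> Suc n" for i
    using face_closed[OF that _ x] by simp
  have ffc: "face n L k j (face (Suc n) L k i x) \<in> carrier (Bar (n - 1) L k)" if "i \<le> Suc n" "j \<le> n" for i j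
    using face_closed[OF that(2) n fc[OF that(1)]] .
  \<comment> \<open>Zero outside the range, since \<open>finsum_antisymmetric_zero\<close> asks for
    entries in the carrier at all indices.\<close>
  define c where "c i j = (if i \<le> Suc n \<and> j \<le> n then
      ?e j \<odot>\<^bsub>Bar (n - 1) L k\<^esub> (?e i \<odot>\<^bsub>Bar (n - 1) L k\<^esub> face n L k j (face (Suc n) L k i x))
      else \<zero>\<^bsub>Bar (n - 1) L k\<^esub>)" for i j
  have cc: "c i j \<in> carrier (Bar (n - 1) L k)" for i j
    by (simp add: c_def ffc neg1_closed)
  have inner: "?e j \<odot>\<^bsub>Bar (n - 1) L k\<^esub> face n L k j (diff (Suc n) L k x) = (\<Oplus>\<^bsub>Bar (n - 1) L k\<^esub>i\<in>{..Suc n}. c i j)"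
    if j: "j \<le> n" for j
  proof -
    have "face n L k j (diff (Suc n) L k x)
       = (\<Oplus>\<^bsub>Bar (n - 1) L k\<^esub>i\<in>{..Suc n}. face n L k j (?e i \<odot>\<^bsub>Bar n L k\<^esub> face (Suc n) L k i x))"
      unfolding diff_eq diff_Suc_1
      by (rule lin_map_finsum[OF bar_module bar_module face_lin[OF j n]]) (simp add: fc neg1_closed)
    also have "\<dots> = (\<Oplus>\<^bsub>Bar (n - 1) L k\<^esub>i\<in>{..Suc n}. ?e i \<odot>\<^bsub>Bar (n - 1) L k\<^esub> face n L k j (face (Suc n) L k i x))"
      by (rule B.finsum_cong') (auto simp: fc ffc j neg1_closed lin_map_smult[OF face_lin[OF j n]])
    finally have 1: "face n L k j (diff (Suc n) L k x)
       = (\<Oplus>\<^bsub>Bar (n - 1) L k\<^esub>i\<in>{..Suc n}. ?e i \<odot>\<^bsub>Bar (n - 1) L k\<^esub> face n L k j (face (Suc n) L k i x))" .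
    have "?e j \<odot>\<^bsub>Bar (n - 1) L k\<^esub> face n L k j (diff (Suc n) L k x) = (\<Oplus>\<^bsub>Bar (n - 1) L k\<^esub>i\<in>{..Suc n}.
        ?e j \<odot>\<^bsub>Bar (n - 1) L k\<^esub> (?e i \<odot>\<^bsub>Bar (n - 1) L k\<^esub> face n L k j (face (Suc n) L k i x)))"
      unfolding 1 by (rule B.finsum_smult_ldistr) (auto simp: ffc j neg1_closed)
    also have "\<dots> = (\<Oplus>\<^bsub>Bar (n - 1) L k\<^esub>i\<in>{..Suc n}. c i j)"
    proof (rule B.finsum_cong'[OF HOL.refl])
      show "(\<lambda>i. c i j) \<in> {..Suc n} \<rightarrow> carrier (Bar (n - 1) L k)" using cc by blast
      fix i assume "i \<in> {..Suc n}"
      then have "i \<le> Suc n \<and> j \<le> n" using j by simp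
      then show "?e j \<odot>\<^bsub>Bar (n - 1) L k\<^esub> (?e i \<odot>\<^bsub>Bar (n - 1) L k\<^esub> face n L k j (face (Suc n) L k i x)) = c i j"
        unfolding c_def by (rule if_P[symmetric])
    qed
    finally show ?thesis .
  qed
  have "diff n L k (diff (Suc n) L k x) = (\<Oplus>\<^bsub>Bar (n - 1) L k\<^esub>j\<in>{..n}. \<Oplus>\<^bsub>Bar (n - 1) L k\<^esub>i\<in>{..Suc n}. c i j)"
    unfolding diff_eq[of n]
  proof (rule B.finsum_cong'[OF HOL.refl])
    show "(\<lambda>j. \<Oplus>\<^bsub>Bar (n - 1) L k\<^esub>i\<in>{..Suc n}. c i j) \<in> {..n} \<rightarrow> carrier (Bar (n - 1) L k)"
      using cc by (intro Pi_I B.finsum_closed) blast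
    show "?e j \<odot>\<^bsub>Bar (n - 1) L k\<^esub> face n L k j (diff (Suc n) L k x) = (\<Oplus>\<^bsub>Bar (n - 1) L k\<^esub>i\<in>{..Suc n}. c i j)"
      if "j \<in> {..n}" for j
      using that by (intro inner) simp
  qed
  also have "\<dots> = \<zero>\<^bsub>Bar (n - 1) L k\<^esub>"
  proof (rule B.finsum_antisymmetric_zero[OF cc])
    fix i j assume ij: "j < i" "i \<le> Suc n"
    obtain i' where i': "i = Suc i'" using ij by (cases i) auto
    show "c i j \<oplus>\<^bsub>Bar (n - 1) L k\<^esub> c j (i - 1) = \<zero>\<^bsub>Bar (n - 1) L k\<^esub>"
    proof -
      have F: "face n L k j (face (Suc n) L k i x) = face n L k i' (face (Suc n) L k j x)"
        using face_face[OF n ij x] by (simp add: i')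
      let ?F = "face n L k i' (face (Suc n) L k j x)"
      have Fc: "?F \<in> carrier (Bar (n - 1) L k)" using ij i' by (intro ffc) auto
      have "c i j = ?e j \<odot>\<^bsub>Bar (n - 1) L k\<^esub> (?e i \<odot>\<^bsub>Bar (n - 1) L k\<^esub> ?F)"
        unfolding c_def F by (rule if_P) (use ij in simp)
      also have "\<dots> = \<ominus>\<^bsub>Bar (n - 1) L k\<^esub> (?e j \<odot>\<^bsub>Bar (n - 1) L k\<^esub> (?e i' \<odot>\<^bsub>Bar (n - 1) L k\<^esub> ?F))"
        unfolding i' neg1_Suc B.smult_l_minus[OF neg1_closed Fc]
        by (rule B.smult_r_minus[OF neg1_closed B.smult_closed[OF neg1_closed Fc]])
      finally have 1: "c i j = \<ominus>\<^bsub>Bar (n - 1) L k\<^esub> (?e j \<odot>\<^bsub>Bar (n - 1) L k\<^esub> (?e i' \<odot>\<^bsub>Bar (n - 1) L k\<^esub> ?F))" .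
      have "c j (i - 1) = ?e i' \<odot>\<^bsub>Bar (n - 1) L k\<^esub> (?e j \<odot>\<^bsub>Bar (n - 1) L k\<^esub> ?F)"
        unfolding i' c_def diff_Suc_1 by (rule if_P) (use ij i' in simp)
      also have "\<dots> = ?e j \<odot>\<^bsub>Bar (n - 1) L k\<^esub> (?e i' \<odot>\<^bsub>Bar (n - 1) L k\<^esub> ?F)"
        unfolding B.smult_assoc1[OF neg1_closed neg1_closed Fc, symmetric]
        by (simp only: R.m_comm[OF neg1_closed neg1_closed])
      finally have 2: "c j (i - 1) = ?e j \<odot>\<^bsub>Bar (n - 1) L k\<^esub> (?e i' \<odot>\<^bsub>Bar (n - 1) L k\<^esub> ?F)" .
      show ?thesis
        unfolding 1 2 by (rule B.l_neg[OF B.smult_closed[OF neg1_closed B.smult_closed[OF neg1_closed Fc]]])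
    qed
  qed
  finally show ?thesis .
qed

text \<open>The two faces of a chain of three cells have the same augmentation, because both compute
  the full product of the chain.\<close>

lemma aug_diff:
  assumes L: "L \<in> MOb MC" and x: "x \<in> carrier (Bar 1 L k)"
  shows "aug L k (diff 1 L k x) = \<zero>\<^bsub>Mm N L k\<^esub>"
proof -
  interpret B: module R "Bar 0 L k" by (rule bar_module)
  interpret M: module R "Mm N L k" using L by (rule Mm_module)
  have fl: "lin_map R (Bar 1 L k) (Bar 0 L k) (face 1 L k i)" if "i \<le> 1" for i
    using face_lin[OF that, of L k] by simp
  have eq: "aug L k (face 1 L k 1 x) = aug L k (face 1 L k 0 x)"
  proof (rule bar_tg_ext[OF M.module_axioms _ _ _ x])
    show "lin_map R (Bar 1 L k) (Mm N L k) (\<lambda>x. aug L k (face 1 L k 1 x))"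
      "lin_map R (Bar 1 L k) (Mm N L k) (\<lambda>x. aug L k (face 1 L k 0 x))"
      by (rule lin_map_compose[OF fl aug_lin[OF L]]; simp)+
    fix zs assume zs: "chain L k zs" "length zs = Suc (Suc 1)"
    then obtain a b c where s: "zs = [a, b, c]" unfolding One_nat_def by (auto simp: length_Suc_conv)
    note Z = zs[unfolded s]
    have f1: "face 1 L k 1 (tg 1 L k zs) = tg 0 L k [a, cmul b c]"
      unfolding One_nat_def by (rule face_tg'[where us = "[a]", OF zs(1) _ zs(2)[unfolded One_nat_def]]) (simp_all add: s)
    have f0: "face 1 L k 0 (tg 1 L k zs) = tg 0 L k [cmul a b, c]"
      unfolding One_nat_def by (rule face_tg'[where us = "[]", OF zs(1) _ zs(2)[unfolded One_nat_def]]) (simp_all add: s)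
    have c1: "chain L k [a, cmul b c]" using chain_merge(1)[of L k "[a]" b c "[]"] Z by simp
    have c0: "chain L k [cmul a b, c]" using chain_merge(1)[of L k "[]" a b "[c]"] Z by simp
    have "cmul (cmul a b) c = cmul a (cmul b c)"
      using chain_merge(2-4)[of L k "[]" a b "[c]"] chain_merge(2-4)[of L k "[a]" b c "[]"] Z
      by (intro cmul_assoc) auto
    then show "aug L k (face 1 L k 1 (tg 1 L k zs)) = aug L k (face 1 L k 0 (tg 1 L k zs))"
      by (simp only: f1 f0 aug_tg[OF L c1] aug_tg[OF L c0])
  qed
  have c: "face 1 L k 0 x \<in> carrier (Bar 0 L k)" "face 1 L k 1 x \<in> carrier (Bar 0 L k)"
    using lin_map_closed[OF fl x] by simp_all
  have "diff 1 L k x = (neg1_pow R 1 \<odot>\<^bsub>Bar 0 L k\<^esub> face 1 L k 1 x) \<oplus>\<^bsub>Bar 0 L k\<^esub> (neg1_pow R 0 \<odot>\<^bsub>Bar 0 L k\<^esub> face 1 L k 0 x)"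
  proof -
    have P: "(\<lambda>i. neg1_pow R (int i) \<odot>\<^bsub>Bar 0 L k\<^esub> face 1 L k i x) \<in> {..Suc 0} \<rightarrow> carrier (Bar 0 L k)"
      using lin_map_closed[OF fl x] neg1_closed by (auto simp: One_nat_def)
    show ?thesis using B.finsum_Suc[OF P] c neg1_closed by (simp add: diff_eq One_nat_def)
  qed
  also have "\<dots> = \<ominus>\<^bsub>Bar 0 L k\<^esub> face 1 L k 1 x \<oplus>\<^bsub>Bar 0 L k\<^esub> face 1 L k 0 x"
    using c by (simp add: neg1_pow_def B.smult_l_minus)
  finally show ?thesis using c lin_map_closed[OF aug_lin[OF L]]
    by (simp add: lin_map_add[OF aug_lin[OF L]] lin_map_uminus[OF bar_module M.module_axioms aug_lin[OF L]] eq M.l_neg)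
qed

subsection \<open>The degenerate part\<close>

abbreviation "degs \<equiv> degenerate R OC MC Q N"

lemma degs_gens_subset: "(\<Union>j<n. degen (n - 1) L k j ` carrier (Bar (n - 1) L k)) \<subseteq> carrier (Bar n L k)"
  using degen_closed[of _ "n - 1" _ L k] by (cases n) auto

lemma degs_submodule: "submodule (degs n L k) R (Bar n L k)"
  unfolding degenerate_def by (rule submod_span_submodule[OF bar_module degs_gens_subset])

lemma degen_in_degs: "j \<le> n \<Longrightarrow> x \<in> carrier (Bar n L k) \<Longrightarrow> degen n L k j x \<in> degs (Suc n) L k"
  unfolding degenerate_def by (rule subsetD[OF submod_span_superset]) auto

lemma degs_image:
  assumes T: "module R T" and f: "lin_map R (Bar n L k) T f" and K: "submodule K R T"
    and "\<And>j x. j < n \<Longrightarrow> x \<in> carrier (Bar (n - 1) L k) \<Longrightarrow> f (degen (n - 1) L k j x) \<in> K"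
    and x: "x \<in> degs n L k"
  shows "f x \<in> K"
proof -
  have "f ` degs n L k \<subseteq> K"
    unfolding degenerate_def
    by (rule lin_map_span_subset[OF bar_module T f K degs_gens_subset]) (use assms(4) in auto)
  then show ?thesis using x by blast
qed

text \<open>Degeneracies are linear, so only chains with one unit inserted have to be
  examined.\<close>

lemma degs_tg_image:
  assumes T: "module R T" and f: "lin_map R (Bar n L k) T f" and K: "submodule K R T"
    and "\<And>us a b vs t. chain L k (us @ a # b # vs) \<Longrightarrow> Suc (length (us @ a # b # vs)) = Suc (Suc n)
      \<Longrightarrow> ccd a = Some t \<Longrightarrow> f (tg n L k (us @ a # cunit t # b # vs)) \<in> K"
    and x: "x \<in> degs n L k"
  shows "f x \<in> K"
proof (rule degs_image[OF T f K _ x])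
  fix j y assume j: "j < n" and y: "y \<in> carrier (Bar (n - 1) L k)"
  obtain n' where n': "n = Suc n'" using j by (cases n) auto
  have l: "lin_map R (Bar (n - 1) L k) T (\<lambda>y. f (degen (n - 1) L k j y))"
    using lin_map_compose[OF degen_lin[of j n' L k] f[unfolded n']] j n' by simp
  have "y \<in> {y \<in> carrier (Bar (n - 1) L k). f (degen (n - 1) L k j y) \<in> K}"
  proof (rule bar_generated[OF submodule_preimage[OF bar_module T l K] _ y])
    fix \<iota> t assume "\<iota> \<in> BI (n - 1) L k" "t \<in> tuples (facs \<iota>) (endm \<iota>)"
    then have "\<iota> \<in> BI n' L k" "t \<in> tuples (facs \<iota>) (endm \<iota>)" by (simp_all add: n')
    then obtain zs where zs: "chain L k zs" "length zs = Suc (Suc n')" "cidx zs = \<iota>" "ctup zs = t"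
      by (rule chain_cover)
    have "j \<le> n'" using j n' by simp
    from zs(2) this obtain us a b vs where s: "zs = us @ a # b # vs" and us: "length us = j"
      by (rule chain_split)
    note Z = zs(1,2)[unfolded s]
    obtain t' where t': "ccd a = Some t'" by (rule chain_ccd[OF Z(1)])
    have "f (degen n' L k j (tg n' L k zs)) \<in> K"
      unfolding s degen_tg[OF Z t' us[symmetric]] using assms(4)[OF Z(1) _ t'] Z(2) n' by simp
    moreover have "tg n' L k zs \<in> carrier (Bar n' L k)" by (rule tg_closed[OF zs(1,2)])
    ultimately have "f (degen n' L k j (gen n' L k \<iota> t)) \<in> K"
      using gen_tg[OF zs(1,2)] lin_map_smult[OF l] module.submoduleE(4)[OF T K] neg1_closed n' zs(3,4) by simp
    then show "gen (n - 1) L k \<iota> t \<in> {y \<in> carrier (Bar (n - 1) L k). f (degen (n - 1) L k j y) \<in> K}"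
      using gen_chain_closed[OF zs(1,2)] zs(3,4) n' by simp
  qed
  then show "f (degen (n - 1) L k j y) \<in> K" by simp
qed

lemma tg_unit_in_degs:
  assumes "chain L k (us @ a # b # vs)" "length (us @ a # b # vs) = Suc (Suc n)" "ccd a = Some t"
  shows "tg (Suc n) L k (us @ a # cunit t # b # vs) \<in> degs (Suc n) L k"
  unfolding degen_tg[OF assms HOL.refl, symmetric]
  using assms by (intro degen_in_degs tg_closed) auto

text \<open>The two faces next to the inserted unit give the same chain with opposite signs and
  cancel; every other face leaves a unit in the chain.\<close>

lemma diff_degs:
  assumes n: "n \<ge> 1" and x: "x \<in> degs n L k"
  shows "diff n L k x \<in> degs (n - 1) L k"
proof (rule degs_tg_image[OF bar_module diff_lin[OF n] degs_submodule _ x])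
  interpret B: module R "Bar (n - 1) L k" by (rule bar_module)
  fix us a b vs t
  assume Z: "chain L k (us @ a # b # vs)" "Suc (length (us @ a # b # vs)) = Suc (Suc n)" and t: "ccd a = Some t"
  let ?zs = "us @ a # cunit t # b # vs" and ?j = "length us"
  note c = chain_insert_unit[OF Z(1) t]
  have len: "length ?zs = Suc (Suc n)" using Z(2) by simp
  have j: "?j < n" using Z(2) by simp
  have ab: "cok a" "cok b" "cdm b = Some t" using chain_merge(2-4)[OF Z(1)] t by (auto simp: clink_def)
  let ?F = "\<lambda>i. neg1_pow R (int i) \<odot>\<^bsub>Bar (n - 1) L k\<^esub> face n L k i (tg n L k ?zs)"
  have Fc: "?F i \<in> carrier (Bar (n - 1) L k)" if "i \<le> n" for i
    using face_closed[OF that n tg_closed[OF c len]] by (simp add: neg1_closed)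
  have f1: "face n L k ?j (tg n L k ?zs) = tg (n - 1) L k (us @ a # b # vs)"
    using face_tg[OF c len n HOL.refl] cmul_unit_right[OF ab(1) t] by simp
  have f2: "face n L k (Suc ?j) (tg n L k ?zs) = tg (n - 1) L k (us @ a # b # vs)"
    using face_tg[of L k "us @ [a]" "cunit t" b vs n "Suc ?j"] c len n cmul_unit_left[OF ab(2,3)] by simp
  have D: "?F i \<in> degs (n - 1) L k" if i: "i \<le> n" "i \<noteq> ?j" "i \<noteq> Suc ?j" for i
  proof -
    obtain n' where n': "n = Suc (Suc n')"
    proof (cases "n = 1")
      case True
      then show ?thesis using i j by (auto simp: le_Suc_eq)
    next
      case False
      then have "n = Suc (Suc (n - 2))" using n by simp
      then show ?thesis by (rule that)
    qed
    have "face n L k i (tg n L k ?zs) \<in> degs (Suc n') L k"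
    proof (cases "i < ?j")
      case True
      then have "us = take i us @ us ! i # drop (Suc i) us" "length (take i us) = i"
        by (simp_all add: id_take_nth_drop[symmetric])
      then obtain us1 c1 us2 where us: "us = us1 @ c1 # us2" "length us1 = i" by blast
      show ?thesis
      proof (cases us2)
        \<comment> \<open>The merged pair ends in \<open>a\<close>, the cell before the unit. The
          product ends at the same vertex \<open>t\<close>, so the unit now follows
          \<open>cmul c1 a\<close>.\<close>
        case Nil
        have ca: "cok c1" "cok a" "clink c1 a" and c': "chain L k (us1 @ cmul c1 a # b # vs)"
          using chain_merge[of L k us1 c1 a "b # vs"] Z us Nil by simp_all
        have "ccd (cmul c1 a) = Some t" using cmul_ok(3)[OF ca] t by simp
        from tg_unit_in_degs[OF c' _ this, of n']
        have "tg (Suc n') L k (us1 @ cmul c1 a # cunit t # b # vs) \<in> degs (Suc n') L k"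
          using Z us Nil n' by simp
        moreover have "face n L k i (tg n L k ?zs) = tg (Suc n') L k (us1 @ cmul c1 a # cunit t # b # vs)"
          unfolding n' by (rule face_tg'[where us = us1, OF c _ len[unfolded n']]) (simp_all add: us Nil)
        ultimately show ?thesis by (simp only:)
      next
        case (Cons c2 us3)
        have c': "chain L k ((us1 @ cmul c1 c2 # us3) @ a # b # vs)"
          using chain_merge(1)[of L k us1 c1 c2 "us3 @ a # b # vs"] Z us Cons by simp
        from tg_unit_in_degs[OF c' _ t, of n']
        have "tg (Suc n') L k (us1 @ cmul c1 c2 # us3 @ a # cunit t # b # vs) \<in> degs (Suc n') L k"
          using Z us Cons n' by simp
        moreover have "face n L k i (tg n L k ?zs) = tg (Suc n') L k (us1 @ cmul c1 c2 # us3 @ a # cunit t # b # vs)"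
          unfolding n' by (rule face_tg'[where us = us1, OF c _ len[unfolded n']]) (simp_all add: us Cons)
        ultimately show ?thesis by (simp only:)
      qed
    next
      case False
      then have "i \<ge> Suc (Suc ?j)" using i by simp
      define m where "m = i - Suc (Suc ?j)"
      have m: "i = Suc (Suc (?j + m))" using \<open>i \<ge> Suc (Suc ?j)\<close> by (simp add: m_def)
      have n2: "length (b # vs) = Suc (Suc (length vs - 1))" "m \<le> length vs - 1"
        using Z(2) m i(1) by auto
      obtain ws c1 c2 vs' where s: "b # vs = ws @ c1 # c2 # vs'" and ws: "length ws = m"
        by (rule chain_split[OF n2])
      have c12: "cok c1" "cok c2" "clink c1 c2" and c': "chain L k (us @ a # ws @ cmul c1 c2 # vs')"
        using chain_merge[of L k "us @ a # ws" c1 c2 vs'] Z s by simp_all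
      \<comment> \<open>The cell after the unit is the old one or, if \<open>ws\<close> is empty,
        the product of the merged pair.\<close>
      obtain b' vs2 where b': "ws @ cmul c1 c2 # vs' = b' # vs2" by (cases ws) auto
      have "tg (Suc n') L k (us @ a # cunit t # b' # vs2) \<in> degs (Suc n') L k"
      proof (rule tg_unit_in_degs[OF _ _ t])
        show "chain L k (us @ a # b' # vs2)" using c' by (simp add: b')
        have "length (ws @ cmul c1 c2 # vs') = length vs" using arg_cong[OF s, of length] by simp
        then show "length (us @ a # b' # vs2) = Suc (Suc n')" using Z(2) n' unfolding b' by simp
      qed
      moreover have "face n L k i (tg n L k ?zs) = tg (Suc n') L k (us @ a # cunit t # b' # vs2)"
        unfolding n' by (rule face_tg'[where us = "us @ a # cunit t # ws", OF c _ len[unfolded n']])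
          (simp_all add: s m ws flip: b')
      ultimately show ?thesis by (simp only:)
    qed
    then show ?thesis using module.submoduleE(4)[OF bar_module degs_submodule neg1_closed] by (simp add: n')
  qed
  have "diff n L k (tg n L k ?zs) = ?F ?j \<oplus>\<^bsub>Bar (n - 1) L k\<^esub> (?F (Suc ?j)
      \<oplus>\<^bsub>Bar (n - 1) L k\<^esub> (\<Oplus>\<^bsub>Bar (n - 1) L k\<^esub>i\<in>{..n} - {?j, Suc ?j}. ?F i))"
    unfolding diff_eq by (rule B.finsum_remove2) (use j Fc in auto)
  also have "\<dots> = (\<Oplus>\<^bsub>Bar (n - 1) L k\<^esub>i\<in>{..n} - {?j, Suc ?j}. ?F i)"
  proof -
    have s: "(\<Oplus>\<^bsub>Bar (n - 1) L k\<^esub>i\<in>{..n} - {?j, Suc ?j}. ?F i) \<in> carrier (Bar (n - 1) L k)"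
      using Fc by (intro B.finsum_closed) auto
    have y: "tg (n - 1) L k (us @ a # b # vs) \<in> carrier (Bar (n - 1) L k)"
      using Z n by (intro tg_closed) auto
    have "?F (Suc ?j) = \<ominus>\<^bsub>Bar (n - 1) L k\<^esub> ?F ?j"
      unfolding f1 f2 neg1_Suc by (rule B.smult_l_minus[OF neg1_closed y])
    then show ?thesis using s Fc[of ?j] j B.add.r_inv by (simp add: B.r_neg flip: B.a_assoc)
  qed
  also have "\<dots> \<in> degs (n - 1) L k"
    by (rule submodule_finsum[OF bar_module degs_submodule]) (use D in auto)
  finally show "diff n L k (tg n L k ?zs) \<in> degs (n - 1) L k" .
qed

end

section \<open>The contraction\<close>

context bar_setting
begin

text \<open>The composite arrow from the source object to the first vertex of a tail of a chain; a
  leading \<open>CT\<close> is passed over. The contraction needs it to find the morphism from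
  \<open>T_0\<close> to the terminal object.\<close>

fun ccomp :: "('o, 'a, 'q, 'l, 'p, 'm) cell list \<Rightarrow> 'q" where
  "ccomp (CF f k x # zs) = Act MC f (ccomp zs)"
| "ccomp (CA \<alpha> k m # zs) = \<alpha>"
| "ccomp (CT T k x # zs) = ccomp zs"
| "ccomp zs = undefined"

lemma ccomp_append_cong: "ccomp ws = ccomp ws' \<Longrightarrow> ws \<noteq> [] \<Longrightarrow> ws' \<noteq> [] \<Longrightarrow> ccomp (us @ ws) = ccomp (us @ ws')"
proof (induction us)
  case (Cons z us)
  then show ?case by (cases z) simp_all
qed simp

lemma ccomp_tail:
  assumes "zs \<noteq> []" "\<forall>z\<in>set zs. cok z" "successively clink zs" "ccd (last zs) = None" "csrc (last zs) = L"
    "cdm (hd zs) = Some T"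
  shows "ccomp zs \<in> MArr MC \<and> Src MC (ccomp zs) = L \<and> Tgt MC (ccomp zs) = T"
  using assms
proof (induction zs arbitrary: T)
  case (Cons z zs)
  show ?case
  proof (cases zs)
    case Nil
    then show ?thesis using Cons.prems by (cases z) auto
  next
    case (Cons z' zs')
    note z' = Cons
    have l: "clink z z'" using Cons.prems z' by simp
    then obtain f k x where z: "z = CF f k x" using Cons.prems z' by (cases z) (auto simp: clink_def)
    have "cdm (hd zs) = Some (Dom OC f)" using l by (auto simp: clink_def z z')
    then have "ccomp zs \<in> MArr MC \<and> Src MC (ccomp zs) = L \<and> Tgt MC (ccomp zs) = Dom OC f"
      using Cons.prems z' by (intro Cons.IH) auto
    moreover have "f \<in> Mor OC" "Cod OC f = T" using Cons.prems z by auto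
    ultimately show ?thesis by (simp add: z facts)
  qed
qed simp

lemma chain_tail:
  assumes "chain L k (us @ a # b # vs)" "ccd a = Some T"
  shows "ccomp (b # vs) \<in> MArr MC" "Src MC (ccomp (b # vs)) = L" "Tgt MC (ccomp (b # vs)) = T"
proof -
  have "clink a b" by (rule chain_merge(4)[OF assms(1)])
  then have "cdm b = Some T" using assms(2) by (simp add: clink_def)
  then have "ccomp (b # vs) \<in> MArr MC \<and> Src MC (ccomp (b # vs)) = L \<and> Tgt MC (ccomp (b # vs)) = T"
    using assms(1) by (intro ccomp_tail) (auto simp: chain_def successively_append_iff)
  then show "ccomp (b # vs) \<in> MArr MC" "Src MC (ccomp (b # vs)) = L" "Tgt MC (ccomp (b # vs)) = T" by auto
qed

text \<open>Merging keeps the composite unless the pair begins with \<open>CT\<close>: there the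
  first vertex moves from \<open>T_0\<close> to \<open>T_1\<close>, which is why \<open>us\<close>
  has to be nonempty.\<close>

lemma ccomp_merge:
  assumes "chain L k (us @ a # b # vs)" "us \<noteq> []"
  shows "ccomp (cmul a b # vs) = ccomp (a # b # vs)"
proof -
  obtain f i x where a: "a = CF f i x" using chain_cells[OF assms(1)] assms(2) by blast
  note ok = chain_merge(2-4)[OF assms(1)]
  show ?thesis
  proof (cases b)
    case b: (CF g j y)
    obtain v vs' where v: "vs = v # vs'" using chain_cells[OF assms(1)] b by (cases vs) auto
    have "chain L k ((us @ [a]) @ b # v # vs')" using assms(1) v by simp
    from chain_tail[OF this, of "Dom OC g"] have "ccomp vs \<in> MArr MC" "Tgt MC (ccomp vs) = Dom OC g"
      by (simp_all add: b v)
    then show ?thesis using ok by (simp add: a b clink_def Act_Cmp)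
  qed (use a ok in \<open>auto simp: clink_def\<close>)
qed

text \<open>The homotopy \<open>hbar\<close> is defined on indices, where the composite appears as a
  \<open>foldr\<close> over the tower.\<close>

lemma ccomp_foldr:
  assumes "chain L k zs" "length zs = Suc (Suc n)"
  shows "ccomp (tl zs) = foldr (Act MC) (cfs zs) (cq (last zs))"
proof -
  obtain T i x ps \<alpha> j m where "zs = CT T i x # map (\<lambda>(f, i, x). CF f i x) ps @ [CA \<alpha> j m]" "length ps = n"
    by (rule chain_shape[OF assms])
  moreover have "ccomp (map (\<lambda>(f, i, x). CF f i x) ps @ [CA \<alpha> j m]) = foldr (Act MC) (map fst ps) \<alpha>"
    by (induction ps) auto
  moreover have "map carr (map (\<lambda>(f, i, x). CF f i x :: ('o, 'a, 'q, 'l, 'p, 'm) cell) ps) = map fst ps"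
    by (auto split: prod.splits)
  ultimately show ?thesis by (simp add: cfs_def butlast_append del: map_map)
qed

end

text \<open>(P2) speaks about the slice of \<open>OC\<close> only; \<open>fixb\<close> is its
  counterpart for the arrows of the module and is arranged in
  \<open>normalized_terminal_arrow\<close>.\<close>

locale bar_contraction = bar_setting R OC MC Q N
  for R :: "('r, 's) ring_scheme" and OC :: "('o, 'a) opcat"
    and MC :: "('o, 'a, 'l, 'q) opmod" and Q :: "('r, 'o, 'a, 'p) operad"
    and N :: "('r, 'l, 'q, 'p, 'm) pmodule" +
  fixes Y :: 'l and b :: 'q
  assumes trm: "terminal_arrow OC MC Y b" and fib: "MFib MC b = Y"
    and dff: "domain_fiber_functor OC (Tgt MC b)"
    and fixb: "\<And>\<alpha> g. \<lbrakk>\<alpha> \<in> MArr MC; Src MC \<alpha> = Y; g \<in> Mor OC; Dom OC g = Tgt MC \<alpha>; Cod OC g = Tgt MC b;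
        Act MC g \<alpha> = b\<rbrakk> \<Longrightarrow> MFibM MC \<alpha> g = \<alpha>"
begin

abbreviation "S0 \<equiv> Tgt MC b"

lemma b_arr: "b \<in> MArr MC" "Src MC b = Y"
  using trm by (auto simp: terminal_arrow_def)

lemma Y_ob: "Y \<in> MOb MC"
  using b_arr Src_closed by blast

lemma S0_ob: "S0 \<in> Ob OC"
  using b_arr by (simp add: Tgt_closed)

definition gof :: "'q \<Rightarrow> 'a" where
  "gof \<alpha> = (THE g. g \<in> Mor OC \<and> Dom OC g = Tgt MC \<alpha> \<and> Cod OC g = S0 \<and> Act MC g \<alpha> = b)"

lemma gof:
  assumes "\<alpha> \<in> MArr MC" "Src MC \<alpha> = Y"
  shows "gof \<alpha> \<in> Mor OC" "Dom OC (gof \<alpha>) = Tgt MC \<alpha>" "Cod OC (gof \<alpha>) = S0" "Act MC (gof \<alpha>) \<alpha> = b"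
proof -
  have "\<exists>!g. g \<in> Mor OC \<and> Dom OC g = Tgt MC \<alpha> \<and> Cod OC g = S0 \<and> Act MC g \<alpha> = b"
    using trm assms by (simp add: terminal_arrow_def)
  from theI'[OF this] show "gof \<alpha> \<in> Mor OC" "Dom OC (gof \<alpha>) = Tgt MC \<alpha>" "Cod OC (gof \<alpha>) = S0"
    "Act MC (gof \<alpha>) \<alpha> = b" unfolding gof_def by blast+
qed

lemma gof_unique:
  assumes "\<alpha> \<in> MArr MC" "Src MC \<alpha> = Y" "g \<in> Mor OC" "Dom OC g = Tgt MC \<alpha>" "Cod OC g = S0" "Act MC g \<alpha> = b"
  shows "gof \<alpha> = g"
proof -
  have "\<exists>!g. g \<in> Mor OC \<and> Dom OC g = Tgt MC \<alpha> \<and> Cod OC g = S0 \<and> Act MC g \<alpha> = b"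
    using trm assms by (simp add: terminal_arrow_def)
  then show ?thesis unfolding gof_def by (rule the1_equality) (use assms in blast)
qed

lemma fib_S0: "g \<in> Mor OC \<Longrightarrow> Cod OC g = S0 \<Longrightarrow> Fib OC g = Dom OC g"
  "g \<in> Mor OC \<Longrightarrow> Cod OC g = S0 \<Longrightarrow> f \<in> Mor OC \<Longrightarrow> Cod OC f = Dom OC g \<Longrightarrow> FibM OC f g = f"
  using dff by (simp_all add: domain_fiber_functor_def)

lemma unt_S0: "unt Q S0 \<in> carrier (Pm Q S0 0)"
  using unt_closed[OF S0_ob] fib_S0(1)[of "Idn OC S0"] S0_ob by (simp add: Ufib_def facts)

text \<open>The old \<open>t_0\<close> is reread as an entry over the morphism from
  \<open>T_0\<close> to \<open>S0\<close>, whose fiber is \<open>T_0\<close> by (P2). The unit in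
  front is an element over \<open>S0\<close> because (P2) also gives
  \<open>Ufib OC S0 = S0\<close>.\<close>

definition hch :: "('o, 'a, 'q, 'l, 'p, 'm) cell list \<Rightarrow> ('o, 'a, 'q, 'l, 'p, 'm) cell list" where
  "hch zs = CT S0 0 (unt Q S0) # CF (gof (ccomp (tl zs))) (cdeg (hd zs)) (cval (hd zs)) # tl zs"

lemma chain_head:
  assumes "chain L k zs" "length zs = Suc (Suc n)"
  obtains T i x z ws where "zs = CT T i x # z # ws" "length ws = n"
proof -
  have "0 \<le> n" by simp
  with assms(2) obtain us a z ws where s: "zs = us @ a # z # ws" and us: "length us = 0"
    by (rule chain_split)
  obtain T i x where "a = CT T i x" using chain_cells(1)[OF assms(1)[unfolded s]] us by auto
  then show ?thesis using that[of T i x z ws] s us assms(2) by simp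
qed

lemma head_comp:
  assumes "chain Y k (CT T i x # z # ws)"
  shows "ccomp (z # ws) \<in> MArr MC" "Src MC (ccomp (z # ws)) = Y" "Tgt MC (ccomp (z # ws)) = T"
  using chain_tail[of Y k "[]" "CT T i x" z ws T] assms by simp_all

lemma hch_chain:
  assumes "chain Y k zs" "length zs = Suc (Suc n)"
  shows "chain Y k (hch zs)" "length (hch zs) = Suc (Suc (Suc n))"
proof -
  obtain T i x z ws where s: "zs = CT T i x # z # ws" "length ws = n" by (rule chain_head[OF assms])
  note Z = assms(1)[unfolded s(1)]
  note g = gof[OF head_comp(1,2)[OF Z]]
  show "length (hch zs) = Suc (Suc (Suc n))" by (simp add: hch_def s)
  have "T \<in> Ob OC" "x \<in> carrier (Pm Q T i)" "cdm z = Some T"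
    using Z by (auto simp: chain_def clink_def)
  then show "chain Y k (hch zs)"
    using Z g S0_ob unt_S0 head_comp(3)[OF Z] fib_S0(1)[OF g(1,3)]
    by (auto simp: chain_def hch_def s clink_def)
qed

definition hbar :: "nat \<Rightarrow> int \<Rightarrow> ('r, 'a, 'q, 'p, 'm) bar_elt \<Rightarrow> ('r, 'a, 'q, 'p, 'm) bar_elt" where
  "hbar n k = lift n Y k (Bar (Suc n) Y k) (\<lambda>((fs, \<alpha>), ks, l) (xs, m).
     gen (Suc n) Y k ((gof (foldr (Act MC) fs \<alpha>) # fs, \<alpha>), 0 # ks, l) (unt Q S0 # xs, m))"

lemma hch_decode:
  assumes "chain Y k zs" "length zs = Suc (Suc n)"
  shows "cidx (hch zs) = (case cidx zs of ((fs, \<alpha>), ks, l) \<Rightarrow> ((gof (foldr (Act MC) fs \<alpha>) # fs, \<alpha>), 0 # ks, l))"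
    "ctup (hch zs) = (case ctup zs of (xs, m) \<Rightarrow> (unt Q S0 # xs, m))"
    "pair_sum (map cdeg (hch zs)) = pair_sum (map cdeg zs)"
proof -
  obtain T i x z ws where s: "zs = CT T i x # z # ws" "length ws = n" by (rule chain_head[OF assms])
  show "cidx (hch zs) = (case cidx zs of ((fs, \<alpha>), ks, l) \<Rightarrow> ((gof (foldr (Act MC) fs \<alpha>) # fs, \<alpha>), 0 # ks, l))"
    using ccomp_foldr[OF assms] by (simp add: cidx_def s hch_def cfs_def)
  show "ctup (hch zs) = (case ctup zs of (xs, m) \<Rightarrow> (unt Q S0 # xs, m))"
    by (simp add: ctup_def s hch_def)
  show "pair_sum (map cdeg (hch zs)) = pair_sum (map cdeg zs)" by (simp add: s hch_def)
qed

lemma hbar_ml: "bar_ml n Y k (Bar (Suc n) Y k) (\<lambda>((fs, \<alpha>), ks, l) (xs, m).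
     gen (Suc n) Y k ((gof (foldr (Act MC) fs \<alpha>) # fs, \<alpha>), 0 # ks, l) (unt Q S0 # xs, m))"
proof (rule bar_mlI)
  fix zs assume zs: "chain Y k zs" "length zs = Suc (Suc n)"
  obtain T i x z ws where s: "zs = CT T i x # z # ws" "length ws = n" by (rule chain_head[OF zs])
  note Z = zs(1)[unfolded s(1)]
  note h = hch_chain[OF zs]
  note g = gof[OF head_comp(1,2)[OF Z]]
  have F: "Fib OC (gof (ccomp (z # ws))) = T"
    using fib_S0(1)[OF g(1,3)] g(2) head_comp(3)[OF Z] by simp
  have M: "map cmod (butlast (hch zs)) = [] @ Pm Q S0 0 # map cmod (butlast zs)" "last (hch zs) = last zs"
    using F by (simp_all add: hch_def s)
  have "multilin R ([] @ map cmod (butlast zs)) (cend (last zs)) (Bar (Suc n) Y k)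
     (\<lambda>(xs, m). gen (Suc n) Y k (cidx (hch zs)) (take 0 xs @ unt Q S0 # drop 0 xs, m))"
    using gen_chain_ml[OF h] unt_S0 unfolding M by (intro multilin_insert) simp_all
  then show "multilin R (map cmod (butlast zs)) (cend (last zs)) (Bar (Suc n) Y k)
    ((\<lambda>((fs, \<alpha>), ks, l) (xs, m).
     gen (Suc n) Y k ((gof (foldr (Act MC) fs \<alpha>) # fs, \<alpha>), 0 # ks, l) (unt Q S0 # xs, m)) (cidx zs))"
    unfolding hch_decode[OF zs] by (simp add: case_prod_unfold)
qed

lemma hbar_lin: "lin_map R (Bar n Y k) (Bar (Suc n) Y k) (hbar n k)"
  unfolding hbar_def by (rule lift_lin[OF bar_module hbar_ml])

lemma hbar_tg:
  assumes "chain Y k zs" "length zs = Suc (Suc n)"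
  shows "hbar n k (tg n Y k zs) = tg (Suc n) Y k (hch zs)"
  unfolding hbar_def lift_tg[OF bar_module hbar_ml assms]
  unfolding tg_def hch_decode[OF assms] by (simp add: case_prod_unfold)

definition haug :: "int \<Rightarrow> 'm \<Rightarrow> ('r, 'a, 'q, 'p, 'm) bar_elt" where
  "haug k m = tg 0 Y k [CT S0 0 (unt Q S0), CA b k m]"

lemma haug_chain: "m \<in> carrier (Mm N Y k) \<Longrightarrow> chain Y k [CT S0 0 (unt Q S0), CA b k m]"
  using S0_ob unt_S0 b_arr fib by (simp add: chain_def clink_def)

lemma haug_lin: "lin_map R (Mm N Y k) (Bar 0 Y k) (haug k)"
proof -
  interpret M: module R "Mm N Y k" by (rule Mm_module[OF Y_ob])
  interpret B: module R "Bar 0 Y k" by (rule bar_module)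
  \<comment> \<open>The zero entry only serves to exhibit the index as that of a chain.\<close>
  have c: "chain Y k [CT S0 0 (unt Q S0), CA b k \<zero>\<^bsub>Mm N Y k\<^esub>]" by (rule haug_chain) simp
  have t: "([unt Q S0], \<zero>\<^bsub>Mm N Y k\<^esub>) \<in> tuples [Pm Q S0 0] (Mm N Y k)"
    using unt_S0 by (simp add: tuples_def)
  have l: "lin_map R (Mm N Y k) (Bar 0 Y k) (\<lambda>m. gen 0 Y k (([], b), [0], k) ([unt Q S0], m))"
    using multilinD(2)[OF gen_chain_ml[OF c, of 0], of "[unt Q S0]" "\<zero>\<^bsub>Mm N Y k\<^esub>"] t
    by (simp add: cend_def fib cidx_def cfs_def)
  show ?thesis
  proof (rule lin_map_eqI[OF l M.module_axioms])
    fix m assume "m \<in> carrier (Mm N Y k)"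
    then show "haug k m = gen 0 Y k (([], b), [0], k) ([unt Q S0], m)"
      using lin_map_closed[OF l] by (simp add: haug_def tg_def cidx_def ctup_def cfs_def neg1_pow_def)
  qed
qed

lemma aug_haug:
  assumes "m \<in> carrier (Mm N Y k)"
  shows "aug Y k (haug k m) = m"
proof -
  \<comment> \<open>Unitality of the module concerns the arrow that \<open>b\<close> induces over
    the identity of \<open>S0\<close>; \<open>fixb\<close> says that this arrow is
    \<open>b\<close>.\<close>
  have "MFibM MC b (Idn OC S0) = b"
    using b_arr S0_ob Act_Idn by (intro fixb) (auto simp: facts)
  then have "nu N b k 0 m (unt Q S0) = m" using nu_unit[OF b_arr(1), of m k] assms by (simp add: fib)
  then show ?thesis
    unfolding haug_def aug_tg[OF Y_ob haug_chain[OF assms]] by simp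
qed

text \<open>The face \<open>d_0\<close> multiplies the old \<open>t_0\<close> with the new unit
  along \<open>g\<close>, the morphism from \<open>T_0\<close> to \<open>S0\<close>. By (P2),
  \<open>g\<close> is also the morphism it induces over the identity of \<open>S0\<close>, so right
  unitality applies.\<close>

lemma face_hbar_zero:
  assumes x: "x \<in> carrier (Bar n Y k)"
  shows "face (Suc n) Y k 0 (hbar n k x) = x"
proof (rule bar_tg_ext[OF bar_module _ lin_map_ident _ x])
  have fl: "lin_map R (Bar (Suc n) Y k) (Bar n Y k) (face (Suc n) Y k 0)"
    using face_lin[of 0 "Suc n" Y k] by simp
  show "lin_map R (Bar n Y k) (Bar n Y k) (\<lambda>x. face (Suc n) Y k 0 (hbar n k x))"
    by (rule lin_map_compose[OF hbar_lin fl])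
  fix zs assume zs: "chain Y k zs" "length zs = Suc (Suc n)"
  obtain T i x z ws where s: "zs = CT T i x # z # ws" "length ws = n" by (rule chain_head[OF zs])
  note Z = zs(1)[unfolded s(1)]
  note g = gof[OF head_comp(1,2)[OF Z]]
  let ?g = "gof (ccomp (z # ws))"
  have "T \<in> Ob OC" "x \<in> carrier (Pm Q T i)" using Z by (auto simp: chain_def)
  then have "cmul (CT S0 0 (unt Q S0)) (CF ?g i x) = CT T i x"
    using g(1) unt_right[OF g(1), of x i] fib_S0[OF g(1,3)] g(2,3) head_comp(3)[OF Z] fib_S0(2)[of "Idn OC S0" ?g] S0_ob
    by (simp add: facts)
  then have "zs = [] @ cmul (CT S0 0 (unt Q S0)) (CF ?g i x) # z # ws" by (simp add: s)
  from face_tg'[where us = "[]", OF hch_chain(1)[OF zs] _ hch_chain(2)[OF zs] _ this]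
  show "face (Suc n) Y k 0 (hbar n k (tg n Y k zs)) = tg n Y k zs"
    unfolding hbar_tg[OF zs] by (simp add: hch_def s)
qed

text \<open>For \<open>i = 0\<close> the merged cell lies over the composite from \<open>T_1\<close>
  through \<open>T_0\<close> to \<open>S0\<close>; terminality identifies it with the morphism that
  the homotopy attaches to the face. For \<open>i > 0\<close> the merge does not alter the composite
  arrow on which the new morphism depends.\<close>

lemma face_hbar_Suc:
  assumes n: "n \<ge> 1" and i: "i \<le> n" and x: "x \<in> carrier (Bar n Y k)"
  shows "face (Suc n) Y k (Suc i) (hbar n k x) = hbar (n - 1) k (face n Y k i x)"
proof (rule bar_tg_ext[OF bar_module _ _ _ x])
  obtain m where m: "n = Suc m" using n by (cases n) auto
  have fl: "lin_map R (Bar (Suc n) Y k) (Bar n Y k) (face (Suc n) Y k (Suc i))"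
    using face_lin[of "Suc i" "Suc n" Y k] i by simp
  show "lin_map R (Bar n Y k) (Bar n Y k) (\<lambda>x. face (Suc n) Y k (Suc i) (hbar n k x))"
    by (rule lin_map_compose[OF hbar_lin fl])
  have hl: "lin_map R (Bar (n - 1) Y k) (Bar n Y k) (hbar (n - 1) k)" using hbar_lin[of m k] by (simp add: m)
  show "lin_map R (Bar n Y k) (Bar n Y k) (\<lambda>x. hbar (n - 1) k (face n Y k i x))"
    by (rule lin_map_compose[OF face_lin[OF i n] hl])
  fix zs assume zs: "chain Y k zs" "length zs = Suc (Suc n)"
  note zs' = zs(2)[unfolded m]
  from zs(2) i obtain us a c vs where s: "zs = us @ a # c # vs" and us: "length us = i" by (rule chain_split)
  note Z = zs(1)[unfolded s]
  have Zm: "chain Y k (us @ cmul a c # vs)" by (rule chain_merge(1)[OF Z])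
  have lm: "length (us @ cmul a c # vs) = Suc (Suc m)" using zs' by (simp add: s)
  have f2: "face n Y k i (tg n Y k zs) = tg m Y k (us @ cmul a c # vs)"
    unfolding m by (rule face_tg'[where us = us, OF zs(1) s zs']) (simp_all add: us)
  have "face (Suc n) Y k (Suc i) (tg (Suc n) Y k (hch zs)) = tg n Y k (hch (us @ cmul a c # vs))"
  proof (cases us)
    case Nil
    then obtain T j y where a: "a = CT T j y" using chain_cells(1)[OF Z] by blast
    obtain v ws where v: "vs = v # ws" using zs' Nil by (cases vs) (auto simp: s)
    obtain f l w where c: "c = CF f l w" using chain_cells(4)[OF Z] v by blast
    have Z1: "chain Y k (CT T j y # c # vs)" using Z Nil by (simp add: a)
    note g = gof[OF head_comp(1,2)[OF Z1]]
    have t: "ccomp vs \<in> MArr MC" "Src MC (ccomp vs) = Y" "Tgt MC (ccomp vs) = Dom OC f"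
      using chain_tail[of Y k "[CT T j y]" c v ws "Dom OC f"] Z1 by (simp_all add: c v)
    have f: "f \<in> Mor OC" "Cod OC f = T" using Z1 by (auto simp: chain_def c clink_def)
    let ?g = "gof (ccomp (c # vs))"
    have gT: "Dom OC ?g = T" using g(2) head_comp(3)[OF Z1] by simp
    have eq: "gof (ccomp vs) = Cmp OC ?g f"
      using t f g gT by (intro gof_unique) (simp_all add: facts Act_Cmp c)
    have "cmul (CF ?g j y) c = CF (gof (ccomp vs)) (l + j) (gam Q f l j w y)"
      using fib_S0(2)[OF g(1,3) f(1)] f gT by (simp add: c eq)
    then have "hch (us @ cmul a c # vs) = [CT S0 0 (unt Q S0)] @ cmul (CF ?g j y) c # vs"
      by (simp add: hch_def Nil a c)
    from face_tg'[where us = "[CT S0 0 (unt Q S0)]", OF hch_chain(1)[OF zs] _ hch_chain(2)[OF zs] _ this]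
    show ?thesis using us by (simp add: hch_def s Nil a)
  next
    case (Cons u us')
    have e: "ccomp (us' @ cmul a c # vs) = ccomp (us' @ a # c # vs)"
      using Cons by (intro ccomp_append_cong ccomp_merge[OF Z]) auto
    let ?pre = "CT S0 0 (unt Q S0) # CF (gof (ccomp (us' @ a # c # vs))) (cdeg u) (cval u) # us'"
    have "hch (us @ cmul a c # vs) = ?pre @ cmul a c # vs"
      by (simp add: hch_def Cons e)
    from face_tg'[where us = ?pre, OF hch_chain(1)[OF zs] _ hch_chain(2)[OF zs] _ this]
    show ?thesis using us by (simp add: hch_def s Cons)
  qed
  then show "face (Suc n) Y k (Suc i) (hbar n k (tg n Y k zs)) = hbar (n - 1) k (face n Y k i (tg n Y k zs))"
    unfolding hbar_tg[OF zs] f2 using hbar_tg[OF Zm lm] by (simp add: m)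
qed

text \<open>The last face composes \<open>\<alpha>\<close> with its morphism to \<open>S0\<close>,
  giving \<open>b\<close>, and multiplies along the arrow induced by \<open>\<alpha>\<close> over
  \<open>S0\<close>. That this is \<open>\<alpha>\<close> itself, as the augmentation requires, is
  \<open>fixb\<close>.\<close>

lemma face_hbar_aug:
  assumes x: "x \<in> carrier (Bar 0 Y k)"
  shows "face 1 Y k 1 (hbar 0 k x) = haug k (aug Y k x)"
proof (rule bar_tg_ext[OF bar_module _ lin_map_compose[OF aug_lin[OF Y_ob] haug_lin] _ x])
  have fl: "lin_map R (Bar (Suc 0) Y k) (Bar 0 Y k) (face 1 Y k 1)"
    using face_lin[of 1 1 Y k] by (simp add: One_nat_def)
  show "lin_map R (Bar 0 Y k) (Bar 0 Y k) (\<lambda>x. face 1 Y k 1 (hbar 0 k x))"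
    by (rule lin_map_compose[OF hbar_lin fl])
  fix zs assume zs: "chain Y k zs" "length zs = Suc (Suc 0)"
  obtain T i x \<alpha> l m where s: "zs = [CT T i x, CA \<alpha> l m]"
    by (rule chain_shape[OF zs]) auto
  note Z = zs(1)[unfolded s]
  have \<alpha>: "\<alpha> \<in> MArr MC" "Src MC \<alpha> = Y" "Tgt MC \<alpha> = T" "k = l + i" using Z by (auto simp: chain_def clink_def)
  note g = gof[OF \<alpha>(1,2)]
  have "MFibM MC \<alpha> (gof \<alpha>) = \<alpha>" using g \<alpha> by (intro fixb) auto
  then have "cmul (CF (gof \<alpha>) i x) (CA \<alpha> l m) = CA b k (nu N \<alpha> l i m x)" using g(4) \<alpha> by simp
  then have "[CT S0 0 (unt Q S0), CA b k (nu N \<alpha> l i m x)]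
      = [CT S0 0 (unt Q S0)] @ cmul (CF (gof \<alpha>) i x) (CA \<alpha> l m) # []" by simp
  from face_tg'[where us = "[CT S0 0 (unt Q S0)]", OF hch_chain(1)[OF zs] _ hch_chain(2)[OF zs] _ this]
  show "face 1 Y k 1 (hbar 0 k (tg 0 Y k zs)) = haug k (aug Y k (tg 0 Y k zs))"
    unfolding hbar_tg[OF zs] unfolding s aug_tg[OF Y_ob Z]
    by (simp add: hch_def haug_def One_nat_def)
qed

text \<open>From \<open>d_0 h = id\<close> and \<open>d_(i+1) h = h d_i\<close>: apart from its
  first term, \<open>d h\<close> is \<open>- h d\<close>.\<close>

lemma diff_hbar:
  assumes n: "n \<ge> 1" and x: "x \<in> carrier (Bar n Y k)"
  shows "diff (Suc n) Y k (hbar n k x) \<oplus>\<^bsub>Bar n Y k\<^esub> hbar (n - 1) k (diff n Y k x) = x"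
proof -
  interpret B: module R "Bar n Y k" by (rule bar_module)
  obtain m where m: "n = Suc m" using n by (cases n) auto
  have hl: "lin_map R (Bar (n - 1) Y k) (Bar n Y k) (hbar (n - 1) k)" using hbar_lin[of m k] by (simp add: m)
  let ?f = "\<lambda>i. neg1_pow R (int i) \<odot>\<^bsub>Bar n Y k\<^esub> face (Suc n) Y k i (hbar n k x)"
  let ?h = "\<lambda>i. neg1_pow R (int i) \<odot>\<^bsub>Bar n Y k\<^esub> hbar (n - 1) k (face n Y k i x)"
  have hx: "hbar n k x \<in> carrier (Bar (Suc n) Y k)" by (rule lin_map_closed[OF hbar_lin x])
  have fc: "face (Suc n) Y k i (hbar n k x) \<in> carrier (Bar n Y k)" if "i \<le> Suc n" for i
    using face_closed[OF that _ hx] by simp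
  have gc: "face n Y k i x \<in> carrier (Bar (n - 1) Y k)" if "i \<le> n" for i
    by (rule face_closed[OF that n x])
  have hc: "?h i \<in> carrier (Bar n Y k)" if "i \<le> n" for i
    by (rule B.smult_closed[OF neg1_closed lin_map_closed[OF hl gc[OF that]]])
  have F: "?f \<in> {..Suc n} \<rightarrow> carrier (Bar n Y k)"
    using fc by (intro Pi_I B.smult_closed neg1_closed) simp
  have "diff (Suc n) Y k (hbar n k x) = (\<Oplus>\<^bsub>Bar n Y k\<^esub>i\<in>{..n}. ?f (Suc i)) \<oplus>\<^bsub>Bar n Y k\<^esub> ?f 0"
    unfolding diff_eq diff_Suc_1 by (rule B.finsum_Suc2[OF F])
  moreover have "?f 0 = x" using face_hbar_zero[OF x] x by (simp add: neg1_pow_def)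
  moreover have "(\<Oplus>\<^bsub>Bar n Y k\<^esub>i\<in>{..n}. ?f (Suc i)) = (\<Oplus>\<^bsub>Bar n Y k\<^esub>i\<in>{..n}. \<ominus>\<^bsub>R\<^esub> \<one>\<^bsub>R\<^esub> \<odot>\<^bsub>Bar n Y k\<^esub> ?h i)"
  proof (rule B.finsum_cong'[OF HOL.refl])
    show "(\<lambda>i. \<ominus>\<^bsub>R\<^esub> \<one>\<^bsub>R\<^esub> \<odot>\<^bsub>Bar n Y k\<^esub> ?h i) \<in> {..n} \<rightarrow> carrier (Bar n Y k)"
      by (intro Pi_I B.smult_closed[OF _ hc]) simp_all
    fix i assume "i \<in> {..n}"
    then have i: "i \<le> n" by simp
    have y: "hbar (n - 1) k (face n Y k i x) \<in> carrier (Bar n Y k)" by (rule lin_map_closed[OF hl gc[OF i]])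
    show "?f (Suc i) = \<ominus>\<^bsub>R\<^esub> \<one>\<^bsub>R\<^esub> \<odot>\<^bsub>Bar n Y k\<^esub> ?h i"
      unfolding face_hbar_Suc[OF n i x] neg1_Suc B.smult_l_minus[OF neg1_closed y]
        B.smult_l_minus[OF R.one_closed hc[OF i]] B.smult_one[OF hc[OF i]] ..
  qed
  moreover have "(\<Oplus>\<^bsub>Bar n Y k\<^esub>i\<in>{..n}. \<ominus>\<^bsub>R\<^esub> \<one>\<^bsub>R\<^esub> \<odot>\<^bsub>Bar n Y k\<^esub> ?h i) = \<ominus>\<^bsub>R\<^esub> \<one>\<^bsub>R\<^esub> \<odot>\<^bsub>Bar n Y k\<^esub> (\<Oplus>\<^bsub>Bar n Y k\<^esub>i\<in>{..n}. ?h i)"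
    by (intro B.finsum_smult_ldistr[symmetric] Pi_I hc) simp_all
  moreover have "hbar (n - 1) k (diff n Y k x) = (\<Oplus>\<^bsub>Bar n Y k\<^esub>i\<in>{..n}. ?h i)"
  proof -
    have "hbar (n - 1) k (diff n Y k x)
        = (\<Oplus>\<^bsub>Bar n Y k\<^esub>i\<in>{..n}. hbar (n - 1) k (neg1_pow R (int i) \<odot>\<^bsub>Bar (n - 1) Y k\<^esub> face n Y k i x))"
      unfolding diff_eq
      by (rule lin_map_finsum[OF bar_module bar_module hl], intro Pi_I module.smult_closed[OF bar_module] neg1_closed gc) simp
    also have "\<dots> = (\<Oplus>\<^bsub>Bar n Y k\<^esub>i\<in>{..n}. ?h i)"
    proof (rule B.finsum_cong'[OF HOL.refl])
      show "?h \<in> {..n} \<rightarrow> carrier (Bar n Y k)" using hc by (intro Pi_I) simp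
      show "hbar (n - 1) k (neg1_pow R (int i) \<odot>\<^bsub>Bar (n - 1) Y k\<^esub> face n Y k i x) = ?h i" if "i \<in> {..n}" for i
        using that by (intro lin_map_smult[OF hl neg1_closed gc]) simp
    qed
    finally show ?thesis .
  qed
  moreover have s: "(\<Oplus>\<^bsub>Bar n Y k\<^esub>i\<in>{..n}. ?h i) \<in> carrier (Bar n Y k)"
    using hc by (intro B.finsum_closed Pi_I) simp
  ultimately have eq: "diff (Suc n) Y k (hbar n k x) \<oplus>\<^bsub>Bar n Y k\<^esub> hbar (n - 1) k (diff n Y k x)
      = (\<ominus>\<^bsub>R\<^esub> \<one>\<^bsub>R\<^esub> \<odot>\<^bsub>Bar n Y k\<^esub> (\<Oplus>\<^bsub>Bar n Y k\<^esub>i\<in>{..n}. ?h i) \<oplus>\<^bsub>Bar n Y k\<^esub> x) \<oplus>\<^bsub>Bar n Y k\<^esub> (\<Oplus>\<^bsub>Bar n Y k\<^esub>i\<in>{..n}. ?h i)"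
    by (simp only:)
  have "(\<ominus>\<^bsub>R\<^esub> \<one>\<^bsub>R\<^esub> \<odot>\<^bsub>Bar n Y k\<^esub> s \<oplus>\<^bsub>Bar n Y k\<^esub> x) \<oplus>\<^bsub>Bar n Y k\<^esub> s = x" if "s \<in> carrier (Bar n Y k)" for s
    using that x B.a_comm[of "\<ominus>\<^bsub>Bar n Y k\<^esub> s" x] by (simp add: B.smult_l_minus B.a_assoc B.l_neg)
  then show ?thesis unfolding eq using s .
qed

lemma diff_hbar_zero:
  assumes x: "x \<in> carrier (Bar 0 Y k)"
  shows "diff 1 Y k (hbar 0 k x) \<oplus>\<^bsub>Bar 0 Y k\<^esub> haug k (aug Y k x) = x"
proof -
  interpret B: module R "Bar 0 Y k" by (rule bar_module)
  have hx: "hbar 0 k x \<in> carrier (Bar 1 Y k)" using lin_map_closed[OF hbar_lin x] by (simp add: One_nat_def)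
  let ?f = "\<lambda>i. neg1_pow R (int i) \<odot>\<^bsub>Bar 0 Y k\<^esub> face 1 Y k i (hbar 0 k x)"
  have fc: "face 1 Y k i (hbar 0 k x) \<in> carrier (Bar 0 Y k)" if "i \<le> 1" for i
    using face_closed[OF that _ hx] by simp
  have F: "?f \<in> {..Suc 0} \<rightarrow> carrier (Bar 0 Y k)"
    using fc by (intro Pi_I B.smult_closed neg1_closed) (simp add: One_nat_def)
  have "diff 1 Y k (hbar 0 k x) = ?f (Suc 0) \<oplus>\<^bsub>Bar 0 Y k\<^esub> (\<Oplus>\<^bsub>Bar 0 Y k\<^esub>i\<in>{..0}. ?f i)"
    unfolding diff_eq One_nat_def[symmetric] using B.finsum_Suc[OF F] by (simp add: One_nat_def)
  also have "(\<Oplus>\<^bsub>Bar 0 Y k\<^esub>i\<in>{..0}. ?f i) = ?f 0"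
    using B.smult_closed[OF neg1_closed fc[of 0]] by simp
  also have "?f 0 = x"
    using face_hbar_zero[OF x] x by (simp add: neg1_pow_def One_nat_def)
  also have "?f (Suc 0) = \<ominus>\<^bsub>Bar 0 Y k\<^esub> haug k (aug Y k x)"
    using face_hbar_aug[OF x] lin_map_closed[OF haug_lin lin_map_closed[OF aug_lin[OF Y_ob] x]]
    by (simp add: neg1_pow_def B.smult_l_minus One_nat_def)
  finally show ?thesis
    using x lin_map_closed[OF haug_lin lin_map_closed[OF aug_lin[OF Y_ob] x]]
    by (simp add: B.a_ac B.r_neg1 B.r_neg)
qed

text \<open>The inserted unit stays in place. Only if it follows \<open>t_0\<close> directly does
  its left neighbour change, from \<open>CT\<close> to the new \<open>CF\<close>, which ends at the
  same vertex.\<close>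

lemma hbar_degs:
  assumes x: "x \<in> degs n Y k"
  shows "hbar n k x \<in> degs (Suc n) Y k"
proof (rule degs_tg_image[OF bar_module hbar_lin degs_submodule _ x])
  fix us a c vs t
  assume Z: "chain Y k (us @ a # c # vs)" "Suc (length (us @ a # c # vs)) = Suc (Suc n)" and t: "ccd a = Some t"
  let ?zs = "us @ a # cunit t # c # vs"
  have n: "n = Suc (length us + length vs)" using Z(2) by simp
  have lz: "length (us @ a # c # vs) = Suc (Suc (length us + length vs))" by simp
  have c: "chain Y k ?zs" by (rule chain_insert_unit[OF Z(1) t])
  have len: "length ?zs = Suc (Suc n)" using Z(2) by simp
  have tl: "ccomp (c # vs) \<in> MArr MC" "Tgt MC (ccomp (c # vs)) = t" by (rule chain_tail[OF Z(1) t])+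
  then have e: "ccomp (cunit t # c # vs) = ccomp (c # vs)" using Act_Idn[OF tl(1)] by (simp add: cunit_def)
  obtain pre a' where pre: "hch (us @ a # c # vs) = pre @ a' # c # vs" "hch ?zs = pre @ a' # cunit t # c # vs"
    "ccd a' = Some t"
  proof (cases us)
    case Nil
    have "chain Y k (a # c # vs)" using Z(1) Nil by simp
    moreover obtain T i x where a: "a = CT T i x" using chain_cells(1)[OF Z(1)] Nil by blast
    ultimately have "Dom OC (gof (ccomp (c # vs))) = t"
      using gof(2)[OF chain_tail(1,2)[OF Z(1) t]] tl(2) by simp
    then show ?thesis using e 
      by (intro that[of "[CT S0 0 (unt Q S0)]" "CF (gof (ccomp (c # vs))) (cdeg a) (cval a)"]) (simp_all add: hch_def Nil)
  next
    case (Cons u us')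
    have e2: "ccomp (us' @ a # cunit t # c # vs) = ccomp (us' @ a # c # vs)"
      using ccomp_append_cong[OF e, of "us' @ [a]"] by simp
    show ?thesis
      by (rule that[of "CT S0 0 (unt Q S0) # CF (gof (ccomp (us' @ a # c # vs))) (cdeg u) (cval u) # us'" a])
        (simp_all add: hch_def Cons e2 t)
  qed
  note H = hch_chain[OF Z(1) lz]
  show "hbar n k (tg n Y k ?zs) \<in> degs (Suc n) Y k"
    unfolding hbar_tg[OF c len] pre(2)
    using tg_unit_in_degs[of Y k pre a' c vs n t] H pre(1,3) n by simp
qed

theorem bar_acyclic: "aug_acyclic (\<lambda>n. Bar n Y k) (\<lambda>n. diff n Y k) (Mm N Y k) (aug Y k)"
proof (rule aug_acyclicI[where R = R and h = "\<lambda>n. hbar n k" and hA = "haug k"])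
  show "haug k \<zero>\<^bsub>Mm N Y k\<^esub> = \<zero>\<^bsub>Bar 0 Y k\<^esub>"
    by (rule lin_map_zero[OF Mm_module[OF Y_ob] bar_module haug_lin])
qed (simp_all add: bar_module Mm_module Y_ob diff_lin aug_lin hbar_lin lin_map_closed[OF haug_lin]
    aug_diff diff_diff aug_haug diff_hbar diff_hbar_zero)

text \<open>Level 0 has no degeneracies, so its degenerate part is the span of the empty
  set.\<close>

lemma aug_degs: "x \<in> degs 0 Y k \<Longrightarrow> aug Y k x = \<zero>\<^bsub>Mm N Y k\<^esub>"
  using degs_image[OF Mm_module[OF Y_ob] aug_lin[OF Y_ob] submodule_zero[OF Mm_module[OF Y_ob]],
      where x = x and k = k] by simp

theorem nbar_acyclic: "aug_acyclic (\<lambda>n. nbar R OC MC Q N n Y k) (\<lambda>n. nbar_diff R OC MC Q N n Y k)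
    (Mm N Y k) (nbar_aug R OC MC Q N Y k)"
proof -
  have "aug_acyclic (\<lambda>n. quot_mod (Bar n Y k) (degs n Y k))
    (\<lambda>n X. the_elem ((\<lambda>x. degs (n - 1) Y k +>\<^bsub>Bar (n - 1) Y k\<^esub> diff n Y k x) ` X)) (Mm N Y k)
    (\<lambda>X. the_elem (aug Y k ` X))"
    by (rule aug_acyclic_quotient[where R = R and h = "\<lambda>n. hbar n k" and hA = "haug k"])
      (simp_all add: bar_module Mm_module Y_ob diff_lin aug_lin hbar_lin haug_lin
        aug_diff diff_diff aug_haug diff_hbar diff_hbar_zero degs_submodule diff_degs hbar_degs aug_degs)
  then show ?thesis
    by (simp add: nbar_def[abs_def] nbar_diff_def[abs_def] nbar_aug_def[abs_def])
qed

end

context bar_setting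
begin

text \<open>Replacing a terminal \<open>b\<close> by the arrow it induces on fibers over its own target.  Weak blow-up
  makes the passage from an arrow \<open>\<alpha>\<close> out of \<open>Y\<close> to the induced arrow on fibers over \<open>Tgt b\<close> a natural
  bijection \<open>D\<close> of the arrows out of \<open>Y\<close>, and arrows of the form \<open>D \<alpha>\<close> are fixed when the fibers are taken
  over \<open>D b\<close> instead of \<open>b\<close>.\<close>

lemma normalized_terminal_arrow:
  assumes blow: "weak_blow_up_mod OC MC" and trm: "terminal_arrow OC MC Y b" and fib: "MFib MC b = Y"
    and dff: "domain_fiber_functor OC (Tgt MC b)"
  obtains b' where "bar_contraction R OC MC Q N Y b'"
proof -
  let ?S = "Tgt MC b"
  let ?P = "\<lambda>\<alpha> g. g \<in> Mor OC \<and> Dom OC g = Tgt MC \<alpha> \<and> Cod OC g = ?S \<and> Act MC g \<alpha> = b"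
  have b: "b \<in> MArr MC" "Src MC b = Y" using trm by (auto simp: terminal_arrow_def)
  have S: "?S \<in> Ob OC" using b by (simp add: facts)
  have ex1: "\<exists>!g. ?P \<alpha> g" if "\<alpha> \<in> MArr MC" "Src MC \<alpha> = Y" for \<alpha>
    using trm that by (simp add: terminal_arrow_def)
  have d1: "Fib OC g = Dom OC g" if "g \<in> Mor OC" "Cod OC g = ?S" for g
    using dff that by (simp add: domain_fiber_functor_def)
  have d2: "FibM OC f g = f" if "g \<in> Mor OC" "Cod OC g = ?S" "f \<in> Mor OC" "Cod OC f = Dom OC g" for f g
    using dff that by (simp add: domain_fiber_functor_def)
  let ?id = "Idn OC ?S"
  have id: "?id \<in> Mor OC" "Dom OC ?id = ?S" "Cod OC ?id = ?S" using S by (simp_all add: facts)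
  define b' where "b' = MFibM MC b ?id"
  have fS: "Fib OC ?id = ?S" using d1[OF id(1,3)] id(2) by simp
  have b': "b' \<in> MArr MC" "Src MC b' = Y" "Tgt MC b' = ?S" "MFib MC b' = Y"
    using b id fib fS Act_Idn[OF b(1)] by (simp_all add: b'_def facts)
  text \<open>The three properties of \<open>D \<alpha> = MFibM \<alpha> g\<close> for \<open>g \<alpha> = b\<close>: it lies over \<open>b'\<close> via \<open>g\<close>, it is
    fixed by taking fibers, and every arrow has this form.\<close>
  have D: "MFibM MC \<alpha> g \<in> MArr MC" "Src MC (MFibM MC \<alpha> g) = Y" "Tgt MC (MFibM MC \<alpha> g) = Tgt MC \<alpha>"
    "Act MC g (MFibM MC \<alpha> g) = b'" "MFibM MC (MFibM MC \<alpha> g) g = MFibM MC \<alpha> g"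
    if \<alpha>: "\<alpha> \<in> MArr MC" "Src MC \<alpha> = Y" "?P \<alpha> g" for \<alpha> g
  proof -
    have g: "g \<in> Mor OC" "Dom OC g = Tgt MC \<alpha>" "Cod OC g = ?S" "Act MC g \<alpha> = b" using \<alpha>(3) by auto
    show "MFibM MC \<alpha> g \<in> MArr MC" "Src MC (MFibM MC \<alpha> g) = Y" "Tgt MC (MFibM MC \<alpha> g) = Tgt MC \<alpha>"
      using \<alpha> g fib d1[OF g(1,3)] by (simp_all add: facts)
    have idg: "Cmp OC ?id g = g" using Cmp_Idn_left[OF g(1)] g(3) by simp
    have Fg: "FibM OC g ?id = g" using d2[OF id(1,3) g(1)] g(3) id(2) by simp
    show "Act MC g (MFibM MC \<alpha> g) = b'"
      using MFibM_Act[OF \<alpha>(1) g(1) id(1)] g id by (simp add: idg Fg b'_def)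
    show "MFibM MC (MFibM MC \<alpha> g) g = MFibM MC \<alpha> g"
      using MFibM_MFibM[OF \<alpha>(1) g(1) id(1)] g id by (simp add: idg Fg)
  qed
  have surj: "\<exists>\<alpha> g. \<alpha> \<in> MArr MC \<and> Src MC \<alpha> = Y \<and> ?P \<alpha> g \<and> MFibM MC \<alpha> g = \<beta>"
    if \<beta>: "\<beta> \<in> MArr MC" "Src MC \<beta> = Y" for \<beta>
  proof -
    \<comment> \<open>Blow up \<open>b\<close>, whose fiber is \<open>Y\<close>, along
      \<open>\<beta>\<close>.\<close>
    have "\<exists>!(\<phi>', f''). \<phi>' \<in> MArr MC \<and> f'' \<in> Mor OC \<and> Tgt MC \<phi>' = Dom OC f'' \<and> Act MC f'' \<phi>' = b
        \<and> Fib OC f'' = Tgt MC \<beta> \<and> MFibM MC \<phi>' f'' = \<beta>"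
      using blow b(1) \<beta> fib by (simp add: weak_blow_up_mod_def)
    then obtain \<alpha> g where g: "\<alpha> \<in> MArr MC" "g \<in> Mor OC" "Tgt MC \<alpha> = Dom OC g" "Act MC g \<alpha> = b"
        "MFibM MC \<alpha> g = \<beta>" by blast
    have "Src MC \<alpha> = Y" "Cod OC g = ?S" using Src_Act[OF g(1-3)] Tgt_Act[OF g(1-3)] g(4) b by auto
    with g show ?thesis by (intro exI[of _ \<alpha>] exI[of _ g] conjI) simp_all
  qed
  have inj: "g = g'" if \<alpha>: "\<alpha> \<in> MArr MC" "Src MC \<alpha> = Y" "?P \<alpha> g"
    and g': "g' \<in> Mor OC" "Dom OC g' = Tgt MC \<alpha>" "Cod OC g' = ?S" "Act MC g' (MFibM MC \<alpha> g) = b'" for \<alpha> g g'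
  proof -
    have g: "g \<in> Mor OC" "Dom OC g = Tgt MC \<alpha>" "Cod OC g = ?S" "Act MC g \<alpha> = b" using \<alpha>(3) by auto
    \<comment> \<open>Let \<open>h\<close> carry \<open>\<beta>\<close> to \<open>b\<close>; then
      \<open>h g' = g\<close>. The arrow induced by \<open>\<beta>\<close> over \<open>h\<close>
      turns out to be \<open>b'\<close>, as is the one induced by \<open>b\<close> over the
      identity, so uniqueness of blow-ups gives \<open>\<beta> = b\<close> and
      \<open>h = id\<close>, whence \<open>g' = g\<close>.\<close>
    define \<beta> where "\<beta> = Act MC g' \<alpha>"
    have \<beta>: "\<beta> \<in> MArr MC" "Src MC \<beta> = Y" "Tgt MC \<beta> = ?S" using \<alpha> g' by (simp_all add: \<beta>_def facts)
    obtain h where h: "h \<in> Mor OC" "Dom OC h = ?S" "Cod OC h = ?S" "Act MC h \<beta> = b" using ex1[OF \<beta>(1,2)] \<beta>(3) by auto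
    have hg': "Cmp OC h g' = g"
    proof -
      have "?P \<alpha> (Cmp OC h g')" using h g' \<alpha> by (auto simp: facts Act_Cmp \<beta>_def)
      then show ?thesis using ex1[OF \<alpha>(1,2)] \<alpha>(3) by blast
    qed
    have "MFibM MC \<beta> h = Act MC (FibM OC g' h) (MFibM MC \<alpha> (Cmp OC h g'))"
      unfolding \<beta>_def using \<alpha> g' h by (intro MFibM_Act) auto
    also have "\<dots> = b'" using d2[OF h(1,3) g'(1)] g' h(2) by (simp add: hg')
    finally have 1: "MFibM MC \<beta> h = b'" .
    have "\<exists>!(\<phi>', f''). \<phi>' \<in> MArr MC \<and> f'' \<in> Mor OC \<and> Tgt MC \<phi>' = Dom OC f'' \<and> Act MC f'' \<phi>' = b
        \<and> Fib OC f'' = Tgt MC b' \<and> MFibM MC \<phi>' f'' = b'"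
      using blow[unfolded weak_blow_up_mod_def, rule_format, OF b(1) b'(1)] b'(2) fib by simp
    moreover have "\<beta> \<in> MArr MC \<and> h \<in> Mor OC \<and> Tgt MC \<beta> = Dom OC h \<and> Act MC h \<beta> = b
        \<and> Fib OC h = Tgt MC b' \<and> MFibM MC \<beta> h = b'"
      using \<beta> h 1 d1[OF h(1,3)] b'(3) by simp
    moreover have "b \<in> MArr MC \<and> ?id \<in> Mor OC \<and> Tgt MC b = Dom OC ?id \<and> Act MC ?id b = b
        \<and> Fib OC ?id = Tgt MC b' \<and> MFibM MC b ?id = b'"
      using b id Act_Idn[OF b(1)] fS b'(3) by (simp add: b'_def)
    ultimately have "\<beta> = b \<and> h = ?id" by blast
    then show ?thesis using hg' Cmp_Idn_left[OF g'(1)] g'(3) by simp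
  qed
  have "bar_contraction R OC MC Q N Y b'"
  proof (intro bar_contraction.intro bar_contraction_axioms.intro bar_setting_axioms)
    show "terminal_arrow OC MC Y b'"
      unfolding terminal_arrow_def
    proof (intro conjI ballI impI b')
      fix \<beta> assume "\<beta> \<in> MArr MC" "Src MC \<beta> = Y"
      from surj[OF this] obtain \<alpha> g where \<alpha>: "\<alpha> \<in> MArr MC" "Src MC \<alpha> = Y" "?P \<alpha> g" "MFibM MC \<alpha> g = \<beta>" by blast
      note D' = D[OF \<alpha>(1-3), unfolded \<alpha>(4)]
      show "\<exists>!g. g \<in> Mor OC \<and> Dom OC g = Tgt MC \<beta> \<and> Cod OC g = Tgt MC b' \<and> Act MC g \<beta> = b'"
      proof (rule ex1I[of _ g])
        show "g \<in> Mor OC \<and> Dom OC g = Tgt MC \<beta> \<and> Cod OC g = Tgt MC b' \<and> Act MC g \<beta> = b'"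
          using \<alpha>(3) D'(3,4) b'(3) by simp
        fix g' assume "g' \<in> Mor OC \<and> Dom OC g' = Tgt MC \<beta> \<and> Cod OC g' = Tgt MC b' \<and> Act MC g' \<beta> = b'"
        then show "g' = g" using inj[OF \<alpha>(1-3), of g'] D'(3) b'(3) \<alpha>(4) by simp
      qed
    qed
    show "MFib MC b' = Y" by (rule b')
    show "domain_fiber_functor OC (Tgt MC b')" using dff b'(3) by simp
    fix \<beta> g' assume \<beta>: "\<beta> \<in> MArr MC" "Src MC \<beta> = Y"
      and g': "g' \<in> Mor OC" "Dom OC g' = Tgt MC \<beta>" "Cod OC g' = Tgt MC b'" "Act MC g' \<beta> = b'"
    from surj[OF \<beta>] obtain \<alpha> g where \<alpha>: "\<alpha> \<in> MArr MC" "Src MC \<alpha> = Y" "?P \<alpha> g" "MFibM MC \<alpha> g = \<beta>" by blast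
    note D' = D[OF \<alpha>(1-3), unfolded \<alpha>(4)]
    have "g = g'" using inj[OF \<alpha>(1-3), of g'] g' D'(3) b'(3) \<alpha>(4) by simp
    then show "MFibM MC \<beta> g' = \<beta>" using D'(5) by simp
  qed
  then show ?thesis by (rule that)
qed

theorem part_one:
  assumes "weak_blow_up_mod OC MC" "terminal_arrow OC MC Y b" "MFib MC b = Y" "domain_fiber_functor OC (Tgt MC b)"
  shows "aug_acyclic (\<lambda>n. Bar n Y k) (\<lambda>n. diff n Y k) (Mm N Y k) (aug Y k)"
    "aug_acyclic (\<lambda>n. nbar R OC MC Q N n Y k) (\<lambda>n. nbar_diff R OC MC Q N n Y k)
      (Mm N Y k) (nbar_aug R OC MC Q N Y k)"
proof -
  obtain b' where "bar_contraction R OC MC Q N Y b'" by (rule normalized_terminal_arrow[OF assms])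
  then interpret bar_contraction R OC MC Q N Y b' .
  show "aug_acyclic (\<lambda>n. Bar n Y k) (\<lambda>n. diff n Y k) (Mm N Y k) (aug Y k)" by (rule bar_acyclic)
  show "aug_acyclic (\<lambda>n. nbar R OC MC Q N n Y k) (\<lambda>n. nbar_diff R OC MC Q N n Y k)
      (Mm N Y k) (nbar_aug R OC MC Q N Y k)" by (rule nbar_acyclic)
qed

section \<open>Fiber towers and blow-ups of towers\<close>

text \<open>The pair \<open>(ftl g fs, MFibM \<beta> (gtot g fs))\<close> is the tower of fibers, over the codomain of \<open>g : T\<^sub>0 \<rightarrow> S\<close>,
  of the tower \<open>(fs, \<beta>)\<close> ending in \<open>T\<^sub>0\<close>.\<close>

primrec tw :: "'a list \<Rightarrow> 'o \<Rightarrow> 'q \<Rightarrow> bool" where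
  "tw [] T \<beta> \<longleftrightarrow> \<beta> \<in> MArr MC \<and> Tgt MC \<beta> = T"
| "tw (f # fs) T \<beta> \<longleftrightarrow> f \<in> Mor OC \<and> Cod OC f = T \<and> tw fs (Dom OC f) \<beta>"

primrec ftl :: "'a \<Rightarrow> 'a list \<Rightarrow> 'a list" where
  "ftl g [] = []"
| "ftl g (f # fs) = FibM OC f g # ftl (Cmp OC g f) fs"

primrec gtot :: "'a \<Rightarrow> 'a list \<Rightarrow> 'a" where
  "gtot g [] = g"
| "gtot g (f # fs) = gtot (Cmp OC g f) fs"

abbreviation "tcomp fs \<beta> \<equiv> foldr (Act MC) fs \<beta>"

lemma ftl_inverse: "ftl g fs = [] \<longleftrightarrow> fs = []" "length (ftl g fs) = length fs"
  by (induction fs arbitrary: g) auto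

lemma tw_vert: "tw fs T \<beta> \<Longrightarrow> vert OC MC (fs, \<beta>) 0 = T"
  by (cases fs) (auto simp: vert_def)

lemma tw_arr: "tw fs T \<beta> \<Longrightarrow> \<beta> \<in> MArr MC \<and> T \<in> Ob OC"
  by (induction fs arbitrary: T) (auto simp: facts)

lemma towers_tw: "(fs, \<beta>) \<in> towers OC MC n L \<longleftrightarrow>
    length fs = n \<and> Src MC \<beta> = L \<and> tw fs (vert OC MC (fs, \<beta>) 0) \<beta>"
proof (induction fs arbitrary: n)
  case Nil
  then show ?case by (auto simp: towers_def vert_def)
next
  case (Cons f fs)
  have v: "vert OC MC (f # fs, \<beta>) (Suc i) = vert OC MC (fs, \<beta>) i" for i by (simp add: vert_def)
  have "(f # fs, \<beta>) \<in> towers OC MC n L \<longleftrightarrow> n = Suc (length fs) \<and> f \<in> Mor OC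
      \<and> Dom OC f = vert OC MC (fs, \<beta>) 0 \<and> (fs, \<beta>) \<in> towers OC MC (length fs) L"
  proof -
    have "(\<forall>i<Suc (length fs). Dom OC ((f # fs) ! i) = vert OC MC (f # fs, \<beta>) (Suc i))
        \<longleftrightarrow> Dom OC f = vert OC MC (fs, \<beta>) 0 \<and> (\<forall>i<length fs. Dom OC (fs ! i) = vert OC MC (fs, \<beta>) (Suc i))"
      unfolding v All_less_Suc2 by simp
    then show ?thesis unfolding towers_def by auto
  qed
  also have "\<dots> \<longleftrightarrow> n = Suc (length fs) \<and> f \<in> Mor OC \<and> Src MC \<beta> = L \<and> tw fs (Dom OC f) \<beta>"
  proof -
    have "Dom OC f = vert OC MC (fs, \<beta>) 0 \<and> tw fs (vert OC MC (fs, \<beta>) 0) \<beta> \<longleftrightarrow> tw fs (Dom OC f) \<beta>"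
      by (metis tw_vert)
    then show ?thesis unfolding Cons.IH by blast
  qed
  finally show ?case by (auto simp: vert_def)
qed

lemma tcomp_facts: "tw fs T \<beta> \<Longrightarrow> tcomp fs \<beta> \<in> MArr MC \<and> Src MC (tcomp fs \<beta>) = Src MC \<beta> \<and> Tgt MC (tcomp fs \<beta>) = T"
  by (induction fs arbitrary: T) (auto simp: facts)

lemma gtot_facts:
  "tw fs (Dom OC g) \<beta> \<Longrightarrow> g \<in> Mor OC \<Longrightarrow> gtot g fs \<in> Mor OC \<and> Dom OC (gtot g fs) = Tgt MC \<beta>
     \<and> Cod OC (gtot g fs) = Cod OC g \<and> Act MC (gtot g fs) \<beta> = Act MC g (tcomp fs \<beta>)"
proof (induction fs arbitrary: g)
  case (Cons f fs)
  then have "tw fs (Dom OC (Cmp OC g f)) \<beta>" "Cmp OC g f \<in> Mor OC" by (auto simp: facts)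
  from Cons.IH[OF this] show ?case
    using Cons.prems tcomp_facts[of fs "Dom OC f" \<beta>] by (auto simp: facts Act_Cmp)
qed auto

text \<open>The one-step axioms propagate along the tower. The fibers \<open>F_1, ..., F_n\<close>
  and \<open>N\<close> are unchanged, so the entries \<open>p_1, ..., p_n, m\<close> can be carried
  over to the tower of fibers.\<close>

lemma ftl_tw:
  assumes "tw fs (Dom OC g) \<beta>" "g \<in> Mor OC"
  shows "tw (ftl g fs) (Fib OC g) (MFibM MC \<beta> (gtot g fs))"
    and "tcomp (ftl g fs) (MFibM MC \<beta> (gtot g fs)) = MFibM MC (tcomp fs \<beta>) g"
    and "map (Fib OC) (ftl g fs) = map (Fib OC) fs"
    and "MFib MC (MFibM MC \<beta> (gtot g fs)) = MFib MC \<beta>"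
    and "Src MC (MFibM MC \<beta> (gtot g fs)) = MFib MC (Act MC g (tcomp fs \<beta>))"
proof -
  have "tw (ftl g fs) (Fib OC g) (MFibM MC \<beta> (gtot g fs))
    \<and> tcomp (ftl g fs) (MFibM MC \<beta> (gtot g fs)) = MFibM MC (tcomp fs \<beta>) g
    \<and> map (Fib OC) (ftl g fs) = map (Fib OC) fs"
    using assms
  proof (induction fs arbitrary: g)
    case Nil
    then show ?case by (auto simp: facts)
  next
    case (Cons f fs)
    then have f: "f \<in> Mor OC" "Cod OC f = Dom OC g" "tw fs (Dom OC f) \<beta>" by auto
    then have "tw fs (Dom OC (Cmp OC g f)) \<beta>" "Cmp OC g f \<in> Mor OC" using Cons.prems by (auto simp: facts)
    from Cons.IH[OF this] show ?case
      using f Cons.prems(2) tcomp_facts[OF f(3)] by (auto simp: facts MFibM_Act)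
  qed
  then show "tw (ftl g fs) (Fib OC g) (MFibM MC \<beta> (gtot g fs))"
    "tcomp (ftl g fs) (MFibM MC \<beta> (gtot g fs)) = MFibM MC (tcomp fs \<beta>) g"
    "map (Fib OC) (ftl g fs) = map (Fib OC) fs" by auto
  show "MFib MC (MFibM MC \<beta> (gtot g fs)) = MFib MC \<beta>"
    "Src MC (MFibM MC \<beta> (gtot g fs)) = MFib MC (Act MC g (tcomp fs \<beta>))"
    using gtot_facts[OF assms] tw_arr[OF assms(1)] by (auto simp: facts)
qed

text \<open>Axiom (b) along a whole tower: fibers over \<open>Fib OC c\<close> of the fibers over
  the codomain of \<open>c\<close> are the fibers over the codomain of \<open>a\<close>.\<close>

lemma ftl_ftl:
  assumes "tw fs (Dom OC a) \<beta>" "a \<in> Mor OC" "c \<in> Mor OC" "Cod OC a = Dom OC c"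
  shows "ftl (FibM OC a c) (ftl (Cmp OC c a) fs) = ftl a fs"
    and "MFibM MC (MFibM MC \<beta> (gtot (Cmp OC c a) fs)) (gtot (FibM OC a c) (ftl (Cmp OC c a) fs)) = MFibM MC \<beta> (gtot a fs)"
proof -
  have "ftl (FibM OC a c) (ftl (Cmp OC c a) fs) = ftl a fs
    \<and> gtot (Cmp OC c a) fs = Cmp OC c (gtot a fs)
    \<and> gtot (FibM OC a c) (ftl (Cmp OC c a) fs) = FibM OC (gtot a fs) c"
    using assms
  proof (induction fs arbitrary: a)
    case (Cons f fs)
    then have f: "f \<in> Mor OC" "Cod OC f = Dom OC a" "tw fs (Dom OC f) \<beta>" by auto
    have "tw fs (Dom OC (Cmp OC a f)) \<beta>" "Cmp OC a f \<in> Mor OC" "Cod OC (Cmp OC a f) = Dom OC c"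
      using f Cons.prems by (auto simp: facts)
    from Cons.IH[OF this(1,2) Cons.prems(3) this(3)] show ?case
      using f Cons.prems by (simp add: facts FibM_FibM Cmp_assoc flip: FibM_Cmp)
  qed auto
  then show "ftl (FibM OC a c) (ftl (Cmp OC c a) fs) = ftl a fs"
    "MFibM MC (MFibM MC \<beta> (gtot (Cmp OC c a) fs)) (gtot (FibM OC a c) (ftl (Cmp OC c a) fs)) = MFibM MC \<beta> (gtot a fs)"
    using gtot_facts[OF assms(1,2)] tw_arr[OF assms(1)] assms by (auto simp: MFibM_MFibM)
qed

text \<open>Inverse to the passage to towers of fibers: \<open>(fs', \<beta>')\<close> lies over the
  target of \<open>\<alpha>\<close> via \<open>h\<close>, and \<open>(fs, \<beta>)\<close>, a tower
  under the fiber of \<open>\<alpha>\<close>, is its tower of fibers.\<close>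

definition isblow :: "'q \<Rightarrow> 'a list \<Rightarrow> 'o \<Rightarrow> 'q \<Rightarrow> 'a list \<times> 'q \<times> 'a \<Rightarrow> bool" where
  "isblow \<alpha> fs T \<beta> = (\<lambda>(fs', \<beta>', h). h \<in> Mor OC \<and> tw fs' (Dom OC h) \<beta>' \<and> Act MC h (tcomp fs' \<beta>') = \<alpha>
     \<and> Fib OC h = T \<and> ftl h fs' = fs \<and> MFibM MC \<beta>' (gtot h fs') = \<beta>)"

text \<open>The arrow at the far end is lifted by the blow-up axiom of the module; then each
  morphism, going towards \<open>T\<close>, is lifted by the axiom of \<open>OC\<close> applied to
  the map \<open>h\<close> found so far. Uniqueness propagates because the \<open>h\<close> of one
  stage is the composite of the next one with the lifted morphism.\<close>

lemma blow_tower: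
  assumes OB: "weak_blow_up OC" and MB: "weak_blow_up_mod OC MC"
    and "\<alpha> \<in> MArr MC" "tw fs T \<beta>" "Src MC \<beta> = MFib MC \<alpha>"
  shows "\<exists>!p. isblow \<alpha> fs T \<beta> p"
  using assms(4)
proof (induction fs arbitrary: T)
  case Nil
  then have b: "\<beta> \<in> MArr MC" "Tgt MC \<beta> = T" by auto
  let ?P = "\<lambda>\<phi>' f''. \<phi>' \<in> MArr MC \<and> f'' \<in> Mor OC \<and> Tgt MC \<phi>' = Dom OC f'' \<and> Act MC f'' \<phi>' = \<alpha>
        \<and> Fib OC f'' = Tgt MC \<beta> \<and> MFibM MC \<phi>' f'' = \<beta>"
  have "\<exists>!(\<phi>', f''). ?P \<phi>' f''"
    by (rule MB[unfolded weak_blow_up_mod_def, rule_format, OF assms(3) b(1) assms(5)])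
  then obtain \<phi>' f'' where P: "?P \<phi>' f''" and u: "\<And>x y. ?P x y \<Longrightarrow> x = \<phi>' \<and> y = f''" by blast
  show ?case
  proof (rule ex1I[of _ "([], \<phi>', f'')"])
    show "isblow \<alpha> [] T \<beta> ([], \<phi>', f'')" using P b by (simp add: isblow_def)
    fix p assume p: "isblow \<alpha> [] T \<beta> p"
    obtain fs' \<beta>' h where p': "p = (fs', \<beta>', h)" by (cases p)
    have "fs' = []" using p by (simp add: isblow_def p' ftl_inverse)
    moreover from this have "?P \<beta>' h" using p b by (simp add: isblow_def p')
    ultimately show "p = ([], \<phi>', f'')" using u p' by blast
  qed
next
  case (Cons f fs)
  then have f: "f \<in> Mor OC" "Cod OC f = T" "tw fs (Dom OC f) \<beta>" by auto
  from Cons.IH[OF f(3)] obtain fs1 \<beta>1 h1 where B: "isblow \<alpha> fs (Dom OC f) \<beta> (fs1, \<beta>1, h1)"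
    and uB: "\<And>p. isblow \<alpha> fs (Dom OC f) \<beta> p \<Longrightarrow> p = (fs1, \<beta>1, h1)" by (metis prod_cases3)
  have h1: "h1 \<in> Mor OC" "tw fs1 (Dom OC h1) \<beta>1" "Act MC h1 (tcomp fs1 \<beta>1) = \<alpha>"
     "Fib OC h1 = Dom OC f" "ftl h1 fs1 = fs" "MFibM MC \<beta>1 (gtot h1 fs1) = \<beta>"
    using B by (auto simp: isblow_def)
  let ?P = "\<lambda>\<phi>' f''. \<phi>' \<in> Mor OC \<and> f'' \<in> Mor OC \<and> Cod OC \<phi>' = Dom OC f'' \<and> Cmp OC f'' \<phi>' = h1
        \<and> Fib OC f'' = Cod OC f \<and> FibM OC \<phi>' f'' = f"
  have "\<exists>!(\<phi>', f''). ?P \<phi>' f''"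
    by (rule OB[unfolded weak_blow_up_def, rule_format, OF h1(1) f(1) h1(4)[symmetric]])
  then obtain \<phi>' h where P: "?P \<phi>' h" and u: "\<And>x y. ?P x y \<Longrightarrow> x = \<phi>' \<and> y = h" by blast
  have d: "Dom OC h1 = Dom OC \<phi>'" using P Dom_Cmp[of \<phi>' h] by auto
  have tc: "tcomp fs1 \<beta>1 \<in> MArr MC" "Tgt MC (tcomp fs1 \<beta>1) = Dom OC \<phi>'" using tcomp_facts[OF h1(2)] d by auto
  show ?case
  proof (rule ex1I[of _ "(\<phi>' # fs1, \<beta>1, h)"])
    show "isblow \<alpha> (f # fs) T \<beta> (\<phi>' # fs1, \<beta>1, h)"
      using P h1 d f(2) Act_Cmp[OF tc(1), of \<phi>' h] tc(2) by (simp add: isblow_def)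
    fix p assume p: "isblow \<alpha> (f # fs) T \<beta> p"
    obtain fs' \<beta>' h' where p': "p = (fs', \<beta>', h')" by (cases p)
    obtain f0 fs0 where fs': "fs' = f0 # fs0" using p by (cases fs') (auto simp: isblow_def p')
    have q: "h' \<in> Mor OC" "f0 \<in> Mor OC" "Cod OC f0 = Dom OC h'" "tw fs0 (Dom OC f0) \<beta>'"
      "Act MC h' (Act MC f0 (tcomp fs0 \<beta>')) = \<alpha>" "Fib OC h' = T" "FibM OC f0 h' = f"
      "ftl (Cmp OC h' f0) fs0 = fs" "MFibM MC \<beta>' (gtot (Cmp OC h' f0) fs0) = \<beta>"
      using p by (auto simp: isblow_def p' fs')
    have "isblow \<alpha> fs (Dom OC f) \<beta> (fs0, \<beta>', Cmp OC h' f0)"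
      using q tcomp_facts[OF q(4)] Dom_FibM[OF q(2,1,3)] by (auto simp: isblow_def facts Act_Cmp)
    from uB[OF this] have e: "fs0 = fs1" "\<beta>' = \<beta>1" "Cmp OC h' f0 = h1" by auto
    then have "?P f0 h'" using q f(2) by simp
    from u[OF this] show "p = (\<phi>' # fs1, \<beta>1, h)" by (simp add: p' fs' e)
  qed
qed

text \<open>Both \<open>(f, h)\<close> and \<open>(id, h f)\<close> factor \<open>h f\<close> and
  induce the identity on its fiber, so uniqueness of blow-ups identifies them.\<close>

lemma blow_Idn:
  assumes OB: "weak_blow_up OC" and f: "f \<in> Mor OC" "h \<in> Mor OC" "Cod OC f = Dom OC h"
    and id: "FibM OC f h = Idn OC (Dom OC (FibM OC f h))"
  shows "f = Idn OC (Dom OC f)"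
proof -
  let ?g = "Cmp OC h f"
  have g: "?g \<in> Mor OC" "Dom OC ?g = Dom OC f" using f by (simp_all add: facts)
  have D: "Dom OC (FibM OC f h) = Fib OC ?g" using f by (simp add: facts)
  let ?\<phi> = "Idn OC (Fib OC ?g)"
  have i: "?\<phi> \<in> Mor OC" "Dom OC ?\<phi> = Fib OC ?g" "Cod OC ?\<phi> = Fib OC ?g" using g by (simp_all add: facts)
  have "\<exists>!(\<phi>', f''). \<phi>' \<in> Mor OC \<and> f'' \<in> Mor OC \<and> Cod OC \<phi>' = Dom OC f'' \<and> Cmp OC f'' \<phi>' = ?g
        \<and> Fib OC f'' = Cod OC ?\<phi> \<and> FibM OC \<phi>' f'' = ?\<phi>"
    by (rule OB[unfolded weak_blow_up_def, rule_format, OF g(1) i(1,2)])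
  moreover have "f \<in> Mor OC \<and> h \<in> Mor OC \<and> Cod OC f = Dom OC h \<and> Cmp OC h f = ?g
        \<and> Fib OC h = Cod OC ?\<phi> \<and> FibM OC f h = ?\<phi>"
  proof -
    have "FibM OC f h = ?\<phi>" using id D by simp
    moreover from this have "Fib OC h = Cod OC ?\<phi>" using Cod_FibM[OF f] by simp
    ultimately show ?thesis using f by simp
  qed
  moreover have "Idn OC (Dom OC f) \<in> Mor OC \<and> ?g \<in> Mor OC \<and> Cod OC (Idn OC (Dom OC f)) = Dom OC ?g
        \<and> Cmp OC ?g (Idn OC (Dom OC f)) = ?g \<and> Fib OC ?g = Cod OC ?\<phi> \<and> FibM OC (Idn OC (Dom OC f)) ?g = ?\<phi>"
    using g i f Cmp_Idn_right[OF g(1)] FibM_Idn[OF g(1)] by (simp add: facts)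
  ultimately show ?thesis by blast
qed

end

subsection \<open>Multilinear maps with a distinguished first slot\<close>

lemma multilin_Cons:
  assumes "\<And>x. x \<in> carrier A \<Longrightarrow> multilin R Vs B T (\<lambda>(xs, y). \<phi> (x # xs, y))"
    and "\<And>xs y. (xs, y) \<in> tuples Vs B \<Longrightarrow> lin_map R A T (\<lambda>x. \<phi> (x # xs, y))"
  shows "multilin R (A # Vs) B T \<phi>"
proof (rule multilinI)
  have *: "\<exists>a vs. xs = a # vs \<and> a \<in> carrier A \<and> (vs, y) \<in> tuples Vs B"
    if "(xs, y) \<in> tuples (A # Vs) B" for xs y
    using that by (auto simp: tuples_iff list_all2_Cons2)
  fix xs y assume t: "(xs, y) \<in> tuples (A # Vs) B"
  from *[OF t] obtain a vs where xs: "xs = a # vs" "a \<in> carrier A" "(vs, y) \<in> tuples Vs B" by blast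
  show "lin_map R B T (\<lambda>b. \<phi> (xs, b))"
    using multilinD(2)[OF assms(1)[OF xs(2)] xs(3)] by (simp add: xs(1))
  fix j assume j: "j < length (A # Vs)"
  show "lin_map R ((A # Vs) ! j) T (\<lambda>a. \<phi> (xs[j := a], y))"
  proof (cases j)
    case 0
    then show ?thesis using assms(2)[OF xs(3)] by (simp add: xs(1))
  next
    case (Suc j')
    then show ?thesis using multilinD(1)[OF assms(1)[OF xs(2)] xs(3), of j'] j by (simp add: xs(1))
  qed
qed

lemma multilin_fix_head:
  assumes "multilin R (A # Vs) B T \<phi>" "a \<in> carrier A"
  shows "multilin R Vs B T (\<lambda>(xs, y). \<phi> (a # xs, y))"
  using multilin_insert[where Us = "[]" and i = 0, of R A Vs B T \<phi> a] assms by simp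

context bar_setting
begin

definition rfacs :: "'a list \<Rightarrow> int list \<Rightarrow> ('r, 'p) module list" where
  "rfacs fs ks = map2 (Pm Q) (map (Fib OC) fs) ks"

text \<open>The data of a generator with its head \<open>t_0\<close> split off, since the module
  action changes no other entry.\<close>

definition pg :: "nat \<Rightarrow> 'l \<Rightarrow> int \<Rightarrow> 'a list \<Rightarrow> 'o \<Rightarrow> 'q \<Rightarrow> int \<Rightarrow> int list \<Rightarrow> int \<Rightarrow> 'p \<Rightarrow> 'p list \<Rightarrow> 'm \<Rightarrow> bool" where
  "pg n L k fs T \<beta> k0 ks l x xs m \<longleftrightarrow> length fs = n \<and> length ks = n \<and> Src MC \<beta> = L \<and> tw fs T \<beta>
     \<and> k0 + sum_list ks + l = k \<and> x \<in> carrier (Pm Q T k0) \<and> (xs, m) \<in> tuples (rfacs fs ks) (Mm N (MFib MC \<beta>) l)"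

lemma BI_Cons: "((fs, \<beta>), k0 # ks, l) \<in> BI n L k \<longleftrightarrow> length fs = n \<and> length ks = n \<and> Src MC \<beta> = L
    \<and> tw fs (vert OC MC (fs, \<beta>) 0) \<beta> \<and> k0 + sum_list ks + l = k"
  by (auto simp: bar_index_def towers_tw)

lemma facs_Cons: "facs ((fs, \<beta>), k0 # ks, l) = Pm Q (vert OC MC (fs, \<beta>) 0) k0 # rfacs fs ks"
  by (simp add: facs_def bar_facs_def rfacs_def)

lemma endm_eq: "endm ((fs, \<beta>), ks, l) = Mm N (MFib MC \<beta>) l"
  by (simp add: endm_def)

lemma pg_gen:
  "pg n L k fs T \<beta> k0 ks l x xs m \<Longrightarrow> ((fs, \<beta>), k0 # ks, l) \<in> BI n L k"
  "pg n L k fs T \<beta> k0 ks l x xs m \<Longrightarrow> (x # xs, m) \<in> tuples (facs ((fs, \<beta>), k0 # ks, l)) (endm ((fs, \<beta>), k0 # ks, l))"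
  unfolding pg_def BI_Cons facs_Cons endm_eq by (simp_all add: tw_vert[of fs T \<beta>] tuples_iff)

lemma pg_cover:
  assumes "\<iota> \<in> BI n L k" "t \<in> tuples (facs \<iota>) (endm \<iota>)"
  obtains fs T \<beta> k0 ks l x xs m where "pg n L k fs T \<beta> k0 ks l x xs m" "\<iota> = ((fs, \<beta>), k0 # ks, l)" "t = (x # xs, m)"
proof -
  obtain fs \<beta> ks' l where i: "\<iota> = ((fs, \<beta>), ks', l)" by (metis prod.exhaust)
  obtain xs' m where t: "t = (xs', m)" by (cases t)
  obtain k0 ks where ks: "ks' = k0 # ks" using assms(1) by (cases ks') (auto simp: i bar_index_def)
  obtain x xs where xs: "xs' = x # xs" using assms(2) by (cases xs') (auto simp: t i ks facs_Cons tuples_def)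
  have "pg n L k fs (vert OC MC (fs, \<beta>) 0) \<beta> k0 ks l x xs m"
    using assms by (auto simp: pg_def i t ks xs BI_Cons facs_Cons endm_eq tuples_iff)
  then show ?thesis using that i t ks xs by blast
qed

lemma bar_pg_ext:
  assumes "module R T" "lin_map R (Bar n L k) T f" "lin_map R (Bar n L k) T g"
    and "\<And>fs S \<beta> k0 ks l x xs m. pg n L k fs S \<beta> k0 ks l x xs m
      \<Longrightarrow> f (gen n L k ((fs, \<beta>), k0 # ks, l) (x # xs, m)) = g (gen n L k ((fs, \<beta>), k0 # ks, l) (x # xs, m))"
    and "x \<in> carrier (Bar n L k)"
  shows "f x = g x"
proof (rule bar_ext[OF assms(1-3) _ assms(5)])
  fix \<iota> t assume "\<iota> \<in> BI n L k" "t \<in> tuples (facs \<iota>) (endm \<iota>)"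
  then show "f (gen n L k \<iota> t) = g (gen n L k \<iota> t)" by (rule pg_cover) (simp add: assms(4))
qed

lemma gen_pg_closed: "pg n L k fs T \<beta> k0 ks l x xs m \<Longrightarrow> gen n L k ((fs, \<beta>), k0 # ks, l) (x # xs, m) \<in> carrier (Bar n L k)"
  by (rule gen_closed[OF pg_gen])

lemma bar_pg_mlI:
  assumes "\<And>fs T \<beta> k0 ks l. \<lbrakk>length fs = n; length ks = n; Src MC \<beta> = L; tw fs T \<beta>; k0 + sum_list ks + l = k\<rbrakk>
    \<Longrightarrow> multilin R (Pm Q T k0 # rfacs fs ks) (Mm N (MFib MC \<beta>) l) S (\<phi> ((fs, \<beta>), k0 # ks, l))"
  shows "bar_ml n L k S \<phi>"
  unfolding bar_ml_def
proof
  fix \<iota> assume \<iota>: "\<iota> \<in> BI n L k"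
  obtain fs \<beta> ks' l where i: "\<iota> = ((fs, \<beta>), ks', l)" by (metis prod.exhaust)
  obtain k0 ks where ks: "ks' = k0 # ks" using \<iota> by (cases ks') (auto simp: i bar_index_def)
  show "multilin R (facs \<iota>) (endm \<iota>) S (\<phi> \<iota>)"
    using \<iota> assms[of fs ks \<beta> "vert OC MC (fs, \<beta>) 0" k0 l] by (simp add: i ks BI_Cons facs_Cons endm_eq)
qed

lemma gen_pg_ml:
  assumes "length fs = n" "length ks = n" "Src MC \<beta> = L" "tw fs T \<beta>" "k0 + sum_list ks + l = k"
  shows "multilin R (Pm Q T k0 # rfacs fs ks) (Mm N (MFib MC \<beta>) l) (Bar n L k) (gen n L k ((fs, \<beta>), k0 # ks, l))"
proof -
  have "((fs, \<beta>), k0 # ks, l) \<in> BI n L k" using assms tw_vert[OF assms(4)] by (simp add: BI_Cons)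
  then show ?thesis
    using gen_ml tw_vert[OF assms(4)] unfolding bar_ml_def by (fastforce simp: facs_Cons endm_eq)
qed

lemma rfacs_ftl: "tw fs (Dom OC g) \<beta> \<Longrightarrow> g \<in> Mor OC \<Longrightarrow> rfacs (ftl g fs) ks = rfacs fs ks"
  unfolding rfacs_def by (simp add: ftl_tw(3))

end

section \<open>The bar construction in a fixed simplicial degree as a module\<close>

text \<open>The quotients of the bar construction by \<open>0\<close> and by the degenerate part are treated together:
  \<open>bad fs ks xs\<close> singles out the generators that are divided out.\<close>

locale bar_module_structure = bar_setting R OC MC Q N
  for R :: "('r, 's) ring_scheme" and OC :: "('o, 'a) opcat"
    and MC :: "('o, 'a, 'l, 'q) opmod" and Q :: "('r, 'o, 'a, 'p) operad"
    and N :: "('r, 'l, 'q, 'p, 'm) pmodule" +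
  fixes n :: nat and bad :: "'a list \<Rightarrow> int list \<Rightarrow> 'p list \<Rightarrow> bool"
  assumes OB: "weak_blow_up OC" and MB: "weak_blow_up_mod OC MC"
    and bad_ftl: "\<lbrakk>tw fs (Dom OC g) \<beta>; g \<in> Mor OC; length ks = length fs; length xs = length fs\<rbrakk>
      \<Longrightarrow> bad (ftl g fs) ks xs \<longleftrightarrow> bad fs ks xs"
begin

definition Dgens :: "'l \<Rightarrow> int \<Rightarrow> ('r, 'a, 'q, 'p, 'm) bar_elt set" where
  "Dgens L k = {gen n L k ((fs, \<beta>), k0 # ks, l) (x # xs, m) |fs T \<beta> k0 ks l x xs m.
     pg n L k fs T \<beta> k0 ks l x xs m \<and> bad fs ks xs}"

definition Dsub :: "'l \<Rightarrow> int \<Rightarrow> ('r, 'a, 'q, 'p, 'm) bar_elt set" where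
  "Dsub L k = submod_span R (Bar n L k) (Dgens L k)"

lemma Dgens_subset: "Dgens L k \<subseteq> carrier (Bar n L k)"
  using gen_pg_closed by (auto simp: Dgens_def)

lemma Dsub_submodule: "submodule (Dsub L k) R (Bar n L k)"
  unfolding Dsub_def by (rule submod_span_submodule[OF bar_module Dgens_subset])

lemma Dsub_gen: "pg n L k fs T \<beta> k0 ks l x xs m \<Longrightarrow> bad fs ks xs
    \<Longrightarrow> gen n L k ((fs, \<beta>), k0 # ks, l) (x # xs, m) \<in> Dsub L k"
  unfolding Dsub_def by (rule subsetD[OF submod_span_superset]) (unfold Dgens_def, blast)

lemma Dsub_image:
  assumes "module R S" "lin_map R (Bar n L k) S f" "submodule K R S"
    and "\<And>fs T \<beta> k0 ks l x xs m. pg n L k fs T \<beta> k0 ks l x xs m \<Longrightarrow> bad fs ks xs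
      \<Longrightarrow> f (gen n L k ((fs, \<beta>), k0 # ks, l) (x # xs, m)) \<in> K"
    and "y \<in> Dsub L k"
  shows "f y \<in> K"
proof -
  have "f ` Dsub L k \<subseteq> K"
    unfolding Dsub_def
    by (rule lin_map_span_subset[OF bar_module assms(1-3) Dgens_subset]) (auto simp: Dgens_def intro: assms(4))
  then show ?thesis using assms(5) by blast
qed

definition blowup :: "'q \<Rightarrow> 'a list \<Rightarrow> 'q \<Rightarrow> 'a list \<times> 'q \<times> 'a" where
  "blowup \<alpha> fs \<beta> = (THE p. isblow \<alpha> fs (vert OC MC (fs, \<beta>) 0) \<beta> p)"

lemma blowup_eqI:
  assumes "\<alpha> \<in> MArr MC" "tw fs T \<beta>" "Src MC \<beta> = MFib MC \<alpha>" "isblow \<alpha> fs T \<beta> p"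
  shows "blowup \<alpha> fs \<beta> = p"
  unfolding blowup_def tw_vert[OF assms(2)]
  by (rule the1_equality[OF blow_tower[OF OB MB assms(1-3)] assms(4)])

lemma blowup_obtain:
  assumes "\<alpha> \<in> MArr MC" "tw fs T \<beta>" "Src MC \<beta> = MFib MC \<alpha>"
  obtains fs' \<beta>' h where "blowup \<alpha> fs \<beta> = (fs', \<beta>', h)" "h \<in> Mor OC" "tw fs' (Dom OC h) \<beta>'"
    "Act MC h (tcomp fs' \<beta>') = \<alpha>" "Fib OC h = T" "ftl h fs' = fs" "MFibM MC \<beta>' (gtot h fs') = \<beta>"
    "Cod OC h = Tgt MC \<alpha>" "Src MC \<beta>' = Src MC \<alpha>" "length fs' = length fs" "MFib MC \<beta>' = MFib MC \<beta>"
    "\<forall>ks. rfacs fs' ks = rfacs fs ks"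
proof -
  obtain p where p: "isblow \<alpha> fs T \<beta> p" using blow_tower[OF OB MB assms] by blast
  obtain fs' \<beta>' h where p': "p = (fs', \<beta>', h)" by (cases p)
  have q: "h \<in> Mor OC" "tw fs' (Dom OC h) \<beta>'" "Act MC h (tcomp fs' \<beta>') = \<alpha>"
     "Fib OC h = T" "ftl h fs' = fs" "MFibM MC \<beta>' (gtot h fs') = \<beta>"
    using p by (auto simp: isblow_def p')
  note t = tcomp_facts[OF q(2)]
  show ?thesis
  proof (rule that[OF blowup_eqI[OF assms p, unfolded p'] q])
    show "Cod OC h = Tgt MC \<alpha>" "Src MC \<beta>' = Src MC \<alpha>"
      using Tgt_Act[of "tcomp fs' \<beta>'" h] Src_Act[of "tcomp fs' \<beta>'" h] q(1,3) t by auto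
    show "length fs' = length fs" using ftl_inverse(2)[of h fs'] q(5) by simp
    show "MFib MC \<beta>' = MFib MC \<beta>" using ftl_tw(4)[OF q(2,1)] q(6) by simp
    show "\<forall>ks. rfacs fs' ks = rfacs fs ks" using rfacs_ftl[OF q(2,1)] q(5) by simp
  qed
qed

text \<open>No Koszul sign is inserted for moving \<open>q\<close> past the other entries: the
  module axioms reduce to identities for the head alone and hold in this form.\<close>

definition nub_fun :: "'q \<Rightarrow> int \<Rightarrow> int \<Rightarrow> 'p \<Rightarrow> ('a, 'q) bar_idx \<Rightarrow> 'p list \<times> 'm \<Rightarrow> ('r, 'a, 'q, 'p, 'm) bar_elt" where
  "nub_fun \<alpha> i j q = (\<lambda>((fs, \<beta>), ks, l) (xs, m). case blowup \<alpha> fs \<beta> of (fs', \<beta>', h) \<Rightarrow>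
     gen n (Src MC \<alpha>) (i + j) ((fs', \<beta>'), (hd ks + j) # tl ks, l) (gam Q h (hd ks) j (hd xs) q # tl xs, m))"

definition nub :: "'q \<Rightarrow> int \<Rightarrow> int \<Rightarrow> ('r, 'a, 'q, 'p, 'm) bar_elt \<Rightarrow> 'p \<Rightarrow> ('r, 'a, 'q, 'p, 'm) bar_elt" where
  "nub \<alpha> i j x q = lift n (MFib MC \<alpha>) i (Bar n (Src MC \<alpha>) (i + j)) (nub_fun \<alpha> i j q) x"

lemma nub_ml:
  assumes "\<alpha> \<in> MArr MC" "q \<in> carrier (Pm Q (Tgt MC \<alpha>) j)"
  shows "bar_ml n (MFib MC \<alpha>) i (Bar n (Src MC \<alpha>) (i + j)) (nub_fun \<alpha> i j q)"
proof (rule bar_pg_mlI)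
  fix fs T \<beta> k0 ks l
  assume a: "length fs = n" "length ks = n" "Src MC \<beta> = MFib MC \<alpha>" "tw fs T \<beta>" "k0 + sum_list ks + l = i"
  obtain fs' \<beta>' h where b: "blowup \<alpha> fs \<beta> = (fs', \<beta>', h)" "h \<in> Mor OC" "tw fs' (Dom OC h) \<beta>'"
    "Act MC h (tcomp fs' \<beta>') = \<alpha>" "Fib OC h = T" "ftl h fs' = fs" "MFibM MC \<beta>' (gtot h fs') = \<beta>"
    "Cod OC h = Tgt MC \<alpha>" "Src MC \<beta>' = Src MC \<alpha>" "length fs' = length fs" "MFib MC \<beta>' = MFib MC \<beta>"
    "\<forall>ks. rfacs fs' ks = rfacs fs ks" by (rule blowup_obtain[OF assms(1) a(4,3)])
  have g: "lin_map R (Pm Q T k0) (Pm Q (Dom OC h) (k0 + j)) (\<lambda>x. gam Q h k0 j x q)"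
    using gam_bilin[OF b(2), of k0 j] assms(2) by (simp add: bilin_map_def b(5,8))
  have "multilin R (Pm Q (Dom OC h) (k0 + j) # rfacs fs ks) (Mm N (MFib MC \<beta>) l) (Bar n (Src MC \<alpha>) (i + j))
     (gen n (Src MC \<alpha>) (i + j) ((fs', \<beta>'), (k0 + j) # ks, l))"
    using gen_pg_ml[of fs' n ks \<beta>' "Src MC \<alpha>" "Dom OC h" "k0 + j" l "i + j"] a b by (simp add: add.commute)
  from multilin_head[OF this g]
  show "multilin R (Pm Q T k0 # rfacs fs ks) (Mm N (MFib MC \<beta>) l) (Bar n (Src MC \<alpha>) (i + j)) (nub_fun \<alpha> i j q ((fs, \<beta>), k0 # ks, l))"
    by (simp add: nub_fun_def b(1) case_prod_unfold)
qed

lemma nub_lin: "\<alpha> \<in> MArr MC \<Longrightarrow> q \<in> carrier (Pm Q (Tgt MC \<alpha>) j)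
    \<Longrightarrow> lin_map R (Bar n (MFib MC \<alpha>) i) (Bar n (Src MC \<alpha>) (i + j)) (\<lambda>x. nub \<alpha> i j x q)"
  unfolding nub_def by (rule lift_lin[OF bar_module nub_ml])

lemma nub_gen:
  assumes "\<alpha> \<in> MArr MC" "q \<in> carrier (Pm Q (Tgt MC \<alpha>) j)" "pg n (MFib MC \<alpha>) i fs T \<beta> k0 ks l x xs m"
    "blowup \<alpha> fs \<beta> = (fs', \<beta>', h)"
  shows "nub \<alpha> i j (gen n (MFib MC \<alpha>) i ((fs, \<beta>), k0 # ks, l) (x # xs, m)) q
    = gen n (Src MC \<alpha>) (i + j) ((fs', \<beta>'), (k0 + j) # ks, l) (gam Q h k0 j x q # xs, m)"
  unfolding nub_def lift_gen[OF bar_module nub_ml[OF assms(1,2)] pg_gen[OF assms(3)]]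
  by (simp add: nub_fun_def assms(4))

lemma nub_pg:
  assumes "\<alpha> \<in> MArr MC" "q \<in> carrier (Pm Q (Tgt MC \<alpha>) j)" "pg n (MFib MC \<alpha>) i fs T \<beta> k0 ks l x xs m"
    "blowup \<alpha> fs \<beta> = (fs', \<beta>', h)"
  shows "pg n (Src MC \<alpha>) (i + j) fs' (Dom OC h) \<beta>' (k0 + j) ks l (gam Q h k0 j x q) xs m"
    and "bad fs' ks xs \<longleftrightarrow> bad fs ks xs"
proof -
  note p = assms(3)[unfolded pg_def]
  have t: "tw fs T \<beta>" "Src MC \<beta> = MFib MC \<alpha>" using p by auto
  obtain fs2 \<beta>2 h2 where b: "blowup \<alpha> fs \<beta> = (fs2, \<beta>2, h2)" "h2 \<in> Mor OC" "tw fs2 (Dom OC h2) \<beta>2"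
    "Act MC h2 (tcomp fs2 \<beta>2) = \<alpha>" "Fib OC h2 = T" "ftl h2 fs2 = fs" "MFibM MC \<beta>2 (gtot h2 fs2) = \<beta>"
    "Cod OC h2 = Tgt MC \<alpha>" "Src MC \<beta>2 = Src MC \<alpha>" "length fs2 = length fs" "MFib MC \<beta>2 = MFib MC \<beta>"
    "\<forall>ks. rfacs fs2 ks = rfacs fs ks" by (rule blowup_obtain[OF assms(1) t])
  have e: "fs2 = fs'" "\<beta>2 = \<beta>'" "h2 = h" using b(1) assms(4) by auto
  show "pg n (Src MC \<alpha>) (i + j) fs' (Dom OC h) \<beta>' (k0 + j) ks l (gam Q h k0 j x q) xs m"
    using p b(2-) gam_closed[OF b(2), of x k0 q j] assms(2) unfolding e pg_def by auto
  have "length xs = length fs" "length ks = length fs" using p by (auto simp: tuples_def rfacs_def)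
  then show "bad fs' ks xs \<longleftrightarrow> bad fs ks xs" using bad_ftl[OF b(3,2), of ks xs] b(6,10) unfolding e by simp
qed

lemma nub_bilin:
  assumes \<alpha>: "\<alpha> \<in> MArr MC"
  shows "bilin_map R (Bar n (MFib MC \<alpha>) i) (Pm Q (Tgt MC \<alpha>) j) (Bar n (Src MC \<alpha>) (i + j)) (nub \<alpha> i j)"
  unfolding bilin_map_def
proof (intro conjI ballI nub_lin \<alpha>)
  let ?P = "Pm Q (Tgt MC \<alpha>) j" and ?B = "Bar n (Src MC \<alpha>) (i + j)" and ?A = "Bar n (MFib MC \<alpha>) i"
  interpret P: module R ?P using \<alpha> by (intro Pm_module) (simp add: facts)
  interpret B: module R ?B by (rule bar_module)
  fix x assume x: "x \<in> carrier ?A"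
  \<comment> \<open>The element \<open>q\<close> enters only through the head slot of the generator,
    so linearity in \<open>q\<close> is that of the operad operation followed by linearity in this
    slot.\<close>
  have key: "lin_map R ?P ?B (\<lambda>q. gen n (Src MC \<alpha>) (i + j) ((fs', \<beta>'), (k0 + j) # ks, l) (gam Q h k0 j x q # xs, m))"
    if pg: "pg n (MFib MC \<alpha>) i fs T \<beta> k0 ks l x xs m" and bl: "blowup \<alpha> fs \<beta> = (fs', \<beta>', h)"
    for fs T \<beta> k0 ks l x xs m fs' \<beta>' h
  proof -
    note p = pg[unfolded pg_def]
    have t: "tw fs T \<beta>" "Src MC \<beta> = MFib MC \<alpha>" using p by auto
    obtain fs2 \<beta>2 h2 where b: "blowup \<alpha> fs \<beta> = (fs2, \<beta>2, h2)" "h2 \<in> Mor OC" "tw fs2 (Dom OC h2) \<beta>2"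
      "Act MC h2 (tcomp fs2 \<beta>2) = \<alpha>" "Fib OC h2 = T" "ftl h2 fs2 = fs" "MFibM MC \<beta>2 (gtot h2 fs2) = \<beta>"
      "Cod OC h2 = Tgt MC \<alpha>" "Src MC \<beta>2 = Src MC \<alpha>" "length fs2 = length fs" "MFib MC \<beta>2 = MFib MC \<beta>"
      "\<forall>ks. rfacs fs2 ks = rfacs fs ks" by (rule blowup_obtain[OF \<alpha> t])
    have e: "fs2 = fs'" "\<beta>2 = \<beta>'" "h2 = h" using b(1) bl by auto
    have g: "lin_map R ?P (Pm Q (Dom OC h) (k0 + j)) (gam Q h k0 j x)"
      using gam_bilin[OF b(2), of k0 j] p b(5,8) unfolding e bilin_map_def by simp
    have z: "\<zero>\<^bsub>?P\<^esub> \<in> carrier ?P" by simp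
    have "multilin R (Pm Q (Dom OC h) (k0 + j) # rfacs fs ks) (Mm N (MFib MC \<beta>) l) ?B
       (gen n (Src MC \<alpha>) (i + j) ((fs', \<beta>'), (k0 + j) # ks, l))"
      using gen_pg_ml[of fs' n ks \<beta>' "Src MC \<alpha>" "Dom OC h" "k0 + j" l "i + j"] p b(2-) unfolding e
      by (simp add: add.commute)
    from multilinD(1)[OF this, of "gam Q h k0 j x \<zero>\<^bsub>?P\<^esub> # xs" m 0]
    have "lin_map R (Pm Q (Dom OC h) (k0 + j)) ?B (\<lambda>a. gen n (Src MC \<alpha>) (i + j) ((fs', \<beta>'), (k0 + j) # ks, l) (a # xs, m))"
      using p lin_map_closed[OF g z] by (simp add: tuples_iff)
    from lin_map_compose[OF g this] show ?thesis .
  qed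
  show "lin_map R ?P ?B (nub \<alpha> i j x)"
  proof (rule lin_mapI)
    fix p q assume p: "p \<in> carrier ?P" and q: "q \<in> carrier ?P"
    show "nub \<alpha> i j x p \<in> carrier ?B" by (rule lin_map_closed[OF nub_lin[OF \<alpha> p] x])
    show "nub \<alpha> i j x (p \<oplus>\<^bsub>?P\<^esub> q) = nub \<alpha> i j x p \<oplus>\<^bsub>?B\<^esub> nub \<alpha> i j x q"
    proof (rule bar_pg_ext[OF bar_module nub_lin[OF \<alpha>] _ _ x])
      show "p \<oplus>\<^bsub>?P\<^esub> q \<in> carrier ?P" using p q by simp
      show "lin_map R ?A ?B (\<lambda>x. nub \<alpha> i j x p \<oplus>\<^bsub>?B\<^esub> nub \<alpha> i j x q)"
        by (rule lin_map_plus[OF bar_module bar_module nub_lin[OF \<alpha> p] nub_lin[OF \<alpha> q]])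
      fix fs S \<beta> k0 ks l y xs m assume pg: "pg n (MFib MC \<alpha>) i fs S \<beta> k0 ks l y xs m"
      obtain fs' \<beta>' h where bl: "blowup \<alpha> fs \<beta> = (fs', \<beta>', h)" by (metis prod_cases3)
      show "nub \<alpha> i j (gen n (MFib MC \<alpha>) i ((fs, \<beta>), k0 # ks, l) (y # xs, m)) (p \<oplus>\<^bsub>?P\<^esub> q)
        = nub \<alpha> i j (gen n (MFib MC \<alpha>) i ((fs, \<beta>), k0 # ks, l) (y # xs, m)) p
         \<oplus>\<^bsub>?B\<^esub> nub \<alpha> i j (gen n (MFib MC \<alpha>) i ((fs, \<beta>), k0 # ks, l) (y # xs, m)) q"
        using p q by (simp add: nub_gen[OF \<alpha> _ pg bl] lin_map_add[OF key[OF pg bl]])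
    qed
  next
    fix r p assume r: "r \<in> carrier R" and p: "p \<in> carrier ?P"
    show "nub \<alpha> i j x (r \<odot>\<^bsub>?P\<^esub> p) = r \<odot>\<^bsub>?B\<^esub> nub \<alpha> i j x p"
    proof (rule bar_pg_ext[OF bar_module nub_lin[OF \<alpha>] _ _ x])
      show "r \<odot>\<^bsub>?P\<^esub> p \<in> carrier ?P" using r p by simp
      show "lin_map R ?A ?B (\<lambda>x. r \<odot>\<^bsub>?B\<^esub> nub \<alpha> i j x p)"
        by (rule lin_map_scale[OF bar_module bar_module nub_lin[OF \<alpha> p] r])
      fix fs S \<beta> k0 ks l y xs m assume pg: "pg n (MFib MC \<alpha>) i fs S \<beta> k0 ks l y xs m"
      obtain fs' \<beta>' h where bl: "blowup \<alpha> fs \<beta> = (fs', \<beta>', h)" by (metis prod_cases3)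
      show "nub \<alpha> i j (gen n (MFib MC \<alpha>) i ((fs, \<beta>), k0 # ks, l) (y # xs, m)) (r \<odot>\<^bsub>?P\<^esub> p)
        = r \<odot>\<^bsub>?B\<^esub> nub \<alpha> i j (gen n (MFib MC \<alpha>) i ((fs, \<beta>), k0 # ks, l) (y # xs, m)) p"
        using r p by (simp add: nub_gen[OF \<alpha> _ pg bl] lin_map_smult[OF key[OF pg bl]])
    qed
  qed
qed

text \<open>The old tower is the tower of fibers of the blown-up one, so \<open>bad_ftl\<close>
  transports the property of being divided out.\<close>

lemma nub_Dsub:
  assumes \<alpha>: "\<alpha> \<in> MArr MC" and q: "q \<in> carrier (Pm Q (Tgt MC \<alpha>) j)" and x: "x \<in> Dsub (MFib MC \<alpha>) i"
  shows "nub \<alpha> i j x q \<in> Dsub (Src MC \<alpha>) (i + j)"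
proof (rule Dsub_image[OF bar_module nub_lin[OF \<alpha> q] Dsub_submodule _ x])
  fix fs T \<beta> k0 ks l y xs m assume pg: "pg n (MFib MC \<alpha>) i fs T \<beta> k0 ks l y xs m" and bad: "bad fs ks xs"
  obtain fs' \<beta>' h where bl: "blowup \<alpha> fs \<beta> = (fs', \<beta>', h)" by (metis prod_cases3)
  show "nub \<alpha> i j (gen n (MFib MC \<alpha>) i ((fs, \<beta>), k0 # ks, l) (y # xs, m)) q \<in> Dsub (Src MC \<alpha>) (i + j)"
    unfolding nub_gen[OF \<alpha> q pg bl]
    by (rule Dsub_gen[OF nub_pg(1)[OF \<alpha> q pg bl]]) (simp add: nub_pg(2)[OF \<alpha> q pg bl] bad)
qed

text \<open>Both blow-ups are read off from the one along \<open>\<alpha>\<close>: its tower of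
  fibers over the codomain of \<open>g\<close> is the blow-up along
  \<open>MFibM MC \<alpha> g\<close>, and blowing that up along \<open>g \<alpha>\<close> recovers
  \<open>(fs', \<beta>')\<close>. These are the two sides compared by associativity of the
  action.\<close>

lemma blowup_step:
  assumes \<alpha>: "\<alpha> \<in> MArr MC" "g \<in> Mor OC" "Tgt MC \<alpha> = Dom OC g"
    and t: "tw fs T \<beta>" "Src MC \<beta> = MFib MC \<alpha>" and b: "blowup \<alpha> fs \<beta> = (fs', \<beta>', h)"
  shows "blowup (MFibM MC \<alpha> g) fs \<beta> = (ftl (Cmp OC g h) fs', MFibM MC \<beta>' (gtot (Cmp OC g h) fs'), FibM OC h g)"
    and "blowup (Act MC g \<alpha>) (ftl (Cmp OC g h) fs') (MFibM MC \<beta>' (gtot (Cmp OC g h) fs')) = (fs', \<beta>', Cmp OC g h)"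
proof -
  obtain fs2 \<beta>2 h2 where b2: "blowup \<alpha> fs \<beta> = (fs2, \<beta>2, h2)" "h2 \<in> Mor OC" "tw fs2 (Dom OC h2) \<beta>2"
    "Act MC h2 (tcomp fs2 \<beta>2) = \<alpha>" "Fib OC h2 = T" "ftl h2 fs2 = fs" "MFibM MC \<beta>2 (gtot h2 fs2) = \<beta>"
    "Cod OC h2 = Tgt MC \<alpha>" "Src MC \<beta>2 = Src MC \<alpha>" "length fs2 = length fs" "MFib MC \<beta>2 = MFib MC \<beta>"
    "\<forall>ks. rfacs fs2 ks = rfacs fs ks" by (rule blowup_obtain[OF \<alpha>(1) t])
  have e: "fs2 = fs'" "\<beta>2 = \<beta>'" "h2 = h" using b2(1) b by auto
  note b = b2(2-)[unfolded e]
  have c: "Cod OC h = Dom OC g" using b(7) \<alpha>(3) by simp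
  have gh: "Cmp OC g h \<in> Mor OC" "tw fs' (Dom OC (Cmp OC g h)) \<beta>'" using b(1,2) \<alpha>(2) c by (simp_all add: facts)
  note F = ftl_tw[OF gh(2,1)] and FF = ftl_ftl[OF b(2,1) \<alpha>(2) c]
  have tc: "tcomp fs' \<beta>' \<in> MArr MC" "Tgt MC (tcomp fs' \<beta>') = Dom OC h" using tcomp_facts[OF b(2)] by auto
  show "blowup (MFibM MC \<alpha> g) fs \<beta> = (ftl (Cmp OC g h) fs', MFibM MC \<beta>' (gtot (Cmp OC g h) fs'), FibM OC h g)"
  proof (rule blowup_eqI[OF _ t(1)])
    show "MFibM MC \<alpha> g \<in> MArr MC" "Src MC \<beta> = MFib MC (MFibM MC \<alpha> g)" using \<alpha> t(2) by (simp_all add: facts)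
    show "isblow (MFibM MC \<alpha> g) fs T \<beta> (ftl (Cmp OC g h) fs', MFibM MC \<beta>' (gtot (Cmp OC g h) fs'), FibM OC h g)"
      using b(1-6) \<alpha>(2) c F(1,2) FF MFibM_Act[OF tc(1) b(1) \<alpha>(2) tc(2) c]
      by (simp add: isblow_def facts)
  qed
  show "blowup (Act MC g \<alpha>) (ftl (Cmp OC g h) fs') (MFibM MC \<beta>' (gtot (Cmp OC g h) fs')) = (fs', \<beta>', Cmp OC g h)"
  proof (rule blowup_eqI[OF _ F(1)])
    have A: "Act MC (Cmp OC g h) (tcomp fs' \<beta>') = Act MC g \<alpha>"
      using Act_Cmp[OF tc(1) b(1) \<alpha>(2) tc(2) c] b(3) by simp
    show "Act MC g \<alpha> \<in> MArr MC" using \<alpha> by (simp add: facts)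
    show "Src MC (MFibM MC \<beta>' (gtot (Cmp OC g h) fs')) = MFib MC (Act MC g \<alpha>)" using F(5) A by simp
    show "isblow (Act MC g \<alpha>) (ftl (Cmp OC g h) fs') (Fib OC (Cmp OC g h)) (MFibM MC \<beta>' (gtot (Cmp OC g h) fs')) (fs', \<beta>', Cmp OC g h)"
      using gh A by (simp add: isblow_def)
  qed
qed

definition NB :: "('r, 'l, 'q, 'p, ('r, 'a, 'q, 'p, 'm) bar_elt set) pmodule" where
  "NB = \<lparr>Mm = \<lambda>L k. quot_mod (Bar n L k) (Dsub L k),
     nu = \<lambda>\<alpha> i j X q. the_elem ((\<lambda>x. Dsub (Src MC \<alpha>) (i + j) +>\<^bsub>Bar n (Src MC \<alpha>) (i + j)\<^esub> nub \<alpha> i j x q) ` X)\<rparr>"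

definition prj :: "'l \<Rightarrow> int \<Rightarrow> ('r, 'a, 'q, 'p, 'm) bar_elt \<Rightarrow> ('r, 'a, 'q, 'p, 'm) bar_elt set" where
  "prj L k x = Dsub L k +>\<^bsub>Bar n L k\<^esub> x"

lemma NB_module: "module R (Mm NB L k)"
  unfolding NB_def by (simp add: quot_module[OF bar_module Dsub_submodule])

lemma prj_lin: "lin_map R (Bar n L k) (Mm NB L k) (prj L k)"
  unfolding NB_def prj_def[abs_def] using quot_proj_lin[OF bar_module Dsub_submodule] by simp

lemma NB_carrier: "carrier (Mm NB L k) = prj L k ` carrier (Bar n L k)"
  unfolding NB_def prj_def[abs_def] using carrier_quot_mod[OF bar_module Dsub_submodule] by simp

lemma prj_zero: "x \<in> Dsub L k \<Longrightarrow> prj L k x = \<zero>\<^bsub>Mm NB L k\<^esub>"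
proof -
  assume x: "x \<in> Dsub L k"
  then have "x \<in> carrier (Bar n L k)" using module.submoduleE(1)[OF bar_module Dsub_submodule] by blast
  then show ?thesis using x
    by (simp add: NB_def prj_def quot_zero[OF bar_module Dsub_submodule] coset_eq_self_iff[OF bar_module Dsub_submodule])
qed

lemma nu_NB:
  assumes "\<alpha> \<in> MArr MC" "q \<in> carrier (Pm Q (Tgt MC \<alpha>) j)" "x \<in> carrier (Bar n (MFib MC \<alpha>) i)"
  shows "nu NB \<alpha> i j (prj (MFib MC \<alpha>) i x) q = prj (Src MC \<alpha>) (i + j) (nub \<alpha> i j x q)"
  using quot_map(2)[OF bar_module bar_module Dsub_submodule Dsub_submodule nub_lin[OF assms(1,2)]
      nub_Dsub[OF assms(1,2)] assms(3)]
  by (simp add: NB_def prj_def)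

lemma nu_NB_lin:
  assumes "\<alpha> \<in> MArr MC" "q \<in> carrier (Pm Q (Tgt MC \<alpha>) j)"
  shows "lin_map R (Mm NB (MFib MC \<alpha>) i) (Mm NB (Src MC \<alpha>) (i + j)) (\<lambda>X. nu NB \<alpha> i j X q)"
  using quot_map(1)[OF bar_module bar_module Dsub_submodule Dsub_submodule nub_lin[OF assms]
      nub_Dsub[OF assms]]
  by (simp add: NB_def)

text \<open>By \<open>blowup_step\<close> both sides live over the same tower, and the heads agree
  by associativity of the operad for \<open>h\<close> and \<open>g\<close>.\<close>

lemma nub_assoc:
  assumes \<alpha>: "\<alpha> \<in> MArr MC" "g \<in> Mor OC" "Tgt MC \<alpha> = Dom OC g" and x: "x \<in> carrier (Bar n (MFib MC \<alpha>) i)"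
    and y: "y \<in> carrier (Pm Q (Fib OC g) j)" and z: "z \<in> carrier (Pm Q (Cod OC g) k)"
  shows "nub \<alpha> i (j + k) x (gam Q g j k y z) = nub (Act MC g \<alpha>) (i + j) k (nub (MFibM MC \<alpha> g) i j x y) z"
proof -
  have yz: "gam Q g j k y z \<in> carrier (Pm Q (Tgt MC \<alpha>) (j + k))"
    using gam_closed[OF \<alpha>(2) y z] \<alpha>(3) by simp
  have A: "Act MC g \<alpha> \<in> MArr MC" "Src MC (Act MC g \<alpha>) = Src MC \<alpha>" "Tgt MC (Act MC g \<alpha>) = Cod OC g"
    using \<alpha> by (simp_all add: facts)
  have M: "MFibM MC \<alpha> g \<in> MArr MC" "Src MC (MFibM MC \<alpha> g) = MFib MC (Act MC g \<alpha>)" "Tgt MC (MFibM MC \<alpha> g) = Fib OC g"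
    "MFib MC (MFibM MC \<alpha> g) = MFib MC \<alpha>"
    using \<alpha> by (simp_all add: facts)
  have y': "y \<in> carrier (Pm Q (Tgt MC (MFibM MC \<alpha> g)) j)" and z': "z \<in> carrier (Pm Q (Tgt MC (Act MC g \<alpha>)) k)"
    using y z A M by simp_all
  have l1: "lin_map R (Bar n (MFib MC \<alpha>) i) (Bar n (Src MC \<alpha>) (i + j + k)) (\<lambda>x. nub \<alpha> i (j + k) x (gam Q g j k y z))"
    using nub_lin[OF \<alpha>(1) yz, of i] by (simp add: add.assoc)
  have l2: "lin_map R (Bar n (MFib MC \<alpha>) i) (Bar n (Src MC \<alpha>) (i + j + k))
      (\<lambda>x. nub (Act MC g \<alpha>) (i + j) k (nub (MFibM MC \<alpha> g) i j x y) z)"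
    using lin_map_compose[OF nub_lin[OF M(1) y', of i, unfolded M(2,4)] nub_lin[OF A(1) z', of "i + j"]] by (simp add: A(2))
  show ?thesis
  proof (rule bar_pg_ext[OF bar_module l1 l2 _ x])
    fix fs S \<beta> k0 ks l x0 xs m assume pg: "pg n (MFib MC \<alpha>) i fs S \<beta> k0 ks l x0 xs m"
    then have t: "tw fs S \<beta>" "Src MC \<beta> = MFib MC \<alpha>" "x0 \<in> carrier (Pm Q S k0)" by (auto simp: pg_def)
    obtain fs' \<beta>' h where b: "blowup \<alpha> fs \<beta> = (fs', \<beta>', h)" "h \<in> Mor OC" "tw fs' (Dom OC h) \<beta>'"
      "Act MC h (tcomp fs' \<beta>') = \<alpha>" "Fib OC h = S" "ftl h fs' = fs" "MFibM MC \<beta>' (gtot h fs') = \<beta>"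
      "Cod OC h = Tgt MC \<alpha>" "Src MC \<beta>' = Src MC \<alpha>" "length fs' = length fs" "MFib MC \<beta>' = MFib MC \<beta>"
      "\<forall>ks. rfacs fs' ks = rfacs fs ks" by (rule blowup_obtain[OF \<alpha>(1) t(1,2)])
    note st = blowup_step[OF \<alpha> t(1,2) b(1)]
    have pg1: "pg n (MFib MC (MFibM MC \<alpha> g)) i fs S \<beta> k0 ks l x0 xs m" using pg by (simp add: M(4))
    note pg2 = nub_pg(1)[OF M(1) y' pg1 st(1), unfolded M(2)]
    have "gam Q h k0 (j + k) x0 (gam Q g j k y z) = gam Q (Cmp OC g h) (k0 + j) k (gam Q (FibM OC h g) k0 j x0 y) z"
      using b(5,8) \<alpha>(3) t(3) y z by (intro gam_assoc b(2) \<alpha>(2)) simp_all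
    then show "nub \<alpha> i (j + k) (gen n (MFib MC \<alpha>) i ((fs, \<beta>), k0 # ks, l) (x0 # xs, m)) (gam Q g j k y z)
      = nub (Act MC g \<alpha>) (i + j) k (nub (MFibM MC \<alpha> g) i j (gen n (MFib MC \<alpha>) i ((fs, \<beta>), k0 # ks, l) (x0 # xs, m)) y) z"
      unfolding nub_gen[OF \<alpha>(1) yz pg b(1)] nub_gen[OF M(1) y' pg1 st(1), unfolded M(2,4)]
        nub_gen[OF A(1) z' pg2 st(2)] A(2)
      by (simp add: add.assoc)
  qed
qed

text \<open>For \<open>g\<close> the identity, \<open>g h = h\<close>, so \<open>blowup_step\<close>
  returns the original tower; the head is treated by right unitality.\<close>

lemma nub_unit:
  assumes \<alpha>: "\<alpha> \<in> MArr MC" and x: "x \<in> carrier (Bar n (MFib MC \<alpha>) k)"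
  shows "nub (MFibM MC \<alpha> (Idn OC (Tgt MC \<alpha>))) k 0 x (unt Q (Tgt MC \<alpha>)) = x"
proof -
  let ?T = "Tgt MC \<alpha>"
  let ?\<alpha> = "MFibM MC \<alpha> (Idn OC ?T)"
  have i: "Idn OC ?T \<in> Mor OC" "Tgt MC \<alpha> = Dom OC (Idn OC ?T)" using \<alpha> by (simp_all add: facts)
  have M: "?\<alpha> \<in> MArr MC" "Src MC ?\<alpha> = MFib MC \<alpha>" "Tgt MC ?\<alpha> = Ufib OC ?T" "MFib MC ?\<alpha> = MFib MC \<alpha>"
    using \<alpha> i by (simp_all add: facts Ufib_def)
  have u: "unt Q ?T \<in> carrier (Pm Q (Tgt MC ?\<alpha>) 0)" using unt_closed[of ?T] \<alpha> M(3) by (simp add: facts)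
  have l: "lin_map R (Bar n (MFib MC \<alpha>) k) (Bar n (MFib MC \<alpha>) k) (\<lambda>x. nub ?\<alpha> k 0 x (unt Q ?T))"
    using nub_lin[OF M(1) u, of k] by (simp add: M(2,4))
  show ?thesis
  proof (rule bar_pg_ext[OF bar_module l lin_map_ident _ x])
    fix fs S \<beta> k0 ks l x0 xs m assume pg: "pg n (MFib MC \<alpha>) k fs S \<beta> k0 ks l x0 xs m"
    then have t: "tw fs S \<beta>" "Src MC \<beta> = MFib MC \<alpha>" "x0 \<in> carrier (Pm Q S k0)" by (auto simp: pg_def)
    obtain fs' \<beta>' h where b: "blowup \<alpha> fs \<beta> = (fs', \<beta>', h)" "h \<in> Mor OC" "tw fs' (Dom OC h) \<beta>'"
      "Act MC h (tcomp fs' \<beta>') = \<alpha>" "Fib OC h = S" "ftl h fs' = fs" "MFibM MC \<beta>' (gtot h fs') = \<beta>"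
      "Cod OC h = Tgt MC \<alpha>" "Src MC \<beta>' = Src MC \<alpha>" "length fs' = length fs" "MFib MC \<beta>' = MFib MC \<beta>"
      "\<forall>ks. rfacs fs' ks = rfacs fs ks" by (rule blowup_obtain[OF \<alpha> t(1,2)])
    have ih: "Cmp OC (Idn OC ?T) h = h" using Cmp_Idn_left[OF b(2)] b(8) by simp
    note st = blowup_step(1)[OF \<alpha> i t(1,2) b(1), unfolded ih b(6,7)]
    have pg1: "pg n (MFib MC ?\<alpha>) k fs S \<beta> k0 ks l x0 xs m" using pg by (simp add: M(4))
    have "gam Q (FibM OC h (Idn OC ?T)) k0 0 x0 (unt Q ?T) = x0"
      using unt_right[OF b(2), of x0 k0] t(3) b(5,8) by simp
    then show "nub ?\<alpha> k 0 (gen n (MFib MC \<alpha>) k ((fs, \<beta>), k0 # ks, l) (x0 # xs, m)) (unt Q ?T)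
      = gen n (MFib MC \<alpha>) k ((fs, \<beta>), k0 # ks, l) (x0 # xs, m)"
      using nub_gen[OF M(1) u pg1 st] by (simp add: M(2,4))
  qed
qed

lemma NB_unital: "unital_pmodule R OC MC Q NB"
proof
  show "gr_collection R (MOb MC) (Mm NB)" by (simp add: gr_collection_def NB_module)
next
  fix \<alpha> i j assume \<alpha>: "\<alpha> \<in> MArr MC"
  show "bilin_map R (Mm NB (MFib MC \<alpha>) i) (Pm Q (Tgt MC \<alpha>) j) (Mm NB (Src MC \<alpha>) (i + j)) (nu NB \<alpha> i j)"
    unfolding bilin_map_def
  proof (intro conjI ballI nu_NB_lin \<alpha>)
    fix X assume "X \<in> carrier (Mm NB (MFib MC \<alpha>) i)"
    then obtain x where x: "X = prj (MFib MC \<alpha>) i x" "x \<in> carrier (Bar n (MFib MC \<alpha>) i)"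
      unfolding NB_carrier by (rule imageE)
    have "lin_map R (Pm Q (Tgt MC \<alpha>) j) (Bar n (Src MC \<alpha>) (i + j)) (nub \<alpha> i j x)"
      using nub_bilin[OF \<alpha>, of i j] x(2) by (simp add: bilin_map_def)
    from lin_map_compose[OF this prj_lin]
    have l: "lin_map R (Pm Q (Tgt MC \<alpha>) j) (Mm NB (Src MC \<alpha>) (i + j)) (\<lambda>q. prj (Src MC \<alpha>) (i + j) (nub \<alpha> i j x q))" .
    show "lin_map R (Pm Q (Tgt MC \<alpha>) j) (Mm NB (Src MC \<alpha>) (i + j)) (nu NB \<alpha> i j X)"
      by (rule lin_map_eqI[OF l]) (use \<alpha> nu_NB[OF \<alpha> _ x(2)] in \<open>auto simp: x(1) Pm_module facts\<close>)
  qed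
next
  fix \<alpha> g X y z i j k
  assume \<alpha>: "\<alpha> \<in> MArr MC" "g \<in> Mor OC" "Tgt MC \<alpha> = Dom OC g" and X: "X \<in> carrier (Mm NB (MFib MC \<alpha>) i)"
    and y: "y \<in> carrier (Pm Q (Fib OC g) j)" and z: "z \<in> carrier (Pm Q (Cod OC g) k)"
  from X obtain x where x: "X = prj (MFib MC \<alpha>) i x" "x \<in> carrier (Bar n (MFib MC \<alpha>) i)"
    unfolding NB_carrier by (rule imageE)
  have yz: "gam Q g j k y z \<in> carrier (Pm Q (Tgt MC \<alpha>) (j + k))"
    using gam_closed[OF \<alpha>(2) y z] \<alpha>(3) by simp
  have A: "Act MC g \<alpha> \<in> MArr MC" "Src MC (Act MC g \<alpha>) = Src MC \<alpha>" "Tgt MC (Act MC g \<alpha>) = Cod OC g"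
    using \<alpha> by (simp_all add: facts)
  have M: "MFibM MC \<alpha> g \<in> MArr MC" "Src MC (MFibM MC \<alpha> g) = MFib MC (Act MC g \<alpha>)" "Tgt MC (MFibM MC \<alpha> g) = Fib OC g"
    "MFib MC (MFibM MC \<alpha> g) = MFib MC \<alpha>"
    using \<alpha> by (simp_all add: facts)
  have y': "y \<in> carrier (Pm Q (Tgt MC (MFibM MC \<alpha> g)) j)" and z': "z \<in> carrier (Pm Q (Tgt MC (Act MC g \<alpha>)) k)"
    using y z A M by simp_all
  have n1: "nu NB (MFibM MC \<alpha> g) i j X y = prj (MFib MC (Act MC g \<alpha>)) (i + j) (nub (MFibM MC \<alpha> g) i j x y)"
    using nu_NB[OF M(1) y', of x i] x by (simp add: M(2,4))
  have c1: "nub (MFibM MC \<alpha> g) i j x y \<in> carrier (Bar n (MFib MC (Act MC g \<alpha>)) (i + j))"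
    using lin_map_closed[OF nub_lin[OF M(1) y', of i]] x(2) by (simp add: M(2,4))
  show "nu NB \<alpha> i (j + k) X (gam Q g j k y z) = nu NB (Act MC g \<alpha>) (i + j) k (nu NB (MFibM MC \<alpha> g) i j X y) z"
    unfolding x(1) n1[unfolded x(1)] nu_NB[OF A(1) z' c1] nu_NB[OF \<alpha>(1) yz x(2)] nub_assoc[OF \<alpha> x(2) y z]
    by (simp add: A(2) add.assoc)
next
  fix \<alpha> X k assume \<alpha>: "\<alpha> \<in> MArr MC" and X: "X \<in> carrier (Mm NB (MFib MC \<alpha>) k)"
  from X obtain x where x: "X = prj (MFib MC \<alpha>) k x" "x \<in> carrier (Bar n (MFib MC \<alpha>) k)"
    unfolding NB_carrier by (rule imageE)
  let ?T = "Tgt MC \<alpha>"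
  let ?\<alpha> = "MFibM MC \<alpha> (Idn OC ?T)"
  have M: "?\<alpha> \<in> MArr MC" "Src MC ?\<alpha> = MFib MC \<alpha>" "Tgt MC ?\<alpha> = Ufib OC ?T" "MFib MC ?\<alpha> = MFib MC \<alpha>"
    using \<alpha> by (simp_all add: facts Ufib_def)
  have u: "unt Q ?T \<in> carrier (Pm Q (Tgt MC ?\<alpha>) 0)" using unt_closed[of ?T] \<alpha> M(3) by (simp add: facts)
  show "nu NB ?\<alpha> k 0 X (unt Q ?T) = X"
    using nu_NB[OF M(1) u, of x k] nub_unit[OF \<alpha> x(2)] x by (simp add: M(2,4))
qed

end

section \<open>The generating collection\<close>

text \<open>Constant functions; the purpose is to give the generating collection the element type
  \<open>gen_elt\<close> prescribed by the theorem.\<close>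

definition wrap_mod :: "('r, 'x) module \<Rightarrow> ('r, 'q \<Rightarrow> 'x) module" where
  "wrap_mod M = \<lparr>carrier = (\<lambda>x _. x) ` carrier M, mult = undefined, one = undefined,
     zero = (\<lambda>_. \<zero>\<^bsub>M\<^esub>), add = (\<lambda>u v _. u undefined \<oplus>\<^bsub>M\<^esub> v undefined),
     smult = (\<lambda>r u _. r \<odot>\<^bsub>M\<^esub> u undefined)\<rparr>"

lemma wrap_module:
  fixes M :: "('r, 'x) module"
  assumes "module R M"
  shows "module R (wrap_mod M :: ('r, 'q \<Rightarrow> 'x) module)"
proof -
  interpret M: module R M by fact
  have c: "carrier (wrap_mod M :: ('r, 'q \<Rightarrow> 'x) module) = (\<lambda>x _. x) ` carrier M" by (simp add: wrap_mod_def)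
  have s: "\<zero>\<^bsub>wrap_mod M :: ('r, 'q \<Rightarrow> 'x) module\<^esub> = (\<lambda>_. \<zero>\<^bsub>M\<^esub>)" "(\<lambda>_. x) \<oplus>\<^bsub>wrap_mod M\<^esub> (\<lambda>_. y) = (\<lambda>_. x \<oplus>\<^bsub>M\<^esub> y)"
    "r \<odot>\<^bsub>wrap_mod M\<^esub> (\<lambda>_. x) = (\<lambda>_. r \<odot>\<^bsub>M\<^esub> x)" for x y r by (simp_all add: wrap_mod_def)
  show ?thesis
  proof (rule moduleI[OF M.R.cring_axioms])
    show "abelian_group (wrap_mod M :: ('r, 'q \<Rightarrow> 'x) module)"
    proof (rule abelian_groupI)
      fix u v w :: "'q \<Rightarrow> 'x" assume "u \<in> carrier (wrap_mod M)" "v \<in> carrier (wrap_mod M)" "w \<in> carrier (wrap_mod M)"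
      then obtain x y z where x: "u = (\<lambda>_. x)" "x \<in> carrier M" and y: "v = (\<lambda>_. y)" "y \<in> carrier M"
        and z: "w = (\<lambda>_. z)" "z \<in> carrier M" by (auto simp: c)
      show "u \<oplus>\<^bsub>wrap_mod M\<^esub> v \<in> carrier (wrap_mod M)" using x(2) y(2) by (simp add: x(1) y(1) s c)
      show "u \<oplus>\<^bsub>wrap_mod M\<^esub> v \<oplus>\<^bsub>wrap_mod M\<^esub> w = u \<oplus>\<^bsub>wrap_mod M\<^esub> (v \<oplus>\<^bsub>wrap_mod M\<^esub> w)"
        using x(2) y(2) z(2) by (simp add: x(1) y(1) z(1) s M.a_assoc)
      show "u \<oplus>\<^bsub>wrap_mod M\<^esub> v = v \<oplus>\<^bsub>wrap_mod M\<^esub> u"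
        using x(2) y(2) by (simp add: x(1) y(1) s M.a_comm)
      show "\<zero>\<^bsub>wrap_mod M\<^esub> \<oplus>\<^bsub>wrap_mod M\<^esub> u = u" using x(2) by (simp add: x(1) s)
      show "\<exists>v\<in>carrier (wrap_mod M). v \<oplus>\<^bsub>wrap_mod M\<^esub> u = \<zero>\<^bsub>wrap_mod M\<^esub>"
        using x(2) by (intro bexI[of _ "\<lambda>_. \<ominus>\<^bsub>M\<^esub> x"]) (simp_all add: x(1) s c M.l_neg)
    qed (simp add: c s)
  next
    fix a b and u v :: "'q \<Rightarrow> 'x"
    assume a: "a \<in> carrier R" and b: "b \<in> carrier R" and "u \<in> carrier (wrap_mod M)" "v \<in> carrier (wrap_mod M)"
    then obtain x y where x: "u = (\<lambda>_. x)" "x \<in> carrier M" and y: "v = (\<lambda>_. y)" "y \<in> carrier M"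
      by (auto simp: c)
    show "a \<odot>\<^bsub>wrap_mod M\<^esub> u \<in> carrier (wrap_mod M)" using a x(2) by (simp add: x(1) s c)
    show "(a \<oplus>\<^bsub>R\<^esub> b) \<odot>\<^bsub>wrap_mod M\<^esub> u = a \<odot>\<^bsub>wrap_mod M\<^esub> u \<oplus>\<^bsub>wrap_mod M\<^esub> b \<odot>\<^bsub>wrap_mod M\<^esub> u"
      using a b x(2) by (simp add: x(1) s M.smult_l_distr)
    show "a \<odot>\<^bsub>wrap_mod M\<^esub> (u \<oplus>\<^bsub>wrap_mod M\<^esub> v) = a \<odot>\<^bsub>wrap_mod M\<^esub> u \<oplus>\<^bsub>wrap_mod M\<^esub> a \<odot>\<^bsub>wrap_mod M\<^esub> v"
      using a x(2) y(2) by (simp add: x(1) y(1) s M.smult_r_distr)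
    show "(a \<otimes>\<^bsub>R\<^esub> b) \<odot>\<^bsub>wrap_mod M\<^esub> u = a \<odot>\<^bsub>wrap_mod M\<^esub> (b \<odot>\<^bsub>wrap_mod M\<^esub> u)"
      using a b x(2) by (simp add: x(1) s M.smult_assoc1)
  next
    fix u :: "'q \<Rightarrow> 'x" assume "u \<in> carrier (wrap_mod M)"
    then obtain x where x: "u = (\<lambda>_. x)" "x \<in> carrier M" by (auto simp: c)
    show "\<one>\<^bsub>R\<^esub> \<odot>\<^bsub>wrap_mod M\<^esub> u = u" using x(2) by (simp add: x(1) s)
  qed
qed

lemma wrap_lin: "lin_map R M (wrap_mod M) (\<lambda>x _. x)"
  by (rule lin_mapI) (simp_all add: wrap_mod_def)

lemma unwrap_lin: "lin_map R (wrap_mod M) M (\<lambda>u. u undefined)"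
  by (rule lin_mapI) (auto simp: wrap_mod_def)

text \<open>In contrast to \<open>lin_map_span_eq\<close>, the maps are linear on the span only.
  This is the situation in \<open>free_iso\<close>, where a free generator exists just for elements
  of \<open>E\<close>.\<close>

lemma lin_map_span_ext:
  assumes M: "module R M" and T: "module R T" and S: "S \<subseteq> carrier M"
    and f: "lin_map R (M\<lparr>carrier := submod_span R M S\<rparr>) T f" and g: "lin_map R (M\<lparr>carrier := submod_span R M S\<rparr>) T g"
    and fg: "\<And>x. x \<in> S \<Longrightarrow> f x = g x" and x: "x \<in> submod_span R M S"
  shows "f x = g x"
proof -
  interpret M: module R M by fact
  let ?H = "submod_span R M S"
  note H = M.submoduleE[OF submod_span_submodule[OF M S]]
  have m: "\<ominus>\<^bsub>M\<^esub> a = (\<ominus>\<^bsub>R\<^esub> \<one>\<^bsub>R\<^esub>) \<odot>\<^bsub>M\<^esub> a" if "a \<in> carrier M" for a using that by (simp add: M.smult_l_minus)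
  have add: "f (a \<oplus>\<^bsub>M\<^esub> b) = f a \<oplus>\<^bsub>T\<^esub> f b" "g (a \<oplus>\<^bsub>M\<^esub> b) = g a \<oplus>\<^bsub>T\<^esub> g b" if "a \<in> ?H" "b \<in> ?H" for a b
    using lin_map_add[OF f, of a b] lin_map_add[OF g, of a b] that by simp_all
  have sm: "f (r \<odot>\<^bsub>M\<^esub> a) = r \<odot>\<^bsub>T\<^esub> f a" "g (r \<odot>\<^bsub>M\<^esub> a) = r \<odot>\<^bsub>T\<^esub> g a" if "r \<in> carrier R" "a \<in> ?H" for r a
    using lin_map_smult[OF f, of r a] lin_map_smult[OF g, of r a] that by simp_all
  have z0: "\<zero>\<^bsub>M\<^esub> \<in> ?H" by (rule submodule_zero_mem[OF submod_span_submodule[OF M S]])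
  have cl: "f a \<in> carrier T" "g a \<in> carrier T" if "a \<in> ?H" for a
    using lin_map_closed[OF f, of a] lin_map_closed[OF g, of a] that by simp_all
  have z: "f \<zero>\<^bsub>M\<^esub> = g \<zero>\<^bsub>M\<^esub>"
    using sm[of "\<zero>\<^bsub>R\<^esub>" "\<zero>\<^bsub>M\<^esub>"] z0 cl[OF z0] module.smult_l_null[OF T] by simp
  have "submodule {x \<in> ?H. f x = g x} R M"
  proof (rule M.submoduleI)
    show "{x \<in> ?H. f x = g x} \<subseteq> carrier M" using H(1) by blast
    show "\<zero>\<^bsub>M\<^esub> \<in> {x \<in> ?H. f x = g x}" using z0 z by simp
    show "a \<oplus>\<^bsub>M\<^esub> b \<in> {x \<in> ?H. f x = g x}" if "a \<in> {x \<in> ?H. f x = g x}" "b \<in> {x \<in> ?H. f x = g x}" for a b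
      using that H(5) add by simp
    show sc: "r \<odot>\<^bsub>M\<^esub> a \<in> {x \<in> ?H. f x = g x}" if "r \<in> carrier R" "a \<in> {x \<in> ?H. f x = g x}" for r a
      using that H(4) sm by simp
    show "\<ominus>\<^bsub>M\<^esub> a \<in> {x \<in> ?H. f x = g x}" if a: "a \<in> {x \<in> ?H. f x = g x}" for a
      using sc[of "\<ominus>\<^bsub>R\<^esub> \<one>\<^bsub>R\<^esub>", OF _ a] m[of a] H(1) a by auto
  qed
  from submod_span_least[OF this, of S] have "?H \<subseteq> {x \<in> ?H. f x = g x}"
    using fg submod_span_superset[of S R M] by blast
  then show ?thesis using x by blast
qed

lemma multilin_restrict_codomain:
  assumes "multilin R As B M \<phi>" "\<And>t. t \<in> tuples As B \<Longrightarrow> \<phi> t \<in> H"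
  shows "multilin R As B (M\<lparr>carrier := H\<rparr>) \<phi>"
proof (rule multilinI)
  fix xs y i assume t: "(xs, y) \<in> tuples As B" and i: "i < length As"
  note l = multilinD(1)[OF assms(1) t i]
  show "lin_map R (As ! i) (M\<lparr>carrier := H\<rparr>) (\<lambda>a. \<phi> (xs[i := a], y))"
    by (rule lin_mapI) (simp_all add: assms(2) tuples_update[OF t i] lin_map_add[OF l] lin_map_smult[OF l])
next
  fix xs y assume t: "(xs, y) \<in> tuples As B"
  note l = multilinD(2)[OF assms(1) t]
  show "lin_map R B (M\<lparr>carrier := H\<rparr>) (\<lambda>b. \<phi> (xs, b))"
    by (rule lin_mapI) (simp_all add: assms(2) tuples_last[OF t] lin_map_add[OF l] lin_map_smult[OF l])
qed

context bar_module_structure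
begin

text \<open>The action along \<open>tcomp fs \<beta>\<close> of an element \<open>t\<close> of \<open>P(T\<^sub>0)\<close> on \<open>ee fs \<beta> ks l (xs, m)\<close> is the
  generator \<open>t \<otimes> xs \<otimes> m\<close> over the tower \<open>(fs, \<beta>)\<close>; so these elements generate.\<close>

definition ee :: "'a list \<Rightarrow> 'q \<Rightarrow> int list \<Rightarrow> int \<Rightarrow> 'p list \<times> 'm \<Rightarrow> ('r, 'a, 'q, 'p, 'm) bar_elt" where
  "ee fs \<beta> ks l = (\<lambda>(xs, m). let T = Tgt MC (tcomp fs \<beta>); G = MFib MC (tcomp fs \<beta>) in
     gen n G (sum_list ks + l) ((ftl (Idn OC T) fs, MFibM MC \<beta> (gtot (Idn OC T) fs)), 0 # ks, l) (unt Q T # xs, m))"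

definition eg :: "'a list \<Rightarrow> 'o \<Rightarrow> 'q \<Rightarrow> int list \<Rightarrow> int \<Rightarrow> 'p list \<times> 'm \<Rightarrow> bool" where
  "eg fs T \<beta> ks l t \<longleftrightarrow> tw fs T \<beta> \<and> length fs = n \<and> length ks = n \<and> t \<in> tuples (rfacs fs ks) (Mm N (MFib MC \<beta>) l)"

lemma ee_pg:
  assumes "eg fs T \<beta> ks l (xs, m)"
  shows "pg n (MFib MC (tcomp fs \<beta>)) (sum_list ks + l) (ftl (Idn OC T) fs) (Ufib OC T)
      (MFibM MC \<beta> (gtot (Idn OC T) fs)) 0 ks l (unt Q T) xs m"
    and "ee fs \<beta> ks l (xs, m) = gen n (MFib MC (tcomp fs \<beta>)) (sum_list ks + l)
      ((ftl (Idn OC T) fs, MFibM MC \<beta> (gtot (Idn OC T) fs)), 0 # ks, l) (unt Q T # xs, m)"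
proof -
  have t: "tw fs T \<beta>" using assms by (simp add: eg_def)
  have T: "T \<in> Ob OC" using tw_arr[OF t] by simp
  note c = tcomp_facts[OF t]
  show "ee fs \<beta> ks l (xs, m) = gen n (MFib MC (tcomp fs \<beta>)) (sum_list ks + l)
      ((ftl (Idn OC T) fs, MFibM MC \<beta> (gtot (Idn OC T) fs)), 0 # ks, l) (unt Q T # xs, m)"
    using c by (simp add: ee_def)
  have t': "tw fs (Dom OC (Idn OC T)) \<beta>" "Idn OC T \<in> Mor OC" using t T by (simp_all add: facts)
  have "Act MC (Idn OC T) (tcomp fs \<beta>) = tcomp fs \<beta>" using Act_Idn[of "tcomp fs \<beta>"] c by simp
  then show "pg n (MFib MC (tcomp fs \<beta>)) (sum_list ks + l) (ftl (Idn OC T) fs) (Ufib OC T)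
      (MFibM MC \<beta> (gtot (Idn OC T) fs)) 0 ks l (unt Q T) xs m"
    using assms ftl_tw[OF t'] rfacs_ftl[OF t'] unt_closed[OF T]
    by (simp add: pg_def eg_def ftl_inverse Ufib_def)
qed

definition egens :: "'l \<Rightarrow> int \<Rightarrow> ('r, 'a, 'q, 'p, 'm) bar_elt set set" where
  "egens G k = {prj G k (ee fs \<beta> ks l t) |fs T \<beta> ks l t. eg fs T \<beta> ks l t
     \<and> MFib MC (tcomp fs \<beta>) = G \<and> sum_list ks + l = k}"

lemma ee_closed: "eg fs T \<beta> ks l t \<Longrightarrow> ee fs \<beta> ks l t \<in> carrier (Bar n (MFib MC (tcomp fs \<beta>)) (sum_list ks + l))"
  using ee_pg gen_pg_closed by (cases t) metis

lemma egens_subset: "egens G k \<subseteq> carrier (Mm NB G k)"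
  unfolding egens_def NB_carrier using ee_closed by blast

text \<open>Taking the span inside \<open>NB\<close>, instead of a direct sum over towers, imposes
  on \<open>E\<close> exactly the linear relations that hold between these elements in
  \<open>NB\<close>. In particular towers with the same tower of fibers share their
  generators.\<close>

definition espan :: "'l \<Rightarrow> int \<Rightarrow> ('r, 'a, 'q, 'p, 'm) bar_elt set set" where
  "espan G k = submod_span R (Mm NB G k) (egens G k)"

definition EE :: "'l \<Rightarrow> int \<Rightarrow> ('r, ('r, 'a, 'q, 'p, 'm) gen_elt) module" where
  "EE G k = wrap_mod ((Mm NB G k)\<lparr>carrier := espan G k\<rparr>)"

lemma espan_submodule: "submodule (espan G k) R (Mm NB G k)"
  unfolding espan_def by (rule submod_span_submodule[OF NB_module egens_subset])

lemma espan_module: "module R ((Mm NB G k)\<lparr>carrier := espan G k\<rparr>)"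
  by (rule submodule.submodule_is_module[OF espan_submodule NB_module])

lemma EE_module: "module R (EE G k)"
  unfolding EE_def by (rule wrap_module[OF espan_module])

lemma EE_collection: "gr_collection R (MOb MC) EE"
  by (simp add: gr_collection_def EE_module)

lemma EE_wrap: "lin_map R ((Mm NB G k)\<lparr>carrier := espan G k\<rparr>) (EE G k) (\<lambda>X _. X)"
  unfolding EE_def by (rule wrap_lin)

lemma EE_carrier: "carrier (EE G k) = (\<lambda>X _. X) ` espan G k"
  by (simp add: EE_def wrap_mod_def)

lemma EE_unwrap: "lin_map R (EE G k) (Mm NB G k) (\<lambda>u. u undefined)"
proof (rule lin_mapI)
  have l: "lin_map R (EE G k) ((Mm NB G k)\<lparr>carrier := espan G k\<rparr>) (\<lambda>u. u undefined)"
    unfolding EE_def by (rule unwrap_lin)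
  fix u v assume u: "u \<in> carrier (EE G k)" and v: "v \<in> carrier (EE G k)"
  show "u undefined \<in> carrier (Mm NB G k)"
    using lin_map_closed[OF l u] module.submoduleE(1)[OF NB_module espan_submodule] by auto
  show "(u \<oplus>\<^bsub>EE G k\<^esub> v) undefined = u undefined \<oplus>\<^bsub>Mm NB G k\<^esub> v undefined"
    using lin_map_add[OF l u v] by simp
  show "(r \<odot>\<^bsub>EE G k\<^esub> u) undefined = r \<odot>\<^bsub>Mm NB G k\<^esub> u undefined" if "r \<in> carrier R" for r
    using lin_map_smult[OF l that u] by simp
qed

sublocale FS: free_pmodule_setting R OC MC Q EE
  by unfold_locales (rule EE_collection)

abbreviation "FM \<equiv> free_pmodule R OC MC Q EE"
abbreviation "fu \<equiv> free_unit R OC MC Q EE"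

sublocale FU: unital_pmodule R OC MC Q FM
  by (rule FS.free_pmodule_unital)

lemma nu_FM_lin1: "\<alpha> \<in> MArr MC \<Longrightarrow> p \<in> carrier (Pm Q (Tgt MC \<alpha>) j)
    \<Longrightarrow> lin_map R (Mm FM (MFib MC \<alpha>) i) (Mm FM (Src MC \<alpha>) (i + j)) (\<lambda>x. nu FM \<alpha> i j x p)"
  using FU.nu_bilin[of \<alpha> i j] by (simp add: bilin_map_def)

lemma nu_FM_lin2: "\<alpha> \<in> MArr MC \<Longrightarrow> x \<in> carrier (Mm FM (MFib MC \<alpha>) i)
    \<Longrightarrow> lin_map R (Pm Q (Tgt MC \<alpha>) j) (Mm FM (Src MC \<alpha>) (i + j)) (nu FM \<alpha> i j x)"
  using FU.nu_bilin[of \<alpha> i j] by (simp add: bilin_map_def)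

lemma fu_wrap_lin: "L \<in> MOb MC \<Longrightarrow> lin_map R ((Mm NB L k)\<lparr>carrier := espan L k\<rparr>) (Mm FM L k) (\<lambda>X. fu L k (\<lambda>_. X))"
  by (rule lin_map_compose[OF EE_wrap FS.free_unit_lin])

section \<open>Freeness\<close>

definition emap :: "'a list \<Rightarrow> 'q \<Rightarrow> int list \<Rightarrow> int \<Rightarrow> 'p list \<times> 'm \<Rightarrow>
    ('r, 'q, 'p, ('r, 'a, 'q, 'p, 'm) gen_elt) fterm set" where
  "emap fs \<beta> ks l t = fu (MFib MC (tcomp fs \<beta>)) (sum_list ks + l)
     (\<lambda>_. prj (MFib MC (tcomp fs \<beta>)) (sum_list ks + l) (ee fs \<beta> ks l t))"

lemma prj_ee_espan: "eg fs T \<beta> ks l t \<Longrightarrow>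
    prj (MFib MC (tcomp fs \<beta>)) (sum_list ks + l) (ee fs \<beta> ks l t) \<in> espan (MFib MC (tcomp fs \<beta>)) (sum_list ks + l)"
  unfolding espan_def by (rule subsetD[OF submod_span_superset]) (unfold egens_def, blast)

text \<open>The tuple enters through \<open>ee\<close>, and the remaining steps, the projection to
  \<open>NB\<close> and the passage from the span to the free module, are linear.\<close>

lemma emap_ml:
  assumes t: "tw fs T \<beta>" "length fs = n" "length ks = n"
  shows "multilin R (rfacs fs ks) (Mm N (MFib MC \<beta>) l) (Mm FM (MFib MC (tcomp fs \<beta>)) (sum_list ks + l)) (emap fs \<beta> ks l)"
proof -
  let ?G = "MFib MC (tcomp fs \<beta>)" and ?k = "sum_list ks + l"
  have T: "T \<in> Ob OC" using tw_arr[OF t(1)] by simp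
  note c = tcomp_facts[OF t(1)]
  have t': "tw fs (Dom OC (Idn OC T)) \<beta>" "Idn OC T \<in> Mor OC" using t T by (simp_all add: facts)
  have A: "Act MC (Idn OC T) (tcomp fs \<beta>) = tcomp fs \<beta>" using Act_Idn[of "tcomp fs \<beta>"] c by simp
  have "multilin R (Pm Q (Ufib OC T) 0 # rfacs fs ks) (Mm N (MFib MC \<beta>) l) (Bar n ?G ?k)
    (gen n ?G ?k ((ftl (Idn OC T) fs, MFibM MC \<beta> (gtot (Idn OC T) fs)), 0 # ks, l))"
    using gen_pg_ml[of "ftl (Idn OC T) fs" n ks "MFibM MC \<beta> (gtot (Idn OC T) fs)" ?G "Ufib OC T" 0 l ?k]
      ftl_tw[OF t'] rfacs_ftl[OF t'] t A by (simp add: ftl_inverse Ufib_def)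
  from multilin_fix_head[OF this unt_closed[OF T]]
  have "multilin R (rfacs fs ks) (Mm N (MFib MC \<beta>) l) (Bar n ?G ?k) (ee fs \<beta> ks l)"
    using c by (simp add: ee_def)
  from multilin_restrict_codomain[OF multilin_compose[OF this prj_lin]]
  have "multilin R (rfacs fs ks) (Mm N (MFib MC \<beta>) l) ((Mm NB ?G ?k)\<lparr>carrier := espan ?G ?k\<rparr>)
      (\<lambda>t. prj ?G ?k (ee fs \<beta> ks l t))"
    using prj_ee_espan[of fs T \<beta> ks l] t by (simp add: eg_def)
  from multilin_compose[OF this fu_wrap_lin] c
  have "multilin R (rfacs fs ks) (Mm N (MFib MC \<beta>) l) (Mm FM ?G ?k) (\<lambda>t. fu ?G ?k (\<lambda>_. prj ?G ?k (ee fs \<beta> ks l t)))"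
    by (simp add: facts)
  then show ?thesis unfolding emap_def[abs_def] .
qed

definition psi_fun :: "('a, 'q) bar_idx \<Rightarrow> 'p list \<times> 'm \<Rightarrow> ('r, 'q, 'p, ('r, 'a, 'q, 'p, 'm) gen_elt) fterm set" where
  "psi_fun = (\<lambda>((fs, \<beta>), ks, l) (xs, m).
     nu FM (tcomp fs \<beta>) (sum_list (tl ks) + l) (hd ks) (emap fs \<beta> (tl ks) l (tl xs, m)) (hd xs))"

lemma psi_ml: "bar_ml n L k (Mm FM L k) psi_fun"
proof (rule bar_pg_mlI)
  fix fs T \<beta> k0 ks l
  assume a: "length fs = n" "length ks = n" "Src MC \<beta> = L" "tw fs T \<beta>" "k0 + sum_list ks + l = k"
  note c = tcomp_facts[OF a(4)]
  have k: "sum_list ks + l + k0 = k" using a(5) by simp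
  note e = emap_ml[OF a(4,1,2), of l]
  show "multilin R (Pm Q T k0 # rfacs fs ks) (Mm N (MFib MC \<beta>) l) (Mm FM L k) (psi_fun ((fs, \<beta>), k0 # ks, l))"
  proof (rule multilin_Cons)
    fix x assume x: "x \<in> carrier (Pm Q T k0)"
    have "lin_map R (Mm FM (MFib MC (tcomp fs \<beta>)) (sum_list ks + l)) (Mm FM L k)
        (\<lambda>y. nu FM (tcomp fs \<beta>) (sum_list ks + l) k0 y x)"
      using nu_FM_lin1[of "tcomp fs \<beta>" x k0 "sum_list ks + l"] c x a(3) by (simp add: k)
    from multilin_compose[OF e this]
    show "multilin R (rfacs fs ks) (Mm N (MFib MC \<beta>) l) (Mm FM L k) (\<lambda>(xs, y). psi_fun ((fs, \<beta>), k0 # ks, l) (x # xs, y))"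
      by (simp add: psi_fun_def case_prod_unfold)
  next
    fix xs m assume t: "(xs, m) \<in> tuples (rfacs fs ks) (Mm N (MFib MC \<beta>) l)"
    have "emap fs \<beta> ks l (xs, m) \<in> carrier (Mm FM (MFib MC (tcomp fs \<beta>)) (sum_list ks + l))"
      by (rule multilin_closed[OF e t])
    then have "lin_map R (Pm Q T k0) (Mm FM L k) (nu FM (tcomp fs \<beta>) (sum_list ks + l) k0 (emap fs \<beta> ks l (xs, m)))"
      using nu_FM_lin2[of "tcomp fs \<beta>" "emap fs \<beta> ks l (xs, m)" "sum_list ks + l" k0] c a(3) by (simp add: k)
    then show "lin_map R (Pm Q T k0) (Mm FM L k) (\<lambda>x. psi_fun ((fs, \<beta>), k0 # ks, l) (x # xs, m))"
      by (simp add: psi_fun_def)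
  qed
qed

definition psi :: "'l \<Rightarrow> int \<Rightarrow> ('r, 'a, 'q, 'p, 'm) bar_elt \<Rightarrow> ('r, 'q, 'p, ('r, 'a, 'q, 'p, 'm) gen_elt) fterm set" where
  "psi L k = lift n L k (Mm FM L k) psi_fun"

lemma psi_lin: "lin_map R (Bar n L k) (Mm FM L k) (psi L k)"
  unfolding psi_def by (rule lift_lin[OF FS.FM_module psi_ml])

lemma psi_gen:
  assumes "pg n L k fs T \<beta> k0 ks l x xs m"
  shows "psi L k (gen n L k ((fs, \<beta>), k0 # ks, l) (x # xs, m))
    = nu FM (tcomp fs \<beta>) (sum_list ks + l) k0 (emap fs \<beta> ks l (xs, m)) x"
  unfolding psi_def lift_gen[OF FS.FM_module psi_ml pg_gen[OF assms]] by (simp add: psi_fun_def)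

lemma pg_eg: "pg n L k fs T \<beta> k0 ks l x xs m \<Longrightarrow> eg fs T \<beta> ks l (xs, m)"
  by (simp add: pg_def eg_def)

text \<open>Whether a generator is divided out does not change on passing to the tower of fibers
  (\<open>bad_ftl\<close>), so the element \<open>ee\<close> of such a generator is already zero in
  \<open>NB\<close>.\<close>

lemma psi_Dsub:
  assumes "y \<in> Dsub L k"
  shows "psi L k y = \<zero>\<^bsub>Mm FM L k\<^esub>"
proof -
  have "psi L k y \<in> {\<zero>\<^bsub>Mm FM L k\<^esub>}"
  proof (rule Dsub_image[OF FS.FM_module psi_lin submodule_zero[OF FS.FM_module] _ assms])
    fix fs T \<beta> k0 ks l x xs m assume pg: "pg n L k fs T \<beta> k0 ks l x xs m" and bad: "bad fs ks xs"
    note p = pg[unfolded pg_def]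
    let ?G = "MFib MC (tcomp fs \<beta>)" and ?k = "sum_list ks + l"
    note c = tcomp_facts[of fs T \<beta>]
    have c: "tcomp fs \<beta> \<in> MArr MC" "Src MC (tcomp fs \<beta>) = L" "Tgt MC (tcomp fs \<beta>) = T" using p tcomp_facts[of fs T \<beta>] by auto
    have k: "?k + k0 = k" using p by simp
    have x: "x \<in> carrier (Pm Q (Tgt MC (tcomp fs \<beta>)) k0)" using p unfolding c(3) by simp
    have T: "T \<in> Ob OC" using p tw_arr[of fs T \<beta>] by simp
    have t': "tw fs (Dom OC (Idn OC T)) \<beta>" "Idn OC T \<in> Mor OC" using p T by (simp_all add: facts)
    have "length ks = length fs" "length xs = length fs" using p by (auto simp: tuples_def rfacs_def)
    then have b: "bad (ftl (Idn OC T) fs) ks xs" using bad_ftl[OF t'] bad by simp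
    note e = ee_pg[OF pg_eg[OF pg]]
    have "prj ?G ?k (ee fs \<beta> ks l (xs, m)) = \<zero>\<^bsub>Mm NB ?G ?k\<^esub>"
      unfolding e(2) by (rule prj_zero[OF Dsub_gen[OF e(1) b]])
    moreover have "fu ?G ?k (\<lambda>_. \<zero>\<^bsub>Mm NB ?G ?k\<^esub>) = \<zero>\<^bsub>Mm FM ?G ?k\<^esub>"
      using lin_map_zero[OF espan_module FS.FM_module fu_wrap_lin, of ?G ?k] c(1) by (simp add: facts)
    ultimately have "emap fs \<beta> ks l (xs, m) = \<zero>\<^bsub>Mm FM ?G ?k\<^esub>" by (simp add: emap_def)
    then show "psi L k (gen n L k ((fs, \<beta>), k0 # ks, l) (x # xs, m)) \<in> {\<zero>\<^bsub>Mm FM L k\<^esub>}"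
      using lin_map_zero[OF FS.FM_module FS.FM_module nu_FM_lin1[OF c(1), of x k0 ?k]] x k
      by (simp add: psi_gen[OF pg] c)
  qed
  then show ?thesis by simp
qed

definition psiq :: "'l \<Rightarrow> int \<Rightarrow> ('r, 'a, 'q, 'p, 'm) bar_elt set \<Rightarrow> ('r, 'q, 'p, ('r, 'a, 'q, 'p, 'm) gen_elt) fterm set" where
  "psiq L k X = the_elem (psi L k ` X)"

lemma psiq_lin: "lin_map R (Mm NB L k) (Mm FM L k) (psiq L k)"
  using quot_map_target(1)[OF bar_module FS.FM_module Dsub_submodule psi_lin psi_Dsub]
  by (simp add: NB_def psiq_def[abs_def])

lemma psiq_prj: "x \<in> carrier (Bar n L k) \<Longrightarrow> psiq L k (prj L k x) = psi L k x"
  using quot_map_target(2)[OF bar_module FS.FM_module Dsub_submodule psi_lin psi_Dsub]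
  by (simp add: prj_def psiq_def)

lemma NB_ext:
  assumes "module R S" "lin_map R (Mm NB L k) S f" "lin_map R (Mm NB L k) S g"
    and "\<And>fs T \<beta> k0 ks l x xs m. pg n L k fs T \<beta> k0 ks l x xs m
      \<Longrightarrow> f (prj L k (gen n L k ((fs, \<beta>), k0 # ks, l) (x # xs, m))) = g (prj L k (gen n L k ((fs, \<beta>), k0 # ks, l) (x # xs, m)))"
    and "X \<in> carrier (Mm NB L k)"
  shows "f X = g X"
proof -
  obtain x where x: "X = prj L k x" "x \<in> carrier (Bar n L k)" using assms(5) unfolding NB_carrier by (rule imageE)
  show ?thesis unfolding x(1)
    by (rule bar_pg_ext[OF assms(1) lin_map_compose[OF prj_lin assms(2)] lin_map_compose[OF prj_lin assms(3)] assms(4) x(2)])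
qed

text \<open>Blowing up changes the tower but not its element \<open>ee\<close>, which depends on the tower of fibers only.\<close>

lemma ee_blowup:
  assumes \<alpha>: "\<alpha> \<in> MArr MC" and e: "eg fs T \<beta> ks l (xs, m)" and G: "MFib MC (tcomp fs \<beta>) = MFib MC \<alpha>"
    and bl: "blowup \<alpha> (ftl (Idn OC T) fs) (MFibM MC \<beta> (gtot (Idn OC T) fs)) = (fs2, \<beta>2, h)"
  shows "ee fs2 \<beta>2 ks l (xs, m) = ee fs \<beta> ks l (xs, m)"
    and "MFibM MC (tcomp fs2 \<beta>2) h = MFibM MC (tcomp fs \<beta>) (Idn OC T)"
    and "eg fs2 (Dom OC h) \<beta>2 ks l (xs, m)" "h \<in> Mor OC" "Act MC h (tcomp fs2 \<beta>2) = \<alpha>" "Fib OC h = Ufib OC T"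
      "Cod OC h = Tgt MC \<alpha>" "Src MC \<beta>2 = Src MC \<alpha>" "MFib MC (tcomp fs2 \<beta>2) = MFib MC \<alpha>"
proof -
  note ep = ee_pg[OF e]
  note p = ep(1)[unfolded pg_def]
  have t: "tw fs T \<beta>" using e by (simp add: eg_def)
  have T: "T \<in> Ob OC" using tw_arr[OF t] by simp
  note c = tcomp_facts[OF t]
  let ?I = "Idn OC T"
  have I: "?I \<in> Mor OC" "Dom OC ?I = T" "Cod OC ?I = T" using T by (simp_all add: facts)
  have t': "tw fs (Dom OC ?I) \<beta>" using t I by simp
  have t2: "tw (ftl ?I fs) (Ufib OC T) (MFibM MC \<beta> (gtot ?I fs))" "Src MC (MFibM MC \<beta> (gtot ?I fs)) = MFib MC \<alpha>"
    using p G by auto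
  obtain fs3 \<beta>3 h3 where b3: "blowup \<alpha> (ftl ?I fs) (MFibM MC \<beta> (gtot ?I fs)) = (fs3, \<beta>3, h3)" "h3 \<in> Mor OC" "tw fs3 (Dom OC h3) \<beta>3"
    "Act MC h3 (tcomp fs3 \<beta>3) = \<alpha>" "Fib OC h3 = Ufib OC T" "ftl h3 fs3 = ftl ?I fs"
    "MFibM MC \<beta>3 (gtot h3 fs3) = MFibM MC \<beta> (gtot ?I fs)"
    "Cod OC h3 = Tgt MC \<alpha>" "Src MC \<beta>3 = Src MC \<alpha>" "length fs3 = length (ftl ?I fs)" "MFib MC \<beta>3 = MFib MC (MFibM MC \<beta> (gtot ?I fs))"
    "\<forall>ks. rfacs fs3 ks = rfacs (ftl ?I fs) ks" by (rule blowup_obtain[OF \<alpha> t2])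
  have eq: "fs3 = fs2" "\<beta>3 = \<beta>2" "h3 = h" using b3(1) bl by auto
  note b = b3(2-)[unfolded eq]
  show "h \<in> Mor OC" "Act MC h (tcomp fs2 \<beta>2) = \<alpha>" "Fib OC h = Ufib OC T" "Cod OC h = Tgt MC \<alpha>" "Src MC \<beta>2 = Src MC \<alpha>"
    by (rule b)+
  have F: "MFib MC (MFibM MC \<beta> (gtot ?I fs)) = MFib MC \<beta>" by (rule ftl_tw(4)[OF t' I(1)])
  show eg2: "eg fs2 (Dom OC h) \<beta>2 ks l (xs, m)"
    using e b rfacs_ftl[OF t' I(1)] F by (simp add: eg_def ftl_inverse)
  show M: "MFibM MC (tcomp fs2 \<beta>2) h = MFibM MC (tcomp fs \<beta>) ?I"
    using ftl_tw(2)[OF b(2,1)] ftl_tw(2)[OF t' I(1)] b(5,6) by simp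
  note c2 = tcomp_facts[OF b(2)]
  have Ac: "Act MC ?I (tcomp fs \<beta>) = tcomp fs \<beta>" using Act_Idn[of "tcomp fs \<beta>"] c by simp
  have "MFib MC (tcomp fs2 \<beta>2) = MFib MC (MFibM MC (tcomp fs2 \<beta>2) h)"
    using MFib_MFibM[of "tcomp fs2 \<beta>2" h] c2 b(1) by simp
  also have "\<dots> = MFib MC (tcomp fs \<beta>)"
    unfolding M using MFib_MFibM[of "tcomp fs \<beta>" ?I] c I by simp
  finally have G2: "MFib MC (tcomp fs2 \<beta>2) = MFib MC (tcomp fs \<beta>)" .
  then show "MFib MC (tcomp fs2 \<beta>2) = MFib MC \<alpha>" using G by simp
  let ?I2 = "Idn OC (Dom OC h)"
  have D: "Dom OC h \<in> Ob OC" using b(1) by (simp add: facts)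
  have I2: "?I2 \<in> Mor OC" "Dom OC ?I2 = Dom OC h" "Cod OC ?I2 = Dom OC h" using D by (simp_all add: facts)
  have A: "FibM OC ?I2 h = Idn OC (Ufib OC T)" using FibM_Idn[OF b(1)] b(4) by simp
  have B: "FibM OC ?I ?I = Idn OC (Ufib OC T)" using FibM_Idn[OF I(1)] I by (simp add: Ufib_def)
  have hI: "Cmp OC h ?I2 = h" by (rule Cmp_Idn_right[OF b(1)])
  have II: "Cmp OC ?I ?I = ?I" using Cmp_Idn_right[OF I(1)] I by simp
  have tI2: "tw fs2 (Dom OC ?I2) \<beta>2" using b(2) I2 by simp
  \<comment> \<open>Both towers of fibers are obtained from the common tower
    \<open>ftl ?I fs\<close> by taking fibers over the identity of \<open>Ufib OC T\<close>, hence
    they agree.\<close>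
  note X = ftl_ftl[OF tI2 I2(1) b(1) I2(3), unfolded A hI b(5,6)]
  have II': "Cod OC ?I = Dom OC ?I" using I by simp
  note Y = ftl_ftl[OF t' I(1) I(1) II', unfolded B II]
  \<comment> \<open>The heads have to match as elements, too; this follows from
    \<open>Fib OC h = Ufib OC T\<close>.\<close>
  have u: "unt Q (Dom OC h) = unt Q T"
    using unt_Fib[OF b(1)] b(4) unt_Ufib[OF T] by simp
  show "ee fs2 \<beta>2 ks l (xs, m) = ee fs \<beta> ks l (xs, m)"
    unfolding ee_pg(2)[OF e] ee_pg(2)[OF eg2] HOL.trans[OF X(1)[symmetric] Y(1)] HOL.trans[OF X(2)[symmetric] Y(2)] G2 u ..
qed

lemma nu_NB_ee:
  assumes \<alpha>: "\<alpha> \<in> MArr MC" and e: "eg fs T \<beta> ks l (xs, m)" and G: "MFib MC (tcomp fs \<beta>) = MFib MC \<alpha>"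
    and bl: "blowup \<alpha> (ftl (Idn OC T) fs) (MFibM MC \<beta> (gtot (Idn OC T) fs)) = (fs2, \<beta>2, h)"
    and q: "q \<in> carrier (Pm Q (Tgt MC \<alpha>) j)" and i: "i = sum_list ks + l"
  shows "nu NB \<alpha> i j (prj (MFib MC \<alpha>) i (ee fs \<beta> ks l (xs, m))) q
      = prj (Src MC \<alpha>) (i + j) (gen n (Src MC \<alpha>) (i + j) ((fs2, \<beta>2), (0 + j) # ks, l) (gam Q h 0 j (unt Q T) q # xs, m))"
    and "pg n (Src MC \<alpha>) (i + j) fs2 (Dom OC h) \<beta>2 (0 + j) ks l (gam Q h 0 j (unt Q T) q) xs m"
proof -
  note ep = ee_pg[OF e, unfolded G, folded i]
  show "nu NB \<alpha> i j (prj (MFib MC \<alpha>) i (ee fs \<beta> ks l (xs, m))) q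
      = prj (Src MC \<alpha>) (i + j) (gen n (Src MC \<alpha>) (i + j) ((fs2, \<beta>2), (0 + j) # ks, l) (gam Q h 0 j (unt Q T) q # xs, m))"
    unfolding ep(2) nu_NB[OF \<alpha> q gen_pg_closed[OF ep(1)]] nub_gen[OF \<alpha> q ep(1) bl] ..
  show "pg n (Src MC \<alpha>) (i + j) fs2 (Dom OC h) \<beta>2 (0 + j) ks l (gam Q h 0 j (unt Q T) q) xs m"
    by (rule nub_pg(1)[OF \<alpha> q ep(1) bl])
qed

text \<open>A tower is the blow-up of its own tower of fibers along its composite, with
  \<open>h\<close> the identity. Hence acting by \<open>t\<close> on its element \<open>ee\<close>
  replaces the unit by \<open>t\<close>, by left unitality.\<close>

lemma blowup_own:
  assumes t: "tw fs T \<beta>"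
  shows "blowup (tcomp fs \<beta>) (ftl (Idn OC T) fs) (MFibM MC \<beta> (gtot (Idn OC T) fs)) = (fs, \<beta>, Idn OC T)"
proof -
  have T: "T \<in> Ob OC" using tw_arr[OF t] by simp
  note c = tcomp_facts[OF t]
  let ?I = "Idn OC T"
  have I: "?I \<in> Mor OC" "Dom OC ?I = T" using T by (simp_all add: facts)
  have t': "tw fs (Dom OC ?I) \<beta>" using t I by simp
  have A: "Act MC ?I (tcomp fs \<beta>) = tcomp fs \<beta>" using Act_Idn[of "tcomp fs \<beta>"] c by simp
  show ?thesis
  proof (rule blowup_eqI[OF _ ftl_tw(1)[OF t' I(1)]])
    show "tcomp fs \<beta> \<in> MArr MC" using c by simp
    show "Src MC (MFibM MC \<beta> (gtot ?I fs)) = MFib MC (tcomp fs \<beta>)" using ftl_tw(5)[OF t' I(1)] A by simp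
    show "isblow (tcomp fs \<beta>) (ftl ?I fs) (Fib OC ?I) (MFibM MC \<beta> (gtot ?I fs)) (fs, \<beta>, ?I)"
      using I t' A by (simp add: isblow_def)
  qed
qed

section \<open>The comparison map out of the free module and its invertibility\<close>

definition phi_hom :: "('l \<Rightarrow> int \<Rightarrow> ('r, 'q, 'p, ('r, 'a, 'q, 'p, 'm) gen_elt) fterm set \<Rightarrow> ('r, 'a, 'q, 'p, 'm) bar_elt set) \<Rightarrow> bool" where
  "phi_hom \<Phi> \<longleftrightarrow> pmodule_hom R MC Q FM NB \<Phi>
     \<and> (\<forall>L\<in>MOb MC. \<forall>k. \<forall>e\<in>carrier (EE L k). \<Phi> L k (fu L k e) = e undefined)"

text \<open>The universal property extends the inclusion of the generating collection into
  \<open>NB\<close>.\<close>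

lemma phi_exists: "\<exists>\<Phi>. phi_hom \<Phi>"
proof -
  interpret FT: free_pmodule_target R OC MC Q EE NB "\<lambda>L k u. u undefined"
    by (intro free_pmodule_target.intro FS.free_pmodule_setting_axioms NB_unital free_pmodule_target_axioms.intro EE_unwrap)
  show ?thesis unfolding phi_hom_def by (rule FT.free_pmodule_extension)
qed

lemma fu_closed: "L \<in> MOb MC \<Longrightarrow> e \<in> carrier (EE L k) \<Longrightarrow> fu L k e \<in> carrier (Mm FM L k)"
  by (rule lin_map_closed[OF FS.free_unit_lin])

definition fgens :: "'l \<Rightarrow> int \<Rightarrow> ('r, 'q, 'p, ('r, 'a, 'q, 'p, 'm) gen_elt) fterm set set" where
  "fgens L k = fu L k ` carrier (EE L k) \<union> {nu FM \<alpha> i j (fu (MFib MC \<alpha>) i e) p |\<alpha> i j e p.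
     \<alpha> \<in> MArr MC \<and> Src MC \<alpha> = L \<and> i + j = k \<and> e \<in> carrier (EE (MFib MC \<alpha>) i) \<and> p \<in> carrier (Pm Q (Tgt MC \<alpha>) j)}"

lemma fgens_subset: "L \<in> MOb MC \<Longrightarrow> fgens L k \<subseteq> carrier (Mm FM L k)"
  using fu_closed lin_map_closed[OF nu_FM_lin1] by (auto simp: fgens_def facts)

text \<open>Iterated actions collapse: if \<open>\<beta>\<close> acts on a generator and then
  \<open>\<alpha>\<close> acts, the blow-up of \<open>\<alpha>\<close> along \<open>\<beta>\<close>
  gives \<open>\<gamma>\<close> and \<open>g\<close> with \<open>g \<gamma> = \<alpha>\<close>, and
  associativity read backwards makes this one action along \<open>\<gamma>\<close>.\<close>

lemma FM_span:
  assumes "FS.wt L k t" "L \<in> MOb MC"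
  shows "FS.cls L k t \<in> submod_span R (Mm FM L k) (fgens L k)"
  using assms
proof (induction t arbitrary: L k)
  case FZero
  then show ?case
    using submodule_zero_mem[OF submod_span_submodule[OF FS.FM_module fgens_subset]] by (simp add: FS.zero_FM)
next
  case (FAdd s t)
  then show ?case
    using module.submoduleE(5)[OF FS.FM_module submod_span_submodule[OF FS.FM_module fgens_subset]]
    by (simp flip: FS.add_FM)
next
  case (FSmult r t)
  then show ?case
    using module.submoduleE(4)[OF FS.FM_module submod_span_submodule[OF FS.FM_module fgens_subset]]
    by (simp flip: FS.smult_FM)
next
  case (FGen e)
  then have "FS.cls L k (FGen e) \<in> fgens L k" by (auto simp: fgens_def free_unit_def)
  then show ?case by (rule subsetD[OF submod_span_superset])
next
  case (FAct \<alpha> i j t p)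
  then have \<alpha>: "\<alpha> \<in> MArr MC" "Src MC \<alpha> = L" "k = i + j" "FS.wt (MFib MC \<alpha>) i t" "p \<in> carrier (Pm Q (Tgt MC \<alpha>) j)"
    by simp_all
  have G: "MFib MC \<alpha> \<in> MOb MC" using \<alpha> by (simp add: facts)
  let ?K = "submod_span R (Mm FM L k) (fgens L k)"
  have K: "submodule ?K R (Mm FM L k)" by (rule submod_span_submodule[OF FS.FM_module fgens_subset[OF FAct.prems(2)]])
  have l: "lin_map R (Mm FM (MFib MC \<alpha>) i) (Mm FM L k) (\<lambda>x. nu FM \<alpha> i j x p)"
    using nu_FM_lin1[OF \<alpha>(1,5), of i] by (simp add: \<alpha>)
  have "(\<lambda>x. nu FM \<alpha> i j x p) ` submod_span R (Mm FM (MFib MC \<alpha>) i) (fgens (MFib MC \<alpha>) i) \<subseteq> ?K"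
  proof (rule lin_map_span_subset[OF FS.FM_module FS.FM_module l K fgens_subset[OF G]], rule image_subsetI)
    fix y assume "y \<in> fgens (MFib MC \<alpha>) i"
    then consider (1) e where "y = fu (MFib MC \<alpha>) i e" "e \<in> carrier (EE (MFib MC \<alpha>) i)"
      | (2) \<beta> i' j' e p' where "y = nu FM \<beta> i' j' (fu (MFib MC \<beta>) i' e) p'" "\<beta> \<in> MArr MC" "Src MC \<beta> = MFib MC \<alpha>" "i' + j' = i"
        "e \<in> carrier (EE (MFib MC \<beta>) i')" "p' \<in> carrier (Pm Q (Tgt MC \<beta>) j')"
      unfolding fgens_def by blast
    then have "nu FM \<alpha> i j y p \<in> fgens L k"
    proof cases
      case 1
      then show ?thesis unfolding fgens_def using \<alpha> by blast
    next
      case 2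
      have "\<exists>!(\<phi>', f''). \<phi>' \<in> MArr MC \<and> f'' \<in> Mor OC \<and> Tgt MC \<phi>' = Dom OC f'' \<and> Act MC f'' \<phi>' = \<alpha>
        \<and> Fib OC f'' = Tgt MC \<beta> \<and> MFibM MC \<phi>' f'' = \<beta>"
        by (rule MB[unfolded weak_blow_up_mod_def, rule_format, OF \<alpha>(1) 2(2,3)])
      then obtain \<gamma> g where g: "\<gamma> \<in> MArr MC" "g \<in> Mor OC" "Tgt MC \<gamma> = Dom OC g" "Act MC g \<gamma> = \<alpha>"
        "Fib OC g = Tgt MC \<beta>" "MFibM MC \<gamma> g = \<beta>" by blast
      have f: "MFib MC \<gamma> = MFib MC \<beta>" using MFib_MFibM[OF g(1-3)] g(6) by simp
      have s: "Src MC \<gamma> = L" "Cod OC g = Tgt MC \<alpha>" using Src_Act[OF g(1-3)] Tgt_Act[OF g(1-3)] g(4) \<alpha>(2) by auto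
      have e: "fu (MFib MC \<beta>) i' e \<in> carrier (Mm FM (MFib MC \<gamma>) i')"
        using fu_closed[of "MFib MC \<beta>" e i'] 2 f by (simp add: facts)
      have "nu FM \<gamma> i' (j' + j) (fu (MFib MC \<gamma>) i' e) (gam Q g j' j p' p) = nu FM \<alpha> i j y p"
        using FU.nu_assoc[OF g(1-3) e, of p' j' p j] 2 g s(2) \<alpha>(5) by (simp add: f)
      moreover have "gam Q g j' j p' p \<in> carrier (Pm Q (Tgt MC \<gamma>) (j' + j))"
        using gam_closed[OF g(2), of p' j' p j] 2(6) \<alpha>(5) g(3,5) s(2) by simp
      moreover have "e \<in> carrier (EE (MFib MC \<gamma>) i')" using 2(5) f by simp
      moreover have "i' + (j' + j) = k" using 2(4) \<alpha>(3) by simp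
      ultimately show ?thesis unfolding fgens_def using g(1) s(1) by (intro UnI2 CollectI exI conjI) (auto simp: eq_commute)
    qed
    then show "nu FM \<alpha> i j y p \<in> ?K" by (rule subsetD[OF submod_span_superset])
  qed
  moreover have "FS.cls (MFib MC \<alpha>) i t \<in> submod_span R (Mm FM (MFib MC \<alpha>) i) (fgens (MFib MC \<alpha>) i)"
    by (rule FAct.IH[OF \<alpha>(4) G])
  ultimately have "nu FM \<alpha> i j (FS.cls (MFib MC \<alpha>) i t) p \<in> ?K" by blast
  then show ?case using FS.nu_FM[OF \<alpha>(1,4,5)] by (simp add: \<alpha>)
qed

theorem free_iso:
  assumes Y: "Y \<in> MOb MC" and b: "b \<in> MArr MC" "Src MC b = Y" "MFib MC b = Y"
  shows "mod_iso R (Mm NB Y k) (Mm FM Y k)"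
proof -
  obtain \<Phi> where \<Phi>: "phi_hom \<Phi>" using phi_exists by blast
  have pl: "lin_map R (Mm FM L k) (Mm NB L k) (\<Phi> L k)" if "L \<in> MOb MC" for L k
    using \<Phi> that by (simp add: phi_hom_def pmodule_hom_def)
  have pn: "\<Phi> (Src MC \<alpha>) (i + j) (nu FM \<alpha> i j x p) = nu NB \<alpha> i j (\<Phi> (MFib MC \<alpha>) i x) p"
    if "\<alpha> \<in> MArr MC" "x \<in> carrier (Mm FM (MFib MC \<alpha>) i)" "p \<in> carrier (Pm Q (Tgt MC \<alpha>) j)" for \<alpha> i j x p
    using \<Phi> that unfolding phi_hom_def pmodule_hom_def by blast
  have pe: "\<Phi> L k (fu L k (\<lambda>_. X)) = X" if "L \<in> MOb MC" "X \<in> espan L k" for L k X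
    using \<Phi> that unfolding phi_hom_def by (force simp: EE_carrier)
  have ecl: "(\<lambda>_. X) \<in> carrier (EE L k)" if "X \<in> espan L k" for X L k using that by (simp add: EE_carrier)
  have 1: "\<Phi> Y k (psiq Y k X) = X" if X: "X \<in> carrier (Mm NB Y k)" for X
  proof (rule NB_ext[OF NB_module lin_map_compose[OF psiq_lin pl[OF Y]] lin_map_ident _ X])
    fix fs T \<beta> k0 ks l x xs m assume pg: "pg n Y k fs T \<beta> k0 ks l x xs m"
    then have p: "tw fs T \<beta>" "Src MC \<beta> = Y" "x \<in> carrier (Pm Q T k0)" "k0 + sum_list ks + l = k" by (auto simp: pg_def)
    note e = pg_eg[OF pg]
    let ?\<alpha> = "tcomp fs \<beta>" and ?i = "sum_list ks + l"
    have \<alpha>: "?\<alpha> \<in> MArr MC" "Src MC ?\<alpha> = Y" "Tgt MC ?\<alpha> = T" using tcomp_facts[OF p(1)] p(2) by auto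
    have G: "MFib MC ?\<alpha> \<in> MOb MC" using \<alpha> by (simp add: facts)
    have k: "?i + k0 = k" using p(4) by simp
    have T: "T \<in> Ob OC" using tw_arr[OF p(1)] by simp
    have x: "x \<in> carrier (Pm Q (Tgt MC ?\<alpha>) k0)" using p(3) \<alpha>(3) by simp
    note s = prj_ee_espan[OF e]
    have em: "emap fs \<beta> ks l (xs, m) \<in> carrier (Mm FM (MFib MC ?\<alpha>) ?i)"
      unfolding emap_def by (rule fu_closed[OF G ecl[OF s]])
    have "\<Phi> Y k (psi Y k (gen n Y k ((fs, \<beta>), k0 # ks, l) (x # xs, m)))
       = nu NB ?\<alpha> ?i k0 (\<Phi> (MFib MC ?\<alpha>) ?i (emap fs \<beta> ks l (xs, m))) x"
      using pn[OF \<alpha>(1) em x] by (simp add: psi_gen[OF pg] \<alpha>(2) k)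
    also have "\<dots> = nu NB ?\<alpha> ?i k0 (prj (MFib MC ?\<alpha>) ?i (ee fs \<beta> ks l (xs, m))) x"
      unfolding emap_def pe[OF G s] ..
    also have "\<dots> = prj Y k (gen n Y k ((fs, \<beta>), k0 # ks, l) (x # xs, m))"
      using nu_NB_ee(1)[OF \<alpha>(1) e HOL.refl blowup_own[OF p(1)] x HOL.refl] unt_left[OF T p(3)]
      by (simp add: \<alpha>(2) k)
    finally show "\<Phi> Y k (psiq Y k (prj Y k (gen n Y k ((fs, \<beta>), k0 # ks, l) (x # xs, m))))
        = prj Y k (gen n Y k ((fs, \<beta>), k0 # ks, l) (x # xs, m))"
      unfolding psiq_prj[OF gen_pg_closed[OF pg]] .
  qed
  have lc: "lin_map R (Mm FM Y k) (Mm FM Y k) (\<lambda>x. psiq Y k (\<Phi> Y k x))"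
    by (rule lin_map_compose[OF pl[OF Y] psiq_lin])
  \<comment> \<open>The composite on the free side is checked on single actions; bare generators are
    reduced to these below.\<close>
  have key: "psiq Y k (\<Phi> Y k (nu FM \<alpha> i j (fu (MFib MC \<alpha>) i e) q)) = nu FM \<alpha> i j (fu (MFib MC \<alpha>) i e) q"
    if \<alpha>: "\<alpha> \<in> MArr MC" "Src MC \<alpha> = Y" "i + j = k" "e \<in> carrier (EE (MFib MC \<alpha>) i)" "q \<in> carrier (Pm Q (Tgt MC \<alpha>) j)"
    for \<alpha> i j e q
  proof -
    let ?G = "MFib MC \<alpha>"
    have G: "?G \<in> MOb MC" using \<alpha> by (simp add: facts)
    from \<alpha>(4) obtain X where X: "e = (\<lambda>_. X)" "X \<in> espan ?G i" by (auto simp: EE_carrier)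
    have l1: "lin_map R ((Mm NB ?G i)\<lparr>carrier := espan ?G i\<rparr>) (Mm FM Y k) (\<lambda>X. nu FM \<alpha> i j (fu ?G i (\<lambda>_. X)) q)"
      using lin_map_compose[OF fu_wrap_lin[OF G, of i] nu_FM_lin1[OF \<alpha>(1,5), of i]] by (simp add: \<alpha>(2,3))
    \<comment> \<open>As functions of \<open>X\<close> both sides are linear on the span, so
      \<open>X\<close> may be taken to be one of the spanning elements.\<close>
    have "psiq Y k (\<Phi> Y k (nu FM \<alpha> i j (fu ?G i (\<lambda>_. X)) q)) = nu FM \<alpha> i j (fu ?G i (\<lambda>_. X)) q"
    proof (rule lin_map_span_ext[OF NB_module FS.FM_module egens_subset _ _ _ X(2)[unfolded espan_def]])
      show "lin_map R ((Mm NB ?G i)\<lparr>carrier := submod_span R (Mm NB ?G i) (egens ?G i)\<rparr>) (Mm FM Y k)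
        (\<lambda>X. nu FM \<alpha> i j (fu ?G i (\<lambda>_. X)) q)" using l1 unfolding espan_def .
      show "lin_map R ((Mm NB ?G i)\<lparr>carrier := submod_span R (Mm NB ?G i) (egens ?G i)\<rparr>) (Mm FM Y k)
        (\<lambda>X. psiq Y k (\<Phi> Y k (nu FM \<alpha> i j (fu ?G i (\<lambda>_. X)) q)))"
        using lin_map_compose[OF l1 lc] unfolding espan_def .
      fix X assume "X \<in> egens ?G i"
      then obtain fs T \<beta> ks l t where X: "X = prj ?G i (ee fs \<beta> ks l t)" "eg fs T \<beta> ks l t"
        "MFib MC (tcomp fs \<beta>) = ?G" "sum_list ks + l = i" unfolding egens_def by blast
      obtain xs m where t: "t = (xs, m)" by (cases t)
      note e = X(2)[unfolded t]
      have tw: "tw fs T \<beta>" using e by (simp add: eg_def)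
      have T: "T \<in> Ob OC" using tw_arr[OF tw] by simp
      obtain fs2 \<beta>2 h where bl: "blowup \<alpha> (ftl (Idn OC T) fs) (MFibM MC \<beta> (gtot (Idn OC T) fs)) = (fs2, \<beta>2, h)"
        by (metis prod_cases3)
      note B = ee_blowup[OF \<alpha>(1) e X(3) bl]
      note NE = nu_NB_ee[OF \<alpha>(1) e X(3) bl \<alpha>(5) X(4)[symmetric]]
      have Xs: "X \<in> espan ?G i" using prj_ee_espan[OF X(2)] by (simp add: X)
      have fc: "fu ?G i (\<lambda>_. X) \<in> carrier (Mm FM ?G i)" by (rule fu_closed[OF G ecl[OF Xs]])
      let ?\<alpha>2 = "tcomp fs2 \<beta>2" and ?e = "fu ?G i (\<lambda>_. X)"
      have tw2: "tw fs2 (Dom OC h) \<beta>2" using B(3) by (simp add: eg_def)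
      have a2: "?\<alpha>2 \<in> MArr MC" "Tgt MC ?\<alpha>2 = Dom OC h" using tcomp_facts[OF tw2] by auto
      have em: "emap fs2 \<beta>2 ks l (xs, m) = ?e" unfolding emap_def B(1,9) X(1,4) t ..
      have "\<Phi> Y k (nu FM \<alpha> i j ?e q) = nu NB \<alpha> i j X q"
        using pn[OF \<alpha>(1) fc \<alpha>(5)] pe[OF G Xs] by (simp add: \<alpha>(2,3))
      also have "\<dots> = prj Y k (gen n Y k ((fs2, \<beta>2), (0 + j) # ks, l) (gam Q h 0 j (unt Q T) q # xs, m))"
        unfolding X(1) t using NE(1) by (simp add: \<alpha>(2,3))
      finally have 2: "\<Phi> Y k (nu FM \<alpha> i j ?e q) = prj Y k (gen n Y k ((fs2, \<beta>2), (0 + j) # ks, l) (gam Q h 0 j (unt Q T) q # xs, m))" .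
      note pg2 = NE(2)[unfolded \<alpha>(2,3)]
      have "psiq Y k (\<Phi> Y k (nu FM \<alpha> i j ?e q)) = nu FM ?\<alpha>2 i (0 + j) ?e (gam Q h 0 j (unt Q T) q)"
        unfolding 2 psiq_prj[OF gen_pg_closed[OF pg2]] psi_gen[OF pg2] em X(4) ..
      \<comment> \<open>What comes back is an action along \<open>?\<alpha>2\<close>, not along
        \<open>\<alpha>\<close>, with the head \<open>gam Q h 0 j (unt Q T) q\<close> in place of
        \<open>q\<close>. Since \<open>h\<close> carries \<open>?\<alpha>2\<close> to
        \<open>\<alpha>\<close>, associativity splits off the unit.\<close>
      also have "\<dots> = nu FM (Act MC h ?\<alpha>2) (i + 0) j (nu FM (MFibM MC ?\<alpha>2 h) i 0 ?e (unt Q T)) q"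
      proof (rule FU.nu_assoc[OF a2(1) B(4) a2(2)])
        show "?e \<in> carrier (Mm FM (MFib MC ?\<alpha>2) i)" using fc by (simp add: B(9))
        show "unt Q T \<in> carrier (Pm Q (Fib OC h) 0)" using unt_closed[OF T] by (simp add: B(6))
        show "q \<in> carrier (Pm Q (Cod OC h) j)" using \<alpha>(5) by (simp add: B(7))
      qed
      \<comment> \<open>By \<open>ee_blowup\<close> the arrow induced by \<open>?\<alpha>2\<close>
        over \<open>h\<close> is the one induced by the composite of the original tower over the
        identity, which is the form required by unitality.\<close>
      also have "nu FM (MFibM MC ?\<alpha>2 h) i 0 ?e (unt Q T) = ?e"
        using FU.nu_unit[of "tcomp fs \<beta>" ?e i] tcomp_facts[OF tw] fc X(3) by (simp add: B(2))
      finally show "psiq Y k (\<Phi> Y k (nu FM \<alpha> i j ?e q)) = nu FM \<alpha> i j ?e q" by (simp add: B(5))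
    qed
    then show ?thesis by (simp add: X(1))
  qed
  have 2: "psiq Y k (\<Phi> Y k y) = y" if y: "y \<in> carrier (Mm FM Y k)" for y
  proof -
    obtain t where t: "y = FS.cls Y k t" "FS.wt Y k t" using y by (auto simp: FS.carrier_FM)
    show ?thesis
    proof (rule lin_map_span_eq[OF FS.FM_module FS.FM_module lc lin_map_ident fgens_subset[OF Y] _ FM_span[OF t(2) Y, folded t(1)]])
      fix z assume "z \<in> fgens Y k"
      then consider (1) e where "z = fu Y k e" "e \<in> carrier (EE Y k)"
        | (2) \<alpha> i j e p where "z = nu FM \<alpha> i j (fu (MFib MC \<alpha>) i e) p" "\<alpha> \<in> MArr MC" "Src MC \<alpha> = Y" "i + j = k"
          "e \<in> carrier (EE (MFib MC \<alpha>) i)" "p \<in> carrier (Pm Q (Tgt MC \<alpha>) j)"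
        unfolding fgens_def by blast
      then show "psiq Y k (\<Phi> Y k z) = z"
      proof cases
        case 1
        \<comment> \<open>Unitality is stated for the arrow that \<open>b\<close> induces over the
          identity of its target; its source and its fiber are again \<open>Y\<close>.\<close>
        let ?\<alpha> = "MFibM MC b (Idn OC (Tgt MC b))"
        have M: "?\<alpha> \<in> MArr MC" "Src MC ?\<alpha> = Y" "Tgt MC ?\<alpha> = Ufib OC (Tgt MC b)" "MFib MC ?\<alpha> = Y"
          using b by (simp_all add: facts Ufib_def)
        have u: "unt Q (Tgt MC b) \<in> carrier (Pm Q (Tgt MC ?\<alpha>) 0)" using unt_closed[of "Tgt MC b"] b M(3) by (simp add: facts)
        have "nu FM ?\<alpha> k 0 (fu Y k e) (unt Q (Tgt MC b)) = z"
          using FU.nu_unit[OF b(1), of "fu Y k e" k] fu_closed[OF Y 1(2)] by (simp add: b(3) 1(1))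
        then show ?thesis using key[OF M(1,2), of k 0 e "unt Q (Tgt MC b)"] 1(2) u M(4) by simp
      next
        case 2
        then show ?thesis using key[OF 2(2-6)] by simp
      qed
    qed
  qed
  have "bij_betw (psiq Y k) (carrier (Mm NB Y k)) (carrier (Mm FM Y k))"
  proof (rule bij_betw_byWitness[where f' = "\<Phi> Y k"])
    show "\<forall>a\<in>carrier (Mm NB Y k). \<Phi> Y k (psiq Y k a) = a" using 1 by blast
    show "\<forall>a\<in>carrier (Mm FM Y k). psiq Y k (\<Phi> Y k a) = a" using 2 by blast
    show "psiq Y k ` carrier (Mm NB Y k) \<subseteq> carrier (Mm FM Y k)" using lin_map_closed[OF psiq_lin] by blast
    show "\<Phi> Y k ` carrier (Mm FM Y k) \<subseteq> carrier (Mm NB Y k)" using lin_map_closed[OF pl[OF Y]] by blast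
  qed
  with psiq_lin show ?thesis unfolding mod_iso_def by blast
qed

end

section \<open>The degenerate part in terms of generators\<close>

lemma mod_iso_trans: "mod_iso R M N \<Longrightarrow> mod_iso R N K \<Longrightarrow> mod_iso R M K"
  unfolding mod_iso_def
proof (elim exE conjE)
  fix f g assume "lin_map R M N f" "bij_betw f (carrier M) (carrier N)"
    and "lin_map R N K g" "bij_betw g (carrier N) (carrier K)"
  then have "lin_map R M K (\<lambda>x. g (f x))" "bij_betw (\<lambda>x. g (f x)) (carrier M) (carrier K)"
    using lin_map_compose[of R M N f K g] bij_betw_trans[of f _ _ g] by (simp_all add: comp_def)
  then show "\<exists>h. lin_map R M K h \<and> bij_betw h (carrier M) (carrier K)" by blast
qed

context bar_setting
begin

text \<open>The degenerate part described on generators. Positions count from 0, so \<open>j\<close>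
  points at \<open>f_(j+1)\<close> and \<open>p_(j+1)\<close>; the degree is 0 because units have
  degree 0.\<close>

definition dg :: "'a list \<Rightarrow> int list \<Rightarrow> 'p list \<Rightarrow> bool" where
  "dg fs ks xs \<longleftrightarrow> (\<exists>j<length fs. fs ! j = Idn OC (Dom OC (fs ! j)) \<and> ks ! j = 0 \<and> xs ! j = unt Q (Dom OC (fs ! j)))"

lemma ftl_nth:
  assumes "tw fs (Dom OC g) \<beta>" "g \<in> Mor OC" "j < length fs"
  shows "\<exists>h. h \<in> Mor OC \<and> fs ! j \<in> Mor OC \<and> Cod OC (fs ! j) = Dom OC h \<and> ftl g fs ! j = FibM OC (fs ! j) h"
  using assms
proof (induction fs arbitrary: g j)
  case (Cons f fs)
  then have f: "f \<in> Mor OC" "Cod OC f = Dom OC g" "tw fs (Dom OC (Cmp OC g f)) \<beta>" "Cmp OC g f \<in> Mor OC"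
    by (auto simp: facts)
  show ?case
  proof (cases j)
    case 0
    then show ?thesis using f Cons.prems(2) by auto
  next
    case (Suc i)
    then show ?thesis using Cons.IH[OF f(3,4), of i] Cons.prems(3) by simp
  qed
qed simp

lemma FibM_eq_Idn_iff:
  assumes OB: "weak_blow_up OC" and f: "f \<in> Mor OC" "h \<in> Mor OC" "Cod OC f = Dom OC h"
  shows "FibM OC f h = Idn OC (Dom OC (FibM OC f h)) \<longleftrightarrow> f = Idn OC (Dom OC f)"
proof
  assume a: "f = Idn OC (Dom OC f)"
  have "Cod OC (Idn OC (Dom OC f)) = Dom OC f" using f(1) by (simp add: facts)
  with a have d: "Dom OC f = Dom OC h" using f(3) by metis
  have "FibM OC f h = Idn OC (Fib OC h)" using FibM_Idn[OF f(2)] a d by metis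
  then show "FibM OC f h = Idn OC (Dom OC (FibM OC f h))" using f(2) by (simp add: facts)
qed (rule blow_Idn[OF assms])

text \<open>Identities are detected on fibers by \<open>FibM_eq_Idn_iff\<close>. The domain of an
  induced morphism is a fiber, and \<open>unt_Fib\<close> equates its unit with that of the original
  domain.\<close>

lemma dg_ftl:
  assumes OB: "weak_blow_up OC" and t: "tw fs (Dom OC g) \<beta>" "g \<in> Mor OC"
  shows "dg (ftl g fs) ks xs \<longleftrightarrow> dg fs ks xs"
proof -
  have "(ftl g fs ! j = Idn OC (Dom OC (ftl g fs ! j)) \<longleftrightarrow> fs ! j = Idn OC (Dom OC (fs ! j)))
     \<and> unt Q (Dom OC (ftl g fs ! j)) = unt Q (Dom OC (fs ! j))" if "j < length fs" for j
  proof -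
    from ftl_nth[OF t that] obtain h where h: "fs ! j \<in> Mor OC" "h \<in> Mor OC" "Cod OC (fs ! j) = Dom OC h"
      and e: "ftl g fs ! j = FibM OC (fs ! j) h" by blast
    have "unt Q (Dom OC (FibM OC (fs ! j) h)) = unt Q (Dom OC (fs ! j))"
      using unt_Fib[of "Cmp OC h (fs ! j)"] h by (simp add: facts)
    then show ?thesis using FibM_eq_Idn_iff[OF OB h] unfolding e by simp
  qed
  then show ?thesis unfolding dg_def ftl_inverse(2) by (metis (no_types, lifting))
qed

lemma tw_insert:
  assumes "tw fs T \<beta>" "j \<le> length fs"
  shows "tw (take j fs @ Idn OC (vert OC MC (fs, \<beta>) j) # drop j fs) T \<beta> \<and> vert OC MC (fs, \<beta>) j \<in> Ob OC"
  using assms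
proof (induction fs arbitrary: T j)
  case Nil
  then show ?case by (auto simp: vert_def facts)
next
  case (Cons f fs)
  show ?case
  proof (cases j)
    case 0
    then show ?thesis using Cons.prems by (auto simp: vert_def facts)
  next
    case (Suc i)
    have v: "vert OC MC (f # fs, \<beta>) (Suc i) = vert OC MC (fs, \<beta>) i" by (simp add: vert_def)
    show ?thesis using Cons.IH[of "Dom OC f" i] Cons.prems unfolding Suc v by simp
  qed
qed

lemma tw_remove:
  assumes "tw fs T \<beta>" "j < length fs" "fs ! j = Idn OC V" "V \<in> Ob OC"
  shows "tw (take j fs @ drop (Suc j) fs) T \<beta> \<and> vert OC MC (take j fs @ drop (Suc j) fs, \<beta>) j = V"
  using assms
proof (induction fs arbitrary: T j)
  case (Cons f fs)
  show ?case
  proof (cases j)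
    case 0
    then have "tw fs V \<beta>" "T = V" using Cons.prems by (auto simp: facts)
    then show ?thesis using tw_vert[of fs V \<beta>] by (simp add: 0)
  next
    case (Suc i)
    have v: "vert OC MC (f # us, \<beta>) (Suc i) = vert OC MC (us, \<beta>) i" for us by (simp add: vert_def)
    show ?thesis using Cons.IH[of "Dom OC f" i] Cons.prems unfolding Suc by (simp add: v)
  qed
qed simp

lemma rfacs_insert:
  assumes "length ks = length fs" "j \<le> length fs"
  shows "rfacs (take j fs @ f # drop j fs) (take j ks @ i # drop j ks)
    = take j (rfacs fs ks) @ Pm Q (Fib OC f) i # drop j (rfacs fs ks)"
  using assms by (simp add: rfacs_def take_map drop_map take_zip drop_zip)

lemma sum_list_insert: "sum_list (take j ks @ (i :: int) # drop j ks) = i + sum_list ks"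
proof -
  have "sum_list ks = sum_list (take j ks) + sum_list (drop j ks)"
    by (simp flip: sum_list_append)
  then show ?thesis by simp
qed

lemma degen_pg:
  assumes pg: "pg n L k fs T \<beta> k0 ks l x xs m" and j: "j \<le> n"
  defines "V \<equiv> vert OC MC (fs, \<beta>) j"
  shows "degen n L k j (gen n L k ((fs, \<beta>), k0 # ks, l) (x # xs, m))
      = gen (Suc n) L k ((take j fs @ Idn OC V # drop j fs, \<beta>), k0 # take j ks @ 0 # drop j ks, l)
         (x # take j xs @ unt Q V # drop j xs, m)"
    and "pg (Suc n) L k (take j fs @ Idn OC V # drop j fs) T \<beta> k0 (take j ks @ 0 # drop j ks) l
       x (take j xs @ unt Q V # drop j xs) m"
    and "dg (take j fs @ Idn OC V # drop j fs) (take j ks @ 0 # drop j ks) (take j xs @ unt Q V # drop j xs)"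
proof -
  show "degen n L k j (gen n L k ((fs, \<beta>), k0 # ks, l) (x # xs, m))
      = gen (Suc n) L k ((take j fs @ Idn OC V # drop j fs, \<beta>), k0 # take j ks @ 0 # drop j ks, l)
         (x # take j xs @ unt Q V # drop j xs, m)"
    unfolding bar_degen_def lift_gen[OF bar_module degen_ml[OF j] pg_gen[OF pg]] by (simp add: V_def)
  have p: "length fs = n" "length ks = n" "Src MC \<beta> = L" "tw fs T \<beta>" "k0 + sum_list ks + l = k" "x \<in> carrier (Pm Q T k0)"
    "(xs, m) \<in> tuples (rfacs fs ks) (Mm N (MFib MC \<beta>) l)" using pg by (auto simp: pg_def)
  have V: "V \<in> Ob OC" "tw (take j fs @ Idn OC V # drop j fs) T \<beta>"
    using tw_insert[OF p(4), of j] p(1) j by (simp_all add: V_def)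
  have len: "length xs = n" using p by (simp add: tuples_def rfacs_def)
  have "(take j xs @ unt Q V # drop j xs, m)
      \<in> tuples (rfacs (take j fs @ Idn OC V # drop j fs) (take j ks @ 0 # drop j ks)) (Mm N (MFib MC \<beta>) l)"
    using p unt_closed[OF V(1)] j
    by (auto simp: rfacs_insert tuples_iff Ufib_def intro!: list_all2_appendI list_all2_takeI list_all2_dropI)
  then show "pg (Suc n) L k (take j fs @ Idn OC V # drop j fs) T \<beta> k0 (take j ks @ 0 # drop j ks) l
       x (take j xs @ unt Q V # drop j xs) m"
    using p V j unfolding pg_def sum_list_insert by simp
  show "dg (take j fs @ Idn OC V # drop j fs) (take j ks @ 0 # drop j ks) (take j xs @ unt Q V # drop j xs)"
    unfolding dg_def using p(1,2) len j V(1) by (intro exI[of _ j]) (simp add: nth_append facts)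
qed

text \<open>Deleting the identity and its unit leaves a generator one level lower, and the
  degeneracy at position \<open>j\<close> puts them back.\<close>

lemma dg_degen:
  assumes pg: "pg n L k fs T \<beta> k0 ks l x xs m" and dg: "dg fs ks xs"
  shows "gen n L k ((fs, \<beta>), k0 # ks, l) (x # xs, m) \<in> degs n L k"
proof -
  have p: "length fs = n" "length ks = n" "Src MC \<beta> = L" "tw fs T \<beta>" "k0 + sum_list ks + l = k" "x \<in> carrier (Pm Q T k0)"
    "(xs, m) \<in> tuples (rfacs fs ks) (Mm N (MFib MC \<beta>) l)" using pg by (auto simp: pg_def)
  have len: "length xs = n" using p by (simp add: tuples_def rfacs_def)
  obtain j where j: "j < n" and f: "fs ! j = Idn OC (Dom OC (fs ! j))" and k: "ks ! j = 0" and u: "xs ! j = unt Q (Dom OC (fs ! j))"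
    using dg p(1) unfolding dg_def by blast
  obtain n' where n': "n = Suc n'" using j by (cases n) auto
  define V where "V = Dom OC (fs ! j)"
  have V: "V \<in> Ob OC"
  proof -
    have "tw fs T \<beta> \<Longrightarrow> set fs \<subseteq> Mor OC" for fs T by (induction fs arbitrary: T) auto
    from this[OF p(4)] have "fs ! j \<in> Mor OC" using j p(1) by auto
    then show ?thesis by (simp add: V_def facts)
  qed
  let ?fs = "take j fs @ drop (Suc j) fs" and ?ks = "take j ks @ drop (Suc j) ks" and ?xs = "take j xs @ drop (Suc j) xs"
  have del: "take j (take j us @ drop (Suc j) us) = take j us" "drop j (take j us @ drop (Suc j) us) = drop (Suc j) us"
    if "length us = n" for us :: "'z list" using that j by simp_all
  have fs: "take j ?fs @ Idn OC V # drop j ?fs = fs"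
    unfolding del[OF p(1)] V_def f[symmetric] using id_take_nth_drop[of j fs] j p(1) by simp
  have ks: "take j ?ks @ 0 # drop j ?ks = ks"
    using id_take_nth_drop[of j ks] j p(2) k by (simp add: del)
  have xs: "take j ?xs @ unt Q V # drop j ?xs = xs"
    using id_take_nth_drop[of j xs] j len u by (simp add: del V_def)
  have t: "tw ?fs T \<beta>" "vert OC MC (?fs, \<beta>) j = V"
    using tw_remove[OF p(4), of j V] f j p(1) V by (simp_all add: V_def)
  have "rfacs ?fs ?ks = take j (rfacs fs ks) @ drop (Suc j) (rfacs fs ks)"
    using p(1,2) j by (simp add: rfacs_def take_map drop_map take_zip drop_zip)
  then have "(?xs, m) \<in> tuples (rfacs ?fs ?ks) (Mm N (MFib MC \<beta>) l)"
    using p(7) by (auto simp: tuples_iff intro!: list_all2_appendI list_all2_takeI list_all2_dropI)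
  moreover have "sum_list ?ks = sum_list ks" using sum_list_insert[of j ?ks 0] unfolding ks by simp
  ultimately have pg': "pg n' L k ?fs T \<beta> k0 ?ks l x ?xs m"
    using p t(1) j n' unfolding pg_def by simp
  have "gen n L k ((fs, \<beta>), k0 # ks, l) (x # xs, m)
      = degen n' L k j (gen n' L k ((?fs, \<beta>), k0 # ?ks, l) (x # ?xs, m))"
    using degen_pg(1)[OF pg', of j] j unfolding t(2) fs ks xs n' by simp
  then show ?thesis using degen_in_degs[of j n' _ L k] gen_pg_closed[OF pg'] j n' by simp
qed

end

context bar_module_structure
begin

text \<open>If nothing is divided out, \<open>Dsub\<close> is the zero submodule and the projection
  is injective.\<close>

lemma bar_iso_NB:
  assumes "\<And>fs ks xs. \<not> bad fs ks xs"
  shows "mod_iso R (Bar n L k) (Mm NB L k)"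
proof -
  have "Dgens L k = {}" using assms by (simp add: Dgens_def)
  moreover have "submod_span R (Bar n L k) {} \<subseteq> {\<zero>\<^bsub>Bar n L k\<^esub>}"
    by (rule submod_span_least[OF submodule_zero[OF bar_module]]) simp
  ultimately have D: "Dsub L k \<subseteq> {\<zero>\<^bsub>Bar n L k\<^esub>}" by (simp add: Dsub_def)
  interpret B: module R "Bar n L k" by (rule bar_module)
  have "inj_on (prj L k) (carrier (Bar n L k))"
  proof (rule inj_onI)
    fix x y assume xy: "x \<in> carrier (Bar n L k)" "y \<in> carrier (Bar n L k)" "prj L k x = prj L k y"
    then have "x \<ominus>\<^bsub>Bar n L k\<^esub> y \<in> Dsub L k"
      using coset_eq_iff[OF bar_module Dsub_submodule] by (simp add: prj_def)
    with D xy show "x = y" using B.minus_eq_zero_imp_eq by blast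
  qed
  then have "bij_betw (prj L k) (carrier (Bar n L k)) (carrier (Mm NB L k))"
    by (simp add: bij_betw_def NB_carrier)
  with prj_lin show ?thesis unfolding mod_iso_def by blast
qed

end

context bar_setting
begin

lemma free_bar:
  assumes OB: "weak_blow_up OC" and MB: "weak_blow_up_mod OC MC"
    and b: "b \<in> MArr MC" "Src MC b = Y" "MFib MC b = Y"
  shows "\<exists>E :: 'l \<Rightarrow> int \<Rightarrow> ('r, ('r, 'a, 'q, 'p, 'm) gen_elt) module.
    gr_collection R (MOb MC) E \<and> gr_iso R (Bar n Y) (Mm (free_pmodule R OC MC Q E) Y)"
proof -
  interpret D: bar_module_structure R OC MC Q N n "\<lambda>_ _ _. False"
    by unfold_locales (simp_all add: OB MB)
  have "Y \<in> MOb MC" using b by (auto simp: facts)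
  then have "gr_iso R (Bar n Y) (Mm D.FM Y)"
    unfolding gr_iso_def using mod_iso_trans[OF D.bar_iso_NB D.free_iso] b by blast
  then show ?thesis using D.EE_collection by blast
qed

lemma free_nbar:
  assumes OB: "weak_blow_up OC" and MB: "weak_blow_up_mod OC MC"
    and b: "b \<in> MArr MC" "Src MC b = Y" "MFib MC b = Y"
  shows "\<exists>E :: 'l \<Rightarrow> int \<Rightarrow> ('r, ('r, 'a, 'q, 'p, 'm) gen_elt) module.
    gr_collection R (MOb MC) E \<and> gr_iso R (nbar R OC MC Q N n Y) (Mm (free_pmodule R OC MC Q E) Y)"
proof -
  interpret D: bar_module_structure R OC MC Q N n dg
    by unfold_locales (simp_all add: OB MB dg_ftl[OF OB])
  have Y: "Y \<in> MOb MC" using b by (auto simp: facts)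
  \<comment> \<open>The span of the degenerate generators is the whole degenerate part, so
    \<open>NB\<close> at \<open>Y\<close> is the normalized bar module itself.\<close>
  have "D.Dsub Y k = degs n Y k" for k
  proof (intro equalityI subsetI)
    fix y assume "y \<in> D.Dsub Y k"
    then show "y \<in> degs n Y k"
      by (rule D.Dsub_image[OF bar_module lin_map_ident degs_submodule, rotated]) (rule dg_degen)
  next
    fix y assume y: "y \<in> degs n Y k"
    show "y \<in> D.Dsub Y k"
    proof (rule degs_image[OF bar_module lin_map_ident D.Dsub_submodule _ y])
      fix j x assume j: "j < n" and x: "x \<in> carrier (Bar (n - 1) Y k)"
      obtain n' where n': "n = Suc n'" using j by (cases n) auto
      have l: "lin_map R (Bar n' Y k) (Bar n Y k) (degen n' Y k j)" using degen_lin[of j n' Y k] j n' by simp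
      have "x \<in> {x \<in> carrier (Bar n' Y k). degen n' Y k j x \<in> D.Dsub Y k}"
      proof (rule bar_generated[OF submodule_preimage[OF bar_module bar_module l D.Dsub_submodule]])
        show "x \<in> carrier (Bar n' Y k)" using x n' by simp
        fix \<iota> t assume "\<iota> \<in> BI n' Y k" "t \<in> tuples (facs \<iota>) (endm \<iota>)"
        then obtain fs T \<beta> k0 ks l x xs m where pg: "pg n' Y k fs T \<beta> k0 ks l x xs m"
          and i: "\<iota> = ((fs, \<beta>), k0 # ks, l)" "t = (x # xs, m)" by (rule pg_cover)
        have j': "j \<le> n'" using j n' by simp
        note d = degen_pg[OF pg j', folded n']
        show "gen n' Y k \<iota> t \<in> {x \<in> carrier (Bar n' Y k). degen n' Y k j x \<in> D.Dsub Y k}"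
          using D.Dsub_gen[OF d(2,3)] gen_pg_closed[OF pg] by (simp add: i d(1))
      qed
      then show "degen (n - 1) Y k j x \<in> D.Dsub Y k" by (simp add: n')
    qed
  qed
  then have "Mm D.NB Y k = nbar R OC MC Q N n Y k" for k by (simp add: D.NB_def nbar_def)
  then have "gr_iso R (nbar R OC MC Q N n Y) (Mm D.FM Y)"
    unfolding gr_iso_def using D.free_iso[OF Y b] by metis
  then show ?thesis using D.EE_collection by blast
qed

end

theorem theoremA:
  fixes R :: "('r, 's) ring_scheme"
    and OC :: "('o, 'a) opcat"
    and MC :: "('o, 'a, 'l, 'q) opmod"
    and Q :: "('r, 'o, 'a, 'p) operad"
    and N :: "('r, 'l, 'q, 'p, 'm) pmodule"
  assumes "cring R"
    and "unary_operadic_category OC"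
    and "left_operadic_module OC MC"
    and "weak_blow_up OC"
    and "weak_blow_up_mod OC MC"
    and "unital_operad R OC Q"
    and "unital_pmodule R OC MC Q N"
  shows "\<forall>\<Upsilon>\<in>MOb MC.
     ((\<exists>b. terminal_arrow OC MC \<Upsilon> b \<and> MFib MC b = \<Upsilon> \<and> domain_fiber_functor OC (Tgt MC b)) \<longrightarrow>
        (\<forall>k. aug_acyclic (\<lambda>n. bar R OC MC Q N n \<Upsilon> k) (\<lambda>n. bar_diff R OC MC Q N n \<Upsilon> k)
               (Mm N \<Upsilon> k) (bar_aug R OC MC Q N \<Upsilon> k))
      \<and> (\<forall>k. aug_acyclic (\<lambda>n. nbar R OC MC Q N n \<Upsilon> k) (\<lambda>n. nbar_diff R OC MC Q N n \<Upsilon> k)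
               (Mm N \<Upsilon> k) (nbar_aug R OC MC Q N \<Upsilon> k)))
   \<and> (rigid OC MC \<Upsilon> \<longrightarrow>
        (\<forall>n. (\<exists>E :: 'l \<Rightarrow> int \<Rightarrow> ('r, ('r, 'a, 'q, 'p, 'm) gen_elt) module.
                gr_collection R (MOb MC) E \<and>
                gr_iso R (bar R OC MC Q N n \<Upsilon>) (Mm (free_pmodule R OC MC Q E) \<Upsilon>))
           \<and> (\<exists>E :: 'l \<Rightarrow> int \<Rightarrow> ('r, ('r, 'a, 'q, 'p, 'm) gen_elt) module.
                gr_collection R (MOb MC) E \<and>
                gr_iso R (nbar R OC MC Q N n \<Upsilon>) (Mm (free_pmodule R OC MC Q E) \<Upsilon>))))"
proof (intro ballI conjI impI allI)
  fix \<Upsilon> k assume "\<exists>b. terminal_arrow OC MC \<Upsilon> b \<and> MFib MC b = \<Upsilon> \<and> domain_fiber_functor OC (Tgt MC b)"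
  then obtain b where b: "terminal_arrow OC MC \<Upsilon> b" "MFib MC b = \<Upsilon>" "domain_fiber_functor OC (Tgt MC b)"
    by blast
  interpret bar_setting R OC MC Q N by (intro bar_setting.intro bar_setting_axioms.intro assms)
  show "aug_acyclic (\<lambda>n. Bar n \<Upsilon> k) (\<lambda>n. diff n \<Upsilon> k) (Mm N \<Upsilon> k) (aug \<Upsilon> k)"
    by (rule part_one(1)[OF assms(5) b])
  show "aug_acyclic (\<lambda>n. nbar R OC MC Q N n \<Upsilon> k) (\<lambda>n. nbar_diff R OC MC Q N n \<Upsilon> k)
      (Mm N \<Upsilon> k) (nbar_aug R OC MC Q N \<Upsilon> k)"
    by (rule part_one(2)[OF assms(5) b])
next
  fix \<Upsilon> n assume "rigid OC MC \<Upsilon>"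
  then obtain b where b: "b \<in> MArr MC" "Src MC b = \<Upsilon>" "MFib MC b = \<Upsilon>" unfolding rigid_def by blast
  interpret bar_setting R OC MC Q N by (intro bar_setting.intro bar_setting_axioms.intro assms)
  show "\<exists>E :: 'l \<Rightarrow> int \<Rightarrow> ('r, ('r, 'a, 'q, 'p, 'm) gen_elt) module.
      gr_collection R (MOb MC) E \<and> gr_iso R (Bar n \<Upsilon>) (Mm (free_pmodule R OC MC Q E) \<Upsilon>)"
    by (rule free_bar[OF assms(4,5) b])
  show "\<exists>E :: 'l \<Rightarrow> int \<Rightarrow> ('r, ('r, 'a, 'q, 'p, 'm) gen_elt) module.
      gr_collection R (MOb MC) E \<and> gr_iso R (nbar R OC MC Q N n \<Upsilon>) (Mm (free_pmodule R OC MC Q E) \<Upsilon>)"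
    by (rule free_nbar[OF assms(4,5) b])
qed

end
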